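(* Let $\alpha>-1$, let $R>1$, and let $u$ be a subharmonic function on the disk $\mathbb D(R)=\{z\in\mathbb C:\ |z|<R\}$ which is harmonic on $\mathbb D(R)\setminus\{0\}$. Then: (1) The operators $M_u$ and $\mathbb P_\alpha$ commute on $L^2(\mathbb D,dA_\alpha)$ (that is, $\mathscr C_u=0$) if and only if $u$ is constant on $\mathbb D(R)$. (2) The commutator $\mathscr C_u=M_u\circ\mathbb P_\alpha-\mathbb P_\alpha\circ M_u$ belongs to the von Neumann--Schatten class $\mathcal C_p$ for every $p>1$.
   Context: $\mathbb D$ is the open unit disk of $\mathbb C$. For $\alpha>-1$, $dA_\alpha(z)=(\alpha+1)(1-|z|^2)^\alpha\,dA(z)$, where $dA(z)=\frac1\pi\,dx\,dy$; this is a probability measure on $\mathbb D$. $\mathscr H^2_\alpha(\mathbb D)$ is the closed subspace of $L^2(\mathbb D,dA_\alpha)$ of (complex-valued) harmonic functions on $\mathbb D$ that are square-integrable with respect to $dA_\alpha$. Its reproducing kernel is $$K_\alpha(z,w)=\frac{1}{(1-z\overline w)^{\alpha+2}}+\frac{1}{(1-w\overline z)^{\alpha+2}}-1,$$ and $\mathbb P_\alpha$ is the orthogonal projection of $L^2(\mathbb D,dA_\alpha)$ onto $\mathscr H^2_\alpha(\mathbb D)$, given by $\mathbb P_\alpha f(z)=\int_{\mathbb D}f(w)K_\alpha(z,w)\,dA_\alpha(w)$. $M_u$ denotes multiplication by $u$. The commutator is given, for $f\in L^2(\mathbb D,dA_\alpha)$, by $$\mathscr C_uf(z)=\int_{\mathbb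 D}f(w)\,(u(z)-u(w))\,K_\alpha(z,w)\,dA_\alpha(w).$$ For a compact operator $T$ on an infinite-dimensional Hilbert space, $(s_n(T))_{n\ge1}$ is the sequence of eigenvalues of $(T^*T)^{1/2}$, in non-increasing order and counted with multiplicity; $T$ belongs to $\mathcal C_p$ if $\sum_{n}(s_n(T))^p<+\infty$. *)

theory Defs
  imports "HOL-Analysis.Analysis"
begin

section \<open>Harmonic and subharmonic functions\<close>

text \<open>
  Class \<open>C\<^sup>2\<close> with vanishing Laplacian: \<open>f1 z\<close> is the Frechet derivative at \<open>z\<close>,
  \<open>f2 z v\<close> the derivative of \<open>w \<mapsto> f1 w v\<close> at \<open>z\<close>, so \<open>f2 z 1 1\<close> and
  \<open>f2 z \<i> \<i>\<close> are the pure second partial derivatives in \<open>x\<close> and \<open>y\<close>.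
\<close>

definition harmonic_on :: "(complex \<Rightarrow> real) \<Rightarrow> complex set \<Rightarrow> bool" where
  "harmonic_on f S \<longleftrightarrow> open S \<and>
     (\<exists>f1 f2.
        (\<forall>z\<in>S. (f has_derivative f1 z) (at z)) \<and>
        (\<forall>z\<in>S. \<forall>v. ((\<lambda>w. f1 w v) has_derivative f2 z v) (at z)) \<and>
        (\<forall>v w. continuous_on S (\<lambda>z. f2 z v w)) \<and>
        (\<forall>z\<in>S. f2 z 1 1 + f2 z \<i> \<i> = 0))"

text \<open>
  Mean value of an extended-real function over the circle of centre \<open>z\<close> and radius \<open>r\<close>:
  integral of the positive part minus integral of the negative part (\<open>e2ennreal\<close> maps
  negative numbers to 0). For an upper semicontinuous function below \<open>\<infinity>\<close> the first term is
  finite, so the difference is never of the form \<open>\<infinity> - \<infinity>\<close>; it may be \<open>-\<infinity>\<close>.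
\<close>

definition circle_mean :: "(complex \<Rightarrow> ereal) \<Rightarrow> complex \<Rightarrow> real \<Rightarrow> ereal" where
  "circle_mean u z r =
     ereal (1 / (2 * pi)) *
       (enn2ereal (\<integral>\<^sup>+t\<in>{0..2 * pi}. e2ennreal (u (z + rcis r t)) \<partial>lborel)
        - enn2ereal (\<integral>\<^sup>+t\<in>{0..2 * pi}. e2ennreal (- u (z + rcis r t)) \<partial>lborel))"

text \<open>The value \<open>-\<infinity>\<close> is allowed, and so is the constant function \<open>-\<infinity>\<close>.\<close>

definition subharmonic_on :: "(complex \<Rightarrow> ereal) \<Rightarrow> complex set \<Rightarrow> bool" where
  "subharmonic_on u S \<longleftrightarrow> open S \<and>
     (\<forall>z\<in>S. u z < \<infinity>) \<and>
     (\<forall>z\<in>S. \<forall>c. u z < c \<longrightarrow> (\<forall>\<^sub>F w in at z within S. u w < c)) \<and>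
     (\<forall>z r. 0 < r \<and> cball z r \<subseteq> S \<longrightarrow> u z \<le> circle_mean u z r)"


section \<open>Operators on \<open>L\<^sup>2\<close>\<close>

text \<open>
  Elements of \<open>L\<^sup>2(M)\<close> are represented by square-integrable functions, equality in
  \<open>L\<^sup>2(M)\<close> being equality almost everywhere; an operator is a map on representatives.
\<close>

definition L2 :: "'a measure \<Rightarrow> ('a \<Rightarrow> complex) set" where
  "L2 M = {f \<in> borel_measurable M. integrable M (\<lambda>x. (cmod (f x))\<^sup>2)}"

definition L2_inner :: "'a measure \<Rightarrow> ('a \<Rightarrow> complex) \<Rightarrow> ('a \<Rightarrow> complex) \<Rightarrow> complex" where
  "L2_inner M f g = (LINT x|M. f x * cnj (g x))"

definition L2_norm :: "'a measure \<Rightarrow> ('a \<Rightarrow> complex) \<Rightarrow> real" where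
  "L2_norm M f = sqrt (LINT x|M. (cmod (f x))\<^sup>2)"

text \<open>Linearity and boundedness imply that \<open>T\<close> respects almost-everywhere equality.\<close>

definition L2_bounded_linear ::
    "'a measure \<Rightarrow> (('a \<Rightarrow> complex) \<Rightarrow> 'a \<Rightarrow> complex) \<Rightarrow> bool" where
  "L2_bounded_linear M T \<longleftrightarrow>
     (\<forall>f\<in>L2 M. T f \<in> L2 M) \<and>
     (\<forall>f\<in>L2 M. \<forall>g\<in>L2 M. AE x in M. T (\<lambda>y. f y + g y) x = T f x + T g x) \<and>
     (\<forall>f\<in>L2 M. \<forall>c. AE x in M. T (\<lambda>y. c * f y) x = c * T f x) \<and>
     (\<exists>B. \<forall>f\<in>L2 M. L2_norm M (T f) \<le> B * L2_norm M f)"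

definition L2_compact ::
    "'a measure \<Rightarrow> (('a \<Rightarrow> complex) \<Rightarrow> 'a \<Rightarrow> complex) \<Rightarrow> bool" where
  "L2_compact M T \<longleftrightarrow> L2_bounded_linear M T \<and>
     (\<forall>f :: nat \<Rightarrow> 'a \<Rightarrow> complex. (\<forall>n. f n \<in> L2 M \<and> L2_norm M (f n) \<le> 1) \<longrightarrow>
        (\<exists>r g. strict_mono r \<and> g \<in> L2 M \<and>
           (\<lambda>n. L2_norm M (\<lambda>x. T (f (r n)) x - g x)) \<longlonglongrightarrow> 0))"

definition L2_adjoint ::
    "'a measure \<Rightarrow> (('a \<Rightarrow> complex) \<Rightarrow> 'a \<Rightarrow> complex) \<Rightarrow>
     (('a \<Rightarrow> complex) \<Rightarrow> 'a \<Rightarrow> complex) \<Rightarrow> bool" where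
  "L2_adjoint M T S \<longleftrightarrow> L2_bounded_linear M S \<and>
     (\<forall>f\<in>L2 M. \<forall>g\<in>L2 M. L2_inner M (T f) g = L2_inner M f (S g))"

definition L2_positive ::
    "'a measure \<Rightarrow> (('a \<Rightarrow> complex) \<Rightarrow> 'a \<Rightarrow> complex) \<Rightarrow> bool" where
  "L2_positive M A \<longleftrightarrow> L2_bounded_linear M A \<and>
     (\<forall>f\<in>L2 M. L2_inner M (A f) f \<in> \<real> \<and> 0 \<le> Re (L2_inner M (A f) f))"

text \<open>\<open>A\<close> is the positive square root of \<open>T\<^sup>* T\<close>.\<close>

definition L2_modulus ::
    "'a measure \<Rightarrow> (('a \<Rightarrow> complex) \<Rightarrow> 'a \<Rightarrow> complex) \<Rightarrow>
     (('a \<Rightarrow> complex) \<Rightarrow> 'a \<Rightarrow> complex) \<Rightarrow> bool" where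
  "L2_modulus M T A \<longleftrightarrow> L2_positive M A \<and>
     (\<exists>S. L2_adjoint M T S \<and> (\<forall>f\<in>L2 M. AE x in M. A (A f) x = S (T f) x))"

definition L2_eigenspace ::
    "'a measure \<Rightarrow> (('a \<Rightarrow> complex) \<Rightarrow> 'a \<Rightarrow> complex) \<Rightarrow> complex \<Rightarrow> ('a \<Rightarrow> complex) set" where
  "L2_eigenspace M A c = {f \<in> L2 M. AE x in M. A f x = c * f x}"

text \<open>\<open>E\<close>, modulo null functions, has a basis of \<open>n\<close> elements.\<close>

definition L2_has_dim :: "'a measure \<Rightarrow> ('a \<Rightarrow> complex) set \<Rightarrow> nat \<Rightarrow> bool" where
  "L2_has_dim M E n \<longleftrightarrow>
     (\<exists>b :: nat \<Rightarrow> 'a \<Rightarrow> complex.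
        (\<forall>i<n. b i \<in> E) \<and>
        (\<forall>c :: nat \<Rightarrow> complex. (AE x in M. (\<Sum>i<n. c i * b i x) = 0) \<longrightarrow> (\<forall>i<n. c i = 0)) \<and>
        (\<forall>f\<in>E. \<exists>c :: nat \<Rightarrow> complex. AE x in M. f x = (\<Sum>i<n. c i * b i x)))"

text \<open>
  \<open>s\<close> lists the eigenvalues of \<open>(T\<^sup>* T)\<^sup>1\<^sup>/\<^sup>2\<close> in non-increasing order with multiplicity,
  indexed from 0: each \<open>t > 0\<close> occurs as often as the dimension of its eigenspace. This
  determines \<open>s\<close>, which is eventually 0 exactly when \<open>T\<close> has finite rank.
\<close>

definition singular_values ::
    "'a measure \<Rightarrow> (('a \<Rightarrow> complex) \<Rightarrow> 'a \<Rightarrow> complex) \<Rightarrow> (nat \<Rightarrow> real) \<Rightarrow> bool" where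
  "singular_values M T s \<longleftrightarrow>
     decseq s \<and> (\<forall>n. 0 \<le> s n) \<and>
     (\<exists>A. L2_modulus M T A \<and>
        (\<forall>t>0. finite {n. s n = t} \<and>
           L2_has_dim M (L2_eigenspace M A (complex_of_real t)) (card {n. s n = t})))"

definition schatten_class ::
    "'a measure \<Rightarrow> real \<Rightarrow> (('a \<Rightarrow> complex) \<Rightarrow> 'a \<Rightarrow> complex) \<Rightarrow> bool" where
  "schatten_class M p T \<longleftrightarrow> L2_compact M T \<and>
     (\<exists>s. singular_values M T s \<and> summable (\<lambda>n. s n powr p))"


section \<open>The harmonic Bergman projection\<close>

definition disk_measure :: "real \<Rightarrow> complex measure" where
  "disk_measure \<alpha> =
     density (restrict_space lborel (ball 0 1))
       (\<lambda>z. ennreal ((\<alpha> + 1) / pi * (1 - (cmod z)\<^sup>2) powr \<alpha>))"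

text \<open>For \<open>z\<close>, \<open>w\<close> in the unit disk, \<open>1 - z * cnj w\<close> lies in the right half-plane, where
  \<open>powr\<close> is the principal branch.\<close>

definition harmonic_kernel :: "real \<Rightarrow> complex \<Rightarrow> complex \<Rightarrow> complex" where
  "harmonic_kernel \<alpha> z w =
     1 / (1 - z * cnj w) powr complex_of_real (\<alpha> + 2)
     + 1 / (1 - w * cnj z) powr complex_of_real (\<alpha> + 2) - 1"

text \<open>
  The integral formula makes sense pointwise as soon as \<open>f\<close> is integrable, in particular
  for \<open>f = u g\<close> with \<open>u\<close> and \<open>g\<close> square-integrable, even if \<open>f\<close> is not in \<open>L\<^sup>2\<close>.
\<close>

definition harmonic_proj :: "real \<Rightarrow> (complex \<Rightarrow> complex) \<Rightarrow> complex \<Rightarrow> complex" where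
  "harmonic_proj \<alpha> f z = (LINT w|disk_measure \<alpha>. f w * harmonic_kernel \<alpha> z w)"

text \<open>
  The symbol is extended-real valued, as a subharmonic function may be \<open>-\<infinity>\<close> somewhere;
  \<open>real_of_ereal\<close> puts 0 there, which is immaterial on null sets.
\<close>

definition mult_op :: "(complex \<Rightarrow> ereal) \<Rightarrow> (complex \<Rightarrow> complex) \<Rightarrow> complex \<Rightarrow> complex" where
  "mult_op u f z = complex_of_real (real_of_ereal (u z)) * f z"

definition commutator ::
    "real \<Rightarrow> (complex \<Rightarrow> ereal) \<Rightarrow> (complex \<Rightarrow> complex) \<Rightarrow> complex \<Rightarrow> complex" where
  "commutator \<alpha> u f z =
     (LINT w|disk_measure \<alpha>.
        f w * complex_of_real (real_of_ereal (u z) - real_of_ereal (u w)) * harmonic_kernel \<alpha> z w)"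

lemma commutator_eq:
  assumes "integrable (disk_measure \<alpha>) (\<lambda>w. f w * harmonic_kernel \<alpha> z w)"
    and "integrable (disk_measure \<alpha>) (\<lambda>w. mult_op u f w * harmonic_kernel \<alpha> z w)"
  shows "commutator \<alpha> u f z =
    mult_op u (harmonic_proj \<alpha> f) z - harmonic_proj \<alpha> (mult_op u f) z"
proof -
  let ?c = "complex_of_real (real_of_ereal (u z))"
  have "commutator \<alpha> u f z =
      (LINT w|disk_measure \<alpha>. ?c * (f w * harmonic_kernel \<alpha> z w)
         - mult_op u f w * harmonic_kernel \<alpha> z w)"
    unfolding commutator_def mult_op_def
    by (intro Bochner_Integration.integral_cong) (auto simp: algebra_simps)
  also have "\<dots> = (LINT w|disk_measure \<alpha>. ?c * (f w * harmonic_kernel \<alpha> z w))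
      - (LINT w|disk_measure \<alpha>. mult_op u f w * harmonic_kernel \<alpha> z w)"
    using assms by (intro Bochner_Integration.integral_diff) auto
  also have "\<dots> = mult_op u (harmonic_proj \<alpha> f) z - harmonic_proj \<alpha> (mult_op u f) z"
    by (simp add: harmonic_proj_def mult_op_def)
  finally show ?thesis .
qed

end

theory Submission
  imports Defs "HOL-Library.Function_Algebras" "HOL-Complex_Analysis.Complex_Analysis"
begin

text \<open>
  An upper semicontinuous \<open>u\<close> is bounded above near the puncture, and a harmonic function with this
  property is \<open>c ln \<bar>z\<bar> + Re (L z)\<close> with \<open>L\<close> holomorphic in the whole disk
  (\<open>harmonic_bounded_above_near_puncture\<close>). As \<open>{0}\<close> is a null set, the commutator is the integral
  operator \<open>T\<close> with kernel \<open>(v z - v w) K(z, w)\<close>, where \<open>v\<close> is this explicit function. The kernel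
  \<open>K\<close> is real and symmetric, so \<open>T\<close> is skew-adjoint.

  The singular values of \<open>T\<close> are of order \<open>1/n\<close>. By the easy half of the
  Courant--Fischer principle (\<open>s_le_if_small_off\<close>) it is enough that, for some \<open>m\<close> and \<open>C\<close> and for every
  \<open>N\<close>, \<open>\<parallel>T f\<parallel> \<le> C \<parallel>f\<parallel> / (N + 1)\<close> holds for all \<open>f\<close> orthogonal to certain \<open>m N\<close> vectors
  (\<open>rate_one\<close>). This property is stable under sums, multiples and complex conjugation, so the three parts
  of \<open>v\<close> can be treated separately.
  \<^item> For the symbol \<open>z\<close>, the expansion of the kernel in powers of \<open>z cnj w\<close> can be regrouped into
    products of orthogonal functions, and the moments of the measure give the singular values exactly;
    they are of order \<open>1/n\<close> (\<open>good_kernel_z\<close>).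
  \<^item> For \<open>ln \<bar>z\<bar>\<close> the two halves \<open>ln \<bar>z\<bar> K\<close> and \<open>ln \<bar>w\<bar> K\<close> already have this rate: the mass of
    \<open>\<bar>w\<bar>\<^sup>2\<^sup>n\<close> concentrates near the unit circle, where the logarithm vanishes (\<open>good_kernel_ln\<close>).
  \<^item> For \<open>L\<close>, each difference \<open>z\<^sup>n - w\<^sup>n\<close> is \<open>z - w\<close> times a sum of products of monomials. Since
    \<open>R > 1\<close>, the Taylor coefficients decay geometrically, and the \<open>N\<close> vectors can be distributed over the
    monomials in geometrically decreasing shares without spoiling the rate (\<open>good_kernel_power_series\<close>).

  The singular values exist by the spectral theorem for compact operators. For skew-adjoint \<open>T\<close> it takes
  the following form: \<open>T\<^sup>* T = - T\<^sup>2\<close>, a unit vector that maximizes \<open>\<parallel>T f\<parallel>\<close> on the orthogonal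
  complement of the eigenvectors found before is again an eigenvector of \<open>T\<^sup>2\<close> (\<open>top_eigenvector\<close>), and
  the diagonal operator with entries \<open>s j = \<parallel>T (v j)\<parallel>\<close> in the system obtained in this way is the modulus
  of \<open>T\<close> (\<open>A_A\<close>, \<open>A_eigenspace\<close>).

  As to commutation, let \<open>\<tau> w = \<bar>w\<bar>\<^sup>2 - 1 / \<gamma> 1\<close>, where \<open>1 / \<gamma> 1\<close> is the mean of \<open>\<bar>w\<bar>\<^sup>2\<close>; this
  function is radial with mean 0, so the projection \<open>P\<close> kills it. If \<open>P\<close> commutes with multiplication
  by \<open>v\<close>, then \<open>v z\<^sup>k = P (v z\<^sup>k)\<close> is orthogonal to \<open>\<tau>\<close> for every \<open>k\<close>. For \<open>k = 0\<close> only the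
  logarithm contributes, and \<open>\<integral> ln \<bar>w\<bar> \<tau>\<close> is positive because both factors increase with
  \<open>\<bar>w\<bar>\<close>; hence \<open>c = 0\<close>. For \<open>k > 0\<close> only the \<open>k\<close>-th Taylor coefficient of \<open>L\<close> contributes, and it
  vanishes (\<open>symbol_trivial_if_commutes\<close>). So \<open>u\<close> is constant off 0, and its value at 0 is forced by the
  mean value inequality from above and by upper semicontinuity from below.
\<close>

section \<open>Semi-inner product spaces\<close>

text \<open>This turns a dimension count into a vector orthogonal to given ones: there are fewer equations,
  indexed by \<open>B\<close>, than unknowns, indexed by \<open>I\<close>. One unknown and one equation are eliminated at a time.\<close>

lemma homogeneous_system_nontrivial_solution:
  fixes M :: "'i \<Rightarrow> 'b \<Rightarrow> complex"
  assumes "finite B" "finite I" "card B < card I"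
  shows "\<exists>c. (\<exists>i\<in>I. c i \<noteq> 0) \<and> (\<forall>b\<in>B. (\<Sum>i\<in>I. c i * M i b) = 0)"
  using assms
proof (induction B arbitrary: I M rule: finite_induct)
  case empty
  then have "I \<noteq> {}" by auto
  then show ?case by (intro exI[of _ "\<lambda>_. 1"]) auto
next
  case (insert b B)
  show ?case
  proof (cases "\<forall>i\<in>I. M i b = 0")
    case True
    have "card B < card I" using insert by simp
    from insert.IH[OF insert.prems(1) this, of M] True show ?thesis by auto
  next
    case False
    then obtain j where j: "j \<in> I" "M j b \<noteq> 0" by auto
    define M' where "M' i b' = M i b' - M i b / M j b * M j b'" for i b'
    have "card B < card (I - {j})" using insert j by simp
    moreover have "finite (I - {j})" using insert.prems by simp
    ultimately obtain c where
      c: "\<exists>i\<in>I - {j}. c i \<noteq> 0" "\<forall>b\<in>B. (\<Sum>i\<in>I - {j}. c i * M' i b) = 0"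
      using insert.IH[of "I - {j}" M'] by blast
    define d where "d i = (if i = j then - (\<Sum>i\<in>I - {j}. c i * M i b) / M j b else c i)" for i
    have split: "(\<Sum>i\<in>I. d i * M i b') = d j * M j b' + (\<Sum>i\<in>I - {j}. c i * M i b')" for b'
    proof -
      have "(\<Sum>i\<in>I. d i * M i b') = d j * M j b' + (\<Sum>i\<in>I - {j}. d i * M i b')"
        by (rule sum.remove[OF insert.prems(1) j(1)])
      also have "(\<Sum>i\<in>I - {j}. d i * M i b') = (\<Sum>i\<in>I - {j}. c i * M i b')"
        by (rule sum.cong) (simp_all add: d_def)
      finally show ?thesis .
    qed
    have "(\<Sum>i\<in>I. d i * M i b') = 0" if "b' \<in> B" for b'
    proof -
      have "0 = (\<Sum>i\<in>I - {j}. c i * M' i b')" using c that by auto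
      also have "\<dots> = (\<Sum>i\<in>I - {j}. c i * M i b') - (\<Sum>i\<in>I - {j}. c i * M i b) / M j b * M j b'"
        by (simp add: M'_def right_diff_distrib sum_subtractf sum_divide_distrib sum_distrib_right
            mult.assoc)
      finally show ?thesis unfolding split by (simp add: d_def)
    qed
    moreover have "(\<Sum>i\<in>I. d i * M i b) = 0"
      unfolding split using j(2) by (simp add: d_def)
    moreover have "\<exists>i\<in>I. d i \<noteq> 0" using c(1) by (auto simp: d_def)
    ultimately show ?thesis by (intro exI[of _ d]) auto
  qed
qed

text \<open>The model is the set \<open>V\<close> of square-integrable functions, not identified almost everywhere, among
  all functions. It contains nonzero vectors of norm 0, so equations between vectors are replaced by equations
  between inner products.\<close>

locale semi_inner = vector_space scale
  for scale :: "complex \<Rightarrow> 'v::ab_group_add \<Rightarrow> 'v" (infixr "*c" 75) +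
  fixes V :: "'v set" and ip :: "'v \<Rightarrow> 'v \<Rightarrow> complex"
  assumes zero_in: "0 \<in> V"
    and add_in: "\<And>x y. x \<in> V \<Longrightarrow> y \<in> V \<Longrightarrow> x + y \<in> V"
    and scale_in: "\<And>c x. x \<in> V \<Longrightarrow> c *c x \<in> V"
    and ip_add_left: "\<And>x y z. x \<in> V \<Longrightarrow> y \<in> V \<Longrightarrow> z \<in> V \<Longrightarrow> ip (x + y) z = ip x z + ip y z"
    and ip_scale_left: "\<And>c x y. x \<in> V \<Longrightarrow> y \<in> V \<Longrightarrow> ip (c *c x) y = c * ip x y"
    and ip_cnj: "\<And>x y. x \<in> V \<Longrightarrow> y \<in> V \<Longrightarrow> ip y x = cnj (ip x y)"
    and ip_self_nonneg: "\<And>x. x \<in> V \<Longrightarrow> 0 \<le> Re (ip x x)"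
begin

definition nrm :: "'v \<Rightarrow> real" where "nrm x = sqrt (Re (ip x x))"

lemma minus_in: "x \<in> V \<Longrightarrow> - x \<in> V"
  using scale_in[of x "-1"] by simp

lemma diff_in: "x \<in> V \<Longrightarrow> y \<in> V \<Longrightarrow> x - y \<in> V"
  using add_in[of x "- y"] minus_in by simp

lemma sum_in: "(\<And>i. i \<in> I \<Longrightarrow> f i \<in> V) \<Longrightarrow> (\<Sum>i\<in>I. f i) \<in> V"
  by (induction I rule: infinite_finite_induct) (auto intro: zero_in add_in)

lemmas closed = zero_in add_in scale_in minus_in diff_in sum_in

lemma ip_scale_right: "x \<in> V \<Longrightarrow> y \<in> V \<Longrightarrow> ip x (c *c y) = cnj c * ip x y"
  using ip_cnj[of "c *c y" x] ip_cnj[of y x] ip_scale_left[of y x c] scale_in[of y c] by simp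

lemma ip_add_right: "x \<in> V \<Longrightarrow> y \<in> V \<Longrightarrow> z \<in> V \<Longrightarrow> ip x (y + z) = ip x y + ip x z"
  using ip_cnj[of "y + z" x] ip_cnj[of y x] ip_cnj[of z x] ip_add_left[of y z x] add_in[of y z]
  by simp

lemma ip_minus_left: "x \<in> V \<Longrightarrow> y \<in> V \<Longrightarrow> ip (- x) y = - ip x y"
  using ip_scale_left[of x y "-1"] by simp

lemma ip_minus_right: "x \<in> V \<Longrightarrow> y \<in> V \<Longrightarrow> ip x (- y) = - ip x y"
  using ip_scale_right[of x y "-1"] by simp

lemma ip_diff_left: "x \<in> V \<Longrightarrow> y \<in> V \<Longrightarrow> z \<in> V \<Longrightarrow> ip (x - y) z = ip x z - ip y z"
  using ip_add_left[of x "- y" z] ip_minus_left[of y z] minus_in[of y] by simp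

lemma ip_diff_right: "x \<in> V \<Longrightarrow> y \<in> V \<Longrightarrow> z \<in> V \<Longrightarrow> ip x (y - z) = ip x y - ip x z"
  using ip_add_right[of x y "- z"] ip_minus_right[of x z] minus_in[of z] by simp

lemma ip_zero_left: "x \<in> V \<Longrightarrow> ip 0 x = 0"
  using ip_scale_left[of x x 0] by simp

lemma ip_zero_right: "x \<in> V \<Longrightarrow> ip x 0 = 0"
  using ip_scale_right[of x x 0] by simp

lemma ip_sum_left:
  "(\<And>i. i \<in> I \<Longrightarrow> f i \<in> V) \<Longrightarrow> y \<in> V \<Longrightarrow> ip (\<Sum>i\<in>I. f i) y = (\<Sum>i\<in>I. ip (f i) y)"
  by (induction I rule: infinite_finite_induct) (auto simp: ip_zero_left ip_add_left closed)

lemma ip_sum_right: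
  "(\<And>i. i \<in> I \<Longrightarrow> f i \<in> V) \<Longrightarrow> y \<in> V \<Longrightarrow> ip y (\<Sum>i\<in>I. f i) = (\<Sum>i\<in>I. ip y (f i))"
  by (induction I rule: infinite_finite_induct) (auto simp: ip_zero_right ip_add_right closed)

lemmas ip_simps = ip_add_left ip_add_right ip_scale_left ip_scale_right ip_minus_left
  ip_minus_right ip_diff_left ip_diff_right ip_zero_left ip_zero_right

lemma ip_self: "x \<in> V \<Longrightarrow> ip x x = of_real ((nrm x)\<^sup>2)"
  using ip_cnj[of x x] ip_self_nonneg[of x] by (simp add: nrm_def complex_eq_iff)

lemma nrm_ge0: "x \<in> V \<Longrightarrow> 0 \<le> nrm x"
  by (simp add: nrm_def ip_self_nonneg)

lemma nrm_sq: "x \<in> V \<Longrightarrow> (nrm x)\<^sup>2 = Re (ip x x)"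
  by (simp add: ip_self)

lemma nrm_zero [simp]: "nrm 0 = 0"
  using ip_zero_left[OF zero_in] by (simp add: nrm_def)

lemma nrm_scale: "x \<in> V \<Longrightarrow> nrm (c *c x) = cmod c * nrm x"
proof -
  assume x: "x \<in> V"
  have "ip (c *c x) (c *c x) = of_real ((cmod c)\<^sup>2) * ip x x"
    using x complex_norm_square[of c] by (simp add: ip_simps closed mult.assoc[symmetric])
  then show ?thesis using x
    by (simp add: nrm_def real_sqrt_mult)
qed

lemma nrm_minus: "x \<in> V \<Longrightarrow> nrm (- x) = nrm x"
  using nrm_scale[of x "-1"] by simp

lemma nrm_diff_commute: "x \<in> V \<Longrightarrow> y \<in> V \<Longrightarrow> nrm (x - y) = nrm (y - x)"
  using nrm_minus[of "x - y"] by (simp add: closed)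

text \<open>The quadratic \<open>t \<mapsto> \<parallel>x - t \<langle>x, y\<rangle> y\<parallel>\<^sup>2\<close> is nonnegative; this covers null vectors \<open>y\<close>.\<close>

lemma cauchy_schwarz:
  assumes x: "x \<in> V" and y: "y \<in> V"
  shows "cmod (ip x y) \<le> nrm x * nrm y"
proof -
  define A B C where "A = (nrm x)\<^sup>2" and "B = (cmod (ip x y))\<^sup>2" and "C = (nrm y)\<^sup>2"
  have Q: "0 \<le> A - 2 * t * B + t\<^sup>2 * B * C" for t :: real
  proof -
    define l where "l = ip x y"
    have c: "cnj l = ip y x" using ip_cnj[OF x y] by (simp add: l_def)
    have "ip (x - (of_real t * l) *c y) (x - (of_real t * l) *c y)
        = ip x x - cnj (of_real t * l) * l - of_real t * l * cnj l
          + of_real t * l * cnj (of_real t * l) * ip y y"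
      using x y by (simp add: ip_simps closed c[symmetric] l_def[symmetric] algebra_simps)
    also have "\<dots> = of_real A - 2 * of_real t * (l * cnj l) + (of_real t)\<^sup>2 * (l * cnj l) * of_real C"
      using x y by (simp add: ip_self A_def C_def power2_eq_square algebra_simps)
    also have "\<dots> = of_real (A - 2 * t * B + t\<^sup>2 * B * C)"
      using complex_norm_square[of l] by (simp add: B_def l_def)
    finally show ?thesis using ip_self_nonneg[of "x - (of_real t * l) *c y"] x y
      by (simp add: closed)
  qed
  have B0: "0 \<le> B" by (simp add: B_def)
  have "B \<le> A * C"
  proof (cases "C = 0")
    case True
    have "B = 0"
    proof (rule ccontr)
      assume "B \<noteq> 0"
      then have "2 * ((A + 1) / (2 * B)) * B = A + 1" by simp
      then show False using Q[of "(A + 1) / (2 * B)"] True by simp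
    qed
    then show ?thesis using True by simp
  next
    case False
    then have "0 < C" by (simp add: C_def)
    then show ?thesis using Q[of "1 / C"] by (simp add: power2_eq_square field_simps)
  qed
  then have "(cmod (ip x y))\<^sup>2 \<le> (nrm x * nrm y)\<^sup>2"
    by (simp add: A_def B_def C_def power_mult_distrib)
  then show ?thesis by (rule power2_le_imp_le) (simp add: nrm_ge0 x y)
qed

lemma nrm_triangle:
  assumes x: "x \<in> V" and y: "y \<in> V"
  shows "nrm (x + y) \<le> nrm x + nrm y"
proof -
  have "(nrm (x + y))\<^sup>2 = (nrm x)\<^sup>2 + 2 * Re (ip x y) + (nrm y)\<^sup>2"
    using x y ip_cnj[OF x y] by (simp add: nrm_sq ip_simps closed)
  also have "\<dots> \<le> (nrm x)\<^sup>2 + 2 * (nrm x * nrm y) + (nrm y)\<^sup>2"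
    using cauchy_schwarz[OF x y] complex_Re_le_cmod[of "ip x y"] by auto
  also have "\<dots> = (nrm x + nrm y)\<^sup>2" by (simp add: power2_eq_square algebra_simps)
  finally show ?thesis by (rule power2_le_imp_le) (simp add: nrm_ge0 x y)
qed

lemma nrm_triangle_diff: "x \<in> V \<Longrightarrow> y \<in> V \<Longrightarrow> nrm (x - y) \<le> nrm x + nrm y"
  using nrm_triangle[of x "- y"] by (simp add: nrm_minus closed)

lemma nrm_triangle3: "x \<in> V \<Longrightarrow> y \<in> V \<Longrightarrow> z \<in> V \<Longrightarrow> nrm (x - z) \<le> nrm (x - y) + nrm (y - z)"
  using nrm_triangle[of "x - y" "y - z"] by (simp add: closed)

lemma nrm_diff_ineq: "x \<in> V \<Longrightarrow> y \<in> V \<Longrightarrow> \<bar>nrm x - nrm y\<bar> \<le> nrm (x - y)"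
  using nrm_triangle[of "x - y" y] nrm_triangle[of "y - x" x] nrm_diff_commute[of x y]
  by (simp add: closed)

lemma nrm_sum: "(\<And>i. i \<in> I \<Longrightarrow> f i \<in> V) \<Longrightarrow> nrm (\<Sum>i\<in>I. f i) \<le> (\<Sum>i\<in>I. nrm (f i))"
proof (induction I rule: infinite_finite_induct)
  case (insert i I)
  have "nrm (f i + (\<Sum>i\<in>I. f i)) \<le> nrm (f i) + nrm (\<Sum>i\<in>I. f i)"
    using insert by (intro nrm_triangle closed) auto
  with insert show ?case by auto
qed auto

lemma null_iff: "x \<in> V \<Longrightarrow> nrm x = 0 \<longleftrightarrow> (\<forall>y\<in>V. ip x y = 0)"
proof (intro iffI ballI)
  fix y
  assume x: "x \<in> V" and "nrm x = 0" and y: "y \<in> V"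
  then show "ip x y = 0" using cauchy_schwarz[OF x y] by simp
next
  assume "x \<in> V" "\<forall>y\<in>V. ip x y = 0"
  then show "nrm x = 0" by (simp add: nrm_def)
qed

lemma null_ip: "x \<in> V \<Longrightarrow> y \<in> V \<Longrightarrow> nrm x = 0 \<Longrightarrow> ip x y = 0 \<and> ip y x = 0"
  using null_iff[of x] ip_cnj[of x y] by auto

definition tends :: "(nat \<Rightarrow> 'v) \<Rightarrow> 'v \<Rightarrow> bool" where
  "tends X l \<longleftrightarrow> (\<lambda>n. nrm (X n - l)) \<longlonglongrightarrow> 0"

lemma tends_ip:
  assumes "tends X l" "\<And>n. X n \<in> V" "l \<in> V" "y \<in> V"
  shows "(\<lambda>n. ip (X n) y) \<longlonglongrightarrow> ip l y"
proof -
  have "(\<lambda>n. nrm (X n - l) * nrm y) \<longlonglongrightarrow> 0"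
    using assms(1) unfolding tends_def by (rule tendsto_mult_left_zero)
  moreover have "norm (ip (X n) y - ip l y) \<le> nrm (X n - l) * nrm y" for n
    using cauchy_schwarz[of "X n - l" y] assms by (simp add: ip_simps closed)
  then have "\<forall>\<^sub>F n in sequentially. norm (ip (X n) y - ip l y) \<le> nrm (X n - l) * nrm y"
    by (simp add: always_eventually)
  ultimately show ?thesis by (rule LIM_zero_cancel[OF Lim_null_comparison, rotated])
qed

lemma tends_nrm:
  assumes "tends X l" "\<And>n. X n \<in> V" "l \<in> V"
  shows "(\<lambda>n. nrm (X n)) \<longlonglongrightarrow> nrm l"
proof -
  have "\<forall>\<^sub>F n in sequentially. norm (nrm (X n) - nrm l) \<le> nrm (X n - l)"
    using assms nrm_diff_ineq by (simp add: always_eventually)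
  then show ?thesis using assms(1) unfolding tends_def
    by (rule LIM_zero_cancel[OF Lim_null_comparison])
qed

text \<open>Null vectors are admitted, so that a sequence can go on after finitely many unit vectors.\<close>

definition ortho_system :: "'i set \<Rightarrow> ('i \<Rightarrow> 'v) \<Rightarrow> bool" where
  "ortho_system I v \<longleftrightarrow> (\<forall>i\<in>I. v i \<in> V \<and> (nrm (v i) = 1 \<or> nrm (v i) = 0)) \<and>
     (\<forall>i\<in>I. \<forall>j\<in>I. i \<noteq> j \<longrightarrow> ip (v i) (v j) = 0)"

lemma ortho_systemD:
  assumes "ortho_system I v" "i \<in> I"
  shows "v i \<in> V" "nrm (v i) = 1 \<or> nrm (v i) = 0" "nrm (v i) \<le> 1"
    "j \<in> I \<Longrightarrow> i \<noteq> j \<Longrightarrow> ip (v i) (v j) = 0"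
  using assms unfolding ortho_system_def by auto

lemma ortho_system_in: "ortho_system J v \<Longrightarrow> I \<subseteq> J \<Longrightarrow> i \<in> I \<Longrightarrow> v i \<in> V"
  unfolding ortho_system_def by auto

lemma ortho_system_ip:
  assumes "ortho_system I v" "i \<in> I" "j \<in> I"
  shows "ip (v i) (v j) = (if i = j then of_real ((nrm (v i))\<^sup>2) else 0)"
  using ortho_systemD[OF assms(1)] assms ip_self by auto

lemma coeff_absorb:
  assumes "ortho_system I v" "i \<in> I" "x \<in> V"
  shows "ip x (v i) * of_real ((nrm (v i))\<^sup>2) = ip x (v i)"
  using ortho_systemD(1,2)[OF assms(1,2)] null_ip[of "v i" x] assms(3) by auto

definition proj :: "'i set \<Rightarrow> ('i \<Rightarrow> 'v) \<Rightarrow> 'v \<Rightarrow> 'v" where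
  "proj I v x = (\<Sum>i\<in>I. ip x (v i) *c v i)"

lemma proj_in: "ortho_system I v \<Longrightarrow> proj I v x \<in> V"
  unfolding proj_def by (intro closed) (auto dest: ortho_systemD)

lemma ip_combination:
  assumes "ortho_system J v" "finite I" "I \<subseteq> J" "j \<in> J"
  shows "ip (\<Sum>i\<in>I. d i *c v i) (v j) = (if j \<in> I then d j * of_real ((nrm (v j))\<^sup>2) else 0)"
proof -
  have "ip (\<Sum>i\<in>I. d i *c v i) (v j) = (\<Sum>i\<in>I. d i * ip (v i) (v j))"
    using ortho_systemD(1)[OF assms(1)] assms by (subst ip_sum_left) (auto simp: ip_simps closed subset_iff)
  also have "\<dots> = (\<Sum>i\<in>I. if i = j then d j * of_real ((nrm (v j))\<^sup>2) else 0)"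
    using assms by (intro sum.cong) (auto simp: ortho_system_ip subset_iff)
  finally show ?thesis using assms by simp
qed

lemma ip_diff_proj:
  assumes "ortho_system J v" "finite I" "I \<subseteq> J" "j \<in> I" "x \<in> V"
  shows "ip (x - proj I v x) (v j) = 0"
proof -
  have "ip (proj I v x) (v j) = ip x (v j) * of_real ((nrm (v j))\<^sup>2)"
    unfolding proj_def using ip_combination[OF assms(1-3), of j "\<lambda>i. ip x (v i)"] assms by auto
  also have "\<dots> = ip x (v j)" using assms(3-5) by (intro coeff_absorb[OF assms(1)]) auto
  finally have e: "ip (proj I v x) (v j) = ip x (v j)" .
  note V = ortho_system_in[OF assms(1,3)]
  then have "proj I v x \<in> V" unfolding proj_def by (intro closed)
  then show ?thesis using e V[OF assms(4)] assms(5) by (simp add: ip_diff_left)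
qed

lemma nrm_combination:
  assumes "ortho_system J v" "finite I" "I \<subseteq> J"
  shows "(nrm (\<Sum>i\<in>I. d i *c v i))\<^sup>2 = (\<Sum>i\<in>I. (cmod (d i))\<^sup>2 * (nrm (v i))\<^sup>2)"
proof -
  let ?x = "\<Sum>i\<in>I. d i *c v i"
  note V = ortho_system_in[OF assms(1,3)]
  have xV: "?x \<in> V" using V by (intro closed)
  have "ip ?x ?x = (\<Sum>i\<in>I. cnj (d i) * ip ?x (v i))"
    using V xV by (subst ip_sum_right) (auto simp: ip_simps closed)
  also have "\<dots> = (\<Sum>i\<in>I. of_real ((cmod (d i))\<^sup>2 * (nrm (v i))\<^sup>2))"
  proof (rule sum.cong[OF refl])
    fix i assume i: "i \<in> I"
    then have "ip ?x (v i) = d i * of_real ((nrm (v i))\<^sup>2)"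
      using ip_combination[OF assms, of i d] assms(3) by auto
    then show "cnj (d i) * ip ?x (v i) = of_real ((cmod (d i))\<^sup>2 * (nrm (v i))\<^sup>2)"
      using complex_norm_square[of "d i"] by (simp add: mult.commute mult.left_commute)
  qed
  finally have "ip ?x ?x = of_real (\<Sum>i\<in>I. (cmod (d i))\<^sup>2 * (nrm (v i))\<^sup>2)" by simp
  then show ?thesis using xV by (simp add: nrm_sq)
qed

lemma nrm_proj:
  assumes "ortho_system J v" "finite I" "I \<subseteq> J" "x \<in> V"
  shows "(nrm (proj I v x))\<^sup>2 = (\<Sum>i\<in>I. (cmod (ip x (v i)))\<^sup>2)"
proof -
  have "(cmod (ip x (v i)))\<^sup>2 * (nrm (v i))\<^sup>2 = (cmod (ip x (v i)))\<^sup>2" if "i \<in> I" for i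
    using ortho_systemD(1,2)[OF assms(1), of i] null_ip[of "v i" x] assms(4) subsetD[OF assms(3) that]
    by auto
  then show ?thesis unfolding proj_def nrm_combination[OF assms(1-3)] by (rule sum.cong[OF refl])
qed

lemma pythagoras_proj:
  assumes "ortho_system J v" "finite I" "I \<subseteq> J" "x \<in> V"
  shows "(nrm x)\<^sup>2 = (nrm (proj I v x))\<^sup>2 + (nrm (x - proj I v x))\<^sup>2"
proof -
  let ?p = "proj I v x"
  note V = ortho_system_in[OF assms(1,3)]
  have p: "?p \<in> V" using V unfolding proj_def by (intro closed)
  have "ip (x - ?p) ?p = (\<Sum>i\<in>I. ip (x - ?p) (ip x (v i) *c v i))"
    using V p assms(4) unfolding proj_def[of I v x, THEN arg_cong[of _ _ "ip (x - proj I v x)"]]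
    by (subst ip_sum_right) (auto simp: closed)
  also have "\<dots> = 0"
    using V p assms by (intro sum.neutral) (auto simp: ip_scale_right closed ip_diff_proj)
  finally have "ip (x - ?p) ?p = 0" .
  then have e: "ip x ?p = ip ?p ?p" using p assms by (simp add: ip_simps)
  then have e2: "ip ?p x = ip ?p ?p" using ip_cnj[of x ?p] p assms ip_cnj[of ?p ?p] by simp
  show ?thesis using p assms by (simp add: nrm_sq closed ip_simps e e2)
qed

lemma bessel:
  assumes "ortho_system J v" "finite I" "I \<subseteq> J" "x \<in> V"
  shows "(\<Sum>i\<in>I. (cmod (ip x (v i)))\<^sup>2) \<le> (nrm x)\<^sup>2"
  using pythagoras_proj[OF assms] nrm_proj[OF assms] by simp

lemma nrm_diff_proj_le:
  assumes "ortho_system J v" "finite I" "I \<subseteq> J" "x \<in> V"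
  shows "nrm (x - proj I v x) \<le> nrm x"
proof (rule power2_le_imp_le)
  show "(nrm (x - proj I v x))\<^sup>2 \<le> (nrm x)\<^sup>2" using pythagoras_proj[OF assms] by simp
qed (simp add: nrm_ge0 assms)

text \<open>If every vector orthogonal to \<open>E\<close> is orthogonal to \<open>B\<close>, a bound that holds off \<open>B\<close> also holds
  off the orthogonal system \<open>E\<close>, onto which one can project. A member of \<open>B\<close> that depends on the
  previous ones leaves a null vector.\<close>

lemma gram_schmidt:
  assumes "finite B" "B \<subseteq> V"
  shows "\<exists>E. finite E \<and> ortho_system E (\<lambda>e. e) \<and>
     (\<forall>x\<in>V. (\<forall>e\<in>E. ip x e = 0) \<longrightarrow> (\<forall>b\<in>B. ip x b = 0))"
  using assms
proof (induction B rule: finite_induct)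
  case empty
  show ?case by (intro exI[of _ "{}"]) (auto simp: ortho_system_def)
next
  case (insert b B)
  then obtain E where E: "finite E" "ortho_system E (\<lambda>e. e)"
    "\<And>x. x \<in> V \<Longrightarrow> (\<forall>e\<in>E. ip x e = 0) \<Longrightarrow> (\<forall>b\<in>B. ip x b = 0)" by auto
  define d where "d = b - proj E (\<lambda>e. e) b"
  define c where "c = (if nrm d = 0 then d else (1 / of_real (nrm d)) *c d)"
  define s where "s = (if nrm d = 0 then 1 else complex_of_real (nrm d))"
  have bV: "b \<in> V" and EV: "\<And>e. e \<in> E \<Longrightarrow> e \<in> V" using insert.prems E(2) by (auto simp: ortho_system_def)
  have pV: "proj E (\<lambda>e. e) b \<in> V" using E(2) by (rule proj_in)
  have dV: "d \<in> V" unfolding d_def using bV pV by (rule diff_in)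
  have cV: "c \<in> V" unfolding c_def using dV by (auto intro: closed)
  have dc: "d = s *c c" by (simp add: c_def s_def)
  have c1: "nrm c = 1 \<or> nrm c = 0" using dV nrm_ge0[OF dV]
    by (auto simp: c_def nrm_scale norm_divide)
  have dE: "ip d e = 0" if "e \<in> E" for e
    unfolding d_def using ip_diff_proj[OF E(2) E(1) subset_refl that bV] by simp
  then have cE: "ip c e = 0" "ip e c = 0" if "e \<in> E" for e
    using that dV EV[OF that] ip_cnj[OF cV EV[OF that]] by (auto simp: c_def ip_simps)
  have "ortho_system (insert c E) (\<lambda>e. e)"
    using E(2) cV c1 cE unfolding ortho_system_def by auto
  moreover have "\<forall>b'\<in>insert b B. ip x b' = 0" if x: "x \<in> V" "\<forall>e\<in>insert c E. ip x e = 0" for x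
  proof -
    have "ip x (proj E (\<lambda>e. e) b) = 0" unfolding proj_def
      using x EV by (subst ip_sum_right) (auto simp: ip_simps closed)
    moreover have "ip x d = 0" unfolding dc using x cV by (simp add: ip_simps)
    moreover have "ip x d = ip x b - ip x (proj E (\<lambda>e. e) b)"
      unfolding d_def using x bV pV by (simp add: ip_simps)
    ultimately show ?thesis using E(3)[of x] x by auto
  qed
  moreover have "finite (insert c E)" using E(1) by simp
  ultimately show ?case by (intro exI[of _ "insert c E"] conjI ballI impI) blast+
qed

text \<open>A map with an adjoint on all of \<open>V\<close> is linear up to null vectors.\<close>

lemma adjoint_imp_linear:
  assumes T: "\<And>x. x \<in> V \<Longrightarrow> T x \<in> V" and S: "\<And>x. x \<in> V \<Longrightarrow> S x \<in> V"
    and TS: "\<And>x y. x \<in> V \<Longrightarrow> y \<in> V \<Longrightarrow> ip (T x) y = ip x (S y)"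
  shows "x \<in> V \<Longrightarrow> y \<in> V \<Longrightarrow> nrm (T (x + y) - (T x + T y)) = 0"
    and "x \<in> V \<Longrightarrow> nrm (T (c *c x) - c *c T x) = 0"
    and "x \<in> V \<Longrightarrow> y \<in> V \<Longrightarrow> nrm (T (x - y) - (T x - T y)) = 0"
  by (subst null_iff; simp add: ip_simps closed T S TS)+

lemma nrm_eq_if_null:
  assumes "x \<in> V" "y \<in> V" "nrm (x - y) = 0"
  shows "nrm x = nrm y"
  using nrm_diff_ineq[OF assms(1,2)] assms(3) by simp

end

locale semi_hilbert = semi_inner +
  assumes complete: "\<And>X. (\<And>n. X n \<in> V) \<Longrightarrow>
      (\<And>e. 0 < e \<Longrightarrow> \<exists>N. \<forall>m\<ge>N. \<forall>n\<ge>N. nrm (X m - X n) < e) \<Longrightarrow> \<exists>l\<in>V. tends X l"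
begin

lemma completeI:
  assumes "\<And>n. X n \<in> V" "\<And>e. 0 < e \<Longrightarrow> \<exists>N. \<forall>m\<ge>N. \<forall>n\<ge>N. nrm (X m - X n) < e"
  obtains l where "l \<in> V" "tends X l"
  using complete[of X] assms by auto

lemma riesz_fischer:
  assumes v: "ortho_system UNIV (v :: nat \<Rightarrow> 'a)" and d: "summable (\<lambda>j. (cmod (d j))\<^sup>2)"
  obtains g where "g \<in> V" "tends (\<lambda>n. \<Sum>j<n. d j *c v j) g"
proof -
  let ?X = "\<lambda>n. \<Sum>j<n. d j *c v j"
  have vV: "v j \<in> V" for j using ortho_systemD(1)[OF v] by simp
  have XV: "?X n \<in> V" for n using vV by (intro closed)
  have half: "nrm (?X m - ?X n) < e" if "m \<ge> n" "norm (\<Sum>j=n..<m. (cmod (d j))\<^sup>2) < e\<^sup>2" "0 < e" for m n e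
  proof -
    have "?X m - ?X n = (\<Sum>j\<in>{n..<m}. d j *c v j)"
      using that(1) sum_diff_nat_ivl[of 0 n m "\<lambda>j. d j *c v j"] by (simp add: atLeast0LessThan)
    then have "(nrm (?X m - ?X n))\<^sup>2 = (\<Sum>j=n..<m. (cmod (d j))\<^sup>2 * (nrm (v j))\<^sup>2)"
      using nrm_combination[OF v, of "{n..<m}" d] by simp
    also have "\<dots> \<le> (\<Sum>j=n..<m. (cmod (d j))\<^sup>2)"
      using ortho_systemD(2)[OF v] by (intro sum_mono) (metis UNIV_I mult.right_neutral mult_zero_right
          one_power2 order_refl zero_le_power2 power_zero_numeral)
    also have "\<dots> < e\<^sup>2" using that(2) by auto
    finally show ?thesis using that(3) by (intro power2_less_imp_less[of _ e]) auto
  qed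
  have "\<exists>N. \<forall>m\<ge>N. \<forall>n\<ge>N. nrm (?X m - ?X n) < e" if e: "0 < e" for e
  proof -
    from d e obtain N where N: "\<And>m n. m \<ge> N \<Longrightarrow> norm (\<Sum>j=m..<n. (cmod (d j))\<^sup>2) < e\<^sup>2"
      unfolding summable_Cauchy by (metis zero_less_power)
    have "nrm (?X m - ?X n) < e" if "m \<ge> N" "n \<ge> N" for m n
      using half[of n m e] half[of m n e] N[OF that(1), of n] N[OF that(2), of m] e
        nrm_diff_commute[OF XV XV, of m n] by (cases "n \<le> m") auto
    then show ?thesis by blast
  qed
  from completeI[of ?X, OF XV this] that show ?thesis by blast
qed

end

section \<open>Compact skew-adjoint operators\<close>

text \<open>The last assumption is compactness in the form in which it is available for integral operators. Linearity
  follows, up to null vectors, from the existence of an adjoint.\<close>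

locale skew_operator = semi_hilbert +
  fixes T :: "'a \<Rightarrow> 'a"
  assumes T_in: "\<And>x. x \<in> V \<Longrightarrow> T x \<in> V"
    and skew: "\<And>x y. x \<in> V \<Longrightarrow> y \<in> V \<Longrightarrow> ip (T x) y = - ip x (T y)"
    and bounded_ex: "\<exists>C. \<forall>x\<in>V. nrm (T x) \<le> C * nrm x"
    and small_off_finite: "\<And>e. 0 < e \<Longrightarrow>
      \<exists>B. finite B \<and> B \<subseteq> V \<and> (\<forall>x\<in>V. (\<forall>b\<in>B. ip x b = 0) \<longrightarrow> nrm (T x) \<le> e * nrm x)"
begin

lemma skew2: "x \<in> V \<Longrightarrow> y \<in> V \<Longrightarrow> ip (T (T x)) y = ip x (T (T y))"
  by (simp add: skew T_in)

lemma minus_adjoint: "x \<in> V \<Longrightarrow> y \<in> V \<Longrightarrow> ip (T x) y = ip x (- T y)"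
  by (simp add: skew T_in ip_minus_right)

lemmas T_linear = adjoint_imp_linear[of T "\<lambda>y. - T y", OF T_in minus_in[OF T_in] minus_adjoint]

lemma nrm_T_diff: "x \<in> V \<Longrightarrow> y \<in> V \<Longrightarrow> nrm (T (x - y)) = nrm (T x - T y)"
  by (rule nrm_eq_if_null) (auto intro!: closed T_in T_linear)

lemma nrm_T_scale: "x \<in> V \<Longrightarrow> nrm (T (c *c x)) = cmod c * nrm (T x)"
  using nrm_eq_if_null[of "T (c *c x)" "c *c T x"] T_linear(2)[of x c] by (simp add: closed T_in nrm_scale)

lemma nrm_T_add_le: "x \<in> V \<Longrightarrow> y \<in> V \<Longrightarrow> nrm (T (x + y)) \<le> nrm (T x) + nrm (T y)"
  using nrm_eq_if_null[of "T (x + y)" "T x + T y"] T_linear(1)[of x y] nrm_triangle[of "T x" "T y"]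
  by (simp add: closed T_in)

lemma T_bounded: obtains C where "0 < C" "\<And>x. x \<in> V \<Longrightarrow> nrm (T x) \<le> C * nrm x"
proof -
  obtain C where C: "\<And>x. x \<in> V \<Longrightarrow> nrm (T x) \<le> C * nrm x" using bounded_ex by blast
  have "nrm (T x) \<le> (\<bar>C\<bar> + 1) * nrm x" if "x \<in> V" for x
  proof -
    have "C * nrm x \<le> (\<bar>C\<bar> + 1) * nrm x" using nrm_ge0[OF that] by (intro mult_right_mono) auto
    then show ?thesis using C[OF that] by linarith
  qed
  then show ?thesis using that[of "\<bar>C\<bar> + 1"] by simp
qed

lemma tends_T:
  assumes "tends X l" "\<And>n. X n \<in> V" "l \<in> V"
  shows "tends (\<lambda>n. T (X n)) (T l)"
proof -
  obtain C where C: "0 < C" "\<And>x. x \<in> V \<Longrightarrow> nrm (T x) \<le> C * nrm x" by (rule T_bounded) blast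
  have "nrm (T (X n) - T l) \<le> C * nrm (X n - l)" for n
    using C(2)[of "X n - l"] nrm_T_diff[of "X n" l] assms by (simp add: closed)
  then have "\<forall>\<^sub>F n in sequentially. norm (nrm (T (X n) - T l)) \<le> C * nrm (X n - l)"
    using assms nrm_ge0 by (simp add: closed T_in always_eventually)
  moreover have "(\<lambda>n. C * nrm (X n - l)) \<longlonglongrightarrow> 0"
    using assms(1) unfolding tends_def by (rule tendsto_mult_right_zero)
  ultimately show ?thesis unfolding tends_def by (rule Lim_null_comparison)
qed

text \<open>Compactness: after passing to a subsequence, the coefficients against each of the
  countably many vectors that control \<open>T\<close> up to \<open>1/(m+1)\<close> converge.\<close>

lemma compact:
  assumes X: "\<And>n. X n \<in> V" "\<And>n. nrm (X n) \<le> 1"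
  obtains r l where "strict_mono (r :: nat \<Rightarrow> nat)" "l \<in> V" "tends (\<lambda>n. T (X (r n))) l"
proof -
  obtain C where C: "0 < C" "\<And>x. x \<in> V \<Longrightarrow> nrm (T x) \<le> C * nrm x" by (rule T_bounded) blast
  have "\<exists>E. finite E \<and> ortho_system E (\<lambda>e. e) \<and>
      (\<forall>x\<in>V. (\<forall>b\<in>E. ip x b = 0) \<longrightarrow> nrm (T x) \<le> 1 / (real m + 1) * nrm x)" for m
  proof -
    have "0 < 1 / (real m + 1)" by simp
    from small_off_finite[OF this] obtain B where B: "finite B" "B \<subseteq> V"
      "\<forall>x\<in>V. (\<forall>b\<in>B. ip x b = 0) \<longrightarrow> nrm (T x) \<le> 1 / (real m + 1) * nrm x" by blast
    from gram_schmidt[OF B(1,2)] B(3) show ?thesis by blast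
  qed
  then obtain E where E: "\<And>m. finite (E m)" "\<And>m. ortho_system (E m) (\<lambda>e. e)"
    "\<And>m x. x \<in> V \<Longrightarrow> (\<forall>b\<in>E m. ip x b = 0) \<Longrightarrow> nrm (T x) \<le> 1 / (real m + 1) * nrm x"
    by metis
  have EV: "e \<in> V" "nrm e \<le> 1" if "e \<in> E m" for e m
    using ortho_systemD[OF E(2) that] by auto
  have count: "countable (\<Union>m. E m)"
    using E(1) by (intro countable_UN) (auto intro: countable_finite)
  have le1: "norm (ip (X n) e) \<le> 1" if "e \<in> (\<Union>m. E m)" for n e
  proof -
    from that obtain m where "e \<in> E m" by (rule UN_E)
    then have "nrm (X n) * nrm e \<le> 1 * 1" using EV X nrm_ge0 by (intro mult_mono) auto
    then show ?thesis using cauchy_schwarz[OF X(1), of e n] EV[OF \<open>e \<in> E m\<close>] by simp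
  qed
  obtain r where r: "strict_mono (r :: nat \<Rightarrow> nat)"
    "\<And>e. e \<in> (\<Union>m. E m) \<Longrightarrow> \<exists>l. (\<lambda>n. ip (X (r n)) e) \<longlonglongrightarrow> l"
    using function_convergent_subsequence[where f = "\<lambda>n e. ip (X n) e", OF count le1] by metis
  then obtain l where l: "\<And>e m. e \<in> E m \<Longrightarrow> (\<lambda>n. ip (X (r n)) e) \<longlonglongrightarrow> l e"
    by (metis UN_I UNIV_I)
  define Y where "Y n = X (r n)" for n
  have YV: "Y n \<in> V" "nrm (Y n) \<le> 1" for n using X by (auto simp: Y_def)
  have "\<exists>N. \<forall>i\<ge>N. \<forall>j\<ge>N. nrm (T (Y i) - T (Y j)) < e" if e: "0 < e" for e
  proof -
    obtain m :: nat where m: "4 / e < real m" using reals_Archimedean2 by blast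
    then have m': "2 / (real m + 1) < e / 2" using e by (simp add: field_simps)
    define q where "q n = (\<Sum>b\<in>E m. cmod (ip (Y n) b - l b))" for n
    have "q \<longlonglongrightarrow> (\<Sum>b\<in>E m. cmod (l b - l b))"
      unfolding q_def Y_def by (intro tendsto_intros l)
    then have "q \<longlonglongrightarrow> 0" by simp
    then obtain N where N: "\<And>n. n \<ge> N \<Longrightarrow> q n < e / (4 * C)"
      using LIMSEQ_D[of q 0 "e / (4 * C)"] e C(1) by (auto simp: abs_less_iff)
    have "nrm (T (Y i) - T (Y j)) < e" if ij: "i \<ge> N" "j \<ge> N" for i j
    proof -
      define d where "d = Y i - Y j"
      define p where "p = proj (E m) (\<lambda>e. e) d"
      have dV: "d \<in> V" using YV by (simp add: d_def closed)
      have d2: "nrm d \<le> 2"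
        using nrm_triangle_diff[OF YV(1) YV(1), of i j] YV(2)[of i] YV(2)[of j] by (simp add: d_def)
      have pV: "p \<in> V" unfolding p_def by (rule proj_in[OF E(2)])
      have "nrm p \<le> (\<Sum>b\<in>E m. nrm (ip d b *c b))"
        unfolding p_def proj_def using EV by (intro nrm_sum closed) auto
      also have "\<dots> \<le> (\<Sum>b\<in>E m. cmod (ip d b))"
        using EV by (intro sum_mono) (auto simp: nrm_scale mult_left_le)
      also have "\<dots> \<le> (\<Sum>b\<in>E m. cmod (ip (Y i) b - l b) + cmod (ip (Y j) b - l b))"
      proof (intro sum_mono)
        fix b assume "b \<in> E m"
        then have "ip d b = (ip (Y i) b - l b) - (ip (Y j) b - l b)"
          using EV YV by (simp add: d_def ip_simps)
        then show "cmod (ip d b) \<le> cmod (ip (Y i) b - l b) + cmod (ip (Y j) b - l b)"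
          using norm_triangle_ineq4 by metis
      qed
      also have "\<dots> = q i + q j" by (simp add: q_def sum.distrib)
      also have "\<dots> < e / (4 * C) + e / (4 * C)" using N ij by (intro add_strict_mono) auto
      finally have "C * nrm p \<le> C * (e / (2 * C))" using C(1) by (intro mult_left_mono) auto
      then have "nrm (T p) \<le> e / 2" using C(1) C(2)[OF pV] by simp
      moreover have "nrm (T (d - p)) \<le> 1 / (real m + 1) * nrm (d - p)"
        using dV pV ip_diff_proj[OF E(2) E(1) subset_refl _ dV] by (intro E(3)) (auto simp: p_def closed)
      moreover have "nrm (d - p) \<le> 2"
        using nrm_diff_proj_le[OF E(2) E(1) subset_refl dV] d2 unfolding p_def by (rule order_trans)
      then have "1 / (real m + 1) * nrm (d - p) \<le> 1 / (real m + 1) * 2" by (intro mult_left_mono) auto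
      moreover have "nrm (T d) \<le> nrm (T (d - p)) + nrm (T p)"
        using nrm_T_add_le[of "d - p" p] dV pV by (simp add: closed)
      ultimately have "nrm (T d) < e" using m' by simp
      then show ?thesis unfolding d_def using nrm_T_diff YV by simp
    qed
    then show ?thesis by blast
  qed
  from completeI[of "\<lambda>n. T (Y n)", OF T_in[OF YV(1)] this] r(1) that show ?thesis
    unfolding Y_def by blast
qed

text \<open>An eigenvector of \<open>T\<^sup>2\<close>, in weak form; the eigenvalue of a unit vector \<open>v\<close> can only be
  \<open>- \<parallel>T v\<parallel>\<^sup>2\<close>. Null vectors satisfy the definition.\<close>

definition eigen :: "'a \<Rightarrow> bool" where
  "eigen v \<longleftrightarrow> v \<in> V \<and> (\<forall>y\<in>V. ip (T (T v)) y = - of_real ((nrm (T v))\<^sup>2) * ip v y)"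

lemma nrm_T_sq: "x \<in> V \<Longrightarrow> ip (T (T x)) x = - of_real ((nrm (T x))\<^sup>2)"
  using skew[of "T x" x] ip_self[of "T x"] by (simp add: T_in)

lemma eigen_orthogonal:
  assumes v: "eigen v" and x: "x \<in> V" "ip x v = 0"
  shows "ip (T (T x)) v = 0"
proof -
  have vV: "v \<in> V" using v by (simp add: eigen_def)
  have vx: "ip v x = 0" using ip_cnj[OF x(1) vV] x by simp
  have "ip (T (T x)) v = ip x (T (T v))" using x(1) vV by (rule skew2)
  also have "\<dots> = cnj (ip (T (T v)) x)" using x(1) vV by (intro ip_cnj T_in)
  also have "\<dots> = 0" using v x vx by (simp add: eigen_def)
  finally show ?thesis .
qed

text \<open>Let \<open>\<sigma>\<close> be the norm of \<open>T\<close> on the complement \<open>W\<close> of \<open>F\<close>, which \<open>T\<^sup>2\<close> maps into itself. For a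
  sequence \<open>f n\<close> in the unit ball of \<open>W\<close> with \<open>\<parallel>T (f n)\<parallel> \<longlonglongrightarrow> \<sigma>\<close> the vectors
  \<open>- T (T (f n)) - \<sigma>\<^sup>2 f n\<close> tend to 0. By compactness \<open>T (T (f n))\<close> converges along a subsequence, hence
  so does \<open>f n\<close> if \<open>\<sigma> > 0\<close>, and the limit is a maximizer and an eigenvector. If \<open>\<sigma> = 0\<close> the zero
  vector will do.\<close>

lemma top_eigenvector:
  assumes F: "\<And>v. v \<in> F \<Longrightarrow> eigen v"
  shows "\<exists>x. eigen x \<and> (nrm x = 1 \<or> nrm x = 0) \<and> (\<forall>v\<in>F. ip x v = 0) \<and>
     (\<forall>f\<in>V. (\<forall>v\<in>F. ip f v = 0) \<longrightarrow> nrm (T f) \<le> nrm (T x) * nrm f)"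
proof -
  obtain C where C: "0 < C" "\<And>x. x \<in> V \<Longrightarrow> nrm (T x) \<le> C * nrm x" by (rule T_bounded) blast
  have FV: "v \<in> V" if "v \<in> F" for v using F[OF that] by (simp add: eigen_def)
  define W where "W = {f \<in> V. \<forall>v\<in>F. ip f v = 0}"
  have WV: "f \<in> V" if "f \<in> W" for f using that by (simp add: W_def)
  have scaleW: "c *c f \<in> W" if "f \<in> W" for c f
    using that FV by (auto simp: W_def closed ip_simps)
  have zeroW: "0 \<in> W" using FV by (auto simp: W_def closed ip_simps)
  have TTW: "- T (T f) \<in> W" if "f \<in> W" for f
    using that FV F eigen_orthogonal by (auto simp: W_def closed ip_simps T_in)
  define S where "S = {nrm (T f) | f. f \<in> W \<and> nrm f \<le> 1}"
  define \<sigma> where "\<sigma> = Sup S"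
  have T0: "nrm (T 0) = 0" using C(2)[OF zero_in] nrm_ge0[OF T_in[OF zero_in]] by simp
  have S0: "0 \<in> S" using zeroW T0 nrm_zero unfolding S_def by (metis (mono_tags, lifting) CollectI zero_le_one)
  have bdd: "bdd_above S"
  proof (rule bdd_aboveI)
    fix y assume "y \<in> S"
    then obtain f where f: "f \<in> W" "nrm f \<le> 1" "y = nrm (T f)" by (auto simp: S_def)
    have "C * nrm f \<le> C * 1" using f C(1) by (intro mult_left_mono) auto
    then show "y \<le> C" using C(2)[OF WV[OF f(1)]] f by simp
  qed
  have \<sigma>0: "0 \<le> \<sigma>" unfolding \<sigma>_def by (rule cSup_upper[OF S0 bdd])
  have le\<sigma>: "nrm (T f) \<le> \<sigma> * nrm f" if f: "f \<in> W" for f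
  proof (cases "nrm f = 0")
    case True
    then show ?thesis using C(2)[OF WV[OF f]] by simp
  next
    case False
    then have pos: "0 < nrm f" using nrm_ge0[OF WV[OF f]] by simp
    let ?g = "(1 / of_real (nrm f)) *c f"
    have "nrm ?g = 1" using pos f WV by (simp add: nrm_scale norm_divide)
    then have "nrm (T ?g) \<in> S" unfolding S_def using scaleW[OF f] by force
    then have "nrm (T ?g) \<le> \<sigma>" unfolding \<sigma>_def by (rule cSup_upper[OF _ bdd])
    then show ?thesis using pos f WV by (simp add: nrm_T_scale norm_divide field_simps)
  qed
  show ?thesis
  proof (cases "\<sigma> = 0")
    case True
    have "eigen 0" unfolding eigen_def
      using T0 zero_in null_ip[OF T_in[OF T_in[OF zero_in]]] C(2)[OF T_in[OF zero_in]] nrm_ge0[OF T_in[OF T_in[OF zero_in]]]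
      by (auto simp: ip_simps)
    moreover have "nrm (T f) \<le> 0" if "f \<in> W" for f using le\<sigma>[OF that] True by simp
    ultimately show ?thesis using T0 zeroW
      by (intro exI[of _ 0]) (auto simp: W_def)
  next
    case False
    then have \<sigma>pos: "0 < \<sigma>" using \<sigma>0 by simp
    have "\<exists>f. f \<in> W \<and> nrm f \<le> 1 \<and> \<sigma> - 1 / real (Suc n) < nrm (T f)" for n
    proof -
      have "\<sigma> - 1 / real (Suc n) < Sup S" by (simp add: \<sigma>_def)
      from less_cSupD[OF _ this] S0 show ?thesis unfolding S_def by blast
    qed
    then obtain f where f: "\<And>n. f n \<in> W" "\<And>n. nrm (f n) \<le> 1"
      "\<And>n. \<sigma> - 1 / real (Suc n) < nrm (T (f n))" by metis
    have fV: "f n \<in> V" for n using f(1) WV by simp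
    have upper: "nrm (T (f n)) \<le> \<sigma>" for n
      using le\<sigma>[OF f(1), of n] mult_left_mono[OF f(2)[of n] \<sigma>0] by simp
    have limT: "(\<lambda>n. nrm (T (f n))) \<longlonglongrightarrow> \<sigma>"
    proof (rule tendsto_sandwich)
      show "(\<lambda>n. \<sigma> - 1 / real (Suc n)) \<longlonglongrightarrow> \<sigma>"
        using tendsto_diff[OF tendsto_const LIMSEQ_inverse_real_of_nat, of \<sigma>] by (simp add: inverse_eq_divide)
      show "(\<lambda>n. \<sigma>) \<longlonglongrightarrow> \<sigma>" by (rule tendsto_const)
      show "\<forall>\<^sub>F n in sequentially. \<sigma> - 1 / real (Suc n) \<le> nrm (T (f n))"
        using f(3) by (intro always_eventually allI less_imp_le)
      show "\<forall>\<^sub>F n in sequentially. nrm (T (f n)) \<le> \<sigma>" using upper by (intro always_eventually allI)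
    qed
    \<comment> \<open>Expand the square on the left; \<open>\<parallel>B x\<parallel> \<le> \<sigma>\<^sup>2\<close> on the unit ball of \<open>W\<close>, and the inner product
      of \<open>B x\<close> and \<open>x\<close> is \<open>\<parallel>T x\<parallel>\<^sup>2\<close>.\<close>
    define B where "B x = - T (T x)" for x
    have BV: "B x \<in> V" if "x \<in> V" for x using that by (simp add: B_def closed T_in)
    have Bf: "(nrm (B (f n) - (of_real (\<sigma>\<^sup>2)) *c f n))\<^sup>2 \<le> 2 * \<sigma>\<^sup>2 * (\<sigma>\<^sup>2 - (nrm (T (f n)))\<^sup>2)" for n
    proof -
      let ?x = "f n" and ?c = "complex_of_real (\<sigma>\<^sup>2)"
      have x: "?x \<in> V" "B ?x \<in> V" using fV BV by auto
      have BW: "B ?x \<in> W" unfolding B_def by (rule TTW[OF f(1)])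
      have Bx: "ip (B ?x) y = ip (T ?x) (T y)" if "y \<in> V" for y
        using that x(1) by (simp add: B_def ip_simps T_in skew)
      have "(nrm (B ?x))\<^sup>2 = Re (ip (T ?x) (T (B ?x)))" using x Bx by (simp add: nrm_sq)
      also have "\<dots> \<le> nrm (T ?x) * nrm (T (B ?x))"
        using cauchy_schwarz[of "T ?x" "T (B ?x)"] complex_Re_le_cmod[of "ip (T ?x) (T (B ?x))"] x
        by (simp add: T_in)
      also have "\<dots> \<le> nrm (T ?x) * (\<sigma> * nrm (B ?x))"
        using le\<sigma>[OF BW] nrm_ge0 x T_in by (intro mult_left_mono) auto
      also have "\<dots> \<le> \<sigma> * (\<sigma> * nrm (B ?x))"
        using upper[of n] nrm_ge0[OF x(2)] \<sigma>0 by (intro mult_right_mono) auto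
      finally have "nrm (B ?x) * nrm (B ?x) \<le> \<sigma>\<^sup>2 * nrm (B ?x)" by (simp add: power2_eq_square)
      then have "nrm (B ?x) \<le> \<sigma>\<^sup>2"
        using nrm_ge0[OF x(2)] by (cases "nrm (B ?x) = 0") auto
      then have le: "(nrm (B ?x))\<^sup>2 \<le> (\<sigma>\<^sup>2)\<^sup>2" using nrm_ge0[OF x(2)] by (intro power_mono)
      have ipBx: "ip (B ?x) ?x = of_real ((nrm (T ?x))\<^sup>2)" using x Bx[of ?x] by (simp add: ip_self T_in)
      then have ipxB: "ip ?x (B ?x) = of_real ((nrm (T ?x))\<^sup>2)" using ip_cnj[of "B ?x" ?x] x by simp
      have "ip (B ?x - ?c *c ?x) (B ?x - ?c *c ?x)
         = ip (B ?x) (B ?x) - ?c * ip (B ?x) ?x - ?c * ip ?x (B ?x) + ?c * ?c * ip ?x ?x"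
        using x by (simp add: ip_simps closed algebra_simps)
      also have "\<dots> = of_real ((nrm (B ?x))\<^sup>2 - 2 * \<sigma>\<^sup>2 * (nrm (T ?x))\<^sup>2 + (\<sigma>\<^sup>2)\<^sup>2 * (nrm ?x)\<^sup>2)"
        unfolding ipBx ipxB using x by (simp add: ip_self power2_eq_square)
      finally have "(nrm (B ?x - ?c *c ?x))\<^sup>2 = (nrm (B ?x))\<^sup>2 - 2 * \<sigma>\<^sup>2 * (nrm (T ?x))\<^sup>2 + (\<sigma>\<^sup>2)\<^sup>2 * (nrm ?x)\<^sup>2"
        using x by (simp add: nrm_sq closed)
      also have "\<dots> \<le> (\<sigma>\<^sup>2)\<^sup>2 - 2 * \<sigma>\<^sup>2 * (nrm (T ?x))\<^sup>2 + (\<sigma>\<^sup>2)\<^sup>2 * 1"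
        using le f(2)[of n] nrm_ge0[OF x(1)] by (intro add_mono diff_right_mono mult_left_mono) (auto simp: power_le_one)
      finally show ?thesis by (simp add: algebra_simps power2_eq_square)
    qed
    have "(\<lambda>n. 2 * \<sigma>\<^sup>2 * (\<sigma>\<^sup>2 - (nrm (T (f n)))\<^sup>2)) \<longlonglongrightarrow> 2 * \<sigma>\<^sup>2 * (\<sigma>\<^sup>2 - \<sigma>\<^sup>2)"
      by (intro tendsto_intros limT)
    then have lim0: "(\<lambda>n. sqrt (2 * \<sigma>\<^sup>2 * (\<sigma>\<^sup>2 - (nrm (T (f n)))\<^sup>2))) \<longlonglongrightarrow> 0"
      using tendsto_real_sqrt by fastforce
    have "\<forall>\<^sub>F n in sequentially. norm (nrm (B (f n) - of_real (\<sigma>\<^sup>2) *c f n))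
        \<le> sqrt (2 * \<sigma>\<^sup>2 * (\<sigma>\<^sup>2 - (nrm (T (f n)))\<^sup>2))"
    proof (intro always_eventually allI)
      fix n
      have "0 \<le> nrm (B (f n) - of_real (\<sigma>\<^sup>2) *c f n)"
        using fV BV by (intro nrm_ge0 closed) auto
      then show "norm (nrm (B (f n) - of_real (\<sigma>\<^sup>2) *c f n)) \<le> sqrt (2 * \<sigma>\<^sup>2 * (\<sigma>\<^sup>2 - (nrm (T (f n)))\<^sup>2))"
        using real_le_rsqrt[OF Bf[of n]] by simp
    qed
    then have lim1: "(\<lambda>n. nrm (B (f n) - of_real (\<sigma>\<^sup>2) *c f n)) \<longlonglongrightarrow> 0"
      using lim0 by (rule Lim_null_comparison)
    obtain r l where r: "strict_mono (r :: nat \<Rightarrow> nat)" and l: "l \<in> V" "tends (\<lambda>n. T (f (r n))) l"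
      using compact[of f, OF fV f(2)] by blast
    define y where "y = - T l"
    have yV: "y \<in> V" unfolding y_def using l by (intro closed T_in)
    have By: "tends (\<lambda>n. B (f (r n))) y"
    proof -
      have "nrm (B (f (r n)) - y) = nrm (T (T (f (r n))) - T l)" for n
      proof -
        have "B (f (r n)) - y = T l - T (T (f (r n)))" by (simp add: B_def y_def)
        then show ?thesis using nrm_diff_commute[of "T l" "T (T (f (r n)))"] l fV by (simp add: T_in)
      qed
      then show ?thesis using tends_T[OF l(2) T_in[OF fV] l(1)] by (simp add: tends_def)
    qed
    define x where "x = (1 / of_real (\<sigma>\<^sup>2)) *c y"
    have xV: "x \<in> V" unfolding x_def using yV by (rule scale_in)
    have xy: "of_real (\<sigma>\<^sup>2) *c x = y" using \<sigma>pos by (simp add: x_def)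
    have fx: "tends (\<lambda>n. f (r n)) x"
    proof -
      have "\<sigma>\<^sup>2 * nrm (f (r n) - x) \<le> nrm (B (f (r n)) - of_real (\<sigma>\<^sup>2) *c f (r n)) + nrm (B (f (r n)) - y)" for n
      proof -
        have "\<sigma>\<^sup>2 * nrm (f (r n) - x) = nrm (of_real (\<sigma>\<^sup>2) *c (f (r n) - x))"
          using fV xV by (simp add: nrm_scale closed norm_power)
        also have "of_real (\<sigma>\<^sup>2) *c (f (r n) - x) = of_real (\<sigma>\<^sup>2) *c f (r n) - y"
          using xy by (simp add: scale_right_diff_distrib)
        also have "nrm \<dots> \<le> nrm (of_real (\<sigma>\<^sup>2) *c f (r n) - B (f (r n))) + nrm (B (f (r n)) - y)"
          using fV yV BV by (intro nrm_triangle3 closed) auto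
        finally show ?thesis using nrm_diff_commute[OF scale_in[OF fV] BV[OF fV]] by simp
      qed
      then have "nrm (f (r n) - x) \<le> (nrm (B (f (r n)) - of_real (\<sigma>\<^sup>2) *c f (r n)) + nrm (B (f (r n)) - y)) / \<sigma>\<^sup>2" for n
        using \<sigma>pos by (simp add: field_simps)
      then have "\<forall>\<^sub>F n in sequentially. norm (nrm (f (r n) - x))
          \<le> (nrm (B (f (r n)) - of_real (\<sigma>\<^sup>2) *c f (r n)) + nrm (B (f (r n)) - y)) / \<sigma>\<^sup>2"
        using nrm_ge0[OF diff_in[OF fV xV]] by (simp add: always_eventually)
      moreover have "(\<lambda>n. (nrm (B (f (r n)) - of_real (\<sigma>\<^sup>2) *c f (r n)) + nrm (B (f (r n)) - y)) / \<sigma>\<^sup>2) \<longlonglongrightarrow> (0 + 0) / \<sigma>\<^sup>2"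
        using LIMSEQ_subseq_LIMSEQ[OF lim1 r] By \<sigma>pos unfolding tends_def comp_def
        by (intro tendsto_intros) auto
      then have "(\<lambda>n. (nrm (B (f (r n)) - of_real (\<sigma>\<^sup>2) *c f (r n)) + nrm (B (f (r n)) - y)) / \<sigma>\<^sup>2) \<longlonglongrightarrow> 0"
        by simp
      ultimately show ?thesis unfolding tends_def by (rule Lim_null_comparison)
    qed
    have "ip x v = 0" if v: "v \<in> F" for v
    proof -
      have "ip (f (r n)) v = 0" for n using f(1)[of "r n"] v by (simp add: W_def)
      with tends_ip[OF fx fV xV FV[OF v]] show ?thesis by (simp add: LIMSEQ_const_iff)
    qed
    then have xW: "x \<in> W" using xV by (simp add: W_def)
    have nx1: "nrm x \<le> 1"
      using tends_nrm[OF fx fV xV] by (rule LIMSEQ_le_const2) (use f(2) in auto)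
    have nTx: "nrm (T x) = \<sigma>"
      using tends_nrm[OF tends_T[OF fx fV xV] T_in[OF fV] T_in[OF xV]]
        LIMSEQ_subseq_LIMSEQ[OF limT r] unfolding comp_def by (rule LIMSEQ_unique)
    then have "\<sigma> * 1 \<le> \<sigma> * nrm x" using le\<sigma>[OF xW] by simp
    then have nx: "nrm x = 1" using \<sigma>pos nx1 by simp
    have "ip (B x) z = ip y z" if z: "z \<in> V" for z
    proof (rule LIMSEQ_unique)
      have "(\<lambda>n. ip (f (r n)) (- (T (T z)))) \<longlonglongrightarrow> ip x (- (T (T z)))"
        using z by (intro tends_ip[OF fx fV xV] closed T_in)
      then show "(\<lambda>n. ip (B (f (r n))) z) \<longlonglongrightarrow> ip (B x) z"
        using z fV xV by (simp add: B_def ip_simps closed T_in skew2)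
      show "(\<lambda>n. ip (B (f (r n))) z) \<longlonglongrightarrow> ip y z" by (rule tends_ip[OF By BV[OF fV] yV z])
    qed
    moreover have "ip y z = of_real (\<sigma>\<^sup>2) * ip x z" if "z \<in> V" for z
      using that xV by (simp only: xy[symmetric] ip_scale_left)
    moreover have "ip (T (T x)) z = - ip (B x) z" if "z \<in> V" for z
      using that xV by (simp add: B_def ip_simps T_in)
    ultimately have "eigen x" using xV by (simp add: eigen_def nTx)
    then show ?thesis using nx xW le\<sigma> nTx
      by (intro exI[of _ x]) (auto simp: W_def)
  qed
qed

section \<open>Singular values of a compact skew-adjoint operator\<close>

text \<open>Each \<open>v n\<close> maximizes \<open>\<parallel>T f\<parallel> / \<parallel>f\<parallel>\<close> on the complement of its predecessors. Once \<open>T\<close>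
  vanishes on the complement, \<open>v n\<close> may be a null vector.\<close>

definition eigen_seq :: "(nat \<Rightarrow> 'a) \<Rightarrow> bool" where
  "eigen_seq v \<longleftrightarrow> (\<forall>n. eigen (v n) \<and> (nrm (v n) = 1 \<or> nrm (v n) = 0) \<and>
     (\<forall>i<n. ip (v n) (v i) = 0) \<and>
     (\<forall>f\<in>V. (\<forall>i<n. ip f (v i) = 0) \<longrightarrow> nrm (T f) \<le> nrm (T (v n)) * nrm f))"

lemma eigen_seq_exists: "\<exists>v. eigen_seq v"
proof -
  define P where "P v n x \<longleftrightarrow> eigen x \<and> (nrm x = 1 \<or> nrm x = 0) \<and> (\<forall>i<n. ip x (v i) = 0) \<and>
     (\<forall>f\<in>V. (\<forall>i<n. ip f (v i) = 0) \<longrightarrow> nrm (T f) \<le> nrm (T x) * nrm f)"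
    for v :: "nat \<Rightarrow> 'a" and n x
  have "\<exists>v. \<forall>n. P v n (v n)"
  proof (rule dependent_wf_choice[OF wf_less_than])
    fix f g :: "nat \<Rightarrow> 'a" and n x
    assume "\<And>i. (i, n) \<in> less_than \<Longrightarrow> f i = g i"
    then have e: "\<And>i. i < n \<Longrightarrow> f i = g i" by simp
    have "(\<forall>i<n. ip y (f i) = 0) \<longleftrightarrow> (\<forall>i<n. ip y (g i) = 0)" for y
      using e by auto
    then show "P f n x = P g n x" unfolding P_def by simp
  next
    fix n and v :: "nat \<Rightarrow> 'a"
    assume "\<And>i. (i, n) \<in> less_than \<Longrightarrow> P v i (v i)"
    then have "eigen (v i)" if "i < n" for i using that by (simp add: P_def)
    then have "eigen x" if "x \<in> v ` {..<n}" for x using that by auto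
    moreover have img: "(\<forall>y\<in>v ` {..<n}. Q y) \<longleftrightarrow> (\<forall>i<n. Q (v i))" for Q by auto
    ultimately show "\<exists>x. P v n x" using top_eigenvector[of "v ` {..<n}"] unfolding P_def img by blast
  qed
  then show ?thesis unfolding P_def eigen_seq_def .
qed

context
  fixes v assumes es: "eigen_seq v"
begin

lemma v_eigen: "eigen (v n)" and v_nrm: "nrm (v n) = 1 \<or> nrm (v n) = 0"
  and v_max: "f \<in> V \<Longrightarrow> (\<And>i. i < n \<Longrightarrow> ip f (v i) = 0) \<Longrightarrow> nrm (T f) \<le> nrm (T (v n)) * nrm f"
  using es unfolding eigen_seq_def by blast+

lemma v_in: "v n \<in> V"
  using v_eigen[of n] by (simp add: eigen_def)

lemma v_ortho: "ortho_system UNIV v"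
proof -
  have "ip (v i) (v j) = 0" if "i \<noteq> j" for i j
  proof (cases "j < i")
    case True
    then show ?thesis using es by (simp add: eigen_seq_def)
  next
    case False
    then have "ip (v j) (v i) = 0" using that es by (simp add: eigen_seq_def)
    then show ?thesis using ip_cnj[OF v_in v_in, of j i] by simp
  qed
  then show ?thesis unfolding ortho_system_def using v_in v_nrm by blast
qed

text \<open>The singular values of \<open>T\<close>.\<close>

definition s :: "nat \<Rightarrow> real" where "s n = nrm (T (v n))"

lemma s_ge0: "0 \<le> s n"
  unfolding s_def by (intro nrm_ge0 T_in v_in)

lemma s_decseq: "decseq s"
proof (rule decseq_SucI)
  fix n
  have "nrm (T (v (Suc n))) \<le> nrm (T (v n)) * nrm (v (Suc n))"
    using ortho_systemD(4)[OF v_ortho] by (intro v_max v_in) auto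
  also have "\<dots> \<le> nrm (T (v n)) * 1"
    using v_nrm[of "Suc n"] s_ge0[of n] unfolding s_def by (intro mult_left_mono) auto
  finally show "s (Suc n) \<le> s n" by (simp add: s_def)
qed

lemma s_pos_unit: "s n \<noteq> 0 \<Longrightarrow> nrm (v n) = 1"
proof -
  assume "s n \<noteq> 0"
  moreover obtain C where "\<And>x. x \<in> V \<Longrightarrow> nrm (T x) \<le> C * nrm x" by (rule T_bounded) blast
  then have "nrm (T (v n)) \<le> C * nrm (v n)" using v_in by blast
  ultimately show ?thesis using v_nrm[of n] s_ge0[of n] by (auto simp: s_def)
qed

lemma TT_v: "y \<in> V \<Longrightarrow> ip (T (T (v n))) y = - of_real ((s n)\<^sup>2) * ip (v n) y"
  using v_eigen[of n] by (simp add: eigen_def s_def)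

text \<open>The easy half of the Courant--Fischer principle: some combination \<open>x\<close> of
  \<open>v 0, \<dots>, v n\<close> is orthogonal to the at most \<open>n\<close> vectors of \<open>B\<close>, and \<open>\<parallel>T x\<parallel> \<ge> s n \<parallel>x\<parallel>\<close> on
  the span of these \<open>v i\<close>.\<close>

lemma s_le_if_small_off:
  assumes B: "finite B" "B \<subseteq> V" "card B \<le> n" and e: "0 \<le> e"
    and small: "\<And>x. x \<in> V \<Longrightarrow> (\<forall>b\<in>B. ip x b = 0) \<Longrightarrow> nrm (T x) \<le> e * nrm x"
  shows "s n \<le> e"
proof (cases "s n = 0")
  case False
  then have sn: "0 < s n" using s_ge0[of n] by simp
  have unit: "nrm (v i) = 1" and ge: "s n \<le> s i" if "i \<le> n" for i
    using decseqD[OF s_decseq that] sn s_pos_unit[of i] by auto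
  obtain c where c: "\<exists>i\<in>{..n}. c i \<noteq> 0" "\<forall>b\<in>B. (\<Sum>i\<in>{..n}. c i * ip (v i) b) = 0"
    using homogeneous_system_nontrivial_solution[of B "{..n}" "\<lambda>i. ip (v i)"] B by auto
  define x where "x = (\<Sum>i\<le>n. c i *c v i)"
  have xV: "x \<in> V" unfolding x_def using v_in by (intro closed)
  have "ip x b = 0" if "b \<in> B" for b
    unfolding x_def using that c(2) B(2) v_in by (subst ip_sum_left) (auto simp: ip_simps closed)
  then have Tx: "nrm (T x) \<le> e * nrm x" using small[OF xV] by blast
  have "(nrm x)\<^sup>2 = (\<Sum>i\<le>n. (cmod (c i))\<^sup>2 * (nrm (v i))\<^sup>2)"
    unfolding x_def by (rule nrm_combination[OF v_ortho]) auto
  then have nx: "(nrm x)\<^sup>2 = (\<Sum>i\<le>n. (cmod (c i))\<^sup>2)" using unit by simp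
  obtain k where k: "k \<in> {..n}" "c k \<noteq> 0" using c(1) by blast
  have "0 < (\<Sum>i\<le>n. (cmod (c i))\<^sup>2)" by (rule sum_pos2[OF _ k(1)]) (use k(2) in auto)
  then have "nrm x \<noteq> 0" using nx by auto
  then have xpos: "0 < nrm x" using nrm_ge0[OF xV] by simp
  have xv: "ip x (v i) = c i" if "i \<le> n" for i
    unfolding x_def using ip_combination[OF v_ortho, of "{..n}" i c] that unit by simp
  have "ip (T (T x)) x = cnj (\<Sum>i\<le>n. cnj (ip (T (T x)) (c i *c v i)))"
    by (subst (2) x_def, subst ip_sum_right) (auto intro!: closed v_in T_in xV)
  also have "\<dots> = (\<Sum>i\<le>n. - of_real ((s i)\<^sup>2 * (cmod (c i))\<^sup>2))"
    unfolding cnj_sum complex_cnj_cnj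
  proof (rule sum.cong[OF refl])
    fix i assume i: "i \<in> {..n}"
    have "ip (T (T x)) (c i *c v i) = cnj (c i) * ip x (T (T (v i)))"
      using xV v_in by (simp add: ip_simps T_in closed skew2)
    also have "ip x (T (T (v i))) = cnj (ip (T (T (v i))) x)"
      using xV v_in by (intro ip_cnj T_in)
    also have "\<dots> = - of_real ((s i)\<^sup>2) * cnj (ip (v i) x)" using xV by (simp add: TT_v)
    also have "cnj (ip (v i) x) = c i" using ip_cnj[OF v_in xV, of i] xv i by simp
    finally show "ip (T (T x)) (c i *c v i) = - of_real ((s i)\<^sup>2 * (cmod (c i))\<^sup>2)"
      using complex_norm_square[of "c i"] by (simp add: mult.commute mult.left_commute)
  qed
  also have "\<dots> = - of_real (\<Sum>i\<le>n. (s i)\<^sup>2 * (cmod (c i))\<^sup>2)" by (simp add: sum_negf)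
  finally have "complex_of_real ((nrm (T x))\<^sup>2) = of_real (\<Sum>i\<le>n. (s i)\<^sup>2 * (cmod (c i))\<^sup>2)"
    using nrm_T_sq[OF xV] by simp
  then have "(nrm (T x))\<^sup>2 = (\<Sum>i\<le>n. (s i)\<^sup>2 * (cmod (c i))\<^sup>2)" by (simp only: of_real_eq_iff)
  also have "\<dots> \<ge> (\<Sum>i\<le>n. (s n)\<^sup>2 * (cmod (c i))\<^sup>2)"
    using ge sn by (intro sum_mono mult_right_mono power_mono) auto
  finally have "(s n * nrm x)\<^sup>2 \<le> (nrm (T x))\<^sup>2" by (simp add: nx power_mult_distrib sum_distrib_left)
  then have "s n * nrm x \<le> nrm (T x)" by (rule power2_le_imp_le) (intro nrm_ge0 T_in xV)
  then have "s n * nrm x \<le> e * nrm x" using Tx by simp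
  then show ?thesis using xpos by simp
qed (use e in simp)

lemma s_tendsto_0: "s \<longlonglongrightarrow> 0"
proof (rule LIMSEQ_I)
  fix e :: real assume "0 < e"
  then have e2: "0 < e / 2" by simp
  from small_off_finite[OF this] obtain B where B: "finite B" "B \<subseteq> V"
    "\<And>x. x \<in> V \<Longrightarrow> (\<forall>b\<in>B. ip x b = 0) \<Longrightarrow> nrm (T x) \<le> e / 2 * nrm x" by blast
  have "s (card B) \<le> e / 2" by (rule s_le_if_small_off[OF B(1,2) order_refl _ B(3)]) (use e2 in auto)
  then have "norm (s n - 0) < e" if "n \<ge> card B" for n
    using decseqD[OF s_decseq that] s_ge0[of n] e2 by simp
  then show "\<exists>N. \<forall>n\<ge>N. norm (s n - 0) < e" by blast
qed

lemma finite_s_eq: "0 < t \<Longrightarrow> finite {n. s n = t}"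
proof -
  assume t: "0 < t"
  then obtain N where "\<And>n. n \<ge> N \<Longrightarrow> s n < t"
    using LIMSEQ_D[OF s_tendsto_0, of t] s_ge0 by force
  then have "{n. s n = t} \<subseteq> {..<N}" by (force simp: not_le[symmetric])
  then show ?thesis by (rule finite_subset) simp
qed

lemma summable_coeff:
  assumes f: "f \<in> V" shows "summable (\<lambda>j. (cmod (of_real (s j) * ip f (v j)))\<^sup>2)"
    and "(nrm (\<Sum>j<n. (of_real (s j) * ip f (v j)) *c v j)) \<le> s 0 * nrm f"
proof -
  have le: "(\<Sum>j<n. (cmod (of_real (s j) * ip f (v j)))\<^sup>2) \<le> (s 0)\<^sup>2 * (nrm f)\<^sup>2" for n
  proof -
    have "(\<Sum>j<n. (cmod (of_real (s j) * ip f (v j)))\<^sup>2) \<le> (\<Sum>j<n. (s 0)\<^sup>2 * (cmod (ip f (v j)))\<^sup>2)"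
    proof (rule sum_mono)
      fix j
      have "(s j)\<^sup>2 \<le> (s 0)\<^sup>2" using s_ge0[of j] decseqD[OF s_decseq, of 0 j] by (intro power_mono) auto
      then show "(cmod (of_real (s j) * ip f (v j)))\<^sup>2 \<le> (s 0)\<^sup>2 * (cmod (ip f (v j)))\<^sup>2"
        by (simp add: norm_mult power_mult_distrib mult_right_mono)
    qed
    also have "\<dots> = (s 0)\<^sup>2 * (\<Sum>j<n. (cmod (ip f (v j)))\<^sup>2)" by (simp add: sum_distrib_left)
    also have "\<dots> \<le> (s 0)\<^sup>2 * (nrm f)\<^sup>2"
      using bessel[OF v_ortho, of "{..<n}" f] f by (intro mult_left_mono) auto
    finally show ?thesis .
  qed
  show "summable (\<lambda>j. (cmod (of_real (s j) * ip f (v j)))\<^sup>2)"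
    by (rule summableI_nonneg_bounded[OF _ le]) auto
  have "(nrm (\<Sum>j<n. (of_real (s j) * ip f (v j)) *c v j))\<^sup>2
      = (\<Sum>j<n. (cmod (of_real (s j) * ip f (v j)))\<^sup>2 * (nrm (v j))\<^sup>2)"
    by (rule nrm_combination[OF v_ortho]) auto
  also have "\<dots> \<le> (\<Sum>j<n. (cmod (of_real (s j) * ip f (v j)))\<^sup>2)"
  proof (rule sum_mono)
    fix j
    have "(nrm (v j))\<^sup>2 \<le> 1" using v_nrm[of j] by auto
    then show "(cmod (of_real (s j) * ip f (v j)))\<^sup>2 * (nrm (v j))\<^sup>2 \<le> (cmod (of_real (s j) * ip f (v j)))\<^sup>2"
      by (intro mult_left_le) auto
  qed
  also have "\<dots> \<le> (s 0 * nrm f)\<^sup>2" using le by (simp add: power_mult_distrib)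
  finally show "(nrm (\<Sum>j<n. (of_real (s j) * ip f (v j)) *c v j)) \<le> s 0 * nrm f"
    by (rule power2_le_imp_le) (simp add: s_ge0 nrm_ge0[OF f])
qed

text \<open>\<open>A f = (\<Sum>j. s j \<langle>f, v j\<rangle> v j)\<close>, the limit being unique only up to null vectors.\<close>

definition A :: "'a \<Rightarrow> 'a" where
  "A f = (SOME g. g \<in> V \<and> tends (\<lambda>n. \<Sum>j<n. (of_real (s j) * ip f (v j)) *c v j) g)"

lemma A_in: "f \<in> V \<Longrightarrow> A f \<in> V"
  and A_tends: "f \<in> V \<Longrightarrow> tends (\<lambda>n. \<Sum>j<n. (of_real (s j) * ip f (v j)) *c v j) (A f)"
proof -
  assume "f \<in> V"
  from riesz_fischer[OF v_ortho summable_coeff(1)[OF this]]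
  have "\<exists>g. g \<in> V \<and> tends (\<lambda>n. \<Sum>j<n. (of_real (s j) * ip f (v j)) *c v j) g" by blast
  from someI_ex[OF this] show "A f \<in> V" "tends (\<lambda>n. \<Sum>j<n. (of_real (s j) * ip f (v j)) *c v j) (A f)"
    unfolding A_def by auto
qed

lemma partial_in: "(\<Sum>j<n. (of_real (s j) * ip f (v j)) *c v j) \<in> V"
  using v_in by (intro closed)

lemma A_sums:
  assumes f: "f \<in> V" and y: "y \<in> V"
  shows "(\<lambda>j. of_real (s j) * ip f (v j) * ip (v j) y) sums ip (A f) y"
proof -
  have "ip (\<Sum>j<n. (of_real (s j) * ip f (v j)) *c v j) y = (\<Sum>j<n. of_real (s j) * ip f (v j) * ip (v j) y)" for n
    by (simp add: ip_sum_left scale_in ip_scale_left v_in y)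
  then show ?thesis using tends_ip[OF A_tends[OF f] partial_in A_in[OF f] y] by (simp add: sums_def)
qed

lemma A_bounded: "f \<in> V \<Longrightarrow> nrm (A f) \<le> s 0 * nrm f"
  by (rule LIMSEQ_le_const2[OF tends_nrm[OF A_tends partial_in A_in]])
    (use summable_coeff(2) in auto)

lemma A_v: "f \<in> V \<Longrightarrow> ip (A f) (v k) = of_real (s k) * ip f (v k)"
proof -
  assume f: "f \<in> V"
  have "of_real (s j) * ip f (v j) * ip (v j) (v k) = (if j = k then of_real (s k) * ip f (v k) else 0)" for j
    using ortho_system_ip[OF v_ortho, of j k] coeff_absorb[OF v_ortho UNIV_I f, of k] by simp
  then have "(\<lambda>j. if j = k then of_real (s k) * ip f (v k) else 0) sums ip (A f) (v k)"
    using A_sums[OF f v_in, of k] by simp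
  from sums_unique2[OF this sums_single[of k "\<lambda>_. of_real (s k) * ip f (v k)"]] show ?thesis .
qed

lemma A_symmetric: "f \<in> V \<Longrightarrow> g \<in> V \<Longrightarrow> ip (A f) g = ip f (A g)"
proof -
  assume f: "f \<in> V" and g: "g \<in> V"
  have "(\<lambda>j. cnj (of_real (s j) * ip g (v j) * ip (v j) f)) sums cnj (ip (A g) f)"
    using A_sums[OF g f] by (simp only: sums_cnj)
  also have "(\<lambda>j. cnj (of_real (s j) * ip g (v j) * ip (v j) f)) = (\<lambda>j. of_real (s j) * ip f (v j) * ip (v j) g)"
    using ip_cnj[OF g v_in] ip_cnj[OF v_in f] by (auto simp: mult_ac)
  finally have "cnj (ip (A g) f) = ip (A f) g" using A_sums[OF f g] by (rule sums_unique2)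
  then show ?thesis using ip_cnj[OF A_in[OF g] f] by simp
qed

lemma A_positive: "f \<in> V \<Longrightarrow> ip (A f) f \<in> \<real> \<and> 0 \<le> Re (ip (A f) f)"
proof -
  assume f: "f \<in> V"
  have "of_real (s j) * ip f (v j) * ip (v j) f = of_real (s j * (cmod (ip f (v j)))\<^sup>2)" for j
    using ip_cnj[OF f v_in, of j] complex_norm_square[of "ip f (v j)"] by (simp add: mult.assoc)
  then have "(\<lambda>j. of_real (s j * (cmod (ip f (v j)))\<^sup>2)) sums ip (A f) f"
    using A_sums[OF f f] by (simp only:)
  then have 1: "(\<lambda>j. s j * (cmod (ip f (v j)))\<^sup>2) sums Re (ip (A f) f)"
    and 2: "(\<lambda>j. 0) sums Im (ip (A f) f)" unfolding sums_complex_iff by simp_all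
  have "0 \<le> Re (ip (A f) f)" by (rule sums_le[OF _ sums_zero 1]) (simp add: s_ge0)
  moreover have "Im (ip (A f) f) = 0" using 2 sums_zero by (rule sums_unique2)
  ultimately show ?thesis by (simp add: complex_is_Real_iff)
qed

text \<open>Both sides are \<open>\<Sum>j. s j\<^sup>2 \<langle>f, v j\<rangle> \<langle>v j, y\<rangle>\<close>: on the part of \<open>f\<close> orthogonal to
  \<open>v 0, \<dots>, v (n - 1)\<close> the norm of \<open>T\<close> is at most \<open>s n\<close>, which tends to 0.\<close>

lemma A_A: "f \<in> V \<Longrightarrow> y \<in> V \<Longrightarrow> ip (A (A f)) y = - ip (T (T f)) y"
proof -
  assume f: "f \<in> V" and y: "y \<in> V"
  obtain C where C: "0 < C" "\<And>x. x \<in> V \<Longrightarrow> nrm (T x) \<le> C * nrm x" by (rule T_bounded) blast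
  have 1: "(\<lambda>j. of_real ((s j)\<^sup>2) * ip f (v j) * ip (v j) y) sums ip (A (A f)) y"
    using A_sums[OF A_in[OF f] y] A_v[OF f] by (simp add: power2_eq_square mult.assoc)
  define r where "r n = f - proj {..<n} v f" for n
  have pV: "proj {..<n} v f \<in> V" for n unfolding proj_def using v_in by (intro closed)
  have rV: "r n \<in> V" for n unfolding r_def using f pV by (intro closed)
  have part: "- ip (T (T f)) y - (\<Sum>j<n. of_real ((s j)\<^sup>2) * ip f (v j) * ip (v j) y) = ip (T (r n)) (T y)" for n
  proof -
    have "ip (T (T f)) y = ip f (T (T y))" using f y by (rule skew2)
    also have "\<dots> = ip (r n) (T (T y)) + ip (proj {..<n} v f) (T (T y))"
      using f pV y by (simp add: r_def ip_simps T_in)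
    also have "ip (proj {..<n} v f) (T (T y)) = (\<Sum>j<n. ip f (v j) * ip (v j) (T (T y)))"
      unfolding proj_def using v_in y by (subst ip_sum_left) (auto simp: ip_simps closed T_in)
    also have "\<dots> = (\<Sum>j<n. - (of_real ((s j)\<^sup>2) * ip f (v j) * ip (v j) y))"
      using y v_in by (intro sum.cong refl) (simp add: skew2[symmetric] TT_v)
    also have "ip (r n) (T (T y)) = - ip (T (r n)) (T y)"
      using rV[of n] y by (simp add: skew T_in)
    finally show ?thesis by (simp add: sum_negf)
  qed
  have bound: "norm (ip (T (r n)) (T y)) \<le> s n * (nrm f * nrm (T y))" for n
  proof -
    have "nrm (T (r n)) \<le> s n * nrm (r n)" unfolding s_def
      by (rule v_max[OF rV]) (auto simp: r_def intro!: ip_diff_proj[OF v_ortho] f)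
    also have "\<dots> \<le> s n * nrm f" unfolding r_def
      using f s_ge0 by (intro mult_left_mono nrm_diff_proj_le[OF v_ortho]) auto
    finally have "nrm (T (r n)) * nrm (T y) \<le> (s n * nrm f) * nrm (T y)"
      using y by (intro mult_right_mono nrm_ge0 T_in)
    then show ?thesis using cauchy_schwarz[OF T_in[OF rV] T_in[OF y], of n] by (simp add: mult.assoc)
  qed
  have "(\<lambda>n. s n * (nrm f * nrm (T y))) \<longlonglongrightarrow> 0"
    by (rule tendsto_mult_left_zero[OF s_tendsto_0])
  then have "(\<lambda>n. ip (T (r n)) (T y)) \<longlonglongrightarrow> 0"
    using bound by (intro Lim_null_comparison[of "\<lambda>n. ip (T (r n)) (T y)"]) (auto intro: always_eventually)
  then have "(\<lambda>n. - ip (T (T f)) y - (\<Sum>j<n. of_real ((s j)\<^sup>2) * ip f (v j) * ip (v j) y)) \<longlonglongrightarrow> 0"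
    unfolding part .
  then have "(\<lambda>n. - ip (T (T f)) y - (- ip (T (T f)) y - (\<Sum>j<n. of_real ((s j)\<^sup>2) * ip f (v j) * ip (v j) y)))
      \<longlonglongrightarrow> - ip (T (T f)) y - 0" by (rule tendsto_diff[OF tendsto_const])
  then have "(\<lambda>j. of_real ((s j)\<^sup>2) * ip f (v j) * ip (v j) y) sums (- ip (T (T f)) y)"
    by (simp add: sums_def)
  then show ?thesis using 1 sums_unique2 by blast
qed

lemma A_eigenvector: "y \<in> V \<Longrightarrow> ip (A (v j)) y = of_real (s j) * ip (v j) y"
  using A_symmetric[OF v_in, of y j] A_v[of y j] ip_cnj[OF A_in, of y "v j"] ip_cnj[OF _ v_in, of y j] v_in
  by simp

text \<open>An eigenvector for \<open>t\<close> has no component along \<open>v j\<close> unless \<open>s j = t\<close>, and for \<open>t \<noteq> 0\<close> it is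
  determined by its components because it lies in the range of \<open>A\<close>. So the multiplicity of \<open>t\<close> is the
  number of \<open>j\<close> with \<open>s j = t\<close>.\<close>

lemma A_eigenspace:
  assumes f: "f \<in> V" and t: "0 < t" and eig: "\<And>y. y \<in> V \<Longrightarrow> ip (A f) y = of_real t * ip f y"
  shows "nrm (f - (\<Sum>j\<in>{n. s n = t}. ip f (v j) *c v j)) = 0"
proof -
  let ?J = "{n. s n = t}"
  have fin: "finite ?J" by (rule finite_s_eq[OF t])
  have zero: "ip f (v j) = 0" if "s j \<noteq> t" for j
    using A_v[OF f, of j] eig[OF v_in, of j] that by (metis mult_cancel_right of_real_eq_iff)
  have gV: "(\<Sum>j\<in>?J. ip f (v j) *c v j) \<in> V" using v_in by (intro closed)
  have "ip (f - (\<Sum>j\<in>?J. ip f (v j) *c v j)) y = 0" if y: "y \<in> V" for y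
  proof -
    have "of_real (s j) * ip f (v j) * ip (v j) y = (if j \<in> ?J then of_real t * (ip f (v j) * ip (v j) y) else 0)" for j
      using zero[of j] by auto
    then have "(\<lambda>j. if j \<in> ?J then of_real t * (ip f (v j) * ip (v j) y) else 0) sums (of_real t * ip f y)"
      using A_sums[OF f y] eig[OF y] by simp
    then have "of_real t * ip f y = (\<Sum>j\<in>?J. of_real t * (ip f (v j) * ip (v j) y))"
      by (rule sums_unique2[OF _ sums_If_finite_set[OF fin]])
    then have "of_real t * ip f y = of_real t * (\<Sum>j\<in>?J. ip f (v j) * ip (v j) y)"
      by (simp only: sum_distrib_left)
    then have "ip f y = (\<Sum>j\<in>?J. ip f (v j) * ip (v j) y)" using t by simp
    moreover have "ip (\<Sum>j\<in>?J. ip f (v j) *c v j) y = (\<Sum>j\<in>?J. ip f (v j) * ip (v j) y)"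
      using v_in y by (subst ip_sum_left) (auto simp: ip_simps closed)
    ultimately show ?thesis using f gV y by (simp add: ip_simps)
  qed
  then show ?thesis using null_iff f gV by (simp add: closed)
qed

end

end

section \<open>The space of square-integrable functions\<close>

lemma L2D:
  assumes "f \<in> L2 M"
  shows "f \<in> borel_measurable M" "integrable M (\<lambda>x. (cmod (f x))\<^sup>2)"
  using assms by (auto simp: L2_def)

lemma borel_measurable_cnj [measurable (raw)]:
  "f \<in> borel_measurable M \<Longrightarrow> (\<lambda>x. cnj (f x)) \<in> borel_measurable M"
  by (rule borel_measurable_continuous_on[OF _ , of cnj]) (auto intro: continuous_on_cnj)

lemma integrable_mult_L2:
  assumes "f \<in> L2 M" "g \<in> L2 M"
  shows "integrable M (\<lambda>x. f x * g x)" "integrable M (\<lambda>x. f x * cnj (g x))"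
proof -
  note [measurable] = L2D(1)[OF assms(1)] L2D(1)[OF assms(2)]
  have i: "integrable M (\<lambda>x. (cmod (f x))\<^sup>2 + (cmod (g x))\<^sup>2)"
    using assms by (intro Bochner_Integration.integrable_add L2D)
  have le: "cmod (f x) * cmod (g x) \<le> (cmod (f x))\<^sup>2 + (cmod (g x))\<^sup>2" for x
  proof -
    have "0 \<le> cmod (f x) * cmod (g x)" by simp
    then show ?thesis using sum_squares_bound[of "cmod (f x)" "cmod (g x)"] by linarith
  qed
  have le': "norm (f x * g x) \<le> norm ((cmod (f x))\<^sup>2 + (cmod (g x))\<^sup>2)"
    "norm (f x * cnj (g x)) \<le> norm ((cmod (f x))\<^sup>2 + (cmod (g x))\<^sup>2)" for x
    using le[of x] by (simp_all add: norm_mult)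
  show "integrable M (\<lambda>x. f x * g x)" "integrable M (\<lambda>x. f x * cnj (g x))"
    using le' by (auto intro!: Bochner_Integration.integrable_bound[OF i] always_eventually simp del: real_norm_def)
qed

lemma L2_add: assumes "f \<in> L2 M" "g \<in> L2 M" shows "(\<lambda>x. f x + g x) \<in> L2 M"
proof -
  note [measurable] = L2D(1)[OF assms(1)] L2D(1)[OF assms(2)]
  have i: "integrable M (\<lambda>x. 2 * (cmod (f x))\<^sup>2 + 2 * (cmod (g x))\<^sup>2)"
    using assms by (intro Bochner_Integration.integrable_add integrable_mult_right L2D)
  have "(cmod (f x + g x))\<^sup>2 \<le> 2 * (cmod (f x))\<^sup>2 + 2 * (cmod (g x))\<^sup>2" for x
  proof -
    have "(cmod (f x + g x))\<^sup>2 \<le> (cmod (f x) + cmod (g x))\<^sup>2"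
      by (intro power_mono norm_triangle_ineq) simp
    also have "\<dots> \<le> 2 * (cmod (f x))\<^sup>2 + 2 * (cmod (g x))\<^sup>2"
      using sum_squares_bound[of "cmod (f x)" "cmod (g x)"] by (simp add: power2_sum)
    finally show ?thesis .
  qed
  then have "integrable M (\<lambda>x. (cmod (f x + g x))\<^sup>2)"
    by (intro Bochner_Integration.integrable_bound[OF i]) (auto intro!: always_eventually)
  then show ?thesis by (simp add: L2_def)
qed

lemma L2_cmult: "f \<in> L2 M \<Longrightarrow> (\<lambda>x. c * f x) \<in> L2 M"
  by (auto simp: L2_def norm_mult power_mult_distrib)

lemma L2_zero: "(\<lambda>x. 0) \<in> L2 M"
  by (simp add: L2_def)

lemma sum_fun_apply: "(\<Sum>i\<in>I. f i) x = (\<Sum>i\<in>I. f i x)"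
  by (induction I rule: infinite_finite_induct) auto

lemma L2_inner_self: "L2_inner M f f = of_real (LINT x|M. (cmod (f x))\<^sup>2)"
  unfolding L2_inner_def complex_norm_square[symmetric] by (rule integral_complex_of_real)

lemma semi_inner_L2: "semi_inner (\<lambda>c f x. c * f x) (L2 M) (L2_inner M)"
proof
  fix x y z :: "'a \<Rightarrow> complex" and c
  show "0 \<in> L2 M" using L2_zero by (simp add: zero_fun_def)
  show "(\<lambda>w. c * x w) \<in> L2 M" if "x \<in> L2 M" using that by (rule L2_cmult)
  show "x + y \<in> L2 M" if "x \<in> L2 M" "y \<in> L2 M" using L2_add[OF that] by (simp add: plus_fun_def)
  show "L2_inner M (x + y) z = L2_inner M x z + L2_inner M y z" if "x \<in> L2 M" "y \<in> L2 M" "z \<in> L2 M"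
    using integrable_mult_L2(2)[OF that(1,3)] integrable_mult_L2(2)[OF that(2,3)]
    by (simp add: L2_inner_def distrib_right)
  show "L2_inner M (\<lambda>w. c * x w) y = c * L2_inner M x y" by (simp add: L2_inner_def mult.assoc)
  show "L2_inner M y x = cnj (L2_inner M x y)" unfolding L2_inner_def
    by (subst Bochner_Integration.integral_cnj[symmetric]) (simp add: mult.commute)
  show "0 \<le> Re (L2_inner M x x)" by (simp add: L2_inner_self)
qed (auto simp: fun_eq_iff algebra_simps)

lemma L2_norm_eq_nrm: "semi_inner.nrm (L2_inner M) = L2_norm M"
  using semi_inner.nrm_def[OF semi_inner_L2, of M] by (auto simp: fun_eq_iff L2_norm_def L2_inner_self)

lemma L2_norm_nonneg: "0 \<le> L2_norm M f"
  by (simp add: L2_norm_def)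

lemma L2_norm_sq: "(L2_norm M f)\<^sup>2 = (LINT x|M. (cmod (f x))\<^sup>2)"
  by (simp add: L2_norm_def)

lemma L2_norm_eq_0_iff: "f \<in> L2 M \<Longrightarrow> L2_norm M f = 0 \<longleftrightarrow> (AE x in M. f x = 0)"
  using integral_nonneg_eq_0_iff_AE[OF L2D(2), of f M] by (simp add: L2_norm_def)

lemma nn_integral_L2_norm: "f \<in> L2 M \<Longrightarrow> (\<integral>\<^sup>+x. ennreal ((cmod (f x))\<^sup>2) \<partial>M) = ennreal ((L2_norm M f)\<^sup>2)"
  by (simp add: nn_integral_eq_integral L2D L2_norm_sq)

lemma L2_cong_AE:
  assumes "f \<in> L2 M" "g \<in> borel_measurable M" "AE x in M. f x = g x"
  shows "g \<in> L2 M" "L2_norm M g = L2_norm M f"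
proof -
  note [measurable] = L2D(1)[OF assms(1)] assms(2)
  have ae: "AE x in M. (cmod (f x))\<^sup>2 = (cmod (g x))\<^sup>2" using assms(3) by eventually_elim simp
  have "integrable M (\<lambda>x. (cmod (g x))\<^sup>2)"
    using L2D(2)[OF assms(1)] ae by (subst (asm) integrable_cong_AE) auto
  then show "g \<in> L2 M" by (simp add: L2_def)
  show "L2_norm M g = L2_norm M f"
    unfolding L2_norm_def using ae by (subst integral_cong_AE[of _ M "\<lambda>x. (cmod (f x))\<^sup>2"]) auto
qed

lemma L2_inner_cong_AE:
  assumes "f \<in> L2 M" "g \<in> L2 M" "h \<in> L2 M" "AE x in M. f x = g x"
  shows "L2_inner M f h = L2_inner M g h"
proof -
  note [measurable] = L2D(1)[OF assms(1)] L2D(1)[OF assms(2)] L2D(1)[OF assms(3)]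
  have "AE x in M. f x * cnj (h x) = g x * cnj (h x)" using assms(4) by eventually_elim simp
  then show ?thesis unfolding L2_inner_def by (intro integral_cong_AE) measurable
qed

text \<open>This transfers uniform norm bounds from the partial sums of a series, which are finite sums of
  orthogonal terms, to its pointwise limit.\<close>

lemma L2_Fatou:
  assumes F: "\<And>n. F n \<in> L2 M" "\<And>n. L2_norm M (F n) \<le> B"
    and lim: "AE x in M. (\<lambda>n. F n x) \<longlonglongrightarrow> g x" and g: "g \<in> borel_measurable M"
  shows "g \<in> L2 M" "L2_norm M g \<le> B"
proof -
  note [measurable] = g L2D(1)[OF F(1)]
  have B: "0 \<le> B" using F(2)[of 0] L2_norm_nonneg[of M "F 0"] by linarith
  have "AE x in M. ennreal ((cmod (g x))\<^sup>2) = liminf (\<lambda>n. ennreal ((cmod (F n x))\<^sup>2))"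
    using lim
  proof eventually_elim
    case (elim x)
    then have "(\<lambda>n. ennreal ((cmod (F n x))\<^sup>2)) \<longlonglongrightarrow> ennreal ((cmod (g x))\<^sup>2)"
      by (intro tendsto_ennrealI tendsto_intros)
    from lim_imp_Liminf[OF sequentially_bot this] show ?case by simp
  qed
  then have "(\<integral>\<^sup>+x. ennreal ((cmod (g x))\<^sup>2) \<partial>M) = (\<integral>\<^sup>+x. liminf (\<lambda>n. ennreal ((cmod (F n x))\<^sup>2)) \<partial>M)"
    by (rule nn_integral_cong_AE)
  also have "\<dots> \<le> liminf (\<lambda>n. \<integral>\<^sup>+x. ennreal ((cmod (F n x))\<^sup>2) \<partial>M)"
    by (intro nn_integral_liminf) measurable
  also have "\<dots> \<le> ennreal (B\<^sup>2)"
  proof (rule Liminf_le)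
    show "\<forall>\<^sub>F n in sequentially. (\<integral>\<^sup>+x. ennreal ((cmod (F n x))\<^sup>2) \<partial>M) \<le> ennreal (B\<^sup>2)"
      using F L2_norm_nonneg by (auto simp: nn_integral_L2_norm intro!: always_eventually ennreal_leI power_mono)
  qed simp
  finally have le: "(\<integral>\<^sup>+x. ennreal ((cmod (g x))\<^sup>2) \<partial>M) \<le> ennreal (B\<^sup>2)" .
  then have "(\<integral>\<^sup>+x. ennreal (norm ((cmod (g x))\<^sup>2)) \<partial>M) < \<infinity>"
    using le_less_trans by fastforce
  then have "integrable M (\<lambda>x. (cmod (g x))\<^sup>2)" by (intro integrableI_bounded) auto
  then show gL: "g \<in> L2 M" using g by (simp add: L2_def)
  have "(L2_norm M g)\<^sup>2 \<le> B\<^sup>2" using le nn_integral_L2_norm[OF gL] by simp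
  then show "L2_norm M g \<le> B" using B by (rule power2_le_imp_le)
qed

text \<open>Riesz--Fischer: along a subsequence the increments have summable norms, so by monotone
  convergence the subsequence converges almost everywhere, and the Fatou lemma identifies the limit.\<close>

lemma L2_complete:
  fixes X :: "nat \<Rightarrow> 'a \<Rightarrow> complex"
  assumes X: "\<And>n. X n \<in> L2 M"
    and cauchy: "\<And>e. 0 < e \<Longrightarrow> \<exists>N. \<forall>m\<ge>N. \<forall>n\<ge>N. L2_norm M (X m - X n) < e"
  shows "\<exists>l\<in>L2 M. (\<lambda>n. L2_norm M (X n - l)) \<longlonglongrightarrow> 0"
proof -
  interpret semi_inner "\<lambda>c f x. c * f x" "L2 M" "L2_inner M"
    rewrites "semi_inner.nrm (L2_inner M) = L2_norm M"
    by (rule semi_inner_L2) (rule L2_norm_eq_nrm)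
  have "\<exists>N. \<forall>m\<ge>N. \<forall>n\<ge>N. L2_norm M (X m - X n) < (1/2) ^ i" for i
    by (rule cauchy) simp
  then obtain N where N: "\<And>i m n. m \<ge> N i \<Longrightarrow> n \<ge> N i \<Longrightarrow> L2_norm M (X m - X n) < (1/2) ^ i" by metis
  define k where "k i = i + (\<Sum>j\<le>i. N j)" for i
  have kN: "N i \<le> k i" for i unfolding k_def using member_le_sum[of i "{..i}" N] by simp
  have kmono: "k i \<le> k (Suc i)" for i by (simp add: k_def)
  have ki: "i \<le> k i" for i by (simp add: k_def)
  define Y where "Y i = X (k i)" for i
  have YL: "Y i \<in> L2 M" for i using X by (simp add: Y_def)
  note [measurable] = L2D(1)[OF YL]
  have Yd: "L2_norm M (Y (Suc i) - Y i) \<le> (1/2) ^ i" for i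
    unfolding Y_def using N[of i "k (Suc i)" "k i"] kN[of i] kmono[of i] by simp
  define a where "a i x = cmod (Y (Suc i) x - Y i x)" for i x
  define ac where "ac i = (\<lambda>x. complex_of_real (a i x))" for i
  have acL: "ac i \<in> L2 M" and acn: "L2_norm M (ac i) = L2_norm M (Y (Suc i) - Y i)" for i
    using L2D(2)[OF diff_in[OF YL YL], of "Suc i" i] by (simp_all add: ac_def a_def L2_def L2_norm_def fun_diff_def)
  define G where "G n = (\<Sum>i<n. ac i)" for n
  have GL: "G n \<in> L2 M" for n unfolding G_def using acL by (rule sum_in)
  have Gx: "G n x = of_real (\<Sum>i<n. a i x)" for n x by (simp add: G_def sum_fun_apply ac_def)
  have Gn: "L2_norm M (G n) \<le> 2" for n
  proof -
    have "L2_norm M (G n) \<le> (\<Sum>i<n. L2_norm M (ac i))" unfolding G_def using acL by (rule nrm_sum)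
    also have "\<dots> \<le> (\<Sum>i<n. (1/2) ^ i)" using acn Yd by (intro sum_mono) simp
    also have "\<dots> \<le> (\<Sum>i. (1/2) ^ i)" by (intro sum_le_suminf) (auto intro: summable_geometric)
    also have "\<dots> = 2" by (subst suminf_geometric) auto
    finally show ?thesis .
  qed
  have a0: "0 \<le> a i x" for i x by (simp add: a_def)
  have inc: "incseq (\<lambda>n x. ennreal ((cmod (G n x))\<^sup>2))"
    unfolding incseq_def le_fun_def Gx norm_of_real
    using a0 by (auto intro!: ennreal_leI power_mono sum_mono2 simp: abs_of_nonneg sum_nonneg)
  have "(\<integral>\<^sup>+x. (SUP n. ennreal ((cmod (G n x))\<^sup>2)) \<partial>M) = (SUP n. \<integral>\<^sup>+x. ennreal ((cmod (G n x))\<^sup>2) \<partial>M)"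
    using L2D(1)[OF GL] by (intro nn_integral_monotone_convergence_SUP[OF inc]) auto
  also have "\<dots> \<le> ennreal (2\<^sup>2)"
  proof (rule SUP_least)
    fix n
    have "(L2_norm M (G n))\<^sup>2 \<le> 2\<^sup>2" using Gn L2_norm_nonneg by (rule power_mono)
    then show "(\<integral>\<^sup>+x. ennreal ((cmod (G n x))\<^sup>2) \<partial>M) \<le> ennreal (2\<^sup>2)"
      unfolding nn_integral_L2_norm[OF GL] by (rule ennreal_leI)
  qed
  finally have "(\<integral>\<^sup>+x. (SUP n. ennreal ((cmod (G n x))\<^sup>2)) \<partial>M) \<noteq> \<infinity>"
    using neq_top_trans[OF ennreal_neq_top] by fastforce
  then have "AE x in M. (SUP n. ennreal ((cmod (G n x))\<^sup>2)) \<noteq> \<infinity>"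
    using L2D(1)[OF GL] by (intro nn_integral_PInf_AE) auto
  then have conv: "AE x in M. convergent (\<lambda>i. Y i x)"
  proof eventually_elim
    case (elim x)
    then obtain c where c: "(SUP n. ennreal ((cmod (G n x))\<^sup>2)) = ennreal c" "0 \<le> c"
      by (cases "SUP n. ennreal ((cmod (G n x))\<^sup>2)") auto
    have "ennreal ((cmod (G n x))\<^sup>2) \<le> ennreal c" for n unfolding c(1)[symmetric] by (rule SUP_upper) simp
    then have "(cmod (G n x))\<^sup>2 \<le> c" for n using c(2) by simp
    then have "cmod (G n x) \<le> sqrt c" for n by (rule real_le_rsqrt)
    then have "(\<Sum>i<n. a i x) \<le> sqrt c" for n unfolding Gx norm_of_real by (meson abs_le_D1)
    then have "summable (\<lambda>i. a i x)" using a0 by (intro summableI_nonneg_bounded[where x = "sqrt c"]) auto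
    then have "summable (\<lambda>i. Y (Suc i) x - Y i x)" unfolding a_def by (rule summable_norm_cancel)
    then have "convergent (\<lambda>n. \<Sum>i<n. Y (Suc i) x - Y i x)" by (simp add: summable_iff_convergent)
    then have "convergent (\<lambda>n. Y n x - Y 0 x)" unfolding sum_lessThan_telescope[of "\<lambda>i. Y i x"] .
    then show "convergent (\<lambda>n. Y n x)" by (simp add: convergent_diff_const_right_iff)
  qed
  define l where "l x = lim (\<lambda>i. Y i x)" for x
  have lM[measurable]: "l \<in> borel_measurable M" unfolding l_def by measurable
  have lim: "AE x in M. (\<lambda>i. Y i x) \<longlonglongrightarrow> l x"
    using conv by eventually_elim (simp add: l_def convergent_LIMSEQ_iff)
  have tail: "X m - l \<in> L2 M \<and> L2_norm M (X m - l) \<le> e" if e: "0 < e" "\<And>m n. m \<ge> n0 \<Longrightarrow> n \<ge> n0 \<Longrightarrow> L2_norm M (X m - X n) < e" "m \<ge> n0" for e n0 m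
  proof -
    have "X m - Y (i + n0) \<in> L2 M" for i using X YL by (rule diff_in)
    moreover have "L2_norm M (X m - Y (i + n0)) \<le> e" for i
      unfolding Y_def using e(2)[OF e(3), of "k (i + n0)"] ki[of "i + n0"] by simp
    moreover have "AE x in M. (\<lambda>i. (X m - Y (i + n0)) x) \<longlonglongrightarrow> (X m - l) x"
      using lim by eventually_elim (auto intro!: tendsto_intros LIMSEQ_ignore_initial_segment)
    moreover have "X m - l \<in> borel_measurable M" using L2D(1)[OF X] by (simp add: fun_diff_def)
    ultimately show ?thesis using L2_Fatou[of "\<lambda>i. X m - Y (i + n0)" M e "X m - l"] by blast
  qed
  obtain n0 where "\<And>m n. m \<ge> n0 \<Longrightarrow> n \<ge> n0 \<Longrightarrow> L2_norm M (X m - X n) < 1" using cauchy[of 1] by auto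
  from tail[OF _ this, of n0] have "X n0 - l \<in> L2 M" by simp
  from diff_in[OF X this, of n0] have lL: "l \<in> L2 M" by simp
  have "(\<lambda>n. L2_norm M (X n - l)) \<longlonglongrightarrow> 0"
  proof (rule LIMSEQ_I)
    fix r :: real assume r: "0 < r"
    then obtain n0 where "\<And>m n. m \<ge> n0 \<Longrightarrow> n \<ge> n0 \<Longrightarrow> L2_norm M (X m - X n) < r / 2"
      using cauchy[of "r / 2"] by auto
    then have "L2_norm M (X m - l) \<le> r / 2" if "m \<ge> n0" for m using tail[of "r / 2" n0 m] r that by auto
    then have "norm (L2_norm M (X m - l) - 0) < r" if "m \<ge> n0" for m
      using r that L2_norm_nonneg[of M "X m - l"] by fastforce
    then show "\<exists>n0. \<forall>n\<ge>n0. norm (L2_norm M (X n - l) - 0) < r" by blast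
  qed
  with lL show ?thesis by blast
qed

lemma semi_hilbert_L2: "semi_hilbert (\<lambda>c f x. c * f x) (L2 M) (L2_inner M)"
proof -
  interpret semi_inner "\<lambda>c f x. c * f x" "L2 M" "L2_inner M" by (rule semi_inner_L2)
  show ?thesis
  proof
    fix X :: "nat \<Rightarrow> 'a \<Rightarrow> complex"
    assume "\<And>n. X n \<in> L2 M" "\<And>e. 0 < e \<Longrightarrow> \<exists>N. \<forall>m\<ge>N. \<forall>n\<ge>N. nrm (X m - X n) < e"
    then show "\<exists>l\<in>L2 M. tends X l" using L2_complete[of X M] by (simp add: tends_def L2_norm_eq_nrm)
  qed
qed

lemma L2_bounded_linear_if_adjoint:
  assumes T: "\<And>f. f \<in> L2 M \<Longrightarrow> T f \<in> L2 M" and S: "\<And>f. f \<in> L2 M \<Longrightarrow> S f \<in> L2 M"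
    and TS: "\<And>f g. f \<in> L2 M \<Longrightarrow> g \<in> L2 M \<Longrightarrow> L2_inner M (T f) g = L2_inner M f (S g)"
    and B: "\<And>f. f \<in> L2 M \<Longrightarrow> L2_norm M (T f) \<le> B * L2_norm M f"
  shows "L2_bounded_linear M T"
proof -
  interpret semi_inner "\<lambda>c f x. c * f x" "L2 M" "L2_inner M"
    rewrites "semi_inner.nrm (L2_inner M) = L2_norm M"
    by (rule semi_inner_L2) (rule L2_norm_eq_nrm)
  have "AE x in M. T (\<lambda>y. f y + g y) x = T f x + T g x" if f: "f \<in> L2 M" and g: "g \<in> L2 M" for f g
  proof -
    have "L2_norm M (T (f + g) - (T f + T g)) = 0" by (rule adjoint_imp_linear(1)[OF T S TS f g])
    moreover have "T (f + g) - (T f + T g) \<in> L2 M" using f g by (intro closed T)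
    ultimately have "AE x in M. (T (f + g) - (T f + T g)) x = 0" by (simp add: L2_norm_eq_0_iff)
    then show ?thesis by (simp add: plus_fun_def)
  qed
  moreover have "AE x in M. T (\<lambda>y. c * f y) x = c * T f x" if f: "f \<in> L2 M" for f c
  proof -
    let ?d = "T (\<lambda>y. c * f y) - (\<lambda>x. c * T f x)"
    have "L2_norm M ?d = 0" by (rule adjoint_imp_linear(2)[OF T S TS f])
    moreover have "?d \<in> L2 M" using f by (intro closed T)
    ultimately have "AE x in M. ?d x = 0" by (simp only: L2_norm_eq_0_iff)
    then show ?thesis by simp
  qed
  ultimately show ?thesis unfolding L2_bounded_linear_def using T B by blast
qed

section \<open>A criterion for Schatten classes\<close>

text \<open>The hypothesis bounds \<open>s (K N)\<close> by \<open>C / (N + 1)\<close>, so that \<open>s n\<close> is of order \<open>1/n\<close>, and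
  \<open>\<Sum>n. n powr - p\<close> converges for \<open>p > 1\<close>. The rest translates the spectral theory of \<open>T\<close> from
  statements up to null vectors into statements almost everywhere.\<close>

theorem schatten_class_if_small_off_finite:
  fixes K :: nat
  assumes T: "\<And>f. f \<in> L2 M \<Longrightarrow> T f \<in> L2 M"
    and skew: "\<And>f g. f \<in> L2 M \<Longrightarrow> g \<in> L2 M \<Longrightarrow> L2_inner M (T f) g = - L2_inner M f (T g)"
    and small: "\<And>N. \<exists>B. finite B \<and> B \<subseteq> L2 M \<and> card B \<le> K * N \<and>
      (\<forall>f\<in>L2 M. (\<forall>b\<in>B. L2_inner M f b = 0) \<longrightarrow> L2_norm M (T f) \<le> C / (real N + 1) * L2_norm M f)"
    and p: "1 < p"
  shows "schatten_class M p T"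
proof -
  have C0: "L2_norm M (T f) \<le> C * L2_norm M f" if "f \<in> L2 M" for f
  proof -
    obtain B where "finite B" "card B \<le> K * 0"
      "\<forall>f\<in>L2 M. (\<forall>b\<in>B. L2_inner M f b = 0) \<longrightarrow> L2_norm M (T f) \<le> C / (real 0 + 1) * L2_norm M f"
      using small[of 0] by blast
    then show ?thesis using that by simp
  qed
  have sm: "\<exists>B. finite B \<and> B \<subseteq> L2 M \<and> (\<forall>x\<in>L2 M. (\<forall>b\<in>B. L2_inner M x b = 0) \<longrightarrow> L2_norm M (T x) \<le> e * L2_norm M x)"
    if e: "0 < e" for e
  proof -
    obtain N :: nat where "C / e < real N" using reals_Archimedean2 by blast
    then have le: "C / (real N + 1) \<le> e" using e by (simp add: field_simps)
    obtain B where B: "finite B" "B \<subseteq> L2 M"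
      "\<forall>f\<in>L2 M. (\<forall>b\<in>B. L2_inner M f b = 0) \<longrightarrow> L2_norm M (T f) \<le> C / (real N + 1) * L2_norm M f"
      using small[of N] by blast
    have "C / (real N + 1) * L2_norm M x \<le> e * L2_norm M x" for x
      using le L2_norm_nonneg by (rule mult_right_mono)
    then show ?thesis using B by (meson order_trans)
  qed
  interpret skew_operator "\<lambda>c f x. c * f x" "L2 M" "L2_inner M" T
    rewrites nrm_eq: "semi_inner.nrm (L2_inner M) = L2_norm M"
  proof -
    interpret semi_hilbert "\<lambda>c f x. c * f x" "L2 M" "L2_inner M" by (rule semi_hilbert_L2)
    show "skew_operator (\<lambda>c f x. c * f x) (L2 M) (L2_inner M) T"
    proof
      show "\<exists>C. \<forall>x\<in>L2 M. semi_inner.nrm (L2_inner M) (T x) \<le> C * semi_inner.nrm (L2_inner M) x"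
        unfolding L2_norm_eq_nrm using C0 by blast
      show "\<exists>B. finite B \<and> B \<subseteq> L2 M \<and> (\<forall>x\<in>L2 M. (\<forall>b\<in>B. L2_inner M x b = 0) \<longrightarrow>
          semi_inner.nrm (L2_inner M) (T x) \<le> e * semi_inner.nrm (L2_inner M) x)" if "0 < e" for e
        unfolding L2_norm_eq_nrm by (rule sm[OF that])
    qed (use T skew in auto)
  qed (rule L2_norm_eq_nrm)
  obtain v where v: "eigen_seq v" using eigen_seq_exists by blast
  define \<sigma> where "\<sigma> = s v"
  define S where "S f = - T f" for f
  have SL: "S f \<in> L2 M" if "f \<in> L2 M" for f unfolding S_def using that by (intro closed T)
  have TS: "L2_inner M (T f) g = L2_inner M f (S g)" if "f \<in> L2 M" "g \<in> L2 M" for f g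
    using minus_adjoint[OF that] by (simp add: S_def)
  have ST: "L2_inner M (S f) g = L2_inner M f (T g)" if "f \<in> L2 M" "g \<in> L2 M" for f g
    using that by (simp add: S_def ip_minus_left T skew)
  have Sn: "L2_norm M (S f) \<le> C * L2_norm M f" if "f \<in> L2 M" for f
    using C0[OF that] nrm_minus[OF T[OF that]] by (simp add: S_def)
  have blT: "L2_bounded_linear M T" by (rule L2_bounded_linear_if_adjoint[OF T SL TS C0])
  have blS: "L2_bounded_linear M S" by (rule L2_bounded_linear_if_adjoint[OF SL T ST Sn])
  have blA: "L2_bounded_linear M (A v)"
    by (rule L2_bounded_linear_if_adjoint[OF A_in[OF v] A_in[OF v] A_symmetric[OF v] A_bounded[OF v]])
  have "L2_compact M T"
    unfolding L2_compact_def
  proof (intro conjI blT allI impI)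
    fix f :: "nat \<Rightarrow> 'a \<Rightarrow> complex"
    assume f: "\<forall>n. f n \<in> L2 M \<and> L2_norm M (f n) \<le> 1"
    obtain r l where "strict_mono (r :: nat \<Rightarrow> nat)" "l \<in> L2 M" "tends (\<lambda>n. T (f (r n))) l"
      using compact[of f] f by blast
    then show "\<exists>r g. strict_mono r \<and> g \<in> L2 M \<and> (\<lambda>n. L2_norm M (\<lambda>x. T (f (r n)) x - g x)) \<longlonglongrightarrow> 0"
      unfolding tends_def by (auto simp: fun_diff_def)
  qed
  moreover have "L2_modulus M T (A v)"
  proof -
    have "AE x in M. A v (A v f) x = S (T f) x" if f: "f \<in> L2 M" for f
    proof -
      have d: "A v (A v f) - S (T f) \<in> L2 M" using f by (intro closed A_in[OF v] SL T)
      have "L2_inner M (A v (A v f) - S (T f)) y = 0" if "y \<in> L2 M" for y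
        using A_A[OF v f that] f that by (simp add: ip_add_left A_in[OF v] T S_def)
      then have "L2_norm M (A v (A v f) - S (T f)) = 0" using null_iff[OF d] by blast
      then have "AE x in M. (A v (A v f) - S (T f)) x = 0" using L2_norm_eq_0_iff[OF d] by simp
      then show ?thesis by simp
    qed
    then show ?thesis unfolding L2_modulus_def L2_positive_def L2_adjoint_def
      using blA blS TS A_positive[OF v] by blast
  qed
  moreover have "L2_has_dim M (L2_eigenspace M (A v) (of_real t)) (card {n. \<sigma> n = t})" if t: "0 < t" for t
  proof -
    let ?J = "{n. \<sigma> n = t}"
    have fin: "finite ?J" unfolding \<sigma>_def by (rule finite_s_eq[OF v t])
    obtain h where h: "bij_betw h {..<card ?J} ?J"
      using ex_bij_betw_nat_finite[OF fin] by (auto simp: atLeast0LessThan)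
    define b where "b i = v (h i)" for i
    have hJ: "\<sigma> (h i) = t" if "i < card ?J" for i using bij_betwE[OF h] that by auto
    have bL: "b i \<in> L2 M" for i unfolding b_def by (rule v_in[OF v])
    have ipb: "L2_inner M (b i) (b j) = (if i = j then 1 else 0)" if "i < card ?J" "j < card ?J" for i j
    proof (cases "i = j")
      case True
      have "L2_norm M (b i) = 1" unfolding b_def using s_pos_unit[OF v] hJ[OF that(1)] t by (simp add: \<sigma>_def)
      then show ?thesis using True ip_self[OF bL, of i] by simp
    next
      case False
      then have "h i \<noteq> h j" using bij_betw_imp_inj_on[OF h] that by (auto dest: inj_onD)
      then show ?thesis using ortho_systemD(4)[OF v_ortho[OF v]] False by (simp add: b_def)
    qed
    have "b i \<in> L2_eigenspace M (A v) (of_real t)" if i: "i < card ?J" for i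
    proof -
      let ?d = "A v (b i) - (\<lambda>x. of_real t * b i x)"
      have dL: "?d \<in> L2 M" using bL by (intro closed A_in[OF v])
      have "L2_inner M ?d y = 0" if y: "y \<in> L2 M" for y
      proof -
        have "L2_inner M (A v (b i)) y = of_real t * L2_inner M (b i) y"
          using A_eigenvector[OF v y, of "h i"] hJ[OF i] by (simp add: b_def \<sigma>_def)
        then show ?thesis
          by (subst ip_diff_left) (use y bL A_in[OF v] in \<open>auto simp: ip_scale_left intro: scale_in\<close>)
      qed
      then have "L2_norm M ?d = 0" using null_iff[OF dL] by blast
      then have "AE x in M. ?d x = 0" using L2_norm_eq_0_iff[OF dL] by blast
      then show ?thesis using bL by (simp add: L2_eigenspace_def)
    qed
    moreover have "\<forall>i<card ?J. c i = 0" if c: "AE x in M. (\<Sum>i<card ?J. c i * b i x) = 0" for c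
    proof (intro allI impI)
      fix j assume j: "j < card ?J"
      let ?x = "\<Sum>i<card ?J. (\<lambda>x. c i * b i x)"
      have xL: "?x \<in> L2 M" using bL by (intro closed)
      have "AE x in M. ?x x = 0" using c by (simp add: sum_fun_apply)
      then have "L2_norm M ?x = 0" using L2_norm_eq_0_iff[OF xL] by blast
      then have "L2_inner M ?x (b j) = 0" using null_ip[OF xL bL] by blast
      also have "L2_inner M ?x (b j) = (\<Sum>i<card ?J. c i * L2_inner M (b i) (b j))"
        by (subst ip_sum_left) (auto simp: ip_scale_left bL intro: scale_in)
      also have "\<dots> = (\<Sum>i<card ?J. if i = j then c j else 0)"
        using ipb j by (intro sum.cong) auto
      also have "\<dots> = c j" using j by simp
      finally show "c j = 0" by simp
    qed
    moreover have "\<exists>c. AE x in M. f x = (\<Sum>i<card ?J. c i * b i x)"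
      if f: "f \<in> L2_eigenspace M (A v) (of_real t)" for f
    proof -
      have fL: "f \<in> L2 M" and ae: "AE x in M. A v f x = of_real t * f x"
        using f by (auto simp: L2_eigenspace_def)
      have "L2_inner M (A v f) y = of_real t * L2_inner M f y" if y: "y \<in> L2 M" for y
      proof -
        have "L2_inner M (A v f) y = L2_inner M (\<lambda>x. of_real t * f x) y"
          by (rule L2_inner_cong_AE[OF A_in[OF v fL] scale_in[OF fL] y ae])
        then show ?thesis using fL y by (simp add: ip_scale_left)
      qed
      from A_eigenspace[OF v fL t this]
      have "L2_norm M (f - (\<Sum>j\<in>?J. (\<lambda>x. L2_inner M f (v j) * v j x))) = 0" unfolding \<sigma>_def .
      moreover have "f - (\<Sum>j\<in>?J. (\<lambda>x. L2_inner M f (v j) * v j x)) \<in> L2 M"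
        using fL v_in[OF v] by (intro closed)
      ultimately have "AE x in M. (f - (\<Sum>j\<in>?J. (\<lambda>x. L2_inner M f (v j) * v j x))) x = 0"
        using L2_norm_eq_0_iff by blast
      moreover have "(\<Sum>j\<in>?J. L2_inner M f (v j) * v j x) = (\<Sum>i<card ?J. L2_inner M f (b i) * b i x)" for x
        using sum.reindex_bij_betw[OF h, of "\<lambda>j. L2_inner M f (v j) * v j x"] by (simp add: b_def)
      ultimately show ?thesis
        by (intro exI[of _ "\<lambda>i. L2_inner M f (b i)"]) (simp add: sum_fun_apply)
    qed
    ultimately show ?thesis unfolding L2_has_dim_def by (intro exI[of _ b]) blast
  qed
  moreover have "summable (\<lambda>n. \<sigma> n powr p)"
  proof -
    \<comment> \<open>\<open>K + 1\<close> in place of \<open>K\<close> avoids division by 0.\<close>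
    let ?K = "K + 1"
    have le: "\<sigma> n \<le> \<bar>C\<bar> * real ?K / real (Suc n)" for n
    proof -
      define N where "N = n div ?K"
      obtain B where B: "finite B" "B \<subseteq> L2 M" "card B \<le> K * N"
        "\<forall>f\<in>L2 M. (\<forall>b\<in>B. L2_inner M f b = 0) \<longrightarrow> L2_norm M (T f) \<le> C / (real N + 1) * L2_norm M f"
        using small[of N] by blast
      have "K * N \<le> ?K * N" by simp
      also have "\<dots> \<le> n" unfolding N_def by (rule times_div_less_eq_dividend)
      finally have card: "card B \<le> n" using B(3) by simp
      have "C / (real N + 1) * x \<le> \<bar>C\<bar> / (real N + 1) * x" if "0 \<le> x" for x
        using that by (intro mult_right_mono divide_right_mono) auto
      then have "L2_norm M (T x) \<le> \<bar>C\<bar> / (real N + 1) * L2_norm M x" if "x \<in> L2 M" "\<forall>b\<in>B. L2_inner M x b = 0" for x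
        using B(4) that L2_norm_nonneg by (meson order_trans)
      then have "\<sigma> n \<le> \<bar>C\<bar> / (real N + 1)" unfolding \<sigma>_def
        by (intro s_le_if_small_off[OF v B(1,2) card]) auto
      also have "\<dots> \<le> \<bar>C\<bar> * real ?K / real (Suc n)"
      proof -
        have "n mod ?K < ?K" by simp
        moreover have "n = ?K * N + n mod ?K" unfolding N_def by (simp only: mult_div_mod_eq)
        ultimately have "Suc n \<le> ?K * N + ?K" by linarith
        then have "Suc n \<le> ?K * (N + 1)" by (simp only: distrib_left mult_1_right)
        then have "real (Suc n) \<le> real (?K * (N + 1))" by (simp only: of_nat_le_iff)
        then have "real (Suc n) \<le> real ?K * (real N + 1)" by (simp only: of_nat_mult of_nat_add of_nat_1)
        then have "\<bar>C\<bar> * real (Suc n) \<le> \<bar>C\<bar> * (real ?K * (real N + 1))" by (rule mult_left_mono) simp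
        then show ?thesis by (simp add: field_simps)
      qed
      finally show ?thesis .
    qed
    have "summable (\<lambda>n. real n powr - p)" using p by (simp add: summable_real_powr_iff)
    then have "summable (\<lambda>n. real (Suc n) powr - p)" by (subst summable_Suc_iff)
    then have sm: "summable (\<lambda>n. (\<bar>C\<bar> * real ?K) powr p * real (Suc n) powr - p)" by (rule summable_mult)
    show ?thesis
    proof (rule summable_comparison_test'[OF sm])
      fix n
      have "\<sigma> n powr p \<le> (\<bar>C\<bar> * real ?K / real (Suc n)) powr p"
        using le[of n] s_ge0[OF v, of n] p by (intro powr_mono2) (auto simp: \<sigma>_def)
      also have "\<dots> = (\<bar>C\<bar> * real ?K) powr p * real (Suc n) powr - p"
        by (subst powr_divide) (simp_all add: powr_minus divide_inverse del: of_nat_Suc)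
      finally show "norm (\<sigma> n powr p) \<le> (\<bar>C\<bar> * real ?K) powr p * real (Suc n) powr - p" by simp
    qed
  qed
  ultimately show ?thesis
    unfolding schatten_class_def singular_values_def
    using s_decseq[OF v] s_ge0[OF v] finite_s_eq[OF v] unfolding \<sigma>_def by blast
qed

section \<open>Harmonic functions near an isolated singularity\<close>

lemma has_real_derivative_along_line:
  fixes f :: "'a::real_normed_vector \<Rightarrow> real"
  assumes "(f has_derivative F) (at (p + s *\<^sub>R v))"
  shows "((\<lambda>s. f (p + s *\<^sub>R v)) has_real_derivative F v) (at s)"
proof -
  have "((\<lambda>s. p + s *\<^sub>R v) has_derivative (\<lambda>h. h *\<^sub>R v)) (at s)"
    by (auto intro!: derivative_eq_intros)
  from has_derivative_compose[OF this assms]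
  have "((\<lambda>s. f (p + s *\<^sub>R v)) has_derivative (\<lambda>h. F (h *\<^sub>R v))) (at s)" .
  moreover have "F (h *\<^sub>R v) = F v * h" for h
    using linear_cmul[OF has_derivative_linear[OF assms], of h v] by simp
  ultimately show ?thesis by (simp add: has_field_derivative_def)
qed

text \<open>Two applications of the mean value theorem to the second difference quotient.\<close>

lemma second_difference_mean_value:
  fixes f :: "'a::real_normed_vector \<Rightarrow> real"
  assumes h: "0 < h"
    and S: "\<And>s t. 0 \<le> s \<Longrightarrow> s \<le> h \<Longrightarrow> 0 \<le> t \<Longrightarrow> t \<le> h \<Longrightarrow> z + s *\<^sub>R v + t *\<^sub>R w \<in> S"
    and f1: "\<And>x. x \<in> S \<Longrightarrow> (f has_derivative f1 x) (at x)"
    and f2: "\<And>x. x \<in> S \<Longrightarrow> ((\<lambda>y. f1 y v) has_derivative f2 x v) (at x)"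
  obtains s t where "0 < s" "s < h" "0 < t" "t < h"
    "f (z + h *\<^sub>R v + h *\<^sub>R w) - f (z + h *\<^sub>R v) - f (z + h *\<^sub>R w) + f z = h\<^sup>2 * f2 (z + s *\<^sub>R v + t *\<^sub>R w) v w"
proof -
  define g where "g s = f ((z + h *\<^sub>R w) + s *\<^sub>R v) - f (z + s *\<^sub>R v)" for s
  have "\<exists>s. 0 < s \<and> s < h \<and> g h - g 0 = (h - 0) * (f1 ((z + h *\<^sub>R w) + s *\<^sub>R v) v - f1 (z + s *\<^sub>R v) v)"
  proof (rule MVT2[OF h])
    fix s assume s: "0 \<le> s" "s \<le> h"
    have "z + h *\<^sub>R w + s *\<^sub>R v \<in> S" "z + s *\<^sub>R v \<in> S"
      using S[OF s, of h] S[OF s, of 0] h by (simp_all add: add.commute add.left_commute)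
    then show "(g has_real_derivative f1 ((z + h *\<^sub>R w) + s *\<^sub>R v) v - f1 (z + s *\<^sub>R v) v) (at s)"
      unfolding g_def by (intro DERIV_diff has_real_derivative_along_line f1)
  qed
  then obtain s where s: "0 < s" "s < h"
    "g h - g 0 = h * (f1 ((z + h *\<^sub>R w) + s *\<^sub>R v) v - f1 (z + s *\<^sub>R v) v)" by auto
  define k where "k t = f1 ((z + s *\<^sub>R v) + t *\<^sub>R w) v" for t
  have "\<exists>t. 0 < t \<and> t < h \<and> k h - k 0 = (h - 0) * f2 ((z + s *\<^sub>R v) + t *\<^sub>R w) v w"
  proof (rule MVT2[OF h])
    fix t assume t: "0 \<le> t" "t \<le> h"
    have "z + s *\<^sub>R v + t *\<^sub>R w \<in> S" using S[of s t] s t by simp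
    then show "(k has_real_derivative f2 ((z + s *\<^sub>R v) + t *\<^sub>R w) v w) (at t)"
      unfolding k_def by (intro has_real_derivative_along_line f2)
  qed
  then obtain t where t: "0 < t" "t < h" "k h - k 0 = h * f2 ((z + s *\<^sub>R v) + t *\<^sub>R w) v w" by auto
  have "k h - k 0 = f1 ((z + h *\<^sub>R w) + s *\<^sub>R v) v - f1 (z + s *\<^sub>R v) v"
    by (simp add: k_def add.commute add.left_commute)
  then have "g h - g 0 = h\<^sup>2 * f2 (z + s *\<^sub>R v + t *\<^sub>R w) v w"
    using s(3) t(3) by (simp add: power2_eq_square)
  moreover have "g h - g 0 = f (z + h *\<^sub>R v + h *\<^sub>R w) - f (z + h *\<^sub>R v) - f (z + h *\<^sub>R w) + f z"
    by (simp add: g_def add.commute add.left_commute)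
  ultimately show ?thesis using that s(1,2) t(1,2) by simp
qed

text \<open>The second difference quotient is symmetric in \<open>v\<close> and \<open>w\<close>, and it tends to both mixed derivatives.\<close>

lemma symmetric_second_derivative:
  fixes f :: "'a::real_normed_vector \<Rightarrow> real"
  assumes S: "open S" "z \<in> S"
    and f1: "\<And>x. x \<in> S \<Longrightarrow> (f has_derivative f1 x) (at x)"
    and f2: "\<And>x v. x \<in> S \<Longrightarrow> ((\<lambda>y. f1 y v) has_derivative f2 x v) (at x)"
    and cont: "\<And>v w. continuous_on S (\<lambda>x. f2 x v w)"
  shows "f2 z v w = f2 z w v"
proof (rule ccontr)
  assume ne: "f2 z v w \<noteq> f2 z w v"
  define e where "e = \<bar>f2 z v w - f2 z w v\<bar> / 2"
  have e: "0 < e" using ne by (simp add: e_def)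
  have "isCont (\<lambda>x. f2 x v w) z" "isCont (\<lambda>x. f2 x w v) z"
    using cont S by (simp_all add: continuous_on_eq_continuous_at)
  then have "\<forall>\<^sub>F x in at z. dist (f2 x v w) (f2 z v w) < e" "\<forall>\<^sub>F x in at z. dist (f2 x w v) (f2 z w v) < e"
    using e by (simp_all add: isCont_def tendstoD)
  then have "\<forall>\<^sub>F x in at z. x \<in> S \<and> dist (f2 x v w) (f2 z v w) < e \<and> dist (f2 x w v) (f2 z w v) < e"
    using eventually_at_in_open'[OF S] by eventually_elim simp
  then obtain d where d: "0 < d" "\<And>x. x \<noteq> z \<Longrightarrow> dist x z < d \<Longrightarrow> x \<in> S \<and> dist (f2 x v w) (f2 z v w) < e \<and> dist (f2 x w v) (f2 z w v) < e"
    unfolding eventually_at by auto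
  then have d': "x \<in> S \<and> dist (f2 x v w) (f2 z v w) < e \<and> dist (f2 x w v) (f2 z w v) < e" if "dist x z < d" for x
    using that S e by (cases "x = z") auto
  define h where "h = d / 2 / (norm v + norm w + 1)"
  have n: "0 < norm v + norm w + 1" using norm_ge_zero[of v] norm_ge_zero[of w] by linarith
  have h: "0 < h" using d n by (simp add: h_def)
  have near: "dist (z + s *\<^sub>R v + t *\<^sub>R w) z < d" if "0 \<le> s" "s \<le> h" "0 \<le> t" "t \<le> h" for s t
  proof -
    have "dist (z + s *\<^sub>R v + t *\<^sub>R w) z = norm (s *\<^sub>R v + t *\<^sub>R w)" by (simp add: dist_norm)
    also have "\<dots> \<le> norm (s *\<^sub>R v) + norm (t *\<^sub>R w)" by (rule norm_triangle_ineq)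
    also have "\<dots> \<le> h * norm v + h * norm w" using that by (auto intro!: add_mono mult_right_mono)
    also have "\<dots> \<le> h * (norm v + norm w + 1)" using h by (simp add: distrib_left)
    also have "\<dots> = d / 2" using n by (metis h_def less_irrefl nonzero_eq_divide_eq)
    also have "\<dots> < d" using d by simp
    finally show ?thesis .
  qed
  have S1: "z + s *\<^sub>R v + t *\<^sub>R w \<in> S" "z + s *\<^sub>R w + t *\<^sub>R v \<in> S" if "0 \<le> s" "s \<le> h" "0 \<le> t" "t \<le> h" for s t
    using d'[OF near[OF that]] d'[OF near[OF that(3,4,1,2)]] by (simp_all add: add.commute add.left_commute)
  obtain s t where st: "0 < s" "s < h" "0 < t" "t < h"
    "f (z + h *\<^sub>R v + h *\<^sub>R w) - f (z + h *\<^sub>R v) - f (z + h *\<^sub>R w) + f z = h\<^sup>2 * f2 (z + s *\<^sub>R v + t *\<^sub>R w) v w"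
    using second_difference_mean_value[where f = f and ?f1.0 = f1 and ?f2.0 = f2 and z = z and v = v and w = w,
        OF h S1(1) f1 f2] by blast
  obtain s' t' where st': "0 < s'" "s' < h" "0 < t'" "t' < h"
    "f (z + h *\<^sub>R w + h *\<^sub>R v) - f (z + h *\<^sub>R w) - f (z + h *\<^sub>R v) + f z = h\<^sup>2 * f2 (z + s' *\<^sub>R w + t' *\<^sub>R v) w v"
    using second_difference_mean_value[where f = f and ?f1.0 = f1 and ?f2.0 = f2 and z = z and v = w and w = v,
        OF h S1(2) f1 f2] by blast
  have "f (z + h *\<^sub>R v + h *\<^sub>R w) = f (z + h *\<^sub>R w + h *\<^sub>R v)" by (simp add: add.commute add.left_commute)
  then have "h\<^sup>2 * f2 (z + s *\<^sub>R v + t *\<^sub>R w) v w = h\<^sup>2 * f2 (z + s' *\<^sub>R w + t' *\<^sub>R v) w v"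
    using st(5) st'(5) by linarith
  then have eq: "f2 (z + s *\<^sub>R v + t *\<^sub>R w) v w = f2 (z + s' *\<^sub>R w + t' *\<^sub>R v) w v" using h by simp
  have "dist (f2 (z + s *\<^sub>R v + t *\<^sub>R w) v w) (f2 z v w) < e" using d'[OF near[of s t]] st by simp
  moreover have "dist (f2 (z + s' *\<^sub>R w + t' *\<^sub>R v) w v) (f2 z w v) < e"
    using d'[OF near[of t' s']] st' by (simp add: add.commute add.left_commute)
  ultimately have "dist (f2 z v w) (f2 z w v) < e + e"
    unfolding eq using dist_triangle_less_add dist_commute by metis
  then show False by (simp add: e_def dist_real_def)
qed

lemma linear_complex_to_real: "linear (F :: complex \<Rightarrow> real) \<Longrightarrow> F h = Re h * F 1 + Im h * F \<i>"
proof -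
  assume F: "linear F"
  have "F h = F (Re h *\<^sub>R 1 + Im h *\<^sub>R \<i>)" by (rule arg_cong[of _ _ F]) (simp add: complex_eq_iff)
  also have "\<dots> = Re h * F 1 + Im h * F \<i>" by (simp only: linear_add[OF F] linear_cmul[OF F] real_scaleR_def)
  finally show ?thesis .
qed

text \<open>The gradient of a harmonic function, as \<open>f\<^sub>x - \<i> f\<^sub>y\<close>, satisfies the Cauchy--Riemann equations.\<close>

lemma harmonic_on_holomorphic_gradient:
  assumes "harmonic_on f S"
  obtains \<phi> where "\<phi> holomorphic_on S"
    "\<And>z. z \<in> S \<Longrightarrow> (f has_derivative (\<lambda>h. Re (\<phi> z * h))) (at z)"
proof -
  from assms obtain f1 f2 where S: "open S"
    and f1: "\<And>z. z \<in> S \<Longrightarrow> (f has_derivative f1 z) (at z)"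
    and f2: "\<And>z v. z \<in> S \<Longrightarrow> ((\<lambda>w. f1 w v) has_derivative f2 z v) (at z)"
    and cont: "\<And>v w. continuous_on S (\<lambda>z. f2 z v w)"
    and lap: "\<And>z. z \<in> S \<Longrightarrow> f2 z 1 1 + f2 z \<i> \<i> = 0"
    unfolding harmonic_on_def by blast
  define \<phi> where "\<phi> z = of_real (f1 z 1) - \<i> * of_real (f1 z \<i>)" for z
  have "(\<phi> has_field_derivative (of_real (f2 z 1 1) - \<i> * of_real (f2 z 1 \<i>))) (at z)" if z: "z \<in> S" for z
  proof -
    have sym: "f2 z \<i> 1 = f2 z 1 \<i>" by (rule symmetric_second_derivative[OF S z f1 f2 cont])
    have "(\<phi> has_derivative (\<lambda>h. of_real (f2 z 1 h) - \<i> * of_real (f2 z \<i> h))) (at z)"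
      unfolding \<phi>_def by (intro has_derivative_diff has_derivative_mult_right has_derivative_of_real f2 z)
    moreover have "of_real (f2 z 1 h) - \<i> * of_real (f2 z \<i> h) = (of_real (f2 z 1 1) - \<i> * of_real (f2 z 1 \<i>)) * h" for h
    proof -
      have "f2 z 1 h = Re h * f2 z 1 1 + Im h * f2 z 1 \<i>" "f2 z \<i> h = Re h * f2 z 1 \<i> - Im h * f2 z 1 1"
        using linear_complex_to_real[OF has_derivative_linear[OF f2[OF z]], of 1 h]
          linear_complex_to_real[OF has_derivative_linear[OF f2[OF z]], of \<i> h] lap[OF z] sym
        by (simp_all add: algebra_simps eq_neg_iff_add_eq_0[symmetric])
      then show ?thesis by (simp add: complex_eq_iff algebra_simps)
    qed
    ultimately show ?thesis by (simp add: has_field_derivative_def)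
  qed
  then have hol: "\<phi> holomorphic_on S" using S by (auto simp: holomorphic_on_open)
  have "f1 z h = Re (\<phi> z * h)" if "z \<in> S" for z h
    using linear_complex_to_real[OF has_derivative_linear[OF f1[OF that]], of h] by (simp add: \<phi>_def algebra_simps)
  then have "f1 z = (\<lambda>h. Re (\<phi> z * h))" if "z \<in> S" for z using that by auto
  with f1 hol that show ?thesis by metis
qed

lemma exp_image_left_halfplane: "0 < R \<Longrightarrow> Re \<zeta> < ln R \<Longrightarrow> exp \<zeta> \<in> ball 0 R - {0::complex}"
  by (simp add: dist_norm) (metis exp_less_cancel_iff exp_ln)

text \<open>Pulled back by \<open>exp\<close> to a left half plane, \<open>f\<close> is the real part of a holomorphic \<open>\<Phi>\<close>. As
  \<open>f \<circ> exp\<close> has period \<open>2 \<pi> \<i>\<close>, the increment of \<open>\<Phi>\<close> over this period is an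
  imaginary constant \<open>2 \<pi> \<i> c\<close>; then \<open>\<Phi> \<zeta> - c \<zeta>\<close> is periodic and descends to the punctured disk.\<close>

lemma harmonic_punctured_disk_decomposition:
  assumes R: "0 < R" and f: "harmonic_on f (ball 0 R - {0})"
  obtains c G where "G holomorphic_on ball 0 R - {0}"
    "\<And>z. z \<in> ball 0 R - {0} \<Longrightarrow> f z = c * ln (cmod z) + Re (G z)"
proof -
  define H where "H = {\<zeta>. Re \<zeta> < ln R}"
  have H: "open H" "convex H" unfolding H_def by (rule open_halfspace_Re_lt, rule convex_halfspace_Re_lt)
  have expH: "exp \<zeta> \<in> ball 0 R - {0}" if "\<zeta> \<in> H" for \<zeta>
    using that R unfolding H_def by (intro exp_image_left_halfplane) auto
  have LnH: "Ln z \<in> H" if "z \<in> ball 0 R - {0}" for z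
    using that R by (auto simp: H_def Re_Ln ln_less_cancel_iff[of "cmod z" R])
  obtain \<phi> where \<phi>: "\<phi> holomorphic_on ball 0 R - {0}"
    "\<And>z. z \<in> ball 0 R - {0} \<Longrightarrow> (f has_derivative (\<lambda>h. Re (\<phi> z * h))) (at z)"
    using harmonic_on_holomorphic_gradient[OF f] by blast
  define \<psi> where "\<psi> \<zeta> = \<phi> (exp \<zeta>) * exp \<zeta>" for \<zeta>
  have "(\<phi> \<circ> exp) holomorphic_on H"
    by (rule holomorphic_on_compose_gen[OF _ \<phi>(1)]) (use expH in \<open>auto intro!: holomorphic_intros\<close>)
  then have "\<psi> holomorphic_on H" unfolding \<psi>_def comp_def by (intro holomorphic_intros)
  then obtain \<Phi>0 where \<Phi>0: "\<And>\<zeta>. \<zeta> \<in> H \<Longrightarrow> (\<Phi>0 has_field_derivative \<psi> \<zeta>) (at \<zeta>)"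
    using holomorphic_convex_primitive'[OF H(2,1)] at_within_open[OF _ H(1)] by metis
  have "\<exists>a. \<forall>\<zeta>\<in>H. f (exp \<zeta>) - Re (\<Phi>0 \<zeta>) = a"
  proof (rule has_derivative_zero_constant[OF H(2)])
    fix \<zeta> assume \<zeta>: "\<zeta> \<in> H"
    have "(exp has_derivative (\<lambda>h. exp \<zeta> * h)) (at \<zeta>)"
      using DERIV_exp[of \<zeta>] by (simp add: has_field_derivative_def)
    from has_derivative_compose[OF this \<phi>(2)[OF expH[OF \<zeta>]]]
    have 1: "((\<lambda>\<zeta>. f (exp \<zeta>)) has_derivative (\<lambda>h. Re (\<phi> (exp \<zeta>) * (exp \<zeta> * h)))) (at \<zeta>)" .
    have 2: "((\<lambda>\<zeta>. Re (\<Phi>0 \<zeta>)) has_derivative (\<lambda>h. Re (\<psi> \<zeta> * h))) (at \<zeta>)"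
      using \<Phi>0[OF \<zeta>] unfolding has_field_derivative_def by (rule has_derivative_Re)
    have "((\<lambda>\<zeta>. f (exp \<zeta>) - Re (\<Phi>0 \<zeta>)) has_derivative (\<lambda>h. 0)) (at \<zeta>)"
      by (rule has_derivative_eq_rhs[OF has_derivative_diff[OF 1 2]])
        (simp add: \<psi>_def mult.assoc fun_eq_iff)
    then show "((\<lambda>\<zeta>. f (exp \<zeta>) - Re (\<Phi>0 \<zeta>)) has_derivative (\<lambda>h. 0)) (at \<zeta> within H)"
      by (rule has_derivative_at_withinI)
  qed
  then obtain a where a: "\<And>\<zeta>. \<zeta> \<in> H \<Longrightarrow> f (exp \<zeta>) - Re (\<Phi>0 \<zeta>) = a" by blast
  define \<Phi> where "\<Phi> \<zeta> = \<Phi>0 \<zeta> + of_real a" for \<zeta>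
  have \<Phi>: "(\<Phi> has_field_derivative \<psi> \<zeta>) (at \<zeta>)" and Re\<Phi>: "Re (\<Phi> \<zeta>) = f (exp \<zeta>)" if "\<zeta> \<in> H" for \<zeta>
    unfolding \<Phi>_def using \<Phi>0[OF that] a[OF that] by (auto intro!: derivative_eq_intros)
  define \<tau> where "\<tau> = 2 * of_real pi * \<i>"
  have exp\<tau>: "exp (\<zeta> + \<tau>) = exp \<zeta>" for \<zeta> by (simp add: \<tau>_def exp_add)
  have H\<tau>: "\<zeta> + \<tau> \<in> H \<longleftrightarrow> \<zeta> \<in> H" for \<zeta> by (simp add: H_def \<tau>_def)
  have "\<exists>b. \<forall>\<zeta>\<in>H. \<Phi> (\<zeta> + \<tau>) - \<Phi> \<zeta> = b"
  proof (rule has_derivative_zero_constant[OF H(2)])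
    fix \<zeta> assume \<zeta>: "\<zeta> \<in> H"
    have "((\<lambda>\<zeta>. \<Phi> (\<zeta> + \<tau>)) has_field_derivative \<psi> (\<zeta> + \<tau>)) (at \<zeta>)"
      using \<Phi>[of "\<zeta> + \<tau>"] H\<tau> \<zeta> by (simp add: DERIV_shift)
    from DERIV_diff[OF this \<Phi>[OF \<zeta>]]
    have "((\<lambda>\<zeta>. \<Phi> (\<zeta> + \<tau>) - \<Phi> \<zeta>) has_field_derivative 0) (at \<zeta>)" by (simp add: \<psi>_def exp\<tau>)
    then have "((\<lambda>\<zeta>. \<Phi> (\<zeta> + \<tau>) - \<Phi> \<zeta>) has_derivative (\<lambda>h. 0)) (at \<zeta>)"
      unfolding has_field_derivative_def lambda_zero[symmetric] .
    then show "((\<lambda>\<zeta>. \<Phi> (\<zeta> + \<tau>) - \<Phi> \<zeta>) has_derivative (\<lambda>h. 0)) (at \<zeta> within H)"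
      by (rule has_derivative_at_withinI)
  qed
  then obtain b where b: "\<And>\<zeta>. \<zeta> \<in> H \<Longrightarrow> \<Phi> (\<zeta> + \<tau>) - \<Phi> \<zeta> = b" by blast
  define c where "c = Im b / (2 * pi)"
  have "of_real (ln R - 1) \<in> H" by (simp add: H_def)
  then have "Re b = 0" using b[of "of_real (ln R - 1)"] Re\<Phi> H\<tau> exp\<tau> by (metis diff_self minus_complex.simps(1))
  then have bc: "b = of_real c * \<tau>" by (simp add: c_def \<tau>_def complex_eq_iff)
  define \<Theta> where "\<Theta> \<zeta> = \<Phi> \<zeta> - of_real c * \<zeta>" for \<zeta>
  have per: "\<Theta> (\<zeta> + \<tau>) = \<Theta> \<zeta>" if "\<zeta> \<in> H" for \<zeta>
    using b[OF that] bc by (simp add: \<Theta>_def algebra_simps)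
  have pern: "\<Theta> (\<zeta> + of_nat n * \<tau>) = \<Theta> \<zeta> \<and> \<zeta> + of_nat n * \<tau> \<in> H" if "\<zeta> \<in> H" for \<zeta> n
  proof (induction n)
    case (Suc n)
    then show ?case using per[of "\<zeta> + of_nat n * \<tau>"] H\<tau>[of "\<zeta> + of_nat n * \<tau>"]
      by (simp add: algebra_simps)
  qed (use that in simp)
  have peri: "\<Theta> \<zeta>' = \<Theta> \<zeta>" if "\<zeta> \<in> H" "\<zeta>' \<in> H" and e: "exp \<zeta> = exp \<zeta>'" for \<zeta> \<zeta>'
  proof -
    obtain n :: int where n: "\<zeta> = \<zeta>' + complex_of_real (2 * real_of_int n * pi) * \<i>"
      using e unfolding exp_eq by (auto simp: of_real_mult mult_ac)
    show ?thesis
    proof (cases "0 \<le> n")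
      case True
      then have "\<zeta> = \<zeta>' + of_nat (nat n) * \<tau>" using n by (simp add: \<tau>_def mult_ac)
      then show ?thesis using pern[OF that(2)] by simp
    next
      case False
      then have "\<zeta>' = \<zeta> + of_nat (nat (- n)) * \<tau>" using n by (simp add: \<tau>_def mult_ac)
      then show ?thesis using pern[OF that(1)] by simp
    qed
  qed
  define G where "G z = \<Theta> (Ln z)" for z
  have G: "G (exp \<zeta>) = \<Theta> \<zeta>" if "\<zeta> \<in> H" for \<zeta>
    unfolding G_def using that expH[OF that] by (intro peri LnH) auto
  have "G field_differentiable at z0" if z0: "z0 \<in> ball 0 R - {0}" for z0
  proof -
    define g where "g z = Ln (z / z0) + Ln z0" for z
    have "z0 / z0 \<notin> \<real>\<^sub>\<le>\<^sub>0" using z0 by simp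
    then have "g field_differentiable at z0" unfolding g_def
      using z0 by (intro field_differentiable_add field_differentiable_const
          field_differentiable_compose[of "\<lambda>z. z / z0" z0 Ln, unfolded comp_def] field_differentiable_at_Ln)
        (auto intro!: derivative_intros field_differentiable_divide)
    moreover have "\<Theta> field_differentiable at (g z0)"
    proof -
      have "g z0 \<in> H" using LnH[OF z0] z0 by (simp add: g_def)
      then have "\<Phi> field_differentiable at (g z0)" using \<Phi> by (auto simp: field_differentiable_def)
      then show ?thesis unfolding \<Theta>_def
        by (intro field_differentiable_diff field_differentiable_mult field_differentiable_const field_differentiable_ident)
    qed
    ultimately have "(\<Theta> \<circ> g) field_differentiable at z0" by (rule field_differentiable_compose)
    moreover have "\<forall>\<^sub>F z in nhds z0. (\<Theta> \<circ> g) z = G z"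
    proof -
      have "open (ball 0 R - {0::complex})" by (intro open_Diff) auto
      then have "\<forall>\<^sub>F z in nhds z0. z \<in> ball 0 R - {0}" using z0 by (intro eventually_nhds_in_open)
      then show ?thesis
      proof eventually_elim
        case (elim z)
        have e: "exp (g z) = z" using elim z0 by (simp add: g_def exp_add)
        have "exp (Re (g z)) < R" using elim e by (metis DiffD1 mem_ball_0 norm_exp_eq_Re)
        then have "Re (g z) < ln R" using R by (simp add: ln_less_cancel_iff[symmetric] del: ln_less_cancel_iff)
        then have "g z \<in> H" by (simp add: H_def)
        from G[OF this] e show ?case by simp
      qed
    qed
    ultimately show ?thesis unfolding field_differentiable_def
      using DERIV_cong_ev[of z0 z0 "\<Theta> \<circ> g" G] by blast
  qed
  then have "G holomorphic_on ball 0 R - {0}"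
    by (simp add: holomorphic_on_def field_differentiable_at_within)
  moreover have "f z = c * ln (cmod z) + Re (G z)" if "z \<in> ball 0 R - {0}" for z
    using Re\<Phi>[OF LnH[OF that]] that by (simp add: G_def \<Theta>_def Re_Ln)
  ultimately show ?thesis using that by blast
qed

text \<open>Bocher's theorem. Write \<open>f\<close> as \<open>c ln \<bar>z\<bar> + Re (G z)\<close> in the punctured disk. If \<open>m \<ge> c\<close> then
  \<open>z\<^sup>m e\<^bsup>G z\<^esup>\<close>, of modulus \<open>\<bar>z\<bar> powr (m - c) * e\<^bsup>f z\<^esup>\<close>, is bounded near 0, so it extends
  holomorphically; a power of \<open>z\<close> splits off and the remaining factor has a logarithm \<open>L\<close>.\<close>

theorem harmonic_bounded_above_near_puncture:
  assumes R: "0 < R" and f: "harmonic_on f (ball 0 R - {0})"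
    and bd: "\<forall>\<^sub>F z in at 0. f z \<le> M"
  obtains c L where "L holomorphic_on ball 0 R"
    "\<And>z. z \<in> ball 0 R - {0} \<Longrightarrow> f z = c * ln (cmod z) + Re (L z)"
proof -
  obtain c G where G: "G holomorphic_on ball 0 R - {0}"
    "\<And>z. z \<in> ball 0 R - {0} \<Longrightarrow> f z = c * ln (cmod z) + Re (G z)"
    using harmonic_punctured_disk_decomposition[OF R f] by blast
  obtain m :: nat where m: "c \<le> real m" using real_arch_simple by blast
  define q where "q z = z ^ m * exp (G z)" for z
  have qhol: "q holomorphic_on ball 0 R - {0}" unfolding q_def using G(1) by (intro holomorphic_intros)
  have normq: "cmod (q z) = cmod z powr (real m - c) * exp (f z)" if "z \<in> ball 0 R - {0}" for z
  proof -
    have "cmod (q z) = cmod z ^ m * exp (f z - c * ln (cmod z))"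
      using G(2)[OF that] by (simp add: q_def norm_mult norm_power norm_exp_eq_Re)
    also have "\<dots> = cmod z powr m * (exp (f z) / cmod z powr c)"
    proof -
      have "cmod z ^ m = cmod z powr real m" using that by (simp add: powr_realpow)
      then show ?thesis using that by (simp add: exp_diff powr_def)
    qed
    also have "\<dots> = cmod z powr (real m - c) * exp (f z)" by (simp add: powr_diff)
    finally show ?thesis .
  qed
  have "\<forall>\<^sub>F z in at 0. norm (q z) \<le> exp M"
  proof -
    have "\<forall>\<^sub>F z in at (0::complex). z \<in> ball 0 (min R 1) - {0}"
      using R by (intro eventually_at_in_open) auto
    with bd show ?thesis
    proof eventually_elim
      case (elim z)
      then have z: "z \<in> ball 0 R - {0}" "cmod z < 1" by auto
      have "cmod z powr (real m - c) * exp (f z) \<le> 1 * exp M"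
        using m z elim by (intro mult_mono) (auto intro!: powr_le1)
      then show ?case using normq[OF z(1)] by simp
    qed
  qed
  then obtain k where k: "k holomorphic_on ball 0 R" "\<And>z. z \<in> ball 0 R - {0} \<Longrightarrow> k z = q z"
    using holomorphic_on_extend_bounded[OF qhol] R by (auto simp: interior_open)
  have kne: "k z \<noteq> 0" if "z \<in> ball 0 R - {0}" for z using k(2)[OF that] that by (simp add: q_def)
  have "\<exists>n h. h holomorphic_on ball 0 R \<and> (\<forall>z\<in>ball 0 R - {0}. k z = z ^ n * h z) \<and> (\<forall>z\<in>ball 0 R. h z \<noteq> 0)"
  proof (cases "k 0 = 0")
    case False
    then have "k z \<noteq> 0" if "z \<in> ball 0 R" for z using kne[of z] that by (cases "z = 0") auto
    then show ?thesis using k(1) by (intro exI[of _ 0] exI[of _ k]) auto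
  next
    case True
    have "of_real (R / 2) \<in> ball 0 R - {0::complex}" using R by auto
    then have "\<not> k constant_on ball 0 R"
      using kne[of "of_real (R / 2)"] True R unfolding constant_on_def by (metis DiffD1 centre_in_ball)
    then obtain g r n where g: "0 < n" "0 < r" "ball 0 r \<subseteq> ball (0::complex) R" "g holomorphic_on ball 0 r"
      "\<And>w. w \<in> ball 0 r \<Longrightarrow> k w = (w - 0) ^ n * g w" "\<And>w. w \<in> ball 0 r \<Longrightarrow> g w \<noteq> 0"
      using holomorphic_factor_zero_nonconstant[OF k(1) _ _ _ True] R by (metis centre_in_ball connected_ball open_ball)
    define h where "h z = (if z \<in> ball 0 r then g z else k z / z ^ n)" for z
    have eq: "h z = k z / z ^ n" if "z \<noteq> 0" for z using g(5)[of z] that by (auto simp: h_def)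
    have "h holomorphic_on ball 0 r \<union> (ball 0 R - {0})"
    proof (rule holomorphic_on_Un)
      show "h holomorphic_on ball 0 r" by (rule holomorphic_transform[OF g(4)]) (simp add: h_def)
      have "(\<lambda>z. k z / z ^ n) holomorphic_on ball 0 R - {0}"
        using k(1) by (intro holomorphic_intros) (auto elim: holomorphic_on_subset)
      then show "h holomorphic_on ball 0 R - {0}" by (rule holomorphic_transform) (simp add: eq)
    qed (auto intro: open_Diff)
    moreover have "ball 0 r \<union> (ball 0 R - {0}) = ball (0::complex) R" using g(2,3) R by auto
    ultimately have "h holomorphic_on ball 0 R" by simp
    moreover have "k z = z ^ n * h z" if "z \<in> ball 0 R - {0}" for z using eq[of z] that by simp
    moreover have "h z \<noteq> 0" if "z \<in> ball 0 R" for z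
      using g(6)[of z] kne[of z] that g(2) by (cases "z = 0") (auto simp: h_def)
    ultimately show ?thesis by blast
  qed
  then obtain n h where h: "h holomorphic_on ball 0 R" "\<And>z. z \<in> ball 0 R - {0} \<Longrightarrow> k z = z ^ n * h z"
    "\<And>z. z \<in> ball 0 R \<Longrightarrow> h z \<noteq> 0" by blast
  obtain L where L: "L holomorphic_on ball 0 R" "\<And>z. z \<in> ball 0 R \<Longrightarrow> h z = exp (L z)"
    using contractible_imp_holomorphic_log[OF h(1) convex_imp_contractible[OF convex_ball] h(3)] by blast
  have "f z = (c - real m + real n) * ln (cmod z) + Re (L z)" if z: "z \<in> ball 0 R - {0}" for z
  proof -
    have "cmod z ^ m * exp (Re (G z)) = cmod z ^ n * exp (Re (L z))"
      using k(2)[OF z] h(2)[OF z] L(2)[of z] z by (auto simp: q_def norm_mult norm_power norm_exp_eq_Re dest: arg_cong[of _ _ cmod])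
    then have "ln (cmod z ^ m * exp (Re (G z))) = ln (cmod z ^ n * exp (Re (L z)))" by simp
    then have "real m * ln (cmod z) + Re (G z) = real n * ln (cmod z) + Re (L z)"
      using z by (simp add: ln_mult ln_realpow)
    then show ?thesis using G(2)[OF z] by (simp add: algebra_simps)
  qed
  with L(1) that show ?thesis by blast
qed

section \<open>Subharmonic functions at a puncture\<close>

lemma circle_mean_const:
  assumes "\<And>t. u (z + rcis r t) = ereal A"
  shows "circle_mean u z r = ereal A"
proof -
  have int: "(\<integral>\<^sup>+t\<in>{0..2 * pi}. x \<partial>lborel) = x * ennreal (2 * pi)" for x :: ennreal
    by (subst nn_integral_cmult_indicator) auto
  have e: "enn2ereal (e2ennreal (ereal x) * ennreal (2 * pi)) = ereal (max 0 x * (2 * pi))" for x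
  proof -
    have "e2ennreal (ereal x) = ennreal (max 0 x)"
      by (simp add: max_def ennreal_neg)
    then show ?thesis by (simp add: ennreal_mult[symmetric])
  qed
  have "max 0 A * (2 * pi) - max 0 (- A) * (2 * pi) = A * (2 * pi)" by (simp add: max_def)
  then show ?thesis unfolding circle_mean_def assms int uminus_ereal.simps e by simp
qed

text \<open>The mean value inequality on the unit circle gives one inequality; upper semicontinuity gives the other,
  as \<open>u 0 < A\<close> would force \<open>u < A\<close> near 0.\<close>

lemma subharmonic_value_at_puncture:
  assumes u: "subharmonic_on u (ball 0 R)" and R: "1 < R"
    and A: "\<And>z. z \<in> ball 0 R - {0} \<Longrightarrow> u z = ereal A"
  shows "u 0 = ereal A"
proof (rule antisym)
  have "u 0 \<le> circle_mean u 0 1"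
    using u R unfolding subharmonic_on_def by (metis cball_subset_ball_iff dist_self add_0 zero_less_one)
  also have "circle_mean u 0 1 = ereal A"
    using R by (intro circle_mean_const A) (auto simp: rcis_def)
  finally show "u 0 \<le> ereal A" .
  show "ereal A \<le> u 0"
  proof (rule ccontr)
    assume "\<not> ereal A \<le> u 0"
    moreover have "0 \<in> ball (0::complex) R" using R by simp
    ultimately have "\<forall>\<^sub>F w in at 0 within ball 0 R. u w < ereal A"
      using u unfolding subharmonic_on_def by (meson not_le)
    moreover have at: "at 0 within ball 0 R = at (0::complex)" using R by (intro at_within_open) auto
    ultimately have "\<forall>\<^sub>F w in at (0::complex). u w < ereal A" by simp
    moreover have "\<forall>\<^sub>F w in at (0::complex). w \<in> ball 0 R - {0}"
      using R by (intro eventually_at_in_open) auto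
    ultimately have "\<forall>\<^sub>F w in at (0::complex). False"
    proof eventually_elim
      case (elim w)
      then show ?case using A[of w] by simp
    qed
    then show False by simp
  qed
qed

section \<open>The weighted area measure on the disk\<close>

lemma measurable_Complex: "(\<lambda>(x, y). Complex x y) \<in> borel_measurable (lborel \<Otimes>\<^sub>M lborel)"
proof -
  have "(\<lambda>p. Complex (fst p) (snd p)) \<in> borel_measurable borel"
    by (intro borel_measurable_continuous_onI continuous_intros)
  then show ?thesis unfolding lborel_prod case_prod_beta' by simp
qed

lemma lborel_complex:
  "(lborel :: complex measure) = distr (lborel \<Otimes>\<^sub>M lborel) borel (\<lambda>(x, y). Complex x y)"
proof (rule lborel_eqI)
  fix l u :: complex
  assume b: "\<And>b. b \<in> Basis \<Longrightarrow> l \<bullet> b \<le> u \<bullet> b"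
  have le: "Re l \<le> Re u" "Im l \<le> Im u"
    using b[of 1] b[of \<i>] by (simp_all add: Basis_complex_def inner_complex_def)
  have "(\<lambda>(x, y). Complex x y) -` box l u \<inter> space (lborel \<Otimes>\<^sub>M lborel) = {Re l<..<Re u} \<times> {Im l<..<Im u}"
    by (auto simp: box_def Basis_complex_def inner_complex_def space_pair_measure)
  then have "emeasure (distr (lborel \<Otimes>\<^sub>M lborel) borel (\<lambda>(x, y). Complex x y)) (box l u)
      = emeasure (lborel \<Otimes>\<^sub>M lborel) ({Re l<..<Re u} \<times> {Im l<..<Im u})"
    by (subst emeasure_distr[OF measurable_Complex]) auto
  also have "\<dots> = ennreal (Re u - Re l) * ennreal (Im u - Im l)"
    using le by (subst lborel.emeasure_pair_measure_Times) auto
  also have "\<dots> = (\<Prod>b\<in>Basis. (u - l) \<bullet> b)"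
    using le by (simp add: Basis_complex_def inner_complex_def ennreal_mult)
  finally show "emeasure (distr (lborel \<Otimes>\<^sub>M lborel) borel (\<lambda>(x, y). Complex x y)) (box l u)
      = (\<Prod>b\<in>Basis. (u - l) \<bullet> b)" .
qed simp

lemma nn_integral_complex:
  assumes f [measurable]: "f \<in> borel_measurable borel"
  shows "(\<integral>\<^sup>+z. f z \<partial>lborel) = (\<integral>\<^sup>+x. \<integral>\<^sup>+y. f (Complex x y) \<partial>lborel \<partial>lborel)"
    and "(\<integral>\<^sup>+z. f z \<partial>lborel) = (\<integral>\<^sup>+y. \<integral>\<^sup>+x. f (Complex x y) \<partial>lborel \<partial>lborel)"
proof -
  note [measurable] = measurable_Complex
  have m: "(\<lambda>(x, y). f (Complex x y)) \<in> borel_measurable (lborel \<Otimes>\<^sub>M lborel)"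
    using measurable_compose[OF measurable_Complex f] by (simp add: case_prod_beta')
  have "(\<integral>\<^sup>+z. f z \<partial>lborel) = (\<integral>\<^sup>+p. (case p of (x, y) \<Rightarrow> f (Complex x y)) \<partial>(lborel \<Otimes>\<^sub>M lborel))"
    by (subst lborel_complex, subst nn_integral_distr[OF measurable_Complex]) (simp_all add: case_prod_beta')
  then show "(\<integral>\<^sup>+z. f z \<partial>lborel) = (\<integral>\<^sup>+x. \<integral>\<^sup>+y. f (Complex x y) \<partial>lborel \<partial>lborel)"
    and "(\<integral>\<^sup>+z. f z \<partial>lborel) = (\<integral>\<^sup>+y. \<integral>\<^sup>+x. f (Complex x y) \<partial>lborel \<partial>lborel)"
    using lborel_pair.nn_integral_snd[OF m] lborel.nn_integral_fst[OF m] by simp_all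
qed

lemma nn_integral_lborel_shift:
  "f \<in> borel_measurable borel \<Longrightarrow> (\<integral>\<^sup>+x. f (x + c) \<partial>lborel) = (\<integral>\<^sup>+x. f x \<partial>(lborel :: real measure))"
  using nn_integral_real_affine[of f 1 c] by (simp add: add.commute)

lemma nn_integral_shear:
  assumes f [measurable]: "f \<in> borel_measurable borel"
  shows "(\<integral>\<^sup>+z. f (Complex (Re z + t * Im z) (Im z)) \<partial>lborel) = (\<integral>\<^sup>+z. f z \<partial>lborel)"
    and "(\<integral>\<^sup>+z. f (Complex (Re z) (Im z + t * Re z)) \<partial>lborel) = (\<integral>\<^sup>+z. f z \<partial>lborel)"
proof -
  have c: "(\<lambda>z. Complex (Re z + t * Im z) (Im z)) \<in> borel_measurable borel"
    "(\<lambda>z. Complex (Re z) (Im z + t * Re z)) \<in> borel_measurable borel"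
    "(\<lambda>x. Complex x y) \<in> borel_measurable borel" "(\<lambda>x. Complex y x) \<in> borel_measurable borel" for y
    by (intro borel_measurable_continuous_onI continuous_intros)+
  show "(\<integral>\<^sup>+z. f (Complex (Re z + t * Im z) (Im z)) \<partial>lborel) = (\<integral>\<^sup>+z. f z \<partial>lborel)"
    using nn_integral_lborel_shift[OF measurable_compose[OF c(3) f]]
    by (subst (1 2) nn_integral_complex(2)) (auto intro: measurable_compose[OF c(1) f])
  show "(\<integral>\<^sup>+z. f (Complex (Re z) (Im z + t * Re z)) \<partial>lborel) = (\<integral>\<^sup>+z. f z \<partial>lborel)"
    using nn_integral_lborel_shift[OF measurable_compose[OF c(4) f]]
    by (subst (1 2) nn_integral_complex(1)) (auto intro: measurable_compose[OF c(2) f])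
qed

text \<open>A rotation by \<open>\<theta>\<close> is a product of three shears, with parameters \<open>- tan (\<theta>/2)\<close>,
  \<open>sin \<theta>\<close>, \<open>- tan (\<theta>/2)\<close>; each shear preserves Lebesgue measure by the Fubini theorem.\<close>

lemma nn_integral_rotate:
  assumes f [measurable]: "f \<in> borel_measurable borel" and th: "cos (\<theta> / 2) \<noteq> 0"
  shows "(\<integral>\<^sup>+z. f (cis \<theta> * z) \<partial>lborel) = (\<integral>\<^sup>+z. f z \<partial>lborel)"
proof -
  define s1 where "s1 z = Complex (Re z + (- tan (\<theta> / 2)) * Im z) (Im z)" for z
  define s2 where "s2 z = Complex (Re z) (Im z + sin \<theta> * Re z)" for z
  have m [measurable]: "s1 \<in> borel_measurable borel" "s2 \<in> borel_measurable borel"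
    unfolding s1_def s2_def by (intro borel_measurable_continuous_onI continuous_intros)+
  define c s where "c = cos (\<theta> / 2)" and "s = sin (\<theta> / 2)"
  have cs: "c\<^sup>2 = 1 - s\<^sup>2" by (simp add: c_def s_def cos_squared_eq)
  have c0: "c \<noteq> 0" using th by (simp add: c_def)
  have sin: "sin \<theta> = 2 * s * c" using sin_double[of "\<theta> / 2"] by (simp add: c_def s_def)
  have cos: "cos \<theta> = 1 - 2 * s\<^sup>2" using cos_double_sin[of "\<theta> / 2"] by (simp add: s_def)
  have tan: "tan (\<theta> / 2) = s / c" by (simp add: tan_def c_def s_def)
  have ab: "1 - tan (\<theta> / 2) * sin \<theta> = cos \<theta>" unfolding tan sin cos using c0 by (simp add: power2_eq_square)
  have aab: "tan (\<theta> / 2) * (1 + cos \<theta>) = sin \<theta>"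
    unfolding tan sin cos using c0 cs by (simp add: field_simps power2_eq_square) algebra
  have rot: "s1 (s2 (s1 z)) = cis \<theta> * z" for z
  proof -
    have 2: "Im z + sin \<theta> * (Re z - tan (\<theta> / 2) * Im z) = cos \<theta> * Im z + sin \<theta> * Re z"
      unfolding ab[symmetric] by (simp add: algebra_simps)
    have "Re z - tan (\<theta> / 2) * Im z - tan (\<theta> / 2) * (cos \<theta> * Im z + sin \<theta> * Re z)
        = (1 - tan (\<theta> / 2) * sin \<theta>) * Re z - tan (\<theta> / 2) * (1 + cos \<theta>) * Im z"
      by (simp add: algebra_simps)
    also have "\<dots> = cos \<theta> * Re z - sin \<theta> * Im z" unfolding ab aab ..
    finally show ?thesis using 2 by (simp add: s1_def s2_def complex_eq_iff)
  qed
  have "(\<integral>\<^sup>+z. f (s1 (s2 (s1 z))) \<partial>lborel) = (\<integral>\<^sup>+z. f (s1 (s2 z)) \<partial>lborel)"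
    using nn_integral_shear(1)[of "\<lambda>z. f (s1 (s2 z))" "- tan (\<theta> / 2)", folded s1_def] by simp
  also have "\<dots> = (\<integral>\<^sup>+z. f (s1 z) \<partial>lborel)"
    using nn_integral_shear(2)[of "\<lambda>z. f (s1 z)" "sin \<theta>", folded s2_def] by simp
  also have "\<dots> = (\<integral>\<^sup>+z. f z \<partial>lborel)"
    using nn_integral_shear(1)[of f "- tan (\<theta> / 2)", folded s1_def] by simp
  finally show ?thesis unfolding rot .
qed

lemma distr_rotate:
  assumes "cos (\<theta> / 2) \<noteq> 0"
  shows "distr lborel borel (\<lambda>z. cis \<theta> * z) = (lborel :: complex measure)"
proof (rule measure_eqI)
  fix A :: "complex set" assume "A \<in> sets (distr lborel borel (\<lambda>z. cis \<theta> * z))"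
  then have A [measurable]: "A \<in> sets borel" by simp
  have "emeasure (distr lborel borel (\<lambda>z. cis \<theta> * z)) A = (\<integral>\<^sup>+z. indicator A z \<partial>distr lborel borel (\<lambda>z. cis \<theta> * z))"
    by simp
  also have "\<dots> = (\<integral>\<^sup>+z. indicator A (cis \<theta> * z) \<partial>lborel)" by (subst nn_integral_distr) auto
  also have "\<dots> = emeasure lborel A" using nn_integral_rotate[OF _ assms, of "indicator A"] by simp
  finally show "emeasure (distr lborel borel (\<lambda>z. cis \<theta> * z)) A = emeasure lborel A" .
qed simp

text \<open>Polar coordinates for radial functions: the squared modulus is uniformly distributed on the disk,
  since \<open>\<bar>z\<bar>\<^sup>2 > x\<close> defines an annulus of area \<open>\<pi> (1 - x)\<close>.\<close>

lemma distr_norm_square_disk: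
  "distr (restrict_space lborel (ball (0::complex) 1)) borel (\<lambda>z. (cmod z)\<^sup>2)
    = density lborel (\<lambda>t. ennreal pi * indicator {0<..<1} t)"
proof (rule measure_eqI_lessThan)
  let ?D = "restrict_space lborel (ball (0::complex) 1)"
  let ?N = "density lborel (\<lambda>t. ennreal pi * indicator {0<..<1::real} t)"
  fix x :: real
  have m: "(\<lambda>z. (cmod z)\<^sup>2) \<in> borel_measurable ?D" by (intro measurable_restrict_space1) auto
  have "emeasure (distr ?D borel (\<lambda>z. (cmod z)\<^sup>2)) {x<..} = emeasure ?D ({z. x < (cmod z)\<^sup>2} \<inter> ball 0 1)"
    using m by (subst emeasure_distr) (auto simp: space_restrict_space vimage_def Int_commute intro!: arg_cong[of _ _ "emeasure ?D"])
  also have "\<dots> = emeasure lborel ({z. x < (cmod z)\<^sup>2} \<inter> ball 0 1)"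
    by (subst emeasure_restrict_space) auto
  also have "\<dots> = ennreal pi * (if x < 0 then 1 else if x < 1 then ennreal (1 - x) else 0)"
  proof -
    consider "x < 0" | "0 \<le> x" "x < 1" | "1 \<le> x" by linarith
    then show ?thesis
    proof cases
      case 1
      then have "x < (cmod z)\<^sup>2" for z by (rule less_le_trans) simp
      then have "{z. x < (cmod z)\<^sup>2} \<inter> ball 0 1 = ball (0::complex) 1" by auto
      then show ?thesis using 1 by (simp add: emeasure_ball unit_ball_vol_2)
    next
      case 2
      have iff: "x < (cmod z)\<^sup>2 \<longleftrightarrow> sqrt x < cmod z" for z
        using real_sqrt_less_iff[of x "(cmod z)\<^sup>2"] by simp
      have sq: "sqrt x < 1" using 2 by simp
      have "{z. x < (cmod z)\<^sup>2} \<inter> ball 0 1 = ball (0::complex) 1 - cball 0 (sqrt x)"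
        unfolding iff by auto
      also have "emeasure lborel \<dots> = emeasure lborel (ball (0::complex) 1) - emeasure lborel (cball (0::complex) (sqrt x))"
        using 2 by (intro emeasure_Diff) (auto simp: emeasure_cball intro: le_less_trans[OF _ sq])
      also have "\<dots> = ennreal (pi * 1) - ennreal (pi * x)"
        using 2 by (simp add: emeasure_ball emeasure_cball unit_ball_vol_2)
      also have "\<dots> = ennreal pi * ennreal (1 - x)"
        using 2 by (subst ennreal_minus) (auto simp: ennreal_mult[symmetric] algebra_simps)
      finally show ?thesis using 2 by simp
    next
      case 3
      have "(cmod z)\<^sup>2 \<le> 1" if "cmod z < 1" for z :: complex using that by (simp add: power_le_one)
      then have "{z. x < (cmod z)\<^sup>2} \<inter> ball 0 1 = ({} :: complex set)" using 3 by fastforce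
      then show ?thesis using 3 by simp
    qed
  qed
  finally have 1: "emeasure (distr ?D borel (\<lambda>z. (cmod z)\<^sup>2)) {x<..} = ennreal pi * (if x < 0 then 1 else if x < 1 then ennreal (1 - x) else 0)" .
  then show "emeasure (distr ?D borel (\<lambda>z. (cmod z)\<^sup>2)) {x<..} < \<infinity>"
    by (auto simp: ennreal_mult[symmetric] ennreal_mult_less_top)
  have "emeasure ?N {x<..} = (\<integral>\<^sup>+t. ennreal pi * indicator ({0<..<1} \<inter> {x<..}) t \<partial>lborel)"
    by (subst emeasure_density) (auto intro!: nn_integral_cong split: split_indicator)
  also have "\<dots> = ennreal pi * emeasure lborel ({0<..<1} \<inter> {x<..})" by (subst nn_integral_cmult) auto
  also have "{0<..<1} \<inter> {x<..} = {max 0 x<..<1}" by auto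
  also have "ennreal pi * emeasure lborel {max 0 x<..<1} = ennreal pi * (if x < 0 then 1 else if x < 1 then ennreal (1 - x) else 0)"
    by (cases "x < 0"; cases "x < 1") (auto simp: max_def split: if_splits)
  finally show "emeasure (distr ?D borel (\<lambda>z. (cmod z)\<^sup>2)) {x<..} = emeasure ?N {x<..}" using 1 by simp
qed auto

locale weighted_disk =
  fixes \<alpha> :: real
  assumes \<alpha>: "-1 < \<alpha>"
begin

abbreviation \<mu> :: "complex measure" where "\<mu> \<equiv> disk_measure \<alpha>"

lemma space_\<mu> [simp]: "space \<mu> = ball 0 1"
  by (simp add: disk_measure_def space_restrict_space)

lemma borel_measurable_\<mu>: "f \<in> borel_measurable borel \<Longrightarrow> f \<in> borel_measurable \<mu>"
  by (simp add: disk_measure_def measurable_restrict_space1)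

lemma density_measurable [measurable]: "(\<lambda>z::complex. (\<alpha> + 1) / pi * (1 - (cmod z)\<^sup>2) powr \<alpha>) \<in> borel_measurable borel"
  by measurable

lemma AE_\<mu>I: "(AE z in lborel. z \<in> ball 0 1 \<longrightarrow> P z) \<Longrightarrow> AE z in \<mu>. P z"
  unfolding disk_measure_def
  by (subst AE_density) (auto intro!: measurable_restrict_space1 simp: AE_restrict_space_iff elim: eventually_mono)

lemma AE_\<mu>_nonzero: "AE z in \<mu>. z \<in> ball 0 1 - {0}"
  by (rule AE_\<mu>I) (use AE_lborel_singleton[of "0::complex"] in \<open>auto elim: eventually_mono\<close>)

lemma nn_integral_\<mu>:
  assumes [measurable]: "f \<in> borel_measurable borel"
  shows "(\<integral>\<^sup>+z. f z \<partial>\<mu>) = (\<integral>\<^sup>+z. ennreal ((\<alpha> + 1) / pi * (1 - (cmod z)\<^sup>2) powr \<alpha>) * f z \<partial>restrict_space lborel (ball 0 1))"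
  unfolding disk_measure_def by (rule nn_integral_density) (auto intro!: measurable_restrict_space1)

lemma nn_integral_\<mu>_radial:
  assumes [measurable]: "g \<in> borel_measurable borel"
  shows "(\<integral>\<^sup>+z. g ((cmod z)\<^sup>2) \<partial>\<mu>) = (\<integral>\<^sup>+t\<in>{0<..<1}. ennreal ((\<alpha> + 1) * (1 - t) powr \<alpha>) * g t \<partial>lborel)"
proof -
  let ?D = "restrict_space lborel (ball (0::complex) 1)"
  let ?h = "\<lambda>t. ennreal ((\<alpha> + 1) / pi * (1 - t) powr \<alpha>) * g t"
  have m: "(\<lambda>z. (cmod z)\<^sup>2) \<in> borel_measurable ?D" by (intro measurable_restrict_space1) auto
  have "(\<integral>\<^sup>+z. g ((cmod z)\<^sup>2) \<partial>\<mu>) = (\<integral>\<^sup>+z. ?h ((cmod z)\<^sup>2) \<partial>?D)" by (rule nn_integral_\<mu>) measurable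
  also have "\<dots> = (\<integral>\<^sup>+t. ?h t \<partial>distr ?D borel (\<lambda>z. (cmod z)\<^sup>2))" using m by (subst nn_integral_distr) auto
  also have "\<dots> = (\<integral>\<^sup>+t. ennreal pi * indicator {0<..<1} t * ?h t \<partial>lborel)"
    unfolding distr_norm_square_disk by (subst nn_integral_density) auto
  also have "\<dots> = (\<integral>\<^sup>+t\<in>{0<..<1}. ennreal ((\<alpha> + 1) * (1 - t) powr \<alpha>) * g t \<partial>lborel)"
  proof (rule nn_integral_cong)
    fix t
    have "ennreal pi * ennreal ((\<alpha> + 1) / pi * (1 - t) powr \<alpha>) = ennreal ((\<alpha> + 1) * (1 - t) powr \<alpha>)"
      using \<alpha> by (subst ennreal_mult[symmetric]) auto
    then show "ennreal pi * indicator {0<..<1} t * ?h t = ennreal ((\<alpha> + 1) * (1 - t) powr \<alpha>) * g t * indicator {0<..<1} t"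
      by (auto split: split_indicator simp: mult.assoc[symmetric])
  qed
  finally show ?thesis .
qed

text \<open>In the variable \<open>t = \<bar>z\<bar>\<^sup>2\<close> the integral becomes Euler's Beta integral. Exponents below 0 are
  needed for the integrability of \<open>(ln \<bar>z\<bar>)\<^sup>2\<close>.\<close>

lemma powr_moment:
  assumes a: "0 < a"
  shows "integrable \<mu> (\<lambda>z. (cmod z)\<^sup>2 powr (a - 1))"
    and "(LINT z|\<mu>. (cmod z)\<^sup>2 powr (a - 1)) = (\<alpha> + 1) * Beta a (\<alpha> + 1)"
proof -
  have "((\<lambda>t. (\<alpha> + 1) * (t powr (a - 1) * (1 - t) powr \<alpha>)) has_integral ((\<alpha> + 1) * Beta a (\<alpha> + 1))) {0..1}"
    using has_integral_Beta_real[OF a, of "\<alpha> + 1"] \<alpha> by (intro has_integral_mult_right) simp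
  then have "((\<lambda>t. (\<alpha> + 1) * (t powr (a - 1) * (1 - t) powr \<alpha>)) has_integral ((\<alpha> + 1) * Beta a (\<alpha> + 1))) {0<..<1}"
    by (simp add: has_integral_Icc_iff_Ioo)
  from nn_integral_has_integral_lebesgue'[OF _ this]
  have *: "(\<integral>\<^sup>+t. ennreal ((\<alpha> + 1) * (t powr (a - 1) * (1 - t) powr \<alpha>)) * indicator {0<..<1} t \<partial>lborel) = ennreal ((\<alpha> + 1) * Beta a (\<alpha> + 1))"
    using \<alpha> by simp
  have "(\<integral>\<^sup>+z. ennreal ((cmod z)\<^sup>2 powr (a - 1)) \<partial>\<mu>) = (\<integral>\<^sup>+t\<in>{0<..<1}. ennreal ((\<alpha> + 1) * (1 - t) powr \<alpha>) * ennreal (t powr (a - 1)) \<partial>lborel)"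
    by (rule nn_integral_\<mu>_radial) measurable
  also have "\<dots> = (\<integral>\<^sup>+t. ennreal ((\<alpha> + 1) * (t powr (a - 1) * (1 - t) powr \<alpha>)) * indicator {0<..<1} t \<partial>lborel)"
    using \<alpha> by (intro nn_integral_cong) (auto simp: ennreal_mult[symmetric] mult_ac split: split_indicator)
  also note *
  finally have fin: "(\<integral>\<^sup>+z. ennreal ((cmod z)\<^sup>2 powr (a - 1)) \<partial>\<mu>) = ennreal ((\<alpha> + 1) * Beta a (\<alpha> + 1))" .
  have m: "(\<lambda>z. (cmod z)\<^sup>2 powr (a - 1)) \<in> borel_measurable \<mu>"
    by (rule borel_measurable_\<mu>) measurable
  show "integrable \<mu> (\<lambda>z. (cmod z)\<^sup>2 powr (a - 1))"
    using m fin by (intro integrableI_nonneg) auto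
  have "0 \<le> Beta a (\<alpha> + 1)" unfolding Beta_def using a \<alpha> Gamma_real_pos by (intro divide_nonneg_nonneg mult_nonneg_nonneg less_imp_le) auto
  then show "(LINT z|\<mu>. (cmod z)\<^sup>2 powr (a - 1)) = (\<alpha> + 1) * Beta a (\<alpha> + 1)"
    using m fin \<alpha> by (subst integral_eq_nn_integral) auto
qed

text \<open>The Taylor coefficients of \<open>(1 - x) powr - (\<alpha> + 2)\<close>; they are also the reciprocal moments of the measure.\<close>

definition \<gamma> :: "nat \<Rightarrow> real" where "\<gamma> n = pochhammer (\<alpha> + 2) n / fact n"

lemma \<gamma>_0 [simp]: "\<gamma> 0 = 1"
  by (simp add: \<gamma>_def)

lemma \<gamma>_pos: "0 < \<gamma> n"
  using \<alpha> by (simp add: \<gamma>_def pochhammer_pos)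

lemma \<gamma>_Suc: "\<gamma> (Suc n) * (real n + 1) = \<gamma> n * (\<alpha> + 2 + real n)"
proof -
  define c where "c = real n + 1"
  have c: "c \<noteq> 0" by (simp add: c_def)
  have "\<gamma> (Suc n) = pochhammer (\<alpha> + 2) n * (\<alpha> + 2 + real n) / (c * fact n)"
    by (simp add: \<gamma>_def pochhammer_Suc c_def add.commute)
  then show ?thesis unfolding c_def[symmetric] using c by (simp add: \<gamma>_def)
qed

lemma \<gamma>_Suc_le: "\<gamma> (Suc n) \<le> (\<alpha> + 2) * \<gamma> n"
proof -
  have "real n * 1 \<le> real n * (\<alpha> + 2)" using \<alpha> by (intro mult_left_mono) auto
  then have "\<alpha> + 2 + real n \<le> (\<alpha> + 2) * (real n + 1)" by (simp add: algebra_simps)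
  then have "\<gamma> n * (\<alpha> + 2 + real n) \<le> \<gamma> n * ((\<alpha> + 2) * (real n + 1))" using \<gamma>_pos[of n] by (intro mult_left_mono) auto
  then have "\<gamma> (Suc n) * (real n + 1) \<le> ((\<alpha> + 2) * \<gamma> n) * (real n + 1)"
    unfolding \<gamma>_Suc by (simp only: mult_ac)
  then show ?thesis by (rule mult_right_le_imp_le) simp
qed

lemma moment:
  shows "integrable \<mu> (\<lambda>z. (cmod z) ^ (2 * n))" and "(LINT z|\<mu>. (cmod z) ^ (2 * n)) = 1 / \<gamma> n"
proof -
  have ae: "AE z in \<mu>. (cmod z)\<^sup>2 powr (real (Suc n) - 1) = (cmod z) ^ (2 * n)"
    using AE_\<mu>_nonzero by eventually_elim (auto simp: powr_realpow power_mult)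
  have m: "(\<lambda>z. (cmod z)\<^sup>2 powr (real (Suc n) - 1)) \<in> borel_measurable \<mu>" "(\<lambda>z. (cmod z) ^ (2 * n)) \<in> borel_measurable \<mu>"
    by (rule borel_measurable_\<mu>; measurable)+
  show "integrable \<mu> (\<lambda>z. (cmod z) ^ (2 * n))"
    using powr_moment(1)[of "real (Suc n)"] integrable_cong_AE[OF m ae] by simp
  have "(LINT z|\<mu>. (cmod z) ^ (2 * n)) = (\<alpha> + 1) * Beta (real (Suc n)) (\<alpha> + 1)"
    using powr_moment(2)[of "real (Suc n)"] integral_cong_AE[OF m ae] by simp
  also have "\<dots> = 1 / \<gamma> n"
  proof -
    have ni: "\<alpha> + 1 \<notin> \<int>\<^sub>\<le>\<^sub>0" "\<alpha> + 2 \<notin> \<int>\<^sub>\<le>\<^sub>0" using nonpos_Ints_nonpos \<alpha> by force+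
    have "Gamma (\<alpha> + 1 + 1) = (\<alpha> + 1) * Gamma (\<alpha> + 1)" by (rule Gamma_plus1[OF ni(1)])
    then have "Gamma (\<alpha> + 2) = (\<alpha> + 1) * Gamma (\<alpha> + 1)" by (simp add: add.assoc)
    moreover have "pochhammer (\<alpha> + 2) n = Gamma (\<alpha> + 2 + real n) / Gamma (\<alpha> + 2)"
      by (rule pochhammer_Gamma[OF ni(2)])
    ultimately have g: "\<gamma> n = Gamma (\<alpha> + 2 + real n) / ((\<alpha> + 1) * Gamma (\<alpha> + 1)) / fact n"
      by (simp only: \<gamma>_def)
    have "Gamma (real (Suc n)) = fact n" using Gamma_fact[of n, where 'a = real] by (simp add: add.commute)
    moreover have "real (Suc n) + (\<alpha> + 1) = \<alpha> + 2 + real n" by simp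
    ultimately have b: "Beta (real (Suc n)) (\<alpha> + 1) = fact n * Gamma (\<alpha> + 1) / Gamma (\<alpha> + 2 + real n)"
      by (simp only: Beta_def)
    show ?thesis unfolding b g by simp
  qed
  finally show "(LINT z|\<mu>. (cmod z) ^ (2 * n)) = 1 / \<gamma> n" .
qed

lemma emeasure_space_\<mu>: "emeasure \<mu> (space \<mu>) = 1"
proof -
  have "(\<integral>\<^sup>+z. ennreal ((cmod z) ^ (2 * 0)) \<partial>\<mu>) = ennreal (1 / \<gamma> 0)"
    using moment[of 0] by (subst nn_integral_eq_integral) auto
  then show ?thesis by simp
qed

sublocale finite_measure \<mu>
  by (rule finite_measureI) (simp add: emeasure_space_\<mu> del: space_\<mu>)

lemma integral_rotate:
  fixes f :: "complex \<Rightarrow> complex"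
  assumes f [measurable]: "f \<in> borel_measurable borel" and th: "cos (\<theta> / 2) \<noteq> 0"
  shows "(LINT z|\<mu>. f (cis \<theta> * z)) = (LINT z|\<mu>. f z)"
proof -
  let ?w = "\<lambda>z::complex. (\<alpha> + 1) / pi * (1 - (cmod z)\<^sup>2) powr \<alpha>"
  have eq: "(LINT z|\<mu>. g z) = (LINT z|lborel. indicator (ball 0 1) z *\<^sub>R (?w z *\<^sub>R g z))"
    if [measurable]: "g \<in> borel_measurable borel" for g :: "complex \<Rightarrow> complex"
    unfolding disk_measure_def using \<alpha>
    by (subst integral_density) (auto intro!: measurable_restrict_space1 simp: integral_restrict_space)
  let ?F = "\<lambda>z. indicator (ball 0 1) z *\<^sub>R (?w z *\<^sub>R f z)"
  have F: "?F \<in> borel_measurable borel"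
    by (intro borel_measurable_scaleR borel_measurable_indicator density_measurable f) simp
  have "(LINT z|\<mu>. f (cis \<theta> * z)) = (LINT z|lborel. ?F (cis \<theta> * z))"
    by (subst eq) (auto simp: norm_mult indicator_def)
  also have "\<dots> = (LINT z|distr lborel borel (\<lambda>z. cis \<theta> * z). ?F z)"
    by (rule integral_distr[OF _ F, symmetric]) simp
  also have "\<dots> = (LINT z|\<mu>. f z)" unfolding distr_rotate[OF th] by (rule eq[symmetric]) measurable
  finally show ?thesis .
qed

text \<open>A rotation by \<open>1 / (j - k)\<close> multiplies the integrand by \<open>cis 1\<close>, which is not 1, and preserves the
  integral.\<close>

lemma integral_monomials_zero:
  fixes \<psi> :: "real \<Rightarrow> real"
  assumes [measurable]: "\<psi> \<in> borel_measurable borel" and ne: "j \<noteq> k"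
  shows "(LINT z|\<mu>. of_real (\<psi> (cmod z)) * z ^ j * cnj z ^ k) = 0"
proof -
  have main: "(LINT z|\<mu>. of_real (\<psi> (cmod z)) * z ^ j * cnj z ^ k) = 0" if "k < j" for j k
  proof -
    define m where "m = j - k"
    have m: "0 < m" "j = k + m" using that by (auto simp: m_def)
    define \<theta> where "\<theta> = 1 / real m"
    have "\<theta> \<le> 1" "0 < \<theta>" using m(1) by (simp_all add: \<theta>_def)
    then have "0 < \<theta> / 2" "\<theta> / 2 < pi / 2" using pi_gt3 by linarith+
    then have th: "cos (\<theta> / 2) \<noteq> 0" using cos_gt_zero_pi[of "\<theta> / 2"] by simp
    let ?f = "\<lambda>z. of_real (\<psi> (cmod z)) * z ^ j * cnj z ^ k"
    have cm: "?f \<in> borel_measurable borel"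
      by (intro borel_measurable_times borel_measurable_power borel_measurable_cnj) measurable
    have "cis \<theta> ^ m = cis (real m * \<theta>)" by (rule Complex.DeMoivre)
    then have "cis \<theta> ^ m = cis 1" using m(1) by (simp add: \<theta>_def)
    then have z: "?f (cis \<theta> * z) = cis 1 * ?f z" for z
    proof -
      have "cis \<theta> ^ k * cnj (cis \<theta>) ^ k = 1" by (simp add: power_mult_distrib[symmetric] cis_cnj cis_mult)
      then have "(cis \<theta> * z) ^ j * cnj (cis \<theta> * z) ^ k = cis \<theta> ^ m * (z ^ j * cnj z ^ k)"
        unfolding m(2) complex_cnj_mult power_mult_distrib power_add by (simp add: mult_ac)
      then show ?thesis using \<open>cis \<theta> ^ m = cis 1\<close> by (simp add: norm_mult mult.assoc mult.left_commute)
    qed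
    have "(LINT z|\<mu>. ?f z) = (LINT z|\<mu>. ?f (cis \<theta> * z))" by (rule integral_rotate[OF cm th, symmetric])
    also have "\<dots> = cis 1 * (LINT z|\<mu>. ?f z)" unfolding z by (rule integral_mult_right_zero)
    finally have "(1 - cis 1) * (LINT z|\<mu>. ?f z) = 0" by (simp add: algebra_simps)
    moreover have "cis 1 \<noteq> 1"
    proof
      assume "cis 1 = 1"
      then have "sin 1 = (0::real)" by (simp add: complex_eq_iff)
      moreover have "0 < sin (1::real)" using pi_gt3 by (intro sin_gt_zero) auto
      ultimately show False by simp
    qed
    ultimately show ?thesis by simp
  qed
  show ?thesis
  proof (cases "k < j")
    case False
    then have "(LINT z|\<mu>. of_real (\<psi> (cmod z)) * z ^ k * cnj z ^ j) = 0" using main ne by simp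
    then have "cnj (LINT z|\<mu>. of_real (\<psi> (cmod z)) * z ^ k * cnj z ^ j) = 0" by simp
    then show ?thesis unfolding Bochner_Integration.integral_cnj[symmetric] by (simp add: mult_ac)
  qed (rule main)
qed

lemma \<gamma>_sums:
  fixes x :: complex
  assumes "cmod x < 1"
  shows "(\<lambda>n. of_real (\<gamma> n) * x ^ n) sums (1 / (1 - x) powr of_real (\<alpha> + 2))"
proof -
  have "(\<lambda>n. ((- of_real (\<alpha> + 2)) gchoose n) * (- x) ^ n) sums (1 + - x) powr (- of_real (\<alpha> + 2))"
    using assms by (intro gen_binomial_complex) simp
  moreover have "((- of_real (\<alpha> + 2)) gchoose n) * (- x) ^ n = of_real (\<gamma> n) * x ^ n" for n
  proof -
    have "((- of_real (\<alpha> + 2)) gchoose n) * (- x) ^ n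
        = ((- 1) ^ n * (- 1) ^ n) * (of_real (\<gamma> n) * x ^ n)"
      unfolding gbinomial_pochhammer \<gamma>_def power_minus[of x n] of_real_divide pochhammer_of_real[symmetric]
      by (simp del: minus_one_mult_self mult_minus1 mult_minus1_right add: mult.assoc mult.left_commute add.commute)
    then show ?thesis by simp
  qed
  ultimately show ?thesis by (simp only: powr_minus inverse_eq_divide add_uminus_conv_diff)
qed

lemma \<gamma>_summable:
  assumes "0 \<le> r" "r < 1"
  shows "summable (\<lambda>n. \<gamma> n * r ^ n)" "summable (\<lambda>n. \<gamma> (Suc n) * r ^ n)"
proof -
  have "summable (\<lambda>n. of_real (\<gamma> n) * (of_real r) ^ n :: complex)"
    using \<gamma>_sums[of "of_real r"] assms by (auto dest: sums_summable)
  then have "summable (\<lambda>n. complex_of_real (\<gamma> n * r ^ n))" by simp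
  then show 1: "summable (\<lambda>n. \<gamma> n * r ^ n)" by (simp only: summable_of_real_iff)
  show "summable (\<lambda>n. \<gamma> (Suc n) * r ^ n)"
  proof (rule summable_comparison_test'[OF summable_mult[OF 1, of "\<alpha> + 2"]])
    fix n
    have "\<gamma> (Suc n) * r ^ n \<le> (\<alpha> + 2) * \<gamma> n * r ^ n" using \<gamma>_Suc_le assms by (intro mult_right_mono) auto
    then show "norm (\<gamma> (Suc n) * r ^ n) \<le> (\<alpha> + 2) * (\<gamma> n * r ^ n)"
      using \<gamma>_pos[of "Suc n"] assms by (simp add: abs_mult mult.assoc)
  qed
qed

end

section \<open>Operators with singular values of order 1/n\<close>

context semi_inner
begin

text \<open>The norm of a diagonal operator is its largest entry. Vectors \<open>b n\<close> orthogonal to \<open>x\<close> are exempt,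
  so that the same lemma bounds the operator off the first few \<open>b n\<close>.\<close>

lemma orthogonal_operator_bound:
  fixes a b :: "nat \<Rightarrow> 'v"
  assumes aV: "\<And>n. a n \<in> V" and bV: "\<And>n. b n \<in> V"
    and ao: "\<And>m n. m \<noteq> n \<Longrightarrow> ip (a m) (a n) = 0" and bo: "\<And>m n. m \<noteq> n \<Longrightarrow> ip (b m) (b n) = 0"
    and x: "x \<in> V" and \<sigma>: "0 \<le> \<sigma>"
    and ab: "\<And>n. ip x (b n) = 0 \<or> nrm (a n) * nrm (b n) \<le> \<sigma>"
  shows "nrm (\<Sum>n<N. ip x (b n) *c a n) \<le> \<sigma> * nrm x"
proof -
  define unit where "unit y = (if nrm y = 0 then y else (1 / of_real (nrm y)) *c y)" for y
  have unitV: "unit y \<in> V" and unit_nrm: "nrm (unit y) = 1 \<or> nrm (unit y) = 0" if "y \<in> V" for y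
    using that nrm_ge0[OF that] by (auto simp: unit_def scale_in nrm_scale norm_divide)
  have unit_ip: "ip (unit y) (unit y') = 0" if "y \<in> V" "y' \<in> V" "ip y y' = 0" for y y'
    using that by (auto simp: unit_def scale_in ip_scale_left ip_scale_right)
  define s where "s y = (if nrm y = 0 then 1 else nrm y)" for y
  have s: "y = of_real (s y) *c unit y" for y by (simp add: s_def unit_def)
  have osa: "ortho_system UNIV (\<lambda>n. unit (a n))" and osb: "ortho_system UNIV (\<lambda>n. unit (b n))"
    by (simp_all add: ortho_system_def unitV[OF aV] unitV[OF bV] unit_nrm[OF aV] unit_nrm[OF bV]
        unit_ip[OF aV aV ao] unit_ip[OF bV bV bo])
  have "(\<Sum>n<N. ip x (b n) *c a n) = (\<Sum>n<N. (ip x (b n) * of_real (s (a n))) *c unit (a n))"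
    by (intro sum.cong refl) (subst s, simp)
  then have "(nrm (\<Sum>n<N. ip x (b n) *c a n))\<^sup>2
      = (\<Sum>n<N. (cmod (ip x (b n) * of_real (s (a n))))\<^sup>2 * (nrm (unit (a n)))\<^sup>2)"
    using nrm_combination[OF osa, of "{..<N}" "\<lambda>n. ip x (b n) * of_real (s (a n))"] by simp
  also have "\<dots> \<le> (\<Sum>n<N. \<sigma>\<^sup>2 * (cmod (ip x (unit (b n))))\<^sup>2)"
  proof (rule sum_mono)
    fix n
    have na: "s (a n) * nrm (unit (a n)) = nrm (a n)" "0 \<le> s (a n)"
      using aV[of n] nrm_ge0[OF aV[of n]] by (auto simp: s_def unit_def nrm_scale norm_divide)
    have b: "cmod (ip x (b n)) = nrm (b n) * cmod (ip x (unit (b n)))"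
      using bV[of n] x nrm_ge0[OF bV[of n]] null_ip[OF bV x, of n]
      by (auto simp: unit_def ip_scale_right norm_divide)
    have "cmod (ip x (b n)) * nrm (a n) \<le> \<sigma> * cmod (ip x (unit (b n)))"
    proof (cases "ip x (b n) = 0")
      case False
      then have "nrm (a n) * nrm (b n) * cmod (ip x (unit (b n))) \<le> \<sigma> * cmod (ip x (unit (b n)))"
        using ab[of n] by (intro mult_right_mono) auto
      then show ?thesis by (simp add: b mult_ac)
    qed (use \<sigma> in simp)
    then have "(cmod (ip x (b n)) * nrm (a n))\<^sup>2 \<le> (\<sigma> * cmod (ip x (unit (b n))))\<^sup>2"
      using nrm_ge0[OF aV] by (intro power_mono) auto
    then show "(cmod (ip x (b n) * of_real (s (a n))))\<^sup>2 * (nrm (unit (a n)))\<^sup>2 \<le> \<sigma>\<^sup>2 * (cmod (ip x (unit (b n))))\<^sup>2"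
      using na by (simp add: norm_mult power_mult_distrib[symmetric] mult.assoc)
  qed
  also have "\<dots> = \<sigma>\<^sup>2 * (\<Sum>n<N. (cmod (ip x (unit (b n))))\<^sup>2)" by (simp add: sum_distrib_left)
  also have "\<dots> \<le> \<sigma>\<^sup>2 * (nrm x)\<^sup>2" using bessel[OF osb, of "{..<N}" x] x by (intro mult_left_mono) auto
  finally have "(nrm (\<Sum>n<N. ip x (b n) *c a n))\<^sup>2 \<le> (\<sigma> * nrm x)\<^sup>2" by (simp add: power_mult_distrib)
  then show ?thesis by (rule power2_le_imp_le) (simp add: \<sigma> nrm_ge0[OF x])
qed

end

lemma L2_norm_triangle:
  assumes "f \<in> L2 M" "g \<in> L2 M"
  shows "L2_norm M (\<lambda>x. f x + g x) \<le> L2_norm M f + L2_norm M g"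
proof -
  interpret semi_inner "\<lambda>c f x. c * f x" "L2 M" "L2_inner M"
    rewrites "semi_inner.nrm (L2_inner M) = L2_norm M"
    by (rule semi_inner_L2) (rule L2_norm_eq_nrm)
  show ?thesis using nrm_triangle[OF assms] by (simp add: plus_fun_def)
qed

lemma L2_norm_sum:
  assumes "\<And>i. i \<in> I \<Longrightarrow> f i \<in> L2 M"
  shows "(\<lambda>x. \<Sum>i\<in>I. f i x) \<in> L2 M" "L2_norm M (\<lambda>x. \<Sum>i\<in>I. f i x) \<le> (\<Sum>i\<in>I. L2_norm M (f i))"
proof -
  interpret semi_inner "\<lambda>c f x. c * f x" "L2 M" "L2_inner M"
    rewrites "semi_inner.nrm (L2_inner M) = L2_norm M"
    by (rule semi_inner_L2) (rule L2_norm_eq_nrm)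
  have "(\<Sum>i\<in>I. f i) = (\<lambda>x. \<Sum>i\<in>I. f i x)" by (rule ext) (rule sum_fun_apply)
  then show "(\<lambda>x. \<Sum>i\<in>I. f i x) \<in> L2 M" "L2_norm M (\<lambda>x. \<Sum>i\<in>I. f i x) \<le> (\<Sum>i\<in>I. L2_norm M (f i))"
    using sum_in[of I f] nrm_sum[of I f] assms by simp_all
qed

lemma L2_norm_cmult: "L2_norm M (\<lambda>x. c * f x) = cmod c * L2_norm M f"
  by (simp add: L2_norm_def norm_mult power_mult_distrib real_sqrt_mult)

lemma L2_cnj: "f \<in> L2 M \<Longrightarrow> (\<lambda>x. cnj (f x)) \<in> L2 M" "L2_norm M (\<lambda>x. cnj (f x)) = L2_norm M f"
  by (auto simp: L2_def L2_norm_def intro: borel_measurable_cnj)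

lemma L2_inner_cnj: "L2_inner M (\<lambda>x. cnj (f x)) g = cnj (L2_inner M f (\<lambda>x. cnj (g x)))"
  unfolding L2_inner_def Bochner_Integration.integral_cnj[symmetric] by simp

lemma L2_mult_bounded:
  assumes f: "f \<in> L2 M" and g: "g \<in> borel_measurable M" "\<And>x. x \<in> space M \<Longrightarrow> cmod (g x) \<le> 1"
  shows "(\<lambda>x. g x * f x) \<in> L2 M" "L2_norm M (\<lambda>x. g x * f x) \<le> L2_norm M f"
proof -
  note [measurable] = g(1) L2D(1)[OF f]
  have le: "(cmod (g x * f x))\<^sup>2 \<le> (cmod (f x))\<^sup>2" if "x \<in> space M" for x
    using g(2)[OF that] by (intro power_mono) (auto simp: norm_mult mult_left_le_one_le)
  have i: "integrable M (\<lambda>x. (cmod (g x * f x))\<^sup>2)"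
  proof (rule Bochner_Integration.integrable_bound[OF L2D(2)[OF f]])
    show "AE x in M. norm ((cmod (g x * f x))\<^sup>2) \<le> norm ((cmod (f x))\<^sup>2)"
      using le by (intro AE_I2) (simp only: real_norm_def abs_power2)
  qed measurable
  then show "(\<lambda>x. g x * f x) \<in> L2 M" by (simp add: L2_def)
  show "L2_norm M (\<lambda>x. g x * f x) \<le> L2_norm M f"
    unfolding L2_norm_def using i L2D(2)[OF f] by (intro real_sqrt_le_mono integral_mono le)
qed

text \<open>\<open>T\<close> is within \<open>C / (N + 1)\<close> of vanishing off some \<open>K N\<close> vectors: its Gelfand numbers,
  and with them its singular values, are of order \<open>1/n\<close>.\<close>

definition rate_one :: "'a measure \<Rightarrow> (('a \<Rightarrow> complex) \<Rightarrow> 'a \<Rightarrow> complex) \<Rightarrow> bool" where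
  "rate_one M T \<longleftrightarrow> (\<forall>f\<in>L2 M. T f \<in> L2 M) \<and>
     (\<exists>(K::nat) C. 0 \<le> C \<and> (\<forall>N. \<exists>B. finite B \<and> B \<subseteq> L2 M \<and> card B \<le> K * N \<and>
        (\<forall>f\<in>L2 M. (\<forall>b\<in>B. L2_inner M f b = 0) \<longrightarrow> L2_norm M (T f) \<le> C / (real N + 1) * L2_norm M f)))"

lemma rate_oneE:
  assumes "rate_one M T"
  obtains K :: nat and C B where "0 \<le> C" "\<And>f. f \<in> L2 M \<Longrightarrow> T f \<in> L2 M"
    "\<And>N. finite (B N)" "\<And>N. B N \<subseteq> L2 M" "\<And>N. card (B N) \<le> K * N"
    "\<And>N f. f \<in> L2 M \<Longrightarrow> (\<And>b. b \<in> B N \<Longrightarrow> L2_inner M f b = 0) \<Longrightarrow> L2_norm M (T f) \<le> C / (real N + 1) * L2_norm M f"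
proof -
  obtain K C where C: "0 \<le> C" "\<forall>N. \<exists>B. finite B \<and> B \<subseteq> L2 M \<and> card B \<le> K * N \<and>
        (\<forall>f\<in>L2 M. (\<forall>b\<in>B. L2_inner M f b = 0) \<longrightarrow> L2_norm M (T f) \<le> C / (real N + 1) * L2_norm M f)"
    using assms unfolding rate_one_def by blast
  from C(2) obtain B where B: "\<forall>N. finite (B N) \<and> B N \<subseteq> L2 M \<and> card (B N) \<le> K * N \<and>
        (\<forall>f\<in>L2 M. (\<forall>b\<in>B N. L2_inner M f b = 0) \<longrightarrow> L2_norm M (T f) \<le> C / (real N + 1) * L2_norm M f)"
    by metis
  show ?thesis by (rule that[of C B K]) (use C(1) B assms in \<open>auto simp: rate_one_def\<close>)
qed

lemma rate_oneI:
  fixes K :: nat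
  assumes "0 \<le> C" "\<And>f. f \<in> L2 M \<Longrightarrow> T f \<in> L2 M"
    "\<And>N. finite (B N)" "\<And>N. B N \<subseteq> L2 M" "\<And>N. card (B N) \<le> K * N"
    "\<And>N f. f \<in> L2 M \<Longrightarrow> (\<And>b. b \<in> B N \<Longrightarrow> L2_inner M f b = 0) \<Longrightarrow> L2_norm M (T f) \<le> C / (real N + 1) * L2_norm M f"
  shows "rate_one M T"
  unfolding rate_one_def
proof (intro conjI ballI exI allI)
  show "0 \<le> C" by fact
  fix N
  show "finite (B N)" "B N \<subseteq> L2 M" "card (B N) \<le> K * N" by fact+
  show "(\<forall>b\<in>B N. L2_inner M f b = 0) \<longrightarrow> L2_norm M (T f) \<le> C / (real N + 1) * L2_norm M f" if "f \<in> L2 M" for f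
    using assms(6) that by blast
qed (use assms(2) in auto)

lemma rate_one_add:
  assumes "rate_one M S" "rate_one M T"
  shows "rate_one M (\<lambda>f x. S f x + T f x)"
proof -
  obtain K1 C1 B1 where 1: "0 \<le> C1" "\<And>f. f \<in> L2 M \<Longrightarrow> S f \<in> L2 M"
    "\<And>N. finite (B1 N)" "\<And>N. B1 N \<subseteq> L2 M" "\<And>N. card (B1 N) \<le> K1 * N"
    "\<And>N f. f \<in> L2 M \<Longrightarrow> (\<And>b. b \<in> B1 N \<Longrightarrow> L2_inner M f b = 0) \<Longrightarrow> L2_norm M (S f) \<le> C1 / (real N + 1) * L2_norm M f"
    by (rule rate_oneE[OF assms(1)]) blast
  obtain K2 C2 B2 where 2: "0 \<le> C2" "\<And>f. f \<in> L2 M \<Longrightarrow> T f \<in> L2 M"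
    "\<And>N. finite (B2 N)" "\<And>N. B2 N \<subseteq> L2 M" "\<And>N. card (B2 N) \<le> K2 * N"
    "\<And>N f. f \<in> L2 M \<Longrightarrow> (\<And>b. b \<in> B2 N \<Longrightarrow> L2_inner M f b = 0) \<Longrightarrow> L2_norm M (T f) \<le> C2 / (real N + 1) * L2_norm M f"
    by (rule rate_oneE[OF assms(2)]) blast
  show ?thesis
  proof (rule rate_oneI[where C = "C1 + C2" and B = "\<lambda>N. B1 N \<union> B2 N" and K = "K1 + K2"])
    fix N f
    show "card (B1 N \<union> B2 N) \<le> (K1 + K2) * N"
      using card_Un_le[of "B1 N" "B2 N"] 1(5)[of N] 2(5)[of N] by (simp add: add_mult_distrib)
    assume f: "f \<in> L2 M" "\<And>b. b \<in> B1 N \<union> B2 N \<Longrightarrow> L2_inner M f b = 0"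
    have "L2_norm M (\<lambda>x. S f x + T f x) \<le> L2_norm M (S f) + L2_norm M (T f)"
      using f 1 2 by (intro L2_norm_triangle)
    also have "\<dots> \<le> C1 / (real N + 1) * L2_norm M f + C2 / (real N + 1) * L2_norm M f"
      using f by (intro add_mono 1(6) 2(6)) auto
    also have "\<dots> = (C1 + C2) / (real N + 1) * L2_norm M f" by (simp add: add_divide_distrib distrib_right)
    finally show "L2_norm M (\<lambda>x. S f x + T f x) \<le> (C1 + C2) / (real N + 1) * L2_norm M f" .
  qed (use 1 2 in \<open>auto intro: L2_add\<close>)
qed

lemma rate_one_cmult:
  assumes "rate_one M T" shows "rate_one M (\<lambda>f x. c * T f x)"
proof -
  obtain K C B where 1: "0 \<le> C" "\<And>f. f \<in> L2 M \<Longrightarrow> T f \<in> L2 M"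
    "\<And>N. finite (B N)" "\<And>N. B N \<subseteq> L2 M" "\<And>N. card (B N) \<le> K * N"
    "\<And>N f. f \<in> L2 M \<Longrightarrow> (\<And>b. b \<in> B N \<Longrightarrow> L2_inner M f b = 0) \<Longrightarrow> L2_norm M (T f) \<le> C / (real N + 1) * L2_norm M f"
    by (rule rate_oneE[OF assms]) blast
  show ?thesis
  proof (rule rate_oneI[where C = "cmod c * C" and B = B and K = K])
    fix N f
    assume f: "f \<in> L2 M" and off: "\<And>b. b \<in> B N \<Longrightarrow> L2_inner M f b = 0"
    have "L2_norm M (T f) \<le> C / (real N + 1) * L2_norm M f" by (rule 1(6)[OF f off])
    from mult_left_mono[OF this, where c = "cmod c"]
    show "L2_norm M (\<lambda>x. c * T f x) \<le> cmod c * C / (real N + 1) * L2_norm M f"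
      by (simp add: L2_norm_cmult)
  qed (use 1 in \<open>auto intro: L2_cmult\<close>)
qed

lemma rate_one_cnj:
  assumes "rate_one M T" shows "rate_one M (\<lambda>f x. cnj (T (\<lambda>y. cnj (f y)) x))"
proof -
  obtain K C B where 1: "0 \<le> C" "\<And>f. f \<in> L2 M \<Longrightarrow> T f \<in> L2 M"
    "\<And>N. finite (B N)" "\<And>N. B N \<subseteq> L2 M" "\<And>N. card (B N) \<le> K * N"
    "\<And>N f. f \<in> L2 M \<Longrightarrow> (\<And>b. b \<in> B N \<Longrightarrow> L2_inner M f b = 0) \<Longrightarrow> L2_norm M (T f) \<le> C / (real N + 1) * L2_norm M f"
    by (rule rate_oneE[OF assms]) blast
  show ?thesis
  proof (rule rate_oneI[where C = C and B = "\<lambda>N. (\<lambda>b x. cnj (b x)) ` B N" and K = K])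
    fix N f
    show "(\<lambda>b x. cnj (b x)) ` B N \<subseteq> L2 M" using 1(4)[of N] L2_cnj(1) by blast
    show "card ((\<lambda>b x. cnj (b x)) ` B N) \<le> K * N" using card_image_le[OF 1(3)] 1(5) by (rule order_trans)
    assume f: "f \<in> L2 M" "\<And>b. b \<in> (\<lambda>b x. cnj (b x)) ` B N \<Longrightarrow> L2_inner M f b = 0"
    have "L2_norm M (T (\<lambda>y. cnj (f y))) \<le> C / (real N + 1) * L2_norm M (\<lambda>y. cnj (f y))"
      using f by (intro 1(6)) (auto simp: L2_cnj L2_inner_cnj)
    then show "L2_norm M (\<lambda>x. cnj (T (\<lambda>y. cnj (f y)) x)) \<le> C / (real N + 1) * L2_norm M f"
      by (simp add: L2_cnj)
  qed (use 1 in \<open>auto intro: L2_cnj\<close>)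
qed

lemma rate_one_cong_AE:
  assumes T: "rate_one M T" and m: "\<And>f. f \<in> L2 M \<Longrightarrow> S f \<in> borel_measurable M"
    and ae: "\<And>f. f \<in> L2 M \<Longrightarrow> AE x in M. T f x = S f x"
  shows "rate_one M S"
proof -
  have "S f \<in> L2 M" "L2_norm M (S f) = L2_norm M (T f)" if "f \<in> L2 M" for f
    using L2_cong_AE[OF _ m[OF that] ae[OF that]] T that by (auto simp: rate_one_def)
  then show ?thesis using T unfolding rate_one_def by simp
qed

section \<open>Integral operators on the disk\<close>

context weighted_disk
begin

lemma pair_sigma_finite_\<mu>: "pair_sigma_finite \<mu> \<mu>"
  by (simp add: pair_sigma_finite_def sigma_finite_measure_axioms)

sublocale pair: pair_sigma_finite \<mu> \<mu>
  by (rule pair_sigma_finite_\<mu>)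

definition kernel_op :: "(complex \<Rightarrow> complex \<Rightarrow> complex) \<Rightarrow> (complex \<Rightarrow> complex) \<Rightarrow> complex \<Rightarrow> complex" where
  "kernel_op k f z = (LINT w|\<mu>. f w * k z w)"

text \<open>The integrability condition, for each single \<open>z\<close>, makes sums and multiples of kernels correspond to sums
  and multiples of operators at every point.\<close>

definition good_kernel :: "(complex \<Rightarrow> complex \<Rightarrow> complex) \<Rightarrow> bool" where
  "good_kernel k \<longleftrightarrow> (\<lambda>(z, w). k z w) \<in> borel_measurable (\<mu> \<Otimes>\<^sub>M \<mu>) \<and>
     (\<forall>f\<in>L2 \<mu>. \<forall>z\<in>ball 0 1. integrable \<mu> (\<lambda>w. f w * k z w)) \<and> rate_one \<mu> (kernel_op k)"

lemma kernel_op_measurable: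
  assumes k: "(\<lambda>(z, w). k z w) \<in> borel_measurable (\<mu> \<Otimes>\<^sub>M \<mu>)" and f: "f \<in> borel_measurable \<mu>"
  shows "kernel_op k f \<in> borel_measurable \<mu>"
proof -
  have "(\<lambda>(z, w). f w * k z w) \<in> borel_measurable (\<mu> \<Otimes>\<^sub>M \<mu>)"
    using borel_measurable_times[OF measurable_compose[OF measurable_snd f] k] by (simp add: case_prod_beta')
  then show ?thesis unfolding kernel_op_def by (rule borel_measurable_lebesgue_integral)
qed

lemma good_kernelD:
  assumes "good_kernel k"
  shows "(\<lambda>(z, w). k z w) \<in> borel_measurable (\<mu> \<Otimes>\<^sub>M \<mu>)"
    "f \<in> L2 \<mu> \<Longrightarrow> z \<in> ball 0 1 \<Longrightarrow> integrable \<mu> (\<lambda>w. f w * k z w)"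
    "rate_one \<mu> (kernel_op k)"
    "f \<in> L2 \<mu> \<Longrightarrow> kernel_op k f \<in> L2 \<mu>"
  using assms unfolding good_kernel_def rate_one_def by auto

lemma good_kernelI:
  assumes k: "(\<lambda>(z, w). k z w) \<in> borel_measurable (\<mu> \<Otimes>\<^sub>M \<mu>)"
    and i: "\<And>f z. f \<in> L2 \<mu> \<Longrightarrow> z \<in> ball 0 1 \<Longrightarrow> integrable \<mu> (\<lambda>w. f w * k z w)"
    and T: "rate_one \<mu> T" "\<And>f z. f \<in> L2 \<mu> \<Longrightarrow> z \<in> ball 0 1 \<Longrightarrow> T f z = kernel_op k f z"
  shows "good_kernel k"
  unfolding good_kernel_def
proof (intro conjI ballI k i)
  show "rate_one \<mu> (kernel_op k)"
    by (rule rate_one_cong_AE[OF T(1)]) (auto intro!: kernel_op_measurable[OF k] AE_I2 T(2) dest: L2D)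
qed

lemma good_kernel_add:
  assumes "good_kernel k" "good_kernel l" shows "good_kernel (\<lambda>z w. k z w + l z w)"
proof (rule good_kernelI)
  show "(\<lambda>(z, w). k z w + l z w) \<in> borel_measurable (\<mu> \<Otimes>\<^sub>M \<mu>)"
    using borel_measurable_add[OF good_kernelD(1)[OF assms(1)] good_kernelD(1)[OF assms(2)]] by (simp add: case_prod_beta')
  show "rate_one \<mu> (\<lambda>f z. kernel_op k f z + kernel_op l f z)"
    by (intro rate_one_add good_kernelD assms)
  fix f and z :: complex assume f: "f \<in> L2 \<mu>" "z \<in> ball 0 1"
  show "integrable \<mu> (\<lambda>w. f w * (k z w + l z w))"
    unfolding distrib_left by (intro Bochner_Integration.integrable_add good_kernelD(2) assms f)
  show "kernel_op k f z + kernel_op l f z = kernel_op (\<lambda>z w. k z w + l z w) f z"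
    unfolding kernel_op_def distrib_left
    by (rule Bochner_Integration.integral_add[symmetric]) (intro good_kernelD(2) assms f)+
qed

lemma good_kernel_cmult:
  assumes "good_kernel k" shows "good_kernel (\<lambda>z w. c * k z w)"
proof (rule good_kernelI)
  show "(\<lambda>(z, w). c * k z w) \<in> borel_measurable (\<mu> \<Otimes>\<^sub>M \<mu>)"
    using borel_measurable_times[OF borel_measurable_const good_kernelD(1)[OF assms], of c] by (simp add: case_prod_beta')
  show "rate_one \<mu> (\<lambda>f z. c * kernel_op k f z)" by (intro rate_one_cmult good_kernelD assms)
  fix f and z :: complex assume f: "f \<in> L2 \<mu>" "z \<in> ball 0 1"
  show "integrable \<mu> (\<lambda>w. f w * (c * k z w))"
    using integrable_mult_right[OF good_kernelD(2)[OF assms f], of c] by (simp add: mult.left_commute)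
  show "c * kernel_op k f z = kernel_op (\<lambda>z w. c * k z w) f z"
    unfolding kernel_op_def integral_mult_right_zero[symmetric] by (simp add: mult.left_commute)
qed

lemma good_kernel_cnj:
  assumes "good_kernel k" shows "good_kernel (\<lambda>z w. cnj (k z w))"
proof (rule good_kernelI)
  show "(\<lambda>(z, w). cnj (k z w)) \<in> borel_measurable (\<mu> \<Otimes>\<^sub>M \<mu>)"
    using borel_measurable_cnj[OF good_kernelD(1)[OF assms]] by (simp add: case_prod_beta')
  show "rate_one \<mu> (\<lambda>f z. cnj (kernel_op k (\<lambda>w. cnj (f w)) z))" by (intro rate_one_cnj good_kernelD assms)
  fix f and z :: complex assume f: "f \<in> L2 \<mu>" "z \<in> ball 0 1"
  from integrable_cnj[OF good_kernelD(2)[OF assms L2_cnj(1)[OF f(1)] f(2)]]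
  show "integrable \<mu> (\<lambda>w. f w * cnj (k z w))" by simp
  show "cnj (kernel_op k (\<lambda>w. cnj (f w)) z) = kernel_op (\<lambda>z w. cnj (k z w)) f z"
    unfolding kernel_op_def Bochner_Integration.integral_cnj[symmetric] by simp
qed

lemma good_kernel_cong:
  assumes "good_kernel k" and eq: "\<And>z w. z \<in> ball 0 1 \<Longrightarrow> w \<in> ball 0 1 \<Longrightarrow> k z w = l z w"
  shows "good_kernel l"
proof (rule good_kernelI)
  show "(\<lambda>(z, w). l z w) \<in> borel_measurable (\<mu> \<Otimes>\<^sub>M \<mu>)"
    using good_kernelD(1)[OF assms(1)] by (rule measurable_cong[THEN iffD1, rotated]) (auto simp: space_pair_measure eq)
  show "rate_one \<mu> (kernel_op k)" by (rule good_kernelD[OF assms(1)])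
  fix f and z :: complex assume f: "f \<in> L2 \<mu>" "z \<in> ball 0 1"
  have "f w * k z w = f w * l z w" if "w \<in> space \<mu>" for w using eq[OF f(2)] that by simp
  note c = Bochner_Integration.integral_cong[of \<mu> \<mu> "\<lambda>w. f w * k z w" "\<lambda>w. f w * l z w", OF refl this]
    Bochner_Integration.integrable_cong[of \<mu> \<mu> "\<lambda>w. f w * k z w" "\<lambda>w. f w * l z w", OF refl this]
  show "integrable \<mu> (\<lambda>w. f w * l z w)" using good_kernelD(2)[OF assms(1) f] c(2) by simp
  show "kernel_op k f z = kernel_op l f z" unfolding kernel_op_def by (rule c(1))
qed

lemma integral_sums_dominated:
  assumes F: "\<And>n. integrable \<mu> (F n)" and le: "\<And>n w. w \<in> ball 0 1 \<Longrightarrow> cmod (F n w) \<le> m n * h w"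
    and m: "summable m" and h: "integrable \<mu> h" and m0: "\<And>n. 0 \<le> m n" and h0: "\<And>w. 0 \<le> h w"
    and G: "\<And>w. w \<in> ball 0 1 \<Longrightarrow> (\<lambda>n. F n w) sums G w"
  shows "integrable \<mu> G" "(\<lambda>n. LINT w|\<mu>. F n w) sums (LINT w|\<mu>. G w)"
proof -
  have s: "summable (\<lambda>n. norm (F n w))" if "w \<in> ball 0 1" for w
    by (rule summable_comparison_test'[OF summable_mult2[OF m, of "h w"]]) (use le[OF that] in auto)
  then have ae: "AE w in \<mu>. summable (\<lambda>n. norm (F n w))" by (intro AE_I2) simp
  have "summable (\<lambda>n. LINT w|\<mu>. norm (F n w))"
  proof (rule summable_comparison_test'[OF summable_mult2[OF m, of "LINT w|\<mu>. h w"]])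
    fix n
    have "(LINT w|\<mu>. norm (F n w)) \<le> (LINT w|\<mu>. m n * h w)"
      using F h le by (intro integral_mono) auto
    then show "norm (LINT w|\<mu>. norm (F n w)) \<le> m n * (LINT w|\<mu>. h w)" by simp
  qed
  note * = integrable_suminf[OF F ae this] sums_integral[OF F ae this]
  have eq: "(\<Sum>n. F n w) = G w" if "w \<in> space \<mu>" for w using sums_unique[OF G] that by simp
  show "integrable \<mu> G" 
    using *(1) Bochner_Integration.integrable_cong[of \<mu> \<mu> "\<lambda>w. \<Sum>n. F n w" G, OF refl eq] by simp
  show "(\<lambda>n. LINT w|\<mu>. F n w) sums (LINT w|\<mu>. G w)" 
    using *(2) Bochner_Integration.integral_cong[of \<mu> \<mu> "\<lambda>w. \<Sum>n. F n w" G, OF refl eq] by simp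
qed

lemma one_L2: "(\<lambda>_. 1) \<in> L2 \<mu>"
  by (simp add: L2_def)

lemma integrable_L2: "f \<in> L2 \<mu> \<Longrightarrow> integrable \<mu> f"
  using integrable_mult_L2(1)[OF _ one_L2, of f] by simp

text \<open>Integration of the kernel \<open>\<Sum>n. a n cnj (b n w)\<close> term by term. The majorant \<open>m n h w\<close> separates the
  summation from the integration.\<close>

lemma diagonal_sums:
  assumes b: "\<And>n. b n \<in> L2 \<mu>"
    and le: "\<And>n w. w \<in> ball 0 1 \<Longrightarrow> cmod (a n * cnj (b n w)) \<le> m n * h w"
    and m: "summable m" "\<And>n. 0 \<le> m n" and h: "(\<lambda>w. complex_of_real (h w)) \<in> L2 \<mu>" "\<And>w. 0 \<le> h w"
    and k: "\<And>w. w \<in> ball 0 1 \<Longrightarrow> (\<lambda>n. a n * cnj (b n w)) sums k w"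
    and f: "f \<in> L2 \<mu>"
  shows "integrable \<mu> (\<lambda>w. f w * k w)" "(\<lambda>n. L2_inner \<mu> f (b n) * a n) sums (LINT w|\<mu>. f w * k w)"
proof -
  have "integrable \<mu> (\<lambda>w. norm (f w * of_real (h w)))"
    by (intro integrable_norm integrable_mult_L2(1) f h)
  then have ih: "integrable \<mu> (\<lambda>w. cmod (f w) * h w)" using h(2) by (simp add: norm_mult)
  have eq: "f w * (a n * cnj (b n w)) = a n * (f w * cnj (b n w))" for n w by simp
  have i: "integrable \<mu> (\<lambda>w. f w * (a n * cnj (b n w)))" for n
    unfolding eq by (intro integrable_mult_right integrable_mult_L2(2) f b)
  have le': "cmod (f w * (a n * cnj (b n w))) \<le> m n * (cmod (f w) * h w)" if "w \<in> ball 0 1" for n w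
    using mult_left_mono[OF le[OF that, of n], of "cmod (f w)"] by (simp add: norm_mult mult_ac)
  have s: "(\<lambda>n. f w * (a n * cnj (b n w))) sums (f w * k w)" if "w \<in> ball 0 1" for w
    by (rule sums_mult[OF k[OF that]])
  note * = integral_sums_dominated[OF i le' m(1) ih m(2) _ s]
  show "integrable \<mu> (\<lambda>w. f w * k w)" by (rule *(1)) (use h(2) in auto)
  have "(\<lambda>n. LINT w|\<mu>. f w * (a n * cnj (b n w))) sums (LINT w|\<mu>. f w * k w)" by (rule *(2)) (use h(2) in auto)
  then show "(\<lambda>n. L2_inner \<mu> f (b n) * a n) sums (LINT w|\<mu>. f w * k w)"
    unfolding eq L2_inner_def by (simp add: mult.commute)
qed

lemma diagonal_measurable:
  assumes a: "\<And>n. a n \<in> borel_measurable \<mu>" and b: "\<And>n. b n \<in> borel_measurable \<mu>"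
    and k: "\<And>z w. z \<in> ball 0 1 \<Longrightarrow> w \<in> ball 0 1 \<Longrightarrow> (\<lambda>n. a n z * cnj (b n w)) sums k z w"
  shows "(\<lambda>(z, w). k z w) \<in> borel_measurable (\<mu> \<Otimes>\<^sub>M \<mu>)"
proof (rule borel_measurable_LIMSEQ_metric[where f = "\<lambda>N p. \<Sum>n<N. a n (fst p) * cnj (b n (snd p))"])
  show "(\<lambda>p. \<Sum>n<N. a n (fst p) * cnj (b n (snd p))) \<in> borel_measurable (\<mu> \<Otimes>\<^sub>M \<mu>)" for N
    by (intro borel_measurable_sum borel_measurable_times borel_measurable_cnj
        measurable_compose[OF measurable_fst a] measurable_compose[OF measurable_snd b])
  show "(\<lambda>N. \<Sum>n<N. a n (fst p) * cnj (b n (snd p))) \<longlonglongrightarrow> (case p of (z, w) \<Rightarrow> k z w)"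
    if "p \<in> space (\<mu> \<Otimes>\<^sub>M \<mu>)" for p
    using k[of "fst p" "snd p"] that by (auto simp: space_pair_measure sums_def)
qed

lemma diagonal_bound:
  assumes a: "\<And>n. a n \<in> L2 \<mu>" "\<And>m n. m \<noteq> n \<Longrightarrow> L2_inner \<mu> (a m) (a n) = 0"
    and b: "\<And>n. b n \<in> L2 \<mu>" "\<And>m n. m \<noteq> n \<Longrightarrow> L2_inner \<mu> (b m) (b n) = 0"
    and f: "f \<in> L2 \<mu>" and \<sigma>: "0 \<le> \<sigma>" and g: "g \<in> borel_measurable \<mu>"
    and ab: "\<And>n. L2_inner \<mu> f (b n) = 0 \<or> L2_norm \<mu> (a n) * L2_norm \<mu> (b n) \<le> \<sigma>"
    and sums: "\<And>z. z \<in> ball 0 1 \<Longrightarrow> (\<lambda>n. L2_inner \<mu> f (b n) * a n z) sums g z"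
  shows "g \<in> L2 \<mu>" "L2_norm \<mu> g \<le> \<sigma> * L2_norm \<mu> f"
proof -
  interpret semi_inner "\<lambda>c f x. c * f x" "L2 \<mu>" "L2_inner \<mu>"
    rewrites "semi_inner.nrm (L2_inner \<mu>) = L2_norm \<mu>"
    by (rule semi_inner_L2) (rule L2_norm_eq_nrm)
  define F where "F N = (\<Sum>n<N. (\<lambda>z. L2_inner \<mu> f (b n) * a n z))" for N
  have F: "F N \<in> L2 \<mu>" "L2_norm \<mu> (F N) \<le> \<sigma> * L2_norm \<mu> f" for N
    unfolding F_def using sum_in[OF scale_in[OF a(1)]]
    by (auto intro!: orthogonal_operator_bound a b f \<sigma> ab)
  have "AE z in \<mu>. (\<lambda>N. F N z) \<longlonglongrightarrow> g z"
    using sums by (intro AE_I2) (simp add: F_def sum_fun_apply sums_def)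
  from L2_Fatou[OF F this g] show "g \<in> L2 \<mu>" "L2_norm \<mu> g \<le> \<sigma> * L2_norm \<mu> f" .
qed

text \<open>With orthogonal \<open>a n\<close> and orthogonal \<open>b n\<close>, the numbers \<open>\<parallel>a n\<parallel> \<parallel>b n\<parallel>\<close> are the singular values
  of the operator with kernel \<open>\<Sum>n. a n z cnj (b n w)\<close>; off \<open>b 0, \<dots>, b (N - 1)\<close> only the later ones count.\<close>

lemma good_kernel_diagonal:
  assumes a: "\<And>n. a n \<in> L2 \<mu>" "\<And>m n. m \<noteq> n \<Longrightarrow> L2_inner \<mu> (a m) (a n) = 0"
    and b: "\<And>n. b n \<in> L2 \<mu>" "\<And>m n. m \<noteq> n \<Longrightarrow> L2_inner \<mu> (b m) (b n) = 0"
    and C: "0 \<le> C" "\<And>n. L2_norm \<mu> (a n) * L2_norm \<mu> (b n) \<le> C / (real n + 1)"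
    and k: "\<And>z w. z \<in> ball 0 1 \<Longrightarrow> w \<in> ball 0 1 \<Longrightarrow> (\<lambda>n. a n z * cnj (b n w)) sums k z w"
    and le: "\<And>n z w. z \<in> ball 0 1 \<Longrightarrow> w \<in> ball 0 1 \<Longrightarrow> cmod (a n z * cnj (b n w)) \<le> m z n * h w"
    and m: "\<And>z. z \<in> ball 0 1 \<Longrightarrow> summable (m z)" "\<And>z n. 0 \<le> m z n"
    and h: "(\<lambda>w. complex_of_real (h w)) \<in> L2 \<mu>" "\<And>w. 0 \<le> h w"
  shows "good_kernel k"
proof -
  have meas: "(\<lambda>(z, w). k z w) \<in> borel_measurable (\<mu> \<Otimes>\<^sub>M \<mu>)"
    by (rule diagonal_measurable[where a = a and b = b]) (auto intro: L2D(1) a(1) b(1) k)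
  have sums: "integrable \<mu> (\<lambda>w. f w * k z w)" "(\<lambda>n. L2_inner \<mu> f (b n) * a n z) sums kernel_op k f z"
    if "f \<in> L2 \<mu>" "z \<in> ball 0 1" for f z
    unfolding kernel_op_def
    using diagonal_sums[of b "\<lambda>n. a n z" "m z" h "k z" f] b(1) le[OF that(2)] m(1)[OF that(2)] m(2) h k[OF that(2)] that(1)
    by blast+
  have bound: "kernel_op k f \<in> L2 \<mu>" "L2_norm \<mu> (kernel_op k f) \<le> C / (real N + 1) * L2_norm \<mu> f"
    if f: "f \<in> L2 \<mu>" and off: "\<And>n. n < N \<Longrightarrow> L2_inner \<mu> f (b n) = 0" for f N
  proof -
    have "L2_inner \<mu> f (b n) = 0 \<or> L2_norm \<mu> (a n) * L2_norm \<mu> (b n) \<le> C / (real N + 1)" for n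
    proof (cases "n < N")
      case False
      then have "C / (real n + 1) \<le> C / (real N + 1)" using C(1) by (intro divide_left_mono) auto
      then show ?thesis using C(2)[of n] by linarith
    qed (simp add: off)
    note * = diagonal_bound[OF a b f _ kernel_op_measurable[OF meas L2D(1)[OF f]] this sums(2)[OF f]]
    show "kernel_op k f \<in> L2 \<mu>" "L2_norm \<mu> (kernel_op k f) \<le> C / (real N + 1) * L2_norm \<mu> f"
      by (rule *; use C(1) in simp)+
  qed
  have "rate_one \<mu> (kernel_op k)"
  proof (rule rate_oneI[where C = C and B = "\<lambda>N. b ` {..<N}" and K = 1])
    show "card (b ` {..<N}) \<le> 1 * N" for N using card_image_le[of "{..<N}" b] by simp
  qed (use C(1) bound(1)[of _ 0] bound(2) b(1) in auto)
  then show ?thesis unfolding good_kernel_def using meas sums(1) by blast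
qed

section \<open>The symbols z and ln |z|\<close>

definition radial_monomial :: "(real \<Rightarrow> real) \<Rightarrow> nat \<Rightarrow> complex \<Rightarrow> complex" where
  "radial_monomial \<psi> n w = of_real (\<psi> (cmod w)) * w ^ n"

lemma radial_monomial_measurable:
  "\<psi> \<in> borel_measurable borel \<Longrightarrow> radial_monomial \<psi> n \<in> borel_measurable \<mu>"
proof -
  assume [measurable]: "\<psi> \<in> borel_measurable borel"
  show ?thesis unfolding radial_monomial_def by (rule borel_measurable_\<mu>) measurable
qed

lemma radial_monomial_L2:
  assumes "\<psi> \<in> borel_measurable borel" and "integrable \<mu> (\<lambda>w. (\<psi> (cmod w))\<^sup>2 * cmod w ^ (2 * n))"
  shows "radial_monomial \<psi> n \<in> L2 \<mu>"
    and "L2_norm \<mu> (radial_monomial \<psi> n) = sqrt (LINT w|\<mu>. (\<psi> (cmod w))\<^sup>2 * cmod w ^ (2 * n))"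
proof -
  have eq: "(cmod (radial_monomial \<psi> n w))\<^sup>2 = (\<psi> (cmod w))\<^sup>2 * cmod w ^ (2 * n)" for w
    by (simp add: radial_monomial_def norm_mult norm_power power_mult_distrib power_mult[symmetric] mult.commute)
  show "radial_monomial \<psi> n \<in> L2 \<mu>"
    using assms(2) radial_monomial_measurable[OF assms(1)] by (simp add: L2_def eq)
  show "L2_norm \<mu> (radial_monomial \<psi> n) = sqrt (LINT w|\<mu>. (\<psi> (cmod w))\<^sup>2 * cmod w ^ (2 * n))"
    by (simp add: L2_norm_def eq)
qed

lemma radial_monomial_orthogonal:
  assumes "\<psi> \<in> borel_measurable borel" "\<eta> \<in> borel_measurable borel" "j \<noteq> k"
  shows "L2_inner \<mu> (radial_monomial \<psi> j) (radial_monomial \<eta> k) = 0"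
proof -
  have "(\<lambda>r. \<psi> r * \<eta> r) \<in> borel_measurable borel" using assms by measurable
  from integral_monomials_zero[OF this assms(3)] show ?thesis
    by (simp add: L2_inner_def radial_monomial_def mult_ac)
qed

text \<open>Radial multiples of distinct powers are orthogonal whatever the radial factors are. The numbers \<open>i\<close> and
  \<open>j\<close> allow for different degrees in \<open>z\<close> and \<open>w\<close>.\<close>

lemma good_kernel_radial:
  fixes \<psi> \<eta> :: "nat \<Rightarrow> real \<Rightarrow> real" and i j :: nat
  assumes meas: "\<And>n. \<psi> n \<in> borel_measurable borel" "\<And>n. \<eta> n \<in> borel_measurable borel"
    and L2: "\<And>n. integrable \<mu> (\<lambda>w. (\<psi> n (cmod w))\<^sup>2 * cmod w ^ (2 * (n + i)))"
      "\<And>n. integrable \<mu> (\<lambda>w. (\<eta> n (cmod w))\<^sup>2 * cmod w ^ (2 * (n + j)))"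
    and C: "0 \<le> C" "\<And>n. (LINT w|\<mu>. (\<psi> n (cmod w))\<^sup>2 * cmod w ^ (2 * (n + i)))
        * (LINT w|\<mu>. (\<eta> n (cmod w))\<^sup>2 * cmod w ^ (2 * (n + j))) \<le> C / (real n + 1)\<^sup>2"
    and k: "\<And>z w. z \<in> ball 0 1 \<Longrightarrow> w \<in> ball 0 1 \<Longrightarrow>
        (\<lambda>n. of_real (\<psi> n (cmod z)) * z ^ (n + i) * (of_real (\<eta> n (cmod w)) * cnj w ^ (n + j))) sums k z w"
    and le: "\<And>n z w. z \<in> ball 0 1 \<Longrightarrow> w \<in> ball 0 1 \<Longrightarrow> \<bar>\<psi> n (cmod z)\<bar> * cmod z ^ (n + i) * \<bar>\<eta> n (cmod w)\<bar> \<le> m z n * h w"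
    and m: "\<And>z. z \<in> ball 0 1 \<Longrightarrow> summable (m z)" "\<And>z n. 0 \<le> m z n"
    and h: "(\<lambda>w. complex_of_real (h w)) \<in> L2 \<mu>" "\<And>w. 0 \<le> h w"
  shows "good_kernel k"
proof (rule good_kernel_diagonal[where a = "\<lambda>n. radial_monomial (\<psi> n) (n + i)"
      and b = "\<lambda>n. radial_monomial (\<eta> n) (n + j)" and C = "sqrt C" and m = m and h = h])
  fix n
  let ?A = "LINT w|\<mu>. (\<psi> n (cmod w))\<^sup>2 * cmod w ^ (2 * (n + i))"
  let ?B = "LINT w|\<mu>. (\<eta> n (cmod w))\<^sup>2 * cmod w ^ (2 * (n + j))"
  have "sqrt ?A * sqrt ?B = sqrt (?A * ?B)" by (simp add: real_sqrt_mult)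
  also have "\<dots> \<le> sqrt (C / (real n + 1)\<^sup>2)" using C(2) by (rule real_sqrt_le_mono)
  also have "\<dots> = sqrt C / (real n + 1)" by (simp add: real_sqrt_divide)
  finally show "L2_norm \<mu> (radial_monomial (\<psi> n) (n + i)) * L2_norm \<mu> (radial_monomial (\<eta> n) (n + j)) \<le> sqrt C / (real n + 1)"
    using radial_monomial_L2(2)[OF meas(1) L2(1)] radial_monomial_L2(2)[OF meas(2) L2(2)] by simp
next
  fix n z w assume zw: "z \<in> ball (0::complex) 1" "w \<in> ball (0::complex) 1"
  have "cmod w ^ (n + j) \<le> 1" using zw by (intro power_le_one) auto
  then have "\<bar>\<psi> n (cmod z)\<bar> * cmod z ^ (n + i) * (\<bar>\<eta> n (cmod w)\<bar> * cmod w ^ (n + j))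
      \<le> \<bar>\<psi> n (cmod z)\<bar> * cmod z ^ (n + i) * (\<bar>\<eta> n (cmod w)\<bar> * 1)"
    by (intro mult_left_mono) auto
  also have "\<dots> \<le> m z n * h w" using le[OF zw] by simp
  finally show "cmod (radial_monomial (\<psi> n) (n + i) z * cnj (radial_monomial (\<eta> n) (n + j) w)) \<le> m z n * h w"
    by (simp add: radial_monomial_def norm_mult norm_power)
qed (use assms in \<open>auto intro!: radial_monomial_L2 radial_monomial_orthogonal simp: radial_monomial_def\<close>)

lemma good_kernel_rank_one:
  assumes g: "g \<in> L2 \<mu>" and h: "h \<in> L2 \<mu>"
  shows "good_kernel (\<lambda>z w. g z * cnj (h w))"
proof (rule good_kernel_diagonal[where a = "\<lambda>n. if n = 0 then g else (\<lambda>_. 0)" and b = "\<lambda>n. if n = 0 then h else (\<lambda>_. 0)"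
      and C = "L2_norm \<mu> g * L2_norm \<mu> h" and m = "\<lambda>z n. if n = 0 then cmod (g z) else 0" and h = "\<lambda>w. cmod (h w)"])
  fix z w
  show "(\<lambda>n. (if n = 0 then g else (\<lambda>_. 0)) z * cnj ((if n = 0 then h else (\<lambda>_. 0)) w)) sums (g z * cnj (h w))"
    using sums_single[of 0 "\<lambda>_. g z * cnj (h w)"] by (rule sums_cong[THEN iffD1, rotated]) auto
  show "summable (\<lambda>n. if n = 0 then cmod (g z) else 0)" for z
    using sums_single[of 0 "\<lambda>_. cmod (g z)"] by (simp add: sums_iff)
  show "(\<lambda>w. complex_of_real (cmod (h w))) \<in> L2 \<mu>" using h by (auto simp: L2_def)
  show "0 \<le> L2_norm \<mu> g * L2_norm \<mu> h" by (simp add: L2_norm_nonneg)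
  show "L2_norm \<mu> (if n = 0 then g else (\<lambda>_. 0)) * L2_norm \<mu> (if n = 0 then h else (\<lambda>_. 0)) \<le> L2_norm \<mu> g * L2_norm \<mu> h / (real n + 1)" for n
    by (auto simp: L2_norm_nonneg L2_norm_def)
qed (use g h L2_zero in \<open>auto simp: L2_inner_def norm_mult\<close>)

text \<open>The reproducing kernel of the holomorphic functions; the harmonic kernel is \<open>2 Re bergman - 1\<close>.\<close>
definition bergman :: "complex \<Rightarrow> complex \<Rightarrow> complex" where
  "bergman z w = 1 / (1 - z * cnj w) powr of_real (\<alpha> + 2)"

lemma norm_prod_less_1: "z \<in> ball 0 1 \<Longrightarrow> w \<in> ball 0 1 \<Longrightarrow> cmod (z * cnj w) < 1"
  using mult_strict_mono[of "cmod z" 1 "cmod w" 1] by (simp add: norm_mult)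

lemma bergman_sums: "z \<in> ball 0 1 \<Longrightarrow> w \<in> ball 0 1 \<Longrightarrow> (\<lambda>n. of_real (\<gamma> n) * (z * cnj w) ^ n) sums bergman z w"
  unfolding bergman_def by (intro \<gamma>_sums norm_prod_less_1)

lemma bergman_sums_Suc: "z \<in> ball 0 1 \<Longrightarrow> w \<in> ball 0 1 \<Longrightarrow> (\<lambda>n. of_real (\<gamma> (Suc n)) * (z * cnj w) ^ Suc n) sums (bergman z w - 1)"
  using bergman_sums[of z w] by (subst sums_Suc_iff) simp

lemma cnj_bergman: "z \<in> ball 0 1 \<Longrightarrow> w \<in> ball 0 1 \<Longrightarrow> cnj (bergman z w) = bergman w z"
proof -
  assume zw: "z \<in> ball 0 1" "w \<in> ball 0 1"
  have "Re (z * cnj w) < 1" using norm_prod_less_1[OF zw] complex_Re_le_cmod[of "z * cnj w"] by linarith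
  then show ?thesis unfolding bergman_def by (simp add: cnj_powr mult.commute)
qed

lemma harmonic_kernel_eq:
  "z \<in> ball 0 1 \<Longrightarrow> w \<in> ball 0 1 \<Longrightarrow> harmonic_kernel \<alpha> z w = bergman z w + cnj (bergman z w) - 1"
  by (simp add: harmonic_kernel_def bergman_def[symmetric] cnj_bergman) (simp add: bergman_def)

text \<open>The commutator with \<open>z\<close> has the expansion
  \<open>(z - w) K(z, w) = \<Sum>n. z\<^sup>n\<^sup>+\<^sup>1 cnj (G n w) - cnj (G n z) w\<^sup>n\<^sup>+\<^sup>1\<close> with
  \<open>G n w = (\<gamma> n - \<gamma> (n + 1) \<bar>w\<bar>\<^sup>2) w\<^sup>n\<close>. It results from \<open>bergman z w = \<Sum>n. \<gamma> n (z cnj w)\<^sup>n\<close> by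
  combining the terms of degree \<open>n + 1\<close> in \<open>z\<close> and those of degree \<open>n + 1\<close> in \<open>w\<close>. The integral below is
  \<open>\<parallel>G n\<parallel>\<^sup>2\<close>.\<close>

lemma z_commutator_factor_norm:
  "integrable \<mu> (\<lambda>w. (\<gamma> n - \<gamma> (Suc n) * (cmod w)\<^sup>2)\<^sup>2 * cmod w ^ (2 * n))"
  "(LINT w|\<mu>. (\<gamma> n - \<gamma> (Suc n) * (cmod w)\<^sup>2)\<^sup>2 * cmod w ^ (2 * n)) = (\<gamma> (Suc n))\<^sup>2 / \<gamma> (Suc (Suc n)) - \<gamma> n"
proof -
  have eq: "(\<gamma> n - \<gamma> (Suc n) * (cmod w)\<^sup>2)\<^sup>2 * cmod w ^ (2 * n)
     = (\<gamma> n)\<^sup>2 * cmod w ^ (2 * n) + ((\<gamma> (Suc n))\<^sup>2 * cmod w ^ (2 * Suc (Suc n)) - 2 * \<gamma> n * \<gamma> (Suc n) * cmod w ^ (2 * Suc n))" for w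
    by (simp add: power2_eq_square algebra_simps power_add)
  show "integrable \<mu> (\<lambda>w. (\<gamma> n - \<gamma> (Suc n) * (cmod w)\<^sup>2)\<^sup>2 * cmod w ^ (2 * n))"
    unfolding eq by (intro Bochner_Integration.integrable_add Bochner_Integration.integrable_diff integrable_mult_right moment)
  have "(LINT w|\<mu>. (\<gamma> n - \<gamma> (Suc n) * (cmod w)\<^sup>2)\<^sup>2 * cmod w ^ (2 * n))
      = (\<gamma> n)\<^sup>2 * (1 / \<gamma> n) + ((\<gamma> (Suc n))\<^sup>2 * (1 / \<gamma> (Suc (Suc n))) - 2 * \<gamma> n * \<gamma> (Suc n) * (1 / \<gamma> (Suc n)))"
    unfolding eq moment(2)[symmetric]
    by (subst Bochner_Integration.integral_add Bochner_Integration.integral_diff,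
        intro integrable_mult_right moment Bochner_Integration.integrable_diff,
        intro integrable_mult_right moment Bochner_Integration.integrable_diff)+ (simp only: integral_mult_right_zero)
  also have "\<dots> = (\<gamma> (Suc n))\<^sup>2 / \<gamma> (Suc (Suc n)) - \<gamma> n"
    using \<gamma>_pos[of n] \<gamma>_pos[of "Suc n"] by (simp add: power2_eq_square)
  finally show "(LINT w|\<mu>. (\<gamma> n - \<gamma> (Suc n) * (cmod w)\<^sup>2)\<^sup>2 * cmod w ^ (2 * n)) = (\<gamma> (Suc n))\<^sup>2 / \<gamma> (Suc (Suc n)) - \<gamma> n" .
qed

lemma \<gamma>_ratio: "\<gamma> n / \<gamma> (Suc n) = (real n + 1) / (\<alpha> + 2 + real n)"
  using \<gamma>_Suc[of n] \<gamma>_pos[of "Suc n"] \<gamma>_pos[of n] \<alpha> by (simp add: frac_eq_eq mult_ac)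

text \<open>On the left is \<open>\<parallel>z\<^sup>n\<^sup>+\<^sup>1\<parallel>\<^sup>2 \<parallel>G n\<parallel>\<^sup>2\<close>. It equals \<open>(\<alpha> + 1) / ((\<alpha> + 2 + n) (\<alpha> + 3 + n))\<close>: the
  cancellation in \<open>G n\<close>, which nearly vanishes on the unit circle, gains two powers of \<open>n\<close>.\<close>

lemma z_commutator_singular_value:
  "1 / \<gamma> (Suc n) * ((\<gamma> (Suc n))\<^sup>2 / \<gamma> (Suc (Suc n)) - \<gamma> n) \<le> (\<alpha> + 1) / (real n + 1)\<^sup>2"
proof -
  define x where "x = real n"
  have x: "0 \<le> x" by (simp add: x_def)
  have "1 / \<gamma> (Suc n) * ((\<gamma> (Suc n))\<^sup>2 / \<gamma> (Suc (Suc n)) - \<gamma> n) = \<gamma> (Suc n) / \<gamma> (Suc (Suc n)) - \<gamma> n / \<gamma> (Suc n)"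
    using \<gamma>_pos[of "Suc n"] by (simp add: power2_eq_square right_diff_distrib)
  also have "\<dots> = (x + 2) / (\<alpha> + 3 + x) - (x + 1) / (\<alpha> + 2 + x)"
    unfolding \<gamma>_ratio x_def by (simp add: add_ac)
  also have "\<dots> = (\<alpha> + 1) / ((\<alpha> + 2 + x) * (\<alpha> + 3 + x))"
  proof -
    have "\<alpha> + 2 + x \<noteq> 0" "\<alpha> + 3 + x \<noteq> 0" using \<alpha> x by auto
    then show ?thesis by (simp add: field_simps)
  qed
  also have "\<dots> \<le> (\<alpha> + 1) / (x + 1)\<^sup>2"
    unfolding power2_eq_square using \<alpha> x by (intro divide_left_mono mult_mono mult_pos_pos) auto
  finally show ?thesis by (simp add: x_def)
qed

lemma good_kernel_z: "good_kernel (\<lambda>z w. (z - w) * harmonic_kernel \<alpha> z w)"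
proof -
  have meas: "(\<lambda>r. \<gamma> n - \<gamma> (Suc n) * r\<^sup>2) \<in> borel_measurable borel" for n by measurable
  have one: "(\<lambda>w. complex_of_real 1) \<in> L2 \<mu>" using one_L2 by simp
  have cns: "(complex_of_real (cmod w))\<^sup>2 = w * cnj w" for w using complex_norm_square[of w] by simp
  have Gle: "\<bar>\<gamma> n - \<gamma> (Suc n) * (cmod w)\<^sup>2\<bar> \<le> \<gamma> n + \<gamma> (Suc n)" if "w \<in> ball 0 1" for n and w :: complex
  proof -
    have "(cmod w)\<^sup>2 \<le> 1" using that by (simp add: power_le_one)
    then have "\<gamma> (Suc n) * (cmod w)\<^sup>2 \<le> \<gamma> (Suc n) * 1" using \<gamma>_pos[of "Suc n"] by (intro mult_left_mono) auto
    moreover have "0 \<le> \<gamma> (Suc n) * (cmod w)\<^sup>2" using \<gamma>_pos[of "Suc n"] by simp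
    ultimately show ?thesis using \<gamma>_pos[of n] by linarith
  qed
  define m where "m z n = (\<gamma> n + \<gamma> (Suc n)) * cmod z ^ n" for z :: complex and n
  have m: "summable (m z)" if "z \<in> ball 0 1" for z
    unfolding m_def distrib_right using that by (intro summable_add \<gamma>_summable) auto
  have m0: "0 \<le> m z n" for z n using \<gamma>_pos[of n] \<gamma>_pos[of "Suc n"] by (simp add: m_def)
  have 1: "good_kernel (\<lambda>z w. z * bergman z w - w * (bergman z w - 1))"
  proof (rule good_kernel_radial[where \<psi> = "\<lambda>_ _. 1" and \<eta> = "\<lambda>n r. \<gamma> n - \<gamma> (Suc n) * r\<^sup>2" and i = 1 and j = 0
        and C = "\<alpha> + 1" and m = m and h = "\<lambda>_. 1"])
    show "(\<lambda>n. of_real 1 * z ^ (n + 1) * (of_real (\<gamma> n - \<gamma> (Suc n) * (cmod w)\<^sup>2) * cnj w ^ (n + 0))) sums (z * bergman z w - w * (bergman z w - 1))"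
      if "z \<in> ball 0 1" "w \<in> ball 0 1" for z w
      using sums_diff[OF sums_mult[OF bergman_sums[OF that], of z] sums_mult[OF bergman_sums_Suc[OF that], of w]]
      by (rule sums_cong[THEN iffD1, rotated])
        (simp add: power_mult_distrib algebra_simps cns)
    show "\<bar>1\<bar> * cmod z ^ (n + 1) * \<bar>\<gamma> n - \<gamma> (Suc n) * (cmod w)\<^sup>2\<bar> \<le> m z n * 1"
      if zw: "z \<in> ball 0 1" "w \<in> ball 0 1" for n z and w :: complex
    proof -
      have "cmod z ^ (n + 1) * \<bar>\<gamma> n - \<gamma> (Suc n) * (cmod w)\<^sup>2\<bar> \<le> cmod z ^ n * (\<gamma> n + \<gamma> (Suc n))"
        using Gle[OF zw(2)] zw(1) by (intro mult_mono power_decreasing) auto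
      then show ?thesis by (simp add: m_def mult.commute)
    qed
    show "(LINT w|\<mu>. 1\<^sup>2 * cmod w ^ (2 * (n + 1))) * (LINT w|\<mu>. (\<gamma> n - \<gamma> (Suc n) * (cmod w)\<^sup>2)\<^sup>2 * cmod w ^ (2 * (n + 0))) \<le> (\<alpha> + 1) / (real n + 1)\<^sup>2" for n
      using z_commutator_singular_value[of n] moment(2)[of "Suc n"] z_commutator_factor_norm(2)[of n] by simp
    show "integrable \<mu> (\<lambda>w. 1\<^sup>2 * cmod w ^ (2 * (n + 1)))" for n using moment(1)[of "n + 1"] by simp
    show "integrable \<mu> (\<lambda>w. (\<gamma> n - \<gamma> (Suc n) * (cmod w)\<^sup>2)\<^sup>2 * cmod w ^ (2 * (n + 0)))" for n using z_commutator_factor_norm(1)[of n] by simp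
  qed (use \<alpha> m m0 one meas in auto)
  have 2: "good_kernel (\<lambda>z w. cnj w * bergman z w - cnj z * (bergman z w - 1))"
  proof (rule good_kernel_radial[where \<psi> = "\<lambda>n r. \<gamma> n - \<gamma> (Suc n) * r\<^sup>2" and \<eta> = "\<lambda>_ _. 1" and i = 0 and j = 1
        and C = "\<alpha> + 1" and m = m and h = "\<lambda>_. 1"])
    show "(\<lambda>n. of_real (\<gamma> n - \<gamma> (Suc n) * (cmod z)\<^sup>2) * z ^ (n + 0) * (of_real 1 * cnj w ^ (n + 1))) sums (cnj w * bergman z w - cnj z * (bergman z w - 1))"
      if "z \<in> ball 0 1" "w \<in> ball 0 1" for z w
      using sums_diff[OF sums_mult[OF bergman_sums[OF that], of "cnj w"] sums_mult[OF bergman_sums_Suc[OF that], of "cnj z"]]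
      by (rule sums_cong[THEN iffD1, rotated])
        (simp add: power_mult_distrib algebra_simps cns)
    show "\<bar>\<gamma> n - \<gamma> (Suc n) * (cmod z)\<^sup>2\<bar> * cmod z ^ (n + 0) * \<bar>1\<bar> \<le> m z n * 1"
      if zw: "z \<in> ball 0 1" for n z
      using mult_right_mono[OF Gle[OF zw], of "cmod z ^ n" n] by (simp add: m_def)
    show "(LINT w|\<mu>. (\<gamma> n - \<gamma> (Suc n) * (cmod w)\<^sup>2)\<^sup>2 * cmod w ^ (2 * (n + 0))) * (LINT w|\<mu>. 1\<^sup>2 * cmod w ^ (2 * (n + 1))) \<le> (\<alpha> + 1) / (real n + 1)\<^sup>2" for n
      using z_commutator_singular_value[of n] moment(2)[of "Suc n"] z_commutator_factor_norm(2)[of n] by (simp add: mult.commute)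
    show "integrable \<mu> (\<lambda>w. 1\<^sup>2 * cmod w ^ (2 * (n + 1)))" for n using moment(1)[of "n + 1"] by simp
    show "integrable \<mu> (\<lambda>w. (\<gamma> n - \<gamma> (Suc n) * (cmod w)\<^sup>2)\<^sup>2 * cmod w ^ (2 * (n + 0)))" for n using z_commutator_factor_norm(1)[of n] by simp
  qed (use \<alpha> m m0 one meas in auto)
  from good_kernel_add[OF 1 good_kernel_cmult[OF good_kernel_cnj[OF 2], of "- 1"]] show ?thesis
    by (rule good_kernel_cong) (simp add: harmonic_kernel_eq algebra_simps)
qed

definition \<Lambda> :: "nat \<Rightarrow> real" where "\<Lambda> n = (LINT w|\<mu>. (ln (cmod w))\<^sup>2 * cmod w ^ (2 * n))"

lemma ln_moment_integrable: "integrable \<mu> (\<lambda>w. (ln (cmod w))\<^sup>2 * cmod w ^ (2 * n))"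
proof -
  have i: "integrable \<mu> (\<lambda>w. 4 * (cmod w)\<^sup>2 powr (1/2 - 1))"
    using powr_moment(1)[of "1/2"] by (intro integrable_mult_right) simp
  show ?thesis
  proof (rule Bochner_Integration.integrable_bound[OF i])
    show "(\<lambda>w. (ln (cmod w))\<^sup>2 * cmod w ^ (2 * n)) \<in> borel_measurable \<mu>"
      by (rule borel_measurable_\<mu>) measurable
    show "AE w in \<mu>. norm ((ln (cmod w))\<^sup>2 * cmod w ^ (2 * n)) \<le> norm (4 * (cmod w)\<^sup>2 powr (1/2 - 1))"
      using AE_\<mu>_nonzero
    proof eventually_elim
      case (elim w)
      then have r: "0 < cmod w" "cmod w < 1" by auto
      have "ln (1 / sqrt (cmod w)) \<le> 1 / sqrt (cmod w) - 1" using r by (intro ln_le_minus_one) auto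
      moreover have "ln (1 / sqrt (cmod w)) = - (ln (cmod w) / 2)" using r by (simp add: ln_div ln_sqrt)
      ultimately have "- ln (cmod w) \<le> 2 * (1 / sqrt (cmod w))" by simp
      then have "(- ln (cmod w))\<^sup>2 \<le> (2 * (1 / sqrt (cmod w)))\<^sup>2" using r by (intro power_mono) auto
      then have 1: "(ln (cmod w))\<^sup>2 \<le> 4 / cmod w" using r by (simp add: power_divide power_mult_distrib)
      have "(ln (cmod w))\<^sup>2 * cmod w ^ (2 * n) \<le> (4 / cmod w) * 1"
        using r by (intro mult_mono 1 power_le_one) auto
      also have "\<dots> = 4 * (cmod w)\<^sup>2 powr (1/2 - 1)"
      proof -
        have "(cmod w)\<^sup>2 powr (1/2 - 1) = cmod w powr (- 1)"
          using r powr_powr[of "cmod w" 2 "- (1/2)"] by (simp add: powr_numeral)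
        then show ?thesis using r by (simp add: powr_minus_divide)
      qed
      finally show ?case by simp
    qed
  qed
qed

text \<open>From \<open>- ln r \<le> (1 - r) / r\<close> follows \<open>(ln r)\<^sup>2 r\<^sup>2 \<le> (1 - r\<^sup>2)\<^sup>2\<close>, which reduces the integral, for
  \<open>n > 0\<close>, to three ordinary moments, a second difference of \<open>1 / \<gamma>\<close>. For \<open>n = 0\<close> it suffices that the
  integral is finite.\<close>

lemma \<Lambda>_bound: "\<exists>C\<ge>0. \<forall>n. \<gamma> n * \<Lambda> n \<le> C / (real n + 1)\<^sup>2"
proof -
  have \<Lambda>0: "0 \<le> \<Lambda> 0" unfolding \<Lambda>_def by (rule Bochner_Integration.integral_nonneg) simp
  define C where "C = \<Lambda> 0 + 2 * (\<alpha> + 1) * (\<alpha> + 2)"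
  have pos: "0 \<le> 2 * (\<alpha> + 1) * (\<alpha> + 2)" using \<alpha> by simp
  have "\<gamma> n * \<Lambda> n \<le> C / (real n + 1)\<^sup>2" for n
  proof (cases n)
    case 0
    then show ?thesis using pos by (simp add: C_def)
  next
    case (Suc k)
    let ?F = "\<lambda>w. cmod w ^ (2 * k) + (cmod w ^ (2 * Suc (Suc k)) - 2 * cmod w ^ (2 * Suc k))"
    have i: "integrable \<mu> ?F"
      by (intro Bochner_Integration.integrable_add Bochner_Integration.integrable_diff integrable_mult_right moment)
    have "\<Lambda> n \<le> (LINT w|\<mu>. ?F w)" unfolding \<Lambda>_def
    proof (rule integral_mono_AE[OF ln_moment_integrable i])
      show "AE w in \<mu>. (ln (cmod w))\<^sup>2 * cmod w ^ (2 * n) \<le> ?F w"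
        using AE_\<mu>_nonzero
      proof eventually_elim
        case (elim w)
        define r where "r = cmod w"
        have r: "0 < r" "r < 1" using elim by (auto simp: r_def)
        have "ln (1 / r) \<le> 1 / r - 1" using r by (intro ln_le_minus_one) auto
        then have "- ln r \<le> (1 - r) / r" using r by (simp add: ln_div diff_divide_distrib)
        then have "- ln r * r \<le> 1 - r" using r by (simp add: pos_le_divide_eq)
        also have "\<dots> \<le> 1 - r\<^sup>2" using r by (simp add: power2_eq_square)
        finally have "(- ln r * r)\<^sup>2 \<le> (1 - r\<^sup>2)\<^sup>2" using r by (intro power_mono mult_nonneg_nonneg) auto
        then have "(ln r * r)\<^sup>2 * r ^ (2 * k) \<le> (1 - r\<^sup>2)\<^sup>2 * r ^ (2 * k)" using r by (intro mult_right_mono) auto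
        also have "\<dots> = r ^ (2 * k) + (r ^ (2 * Suc (Suc k)) - 2 * r ^ (2 * Suc k))"
          by (simp add: power2_eq_square algebra_simps power_add)
        also have "(ln r * r)\<^sup>2 * r ^ (2 * k) = (ln r)\<^sup>2 * r ^ (2 * n)"
          unfolding Suc by (simp add: power2_eq_square algebra_simps power_add)
        finally show ?case by (simp add: r_def)
      qed
    qed
    also have "(LINT w|\<mu>. ?F w) = 1 / \<gamma> k + (1 / \<gamma> (Suc (Suc k)) - 2 * (1 / \<gamma> (Suc k)))"
      unfolding moment(2)[symmetric]
      by (subst Bochner_Integration.integral_add Bochner_Integration.integral_diff,
          intro integrable_mult_right moment Bochner_Integration.integrable_diff,
          intro integrable_mult_right moment Bochner_Integration.integrable_diff)+ (simp only: integral_mult_right_zero)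
    finally have "\<gamma> n * \<Lambda> n \<le> \<gamma> n * (1 / \<gamma> k + (1 / \<gamma> (Suc (Suc k)) - 2 * (1 / \<gamma> (Suc k))))"
      using \<gamma>_pos[of n] by (intro mult_left_mono) auto
    also have "\<dots> = 1 / (\<gamma> k / \<gamma> (Suc k)) + \<gamma> (Suc k) / \<gamma> (Suc (Suc k)) - 2"
      unfolding Suc using \<gamma>_pos[of "Suc k"] by (simp add: algebra_simps)
    also have "\<dots> = (\<alpha> + 2 + real k) / (real k + 1) + (real k + 2) / (\<alpha> + 3 + real k) - 2"
      unfolding \<gamma>_ratio by (simp add: add_ac)
    also have "\<dots> = (\<alpha> + 1) * (\<alpha> + 2) / ((real k + 1) * (\<alpha> + 3 + real k))"
    proof -
      define x where "x = real k"
      have "x + 1 \<noteq> 0" "\<alpha> + 3 + x \<noteq> 0" using \<alpha> by (auto simp: x_def)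
      then have "(\<alpha> + 2 + x) / (x + 1) = 1 + (\<alpha> + 1) / (x + 1)"
        and "(x + 2) / (\<alpha> + 3 + x) = 1 - (\<alpha> + 1) / (\<alpha> + 3 + x)"
        and "(\<alpha> + 1) / (x + 1) - (\<alpha> + 1) / (\<alpha> + 3 + x) = (\<alpha> + 1) * (\<alpha> + 2) / ((x + 1) * (\<alpha> + 3 + x))"
        by (simp_all add: diff_frac_eq) (simp_all add: field_simps)
      then have "(\<alpha> + 2 + x) / (x + 1) + (x + 2) / (\<alpha> + 3 + x) - 2 = (\<alpha> + 1) * (\<alpha> + 2) / ((x + 1) * (\<alpha> + 3 + x))"
        by simp
      then show ?thesis by (simp add: x_def)
    qed
    also have "\<dots> \<le> (\<alpha> + 1) * (\<alpha> + 2) / ((real n + 1)\<^sup>2 / 2)"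
    proof (rule divide_left_mono)
      have "(real n + 1)\<^sup>2 / 2 \<le> (real k + 1) * (real k + 2)"
        unfolding Suc by (simp add: power2_eq_square algebra_simps)
      also have "\<dots> \<le> (real k + 1) * (\<alpha> + 3 + real k)" using \<alpha> by (intro mult_left_mono) auto
      finally show "(real n + 1)\<^sup>2 / 2 \<le> (real k + 1) * (\<alpha> + 3 + real k)" .
    qed (use \<alpha> in auto)
    also have "\<dots> = 2 * (\<alpha> + 1) * (\<alpha> + 2) / (real n + 1)\<^sup>2" by simp
    also have "\<dots> \<le> C / (real n + 1)\<^sup>2" unfolding C_def using \<Lambda>0 by (intro divide_right_mono) auto
    finally show ?thesis .
  qed
  moreover have "0 \<le> C" using \<Lambda>0 pos by (simp add: C_def)
  ultimately show ?thesis by blast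
qed

definition lnabs :: "complex \<Rightarrow> complex" where "lnabs z = of_real (ln (cmod z))"

lemma lnabs_L2: "lnabs \<in> L2 \<mu>"
proof -
  have "lnabs \<in> borel_measurable \<mu>" unfolding lnabs_def by (rule borel_measurable_\<mu>) measurable
  then show ?thesis using ln_moment_integrable[of 0] by (simp add: L2_def lnabs_def)
qed

text \<open>In contrast to the symbol \<open>z\<close>, no cancellation between \<open>ln \<bar>z\<bar>\<close> and \<open>ln \<bar>w\<bar>\<close> is needed.\<close>

lemma good_kernel_ln: "good_kernel (\<lambda>z w. (lnabs z - lnabs w) * harmonic_kernel \<alpha> z w)"
proof -
  from \<Lambda>_bound obtain C where "0 \<le> C \<and> (\<forall>n. \<gamma> n * \<Lambda> n \<le> C / (real n + 1)\<^sup>2)" ..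
  then have C: "0 \<le> C" "\<And>n. \<gamma> n * \<Lambda> n \<le> C / (real n + 1)\<^sup>2" by simp_all
  have ln_sq: "(\<gamma> n)\<^sup>2 * \<Lambda> n * (1 / \<gamma> n) \<le> C / (real n + 1)\<^sup>2" for n
    using C(2)[of n] \<gamma>_pos[of n] by (simp add: power2_eq_square)
  have one: "(\<lambda>w. complex_of_real 1) \<in> L2 \<mu>" using one_L2 by simp
  have lnL2: "(\<lambda>w. complex_of_real \<bar>ln (cmod w)\<bar>) \<in> L2 \<mu>"
  proof -
    have "(\<lambda>w. complex_of_real \<bar>ln (cmod w)\<bar>) \<in> borel_measurable \<mu>" by (rule borel_measurable_\<mu>) measurable
    then show ?thesis using lnabs_L2 by (simp add: L2_def lnabs_def)
  qed
  have int1: "integrable \<mu> (\<lambda>w. (\<gamma> n * ln (cmod w))\<^sup>2 * cmod w ^ (2 * (n + 0)))"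
    "(LINT w|\<mu>. (\<gamma> n * ln (cmod w))\<^sup>2 * cmod w ^ (2 * (n + 0))) = (\<gamma> n)\<^sup>2 * \<Lambda> n" for n
    using integrable_mult_right[OF ln_moment_integrable[of n], of "(\<gamma> n)\<^sup>2"]
    by (simp_all add: power_mult_distrib mult.assoc \<Lambda>_def)
  have int2: "integrable \<mu> (\<lambda>w. 1\<^sup>2 * cmod w ^ (2 * (n + 0)))" "(LINT w|\<mu>. 1\<^sup>2 * cmod w ^ (2 * (n + 0))) = 1 / \<gamma> n" for n
    using moment[of n] by simp_all
  have int3: "integrable \<mu> (\<lambda>w. (\<gamma> n)\<^sup>2 * cmod w ^ (2 * (n + 0)))" "(LINT w|\<mu>. (\<gamma> n)\<^sup>2 * cmod w ^ (2 * (n + 0))) = (\<gamma> n)\<^sup>2 * (1 / \<gamma> n)" for n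
    using moment[of n] by (simp_all add: integrable_mult_right)
  have int4: "integrable \<mu> (\<lambda>w. (ln (cmod w))\<^sup>2 * cmod w ^ (2 * (n + 0)))" "(LINT w|\<mu>. (ln (cmod w))\<^sup>2 * cmod w ^ (2 * (n + 0))) = \<Lambda> n" for n
    using ln_moment_integrable[of n] by (simp_all add: \<Lambda>_def)
  have summ: "summable (\<lambda>n. \<gamma> n * cmod z ^ n)" if "z \<in> ball 0 1" for z using that by (intro \<gamma>_summable) auto
  have 1: "good_kernel (\<lambda>z w. lnabs z * bergman z w)"
  proof (rule good_kernel_radial[where \<psi> = "\<lambda>n r. \<gamma> n * ln r" and \<eta> = "\<lambda>_ _. 1" and i = 0 and j = 0
        and C = C and m = "\<lambda>z n. \<bar>ln (cmod z)\<bar> * (\<gamma> n * cmod z ^ n)" and h = "\<lambda>_. 1"])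
    show "(\<lambda>n. of_real (\<gamma> n * ln (cmod z)) * z ^ (n + 0) * (of_real 1 * cnj w ^ (n + 0))) sums (lnabs z * bergman z w)"
      if "z \<in> ball 0 1" "w \<in> ball 0 1" for z w
      using sums_mult[OF bergman_sums[OF that], of "lnabs z"] by (simp add: lnabs_def power_mult_distrib mult_ac)
    show "(LINT w|\<mu>. (\<gamma> n * ln (cmod w))\<^sup>2 * cmod w ^ (2 * (n + 0))) * (LINT w|\<mu>. 1\<^sup>2 * cmod w ^ (2 * (n + 0))) \<le> C / (real n + 1)\<^sup>2" for n
      unfolding int1 int2 by (rule ln_sq)
    show "\<bar>\<gamma> n * ln (cmod z)\<bar> * cmod z ^ (n + 0) * \<bar>1\<bar> \<le> \<bar>ln (cmod z)\<bar> * (\<gamma> n * cmod z ^ n) * 1" for n and z :: complex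
      using \<gamma>_pos[of n] by (simp add: abs_mult mult_ac)
    show "summable (\<lambda>n. \<bar>ln (cmod z)\<bar> * (\<gamma> n * cmod z ^ n))" if "z \<in> ball 0 1" for z
      by (rule summable_mult[OF summ[OF that]])
    show "0 \<le> \<bar>ln (cmod z)\<bar> * (\<gamma> n * cmod z ^ n)" for n and z :: complex using \<gamma>_pos[of n] by simp
  qed (use C(1) one int1 int2 in auto)
  have 2: "good_kernel (\<lambda>z w. lnabs w * bergman z w)"
  proof (rule good_kernel_radial[where \<psi> = "\<lambda>n r. \<gamma> n" and \<eta> = "\<lambda>_ r. ln r" and i = 0 and j = 0
        and C = C and m = "\<lambda>z n. \<gamma> n * cmod z ^ n" and h = "\<lambda>w. \<bar>ln (cmod w)\<bar>"])
    show "(\<lambda>n. of_real (\<gamma> n) * z ^ (n + 0) * (of_real (ln (cmod w)) * cnj w ^ (n + 0))) sums (lnabs w * bergman z w)"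
      if "z \<in> ball 0 1" "w \<in> ball 0 1" for z w
      using sums_mult[OF bergman_sums[OF that], of "lnabs w"] by (simp add: lnabs_def power_mult_distrib mult_ac)
    show "(LINT w|\<mu>. (\<gamma> n)\<^sup>2 * cmod w ^ (2 * (n + 0))) * (LINT w|\<mu>. (ln (cmod w))\<^sup>2 * cmod w ^ (2 * (n + 0))) \<le> C / (real n + 1)\<^sup>2" for n
      unfolding int3 int4 using ln_sq[of n] by (simp add: mult_ac)
    show "\<bar>\<gamma> n\<bar> * cmod z ^ (n + 0) * \<bar>ln (cmod w)\<bar> \<le> \<gamma> n * cmod z ^ n * \<bar>ln (cmod w)\<bar>" for n and z w :: complex
      using \<gamma>_pos[of n] by simp
    show "0 \<le> \<gamma> n * cmod z ^ n" for n and z :: complex using \<gamma>_pos[of n] by simp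
  qed (use C(1) lnL2 summ int3 int4 in auto)
  have cl: "cnj (lnabs z) = lnabs z" for z by (simp add: lnabs_def)
  have 3: "good_kernel (\<lambda>z w. lnabs z * cnj 1)" by (rule good_kernel_rank_one[OF lnabs_L2 one_L2])
  have 4: "good_kernel (\<lambda>z w. 1 * cnj (lnabs w))" by (rule good_kernel_rank_one[OF one_L2 lnabs_L2])
  note A = good_kernel_add[OF good_kernel_add[OF 1 good_kernel_cnj[OF 1]] good_kernel_cmult[OF 3, of "- 1"]]
  note B = good_kernel_add[OF good_kernel_add[OF 2 good_kernel_cnj[OF 2]] good_kernel_cmult[OF 4, of "- 1"]]
  from good_kernel_add[OF A good_kernel_cmult[OF B, of "- 1"]] show ?thesis
    by (rule good_kernel_cong) (simp add: harmonic_kernel_eq cl algebra_simps)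
qed

section \<open>Holomorphic symbols\<close>

lemma power_measurable: "(\<lambda>w. w ^ j) \<in> borel_measurable \<mu>"
  by (rule borel_measurable_\<mu>) measurable

lemma power_le_1: "w \<in> ball 0 1 \<Longrightarrow> cmod (w ^ j) \<le> 1"
  by (simp add: norm_power power_le_one)

text \<open>For \<open>k0 z w = (z - w) K(z, w)\<close> the kernel \<open>k\<close> is \<open>(L z - L w) K(z, w)\<close> with \<open>L z = \<Sum>n. a n z\<^sup>n\<close>. Each
  term is the operator of \<open>k0\<close> between multiplications by powers of \<open>w\<close> and \<open>z\<close>, which are contractions,
  so everything reduces to \<open>\<parallel>T\<^sub>0 (w\<^sup>j f)\<parallel> \<le> e q\<^sup>j\<close> with a small \<open>e\<close>, uniformly in \<open>j\<close>. The factor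
  \<open>q\<^sup>j\<close> leaves room for using fewer vectors when \<open>j\<close> is large.\<close>

lemma good_kernel_power_series:
  fixes a :: "nat \<Rightarrow> complex"
  assumes k0: "good_kernel k0" and q: "1 < q" and a: "summable (\<lambda>n. cmod (a n) * real n * q ^ n)"
    and k: "\<And>z w. z \<in> ball 0 1 \<Longrightarrow> w \<in> ball 0 1 \<Longrightarrow>
      (\<lambda>n. a n * (\<Sum>i<n. z ^ i * w ^ (n - Suc i)) * k0 z w) sums k z w"
  shows "good_kernel k"
proof -
  define p where "p n z w = (\<Sum>i<n. z ^ i * w ^ (n - Suc i))" for n and z w :: complex
  have p_le: "cmod (p n z w) \<le> real n" if "z \<in> ball 0 1" "w \<in> ball 0 1" for n z w
  proof -
    have "cmod (p n z w) \<le> (\<Sum>i<n. cmod (z ^ i * w ^ (n - Suc i)))" unfolding p_def by (rule norm_sum)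
    also have "\<dots> \<le> (\<Sum>i<n. 1)"
      using power_le_1[OF that(1)] power_le_1[OF that(2)] by (intro sum_mono) (simp add: norm_mult mult_le_one)
    finally show ?thesis by simp
  qed
  have an: "summable (\<lambda>n. cmod (a n) * real n)"
  proof (rule summable_comparison_test'[OF a])
    fix n
    have "cmod (a n) * real n * 1 \<le> cmod (a n) * real n * q ^ n"
      using q by (intro mult_left_mono one_le_power) auto
    then show "norm (cmod (a n) * real n) \<le> cmod (a n) * real n * q ^ n" by simp
  qed
  have meas: "(\<lambda>(z, w). k z w) \<in> borel_measurable (\<mu> \<Otimes>\<^sub>M \<mu>)"
  proof (rule borel_measurable_LIMSEQ_metric[where f = "\<lambda>N x. \<Sum>n<N. a n * p n (fst x) (snd x) * k0 (fst x) (snd x)"])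
    have k0m: "(\<lambda>x. k0 (fst x) (snd x)) \<in> borel_measurable (\<mu> \<Otimes>\<^sub>M \<mu>)"
      using good_kernelD(1)[OF k0] by (simp add: case_prod_beta')
    show "(\<lambda>x. \<Sum>n<N. a n * p n (fst x) (snd x) * k0 (fst x) (snd x)) \<in> borel_measurable (\<mu> \<Otimes>\<^sub>M \<mu>)" for N
      unfolding p_def
      by (intro borel_measurable_sum borel_measurable_times borel_measurable_const k0m
          measurable_compose[OF measurable_fst power_measurable] measurable_compose[OF measurable_snd power_measurable])
    show "(\<lambda>N. \<Sum>n<N. a n * p n (fst x) (snd x) * k0 (fst x) (snd x)) \<longlonglongrightarrow> (case x of (z, w) \<Rightarrow> k z w)"
      if "x \<in> space (\<mu> \<Otimes>\<^sub>M \<mu>)" for x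
      using k[of "fst x" "snd x"] that by (auto simp: space_pair_measure sums_def p_def)
  qed
  have wf: "(\<lambda>w. w ^ j * f w) \<in> L2 \<mu>" "L2_norm \<mu> (\<lambda>w. w ^ j * f w) \<le> L2_norm \<mu> f" if "f \<in> L2 \<mu>" for f j
    using L2_mult_bounded[OF that power_measurable, of j] power_le_1 by auto
  define H where "H f n z = a n * (\<Sum>i<n. z ^ i * kernel_op k0 (\<lambda>w. w ^ (n - Suc i) * f w) z)" for f n z
  have series: "integrable \<mu> (\<lambda>w. f w * k z w)" "(\<lambda>n. H f n z) sums kernel_op k f z"
    if f: "f \<in> L2 \<mu>" and z: "z \<in> ball 0 1" for f z
  proof -
    have i0: "integrable \<mu> (\<lambda>w. (w ^ j * f w) * k0 z w)" for j by (rule good_kernelD(2)[OF k0 wf(1)[OF f] z])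
    have i0': "integrable \<mu> (\<lambda>w. z ^ i * ((w ^ j * f w) * k0 z w))" for i j by (rule integrable_mult_right[OF i0])
    have eq: "f w * (a n * p n z w * k0 z w) = a n * (\<Sum>i<n. z ^ i * ((w ^ (n - Suc i) * f w) * k0 z w))" for n w
      by (simp add: p_def sum_distrib_left sum_distrib_right mult_ac)
    have i: "integrable \<mu> (\<lambda>w. f w * (a n * p n z w * k0 z w))" for n
      unfolding eq by (intro integrable_mult_right Bochner_Integration.integrable_sum i0')
    have I: "(LINT w|\<mu>. f w * (a n * p n z w * k0 z w)) = H f n z" for n
      unfolding eq H_def kernel_op_def
      by (simp add: Bochner_Integration.integral_sum[OF i0'])
    have le: "cmod (f w * (a n * p n z w * k0 z w)) \<le> (cmod (a n) * real n) * cmod (f w * k0 z w)" if "w \<in> ball 0 1" for n w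
    proof -
      have "cmod (f w * (a n * p n z w * k0 z w)) = cmod (a n) * cmod (p n z w) * cmod (f w * k0 z w)"
        by (simp add: norm_mult mult_ac)
      also have "\<dots> \<le> cmod (a n) * real n * cmod (f w * k0 z w)"
        using p_le[OF z that] by (intro mult_right_mono mult_left_mono) auto
      finally show ?thesis .
    qed
    have ks: "(\<lambda>n. f w * (a n * p n z w * k0 z w)) sums (f w * k z w)" if "w \<in> ball 0 1" for w
      unfolding p_def by (rule sums_mult[OF k[OF z that]])
    have ih: "integrable \<mu> (\<lambda>w. cmod (f w * k0 z w))" by (rule integrable_norm[OF good_kernelD(2)[OF k0 f z]])
    note * = integral_sums_dominated[OF i le an ih _ _ ks]
    show "integrable \<mu> (\<lambda>w. f w * k z w)" by (rule *(1)) auto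
    show "(\<lambda>n. H f n z) sums kernel_op k f z" unfolding kernel_op_def I[symmetric] by (rule *(2)) auto
  qed
  define S where "S = (\<Sum>n. cmod (a n) * real n * q ^ n)"
  have S0: "0 \<le> S" unfolding S_def using q by (intro suminf_nonneg a) auto
  have bound: "kernel_op k f \<in> L2 \<mu>" "L2_norm \<mu> (kernel_op k f) \<le> S * e"
    if f: "f \<in> L2 \<mu>" and e: "\<And>j. L2_norm \<mu> (kernel_op k0 (\<lambda>w. w ^ j * f w)) \<le> e * q ^ j" for f e
  proof -
    have e0: "0 \<le> e" using e[of 0] order_trans[OF L2_norm_nonneg e[of 0]] by simp
    have zk: "(\<lambda>z. z ^ i * kernel_op k0 (\<lambda>w. w ^ j * f w) z) \<in> L2 \<mu>"
      "L2_norm \<mu> (\<lambda>z. z ^ i * kernel_op k0 (\<lambda>w. w ^ j * f w) z) \<le> e * q ^ j" for i j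
      using wf(1)[OF good_kernelD(4)[OF k0 wf(1)[OF f]], of i j] order_trans[OF wf(2)[OF good_kernelD(4)[OF k0 wf(1)[OF f]], of i j] e[of j]]
      by auto
    have H: "H f n \<in> L2 \<mu>" "L2_norm \<mu> (H f n) \<le> (cmod (a n) * real n * q ^ n) * e" for n
    proof -
      show "H f n \<in> L2 \<mu>" unfolding H_def by (intro L2_cmult L2_norm_sum(1) zk)
      have "L2_norm \<mu> (\<lambda>z. \<Sum>i<n. z ^ i * kernel_op k0 (\<lambda>w. w ^ (n - Suc i) * f w) z)
          \<le> (\<Sum>i<n. L2_norm \<mu> (\<lambda>z. z ^ i * kernel_op k0 (\<lambda>w. w ^ (n - Suc i) * f w) z))"
        by (intro L2_norm_sum(2) zk)
      also have "\<dots> \<le> (\<Sum>i<n. e * q ^ n)"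
      proof (rule sum_mono)
        fix i
        have "e * q ^ (n - Suc i) \<le> e * q ^ n" using e0 q by (intro mult_left_mono power_increasing) auto
        then show "L2_norm \<mu> (\<lambda>z. z ^ i * kernel_op k0 (\<lambda>w. w ^ (n - Suc i) * f w) z) \<le> e * q ^ n"
          using zk(2)[of i "n - Suc i"] by linarith
      qed
      finally have "cmod (a n) * L2_norm \<mu> (\<lambda>z. \<Sum>i<n. z ^ i * kernel_op k0 (\<lambda>w. w ^ (n - Suc i) * f w) z)
          \<le> cmod (a n) * (real n * (e * q ^ n))" by (intro mult_left_mono) auto
      then show "L2_norm \<mu> (H f n) \<le> (cmod (a n) * real n * q ^ n) * e"
        unfolding H_def L2_norm_cmult by (simp add: mult_ac)
    qed
    have F: "(\<lambda>z. \<Sum>n<N. H f n z) \<in> L2 \<mu>" "L2_norm \<mu> (\<lambda>z. \<Sum>n<N. H f n z) \<le> S * e" for N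
    proof -
      show "(\<lambda>z. \<Sum>n<N. H f n z) \<in> L2 \<mu>" by (intro L2_norm_sum(1) H)
      have "L2_norm \<mu> (\<lambda>z. \<Sum>n<N. H f n z) \<le> (\<Sum>n<N. L2_norm \<mu> (H f n))" by (intro L2_norm_sum(2) H)
      also have "\<dots> \<le> (\<Sum>n<N. (cmod (a n) * real n * q ^ n) * e)" by (intro sum_mono H)
      also have "\<dots> = (\<Sum>n<N. cmod (a n) * real n * q ^ n) * e" by (simp add: sum_distrib_right)
      also have "\<dots> \<le> S * e" unfolding S_def using e0 q by (intro mult_right_mono sum_le_suminf a) auto
      finally show "L2_norm \<mu> (\<lambda>z. \<Sum>n<N. H f n z) \<le> S * e" .
    qed
    have "AE z in \<mu>. (\<lambda>N. \<Sum>n<N. H f n z) \<longlonglongrightarrow> kernel_op k f z"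
      using series(2)[OF f] by (intro AE_I2) (simp add: sums_def)
    from L2_Fatou[OF F this kernel_op_measurable[OF meas L2D(1)[OF f]]]
    show "kernel_op k f \<in> L2 \<mu>" "L2_norm \<mu> (kernel_op k f) \<le> S * e" .
  qed
  obtain K C B where B: "0 \<le> C" "\<And>f. f \<in> L2 \<mu> \<Longrightarrow> kernel_op k0 f \<in> L2 \<mu>"
    "\<And>N. finite (B N)" "\<And>N. B N \<subseteq> L2 \<mu>" "\<And>N. card (B N) \<le> K * N"
    "\<And>N f. f \<in> L2 \<mu> \<Longrightarrow> (\<And>b. b \<in> B N \<Longrightarrow> L2_inner \<mu> f b = 0) \<Longrightarrow> L2_norm \<mu> (kernel_op k0 f) \<le> C / (real N + 1) * L2_norm \<mu> f"
    by (rule rate_oneE[OF good_kernelD(3)[OF k0]]) blast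
  define \<theta> where "\<theta> = 1 / q"
  have \<theta>: "0 < \<theta>" "\<theta> < 1" "\<theta> ^ j * q ^ j = 1" for j using q by (simp_all add: \<theta>_def power_one_over)
  \<comment> \<open>Multiplication by \<open>w\<^sup>j\<close> occurs with weight about \<open>q\<^sup>-\<^sup>j\<close>, so a share \<open>\<theta>\<^sup>j\<close> of the \<open>N\<close> vectors
    is enough for it, and these shares have a finite sum.\<close>
  define s where "s N j = nat \<lfloor>real N * \<theta> ^ j\<rfloor>" for N j
  have s_le: "real (s N j) \<le> real N * \<theta> ^ j" and s_ge: "real N * \<theta> ^ j \<le> real (s N j) + 1" for N j
  proof -
    have "0 \<le> real N * \<theta> ^ j" using \<theta>(1) by simp
    then have "real (s N j) = of_int \<lfloor>real N * \<theta> ^ j\<rfloor>" by (simp add: s_def)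
    then show "real (s N j) \<le> real N * \<theta> ^ j" "real N * \<theta> ^ j \<le> real (s N j) + 1" by linarith+
  qed
  have "\<exists>J. \<theta> ^ J < 1 / (real N + 1)" for N using \<theta> by (intro real_arch_pow_inv) auto
  then obtain J where J: "\<And>N. \<theta> ^ J N < 1 / (real N + 1)" by metis
  have s0: "s N j = 0" if "J N \<le> j" for N j
  proof -
    have "\<theta> ^ j \<le> \<theta> ^ J N" using \<theta>(1,2) that by (intro power_decreasing) auto
    then have "\<theta> ^ j < 1 / (real N + 1)" using J[of N] by simp
    then have "\<theta> ^ j * (real N + 1) < 1" by (simp add: pos_less_divide_eq)
    then have "real N * \<theta> ^ j < 1" using zero_less_power[OF \<theta>(1), of j] by (simp add: algebra_simps)
    then show ?thesis using s_le[of N j] by simp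
  qed
  define BL where "BL N = (\<Union>j<J N. (\<lambda>b w. cnj (w ^ j) * b w) ` B (s N j))" for N
  define M where "M = nat \<lceil>1 / (1 - \<theta>)\<rceil>"
  have "rate_one \<mu> (kernel_op k)"
  proof (rule rate_oneI[where B = BL and C = "S * (2 * C)" and K = "K * M"])
    show "0 \<le> S * (2 * C)" using S0 B(1) by simp
    have "L2_norm \<mu> (kernel_op k0 (\<lambda>w. w ^ j * f w)) \<le> (C * L2_norm \<mu> f) * q ^ j" if f: "f \<in> L2 \<mu>" for f j
    proof -
      have "B 0 = {}" using B(3)[of 0] B(5)[of 0] by simp
      then have "L2_norm \<mu> (kernel_op k0 (\<lambda>w. w ^ j * f w)) \<le> C / (real 0 + 1) * L2_norm \<mu> (\<lambda>w. w ^ j * f w)"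
        by (intro B(6) wf f) simp
      also have "\<dots> \<le> C * L2_norm \<mu> f" using wf(2)[OF f, of j] B(1) by (simp add: mult_left_mono)
      also have "\<dots> \<le> (C * L2_norm \<mu> f) * q ^ j"
        using mult_left_mono[OF one_le_power[of q j], of "C * L2_norm \<mu> f"] q B(1) L2_norm_nonneg[of \<mu> f] by simp
      finally show ?thesis .
    qed
    then show "kernel_op k f \<in> L2 \<mu>" if "f \<in> L2 \<mu>" for f using bound(1)[OF that] that by blast
    fix N
    show "finite (BL N)" unfolding BL_def using B(3) by auto
    show "BL N \<subseteq> L2 \<mu>"
    proof -
      have "(\<lambda>w. cnj (w ^ j) * b w) \<in> L2 \<mu>" if "b \<in> L2 \<mu>" for b j
        by (rule L2_mult_bounded(1)[OF that borel_measurable_cnj[OF power_measurable]]) (simp add: norm_power power_le_one)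
      then show ?thesis unfolding BL_def using B(4) by blast
    qed
    show "card (BL N) \<le> K * M * N"
    proof -
      have "card (BL N) \<le> (\<Sum>j<J N. card ((\<lambda>b w. cnj (w ^ j) * b w) ` B (s N j)))"
        unfolding BL_def by (rule card_UN_le) simp
      also have "\<dots> \<le> (\<Sum>j<J N. K * s N j)" by (intro sum_mono order_trans[OF card_image_le[OF B(3)] B(5)])
      finally have "real (card (BL N)) \<le> real (\<Sum>j<J N. K * s N j)" by (simp only: of_nat_le_iff)
      also have "\<dots> = real K * (\<Sum>j<J N. real (s N j))" by (simp add: sum_distrib_left)
      also have "\<dots> \<le> real K * (\<Sum>j<J N. real N * \<theta> ^ j)" by (intro mult_left_mono sum_mono s_le) simp
      also have "\<dots> = real K * real N * (\<Sum>j<J N. \<theta> ^ j)" by (simp add: sum_distrib_left mult.assoc)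
      also have "\<dots> \<le> real K * real N * (\<Sum>j. \<theta> ^ j)"
        using \<theta> by (intro mult_left_mono sum_le_suminf summable_geometric) auto
      also have "(\<Sum>j. \<theta> ^ j) = 1 / (1 - \<theta>)" using \<theta> by (intro suminf_geometric) auto
      also have "real K * real N * (1 / (1 - \<theta>)) \<le> real K * real N * real M"
        by (intro mult_left_mono) (auto simp: M_def real_nat_ceiling_ge)
      finally have "real (card (BL N)) \<le> real (K * M * N)" by (simp add: mult_ac)
      then show ?thesis by (simp only: of_nat_le_iff)
    qed
    fix f assume f: "f \<in> L2 \<mu>" and off: "\<And>b. b \<in> BL N \<Longrightarrow> L2_inner \<mu> f b = 0"
    have "L2_norm \<mu> (kernel_op k0 (\<lambda>w. w ^ j * f w)) \<le> (2 * C / (real N + 1) * L2_norm \<mu> f) * q ^ j" for j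
    proof -
      have "L2_inner \<mu> (\<lambda>w. w ^ j * f w) b = 0" if b: "b \<in> B (s N j)" for b
      proof (cases "j < J N")
        case True
        have "L2_inner \<mu> (\<lambda>w. w ^ j * f w) b = L2_inner \<mu> f (\<lambda>w. cnj (w ^ j) * b w)"
          unfolding L2_inner_def by (simp add: mult_ac)
        also have "\<dots> = 0" using True b by (intro off) (auto simp: BL_def)
        finally show ?thesis .
      next
        case False
        then have "B (s N j) = {}" using s0[of N j] B(3)[of 0] B(5)[of 0] by simp
        then show ?thesis using b by simp
      qed
      then have "L2_norm \<mu> (kernel_op k0 (\<lambda>w. w ^ j * f w)) \<le> C / (real (s N j) + 1) * L2_norm \<mu> (\<lambda>w. w ^ j * f w)"
        by (intro B(6) wf f)
      also have "\<dots> \<le> C / (real (s N j) + 1) * L2_norm \<mu> f"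
        using wf(2)[OF f, of j] B(1) by (intro mult_left_mono) auto
      also have "\<dots> \<le> (2 * C / (real N + 1) * q ^ j) * L2_norm \<mu> f"
      proof (rule mult_right_mono[OF _ L2_norm_nonneg])
        have "\<theta> ^ j \<le> 1" using \<theta>(1,2) by (intro power_le_one) auto
        then have "(real N + 1) * \<theta> ^ j \<le> 2 * (real (s N j) + 1)" using s_ge[of N j] by (simp add: distrib_right)
        then have "(real N + 1) * \<theta> ^ j * q ^ j \<le> 2 * (real (s N j) + 1) * q ^ j"
          using q by (intro mult_right_mono) auto
        then have "real N + 1 \<le> 2 * (real (s N j) + 1) * q ^ j" using \<theta>(3)[of j] by (simp add: mult.assoc)
        then have "C * (real N + 1) \<le> C * (2 * (real (s N j) + 1) * q ^ j)" using B(1) by (rule mult_left_mono)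
        then show "C / (real (s N j) + 1) \<le> 2 * C / (real N + 1) * q ^ j"
          by (simp add: pos_divide_le_eq pos_le_divide_eq mult_ac) (simp add: algebra_simps)
      qed
      finally show ?thesis by (simp add: mult_ac)
    qed
    from bound(2)[OF f this]
    show "L2_norm \<mu> (kernel_op k f) \<le> S * (2 * C) / (real N + 1) * L2_norm \<mu> f" by simp
  qed
  then show ?thesis unfolding good_kernel_def using meas series(1) by blast
qed

lemma cnj_harmonic_kernel: "z \<in> ball 0 1 \<Longrightarrow> w \<in> ball 0 1 \<Longrightarrow> cnj (harmonic_kernel \<alpha> z w) = harmonic_kernel \<alpha> z w"
  by (simp add: harmonic_kernel_eq)

lemma harmonic_kernel_commute: "harmonic_kernel \<alpha> z w = harmonic_kernel \<alpha> w z"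
  by (simp add: harmonic_kernel_def)

lemma good_kernel_holomorphic:
  assumes R: "1 < R" and L: "L holomorphic_on ball 0 R"
  shows "good_kernel (\<lambda>z w. (L z - L w) * harmonic_kernel \<alpha> z w)"
proof -
  define a where "a n = (deriv ^^ n) L 0 / fact n" for n
  have sums: "(\<lambda>n. a n * z ^ n) sums L z" if "z \<in> ball 0 R" for z
    using holomorphic_power_series[OF L that] by (simp add: a_def)
  define q where "q = (1 + R) / 2"
  define q' where "q' = (q + R) / 2"
  have q: "1 < q" "q < q'" "q' < R" using R by (auto simp: q_def q'_def)
  have "summable (\<lambda>n. diffs a n * of_real q' ^ n)"
    using q by (intro termdiff_converges[of _ R] sums_summable[OF sums]) auto
  then have "summable (\<lambda>n. norm (diffs a n * of_real q ^ n))"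
    using q by (intro powser_insidea[of "diffs a" "of_real q'"]) auto
  then have "summable (\<lambda>n. norm (diffs a n * of_real q ^ n) * q)" by (rule summable_mult2)
  moreover have "norm (diffs a n * of_real q ^ n) * q = cmod (a (Suc n)) * real (Suc n) * q ^ Suc n" for n
    using q by (simp add: diffs_def norm_mult norm_power mult_ac del: of_nat_Suc)
  ultimately have "summable (\<lambda>n. cmod (a (Suc n)) * real (Suc n) * q ^ Suc n)" by simp
  then have sm: "summable (\<lambda>n. cmod (a n) * real n * q ^ n)" by (subst (asm) summable_Suc_iff)
  show ?thesis
  proof (rule good_kernel_power_series[OF good_kernel_z q(1) sm])
    fix z w :: complex assume zw: "z \<in> ball 0 1" "w \<in> ball 0 1"
    then have "(\<lambda>n. a n * z ^ n - a n * w ^ n) sums (L z - L w)" using R by (intro sums_diff sums) auto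
    from sums_mult2[OF this, of "harmonic_kernel \<alpha> z w"]
    show "(\<lambda>n. a n * (\<Sum>i<n. z ^ i * w ^ (n - Suc i)) * ((z - w) * harmonic_kernel \<alpha> z w)) sums ((L z - L w) * harmonic_kernel \<alpha> z w)"
    proof (rule sums_cong[THEN iffD1, rotated])
      fix n
      have "a n * z ^ n - a n * w ^ n = a n * ((z - w) * (\<Sum>i<n. w ^ (n - Suc i) * z ^ i))"
        unfolding power_diff_sumr2[symmetric] by (rule right_diff_distrib[symmetric])
      then show "(a n * z ^ n - a n * w ^ n) * harmonic_kernel \<alpha> z w
          = a n * (\<Sum>i<n. z ^ i * w ^ (n - Suc i)) * ((z - w) * harmonic_kernel \<alpha> z w)"
        by (simp add: mult_ac)
    qed
  qed
qed

text \<open>Since \<open>K\<close> is real, the real part of \<open>L\<close> is accounted for by the kernel for \<open>L\<close> and its conjugate.\<close>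

lemma good_kernel_commutator:
  assumes R: "1 < R" and L: "L holomorphic_on ball 0 R"
    and v: "\<And>z. z \<in> ball 0 1 \<Longrightarrow> v z = of_real (c * ln (cmod z) + Re (L z))"
  shows "good_kernel (\<lambda>z w. (v z - v w) * harmonic_kernel \<alpha> z w)"
proof -
  note 1 = good_kernel_cmult[OF good_kernel_ln, of "of_real c"]
  note 2 = good_kernel_holomorphic[OF R L]
  note 3 = good_kernel_cmult[OF good_kernel_add[OF 2 good_kernel_cnj[OF 2]], of "1/2"]
  from good_kernel_add[OF 1 3] show ?thesis
  proof (rule good_kernel_cong)
    fix z w :: complex assume zw: "z \<in> ball 0 1" "w \<in> ball 0 1"
    have re: "complex_of_real (Re x) = 1/2 * (x + cnj x)" for x by (simp add: complex_add_cnj)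
    have vd: "v z - v w = of_real c * (lnabs z - lnabs w) + 1/2 * ((L z - L w) + cnj (L z - L w))"
      unfolding v[OF zw(1)] v[OF zw(2)] lnabs_def of_real_add of_real_mult re by (simp add: algebra_simps)
    show "of_real c * ((lnabs z - lnabs w) * harmonic_kernel \<alpha> z w)
        + 1/2 * ((L z - L w) * harmonic_kernel \<alpha> z w + cnj ((L z - L w) * harmonic_kernel \<alpha> z w))
        = (v z - v w) * harmonic_kernel \<alpha> z w"
      unfolding vd by (simp add: cnj_harmonic_kernel[OF zw] algebra_simps)
  qed
qed

lemma bergman_measurable: "(\<lambda>(z, w). bergman z w) \<in> borel_measurable (\<mu> \<Otimes>\<^sub>M \<mu>)"
proof (rule diagonal_measurable[where a = "\<lambda>n z. of_real (\<gamma> n) * z ^ n" and b = "\<lambda>n w. w ^ n"])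
  show "(\<lambda>n. of_real (\<gamma> n) * z ^ n * cnj (w ^ n)) sums bergman z w" if "z \<in> ball 0 1" "w \<in> ball 0 1" for z w
    using bergman_sums[OF that] by (simp add: power_mult_distrib mult.assoc)
qed (intro borel_measurable_times borel_measurable_const power_measurable)+

lemma harmonic_kernel_measurable: "(\<lambda>(z, w). harmonic_kernel \<alpha> z w) \<in> borel_measurable (\<mu> \<Otimes>\<^sub>M \<mu>)"
proof -
  have "(\<lambda>x. bergman (fst x) (snd x) + cnj (bergman (fst x) (snd x)) - 1) \<in> borel_measurable (\<mu> \<Otimes>\<^sub>M \<mu>)"
    using bergman_measurable unfolding case_prod_beta'
    by (intro borel_measurable_diff borel_measurable_add borel_measurable_cnj borel_measurable_const)
  then show ?thesis
    by (rule measurable_cong[THEN iffD1, rotated]) (auto simp: space_pair_measure harmonic_kernel_eq)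
qed

lemma harmonic_kernel_bound:
  assumes "0 \<le> \<rho>" "\<rho> < 1"
  shows "\<exists>C\<ge>0. \<forall>z w. cmod z \<le> \<rho> \<longrightarrow> w \<in> ball 0 1 \<longrightarrow> cmod (harmonic_kernel \<alpha> z w) \<le> C"
proof -
  define S where "S = (\<Sum>n. \<gamma> n * \<rho> ^ n)"
  have sm: "summable (\<lambda>n. \<gamma> n * \<rho> ^ n)" by (rule \<gamma>_summable(1)[OF assms])
  have S0: "0 \<le> S" unfolding S_def using \<gamma>_pos assms by (intro suminf_nonneg sm) (simp add: less_imp_le)
  have "cmod (harmonic_kernel \<alpha> z w) \<le> 2 * S + 1" if z: "cmod z \<le> \<rho>" and w: "w \<in> ball 0 1" for z w
  proof -
    have zb: "z \<in> ball 0 1" using z assms by simp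
    have le: "norm (of_real (\<gamma> n) * (z * cnj w) ^ n) \<le> \<gamma> n * \<rho> ^ n" for n
    proof -
      have "cmod z * cmod w \<le> \<rho> * 1" using z w assms by (intro mult_mono) auto
      then have "(cmod z * cmod w) ^ n \<le> \<rho> ^ n" by (intro power_mono) auto
      then show ?thesis using \<gamma>_pos[of n] by (simp add: norm_mult norm_power)
    qed
    have "cmod (bergman z w) = cmod (\<Sum>n. of_real (\<gamma> n) * (z * cnj w) ^ n)" using sums_unique[OF bergman_sums[OF zb w]] by simp
    also have "\<dots> \<le> S" unfolding S_def by (rule norm_suminf_le[OF le sm])
    finally have "cmod (bergman z w) \<le> S" .
    moreover have "cmod (bergman z w + cnj (bergman z w) - 1) \<le> cmod (bergman z w + cnj (bergman z w)) + cmod 1" by (rule norm_triangle_ineq4)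
    moreover have "cmod (bergman z w + cnj (bergman z w)) \<le> cmod (bergman z w) + cmod (cnj (bergman z w))" by (rule norm_triangle_ineq)
    ultimately show ?thesis unfolding harmonic_kernel_eq[OF zb w] by simp
  qed
  then show ?thesis using S0 by (intro exI[of _ "2 * S + 1"]) auto
qed

section \<open>Adjoints of integral operators\<close>

text \<open>The factor \<open>e\<close> is 1 for a Hermitian and -1 for a skew-Hermitian kernel. If \<open>g\<close> is supported in a
  smaller disk then the double integral converges absolutely, and the Fubini theorem applies; such \<open>g\<close> are
  dense and the operator is bounded.\<close>

lemma kernel_op_adjoint:
  assumes k: "(\<lambda>(z, w). k z w) \<in> borel_measurable (\<mu> \<Otimes>\<^sub>M \<mu>)"
    and int: "\<And>f z. f \<in> L2 \<mu> \<Longrightarrow> z \<in> ball 0 1 \<Longrightarrow> integrable \<mu> (\<lambda>w. f w * k z w)"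
    and TL: "\<And>f. f \<in> L2 \<mu> \<Longrightarrow> kernel_op k f \<in> L2 \<mu>"
    and TC: "\<And>f. f \<in> L2 \<mu> \<Longrightarrow> L2_norm \<mu> (kernel_op k f) \<le> C * L2_norm \<mu> f"
    and sym: "\<And>z w. z \<in> ball 0 1 \<Longrightarrow> w \<in> ball 0 1 \<Longrightarrow> k z w = e * cnj (k w z)"
    and h: "(\<lambda>w. complex_of_real (h w)) \<in> L2 \<mu>" "\<And>w. 0 \<le> h w"
    and bd: "\<And>\<rho>. 0 \<le> \<rho> \<Longrightarrow> \<rho> < 1 \<Longrightarrow> \<exists>D\<ge>0. \<forall>z w. cmod z \<le> \<rho> \<longrightarrow> w \<in> ball 0 1 \<longrightarrow> cmod (k z w) \<le> D * (h z + h w)"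
    and f: "f \<in> L2 \<mu>" and g: "g \<in> L2 \<mu>"
  shows "L2_inner \<mu> (kernel_op k f) g = e * L2_inner \<mu> f (kernel_op k g)"
proof -
  interpret semi_inner "\<lambda>c f x. c * f x" "L2 \<mu>" "L2_inner \<mu>"
    rewrites "semi_inner.nrm (L2_inner \<mu>) = L2_norm \<mu>"
    by (rule semi_inner_L2) (rule L2_norm_eq_nrm)
  note [measurable] = L2D(1)[OF f] L2D(1)[OF g]
  have trunc: "L2_inner \<mu> (kernel_op k f) G = e * L2_inner \<mu> f (kernel_op k G)"
    if \<rho>: "0 \<le> \<rho>" "\<rho> < 1" and G: "G \<in> L2 \<mu>" "\<And>z. \<rho> < cmod z \<Longrightarrow> G z = 0" for G \<rho>
  proof -
    obtain D where D: "0 \<le> D" "\<And>z w. cmod z \<le> \<rho> \<Longrightarrow> w \<in> ball 0 1 \<Longrightarrow> cmod (k z w) \<le> D * (h z + h w)"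
      using bd[OF \<rho>] by blast
    let ?F = "\<lambda>z w. f w * k z w * cnj (G z)"
    have m: "(\<lambda>(z, w). ?F z w) \<in> borel_measurable (\<mu> \<Otimes>\<^sub>M \<mu>)"
      using borel_measurable_times[OF borel_measurable_times[OF measurable_compose[OF measurable_snd L2D(1)[OF f]] k]
          measurable_compose[OF measurable_fst borel_measurable_cnj[OF L2D(1)[OF G(1)]]]]
      by (simp add: case_prod_beta')
    have habs: "(\<lambda>w. complex_of_real (cmod (u w))) \<in> L2 \<mu>" if "u \<in> L2 \<mu>" for u using that by (auto simp: L2_def)
    have i1: "integrable \<mu> (\<lambda>w. cmod (u w) * h w)" if "u \<in> L2 \<mu>" for u
      using integrable_norm[OF integrable_mult_L2(1)[OF that h(1)]] h(2) by (simp add: norm_mult)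
    have i2: "integrable \<mu> (\<lambda>w. cmod (u w))" if "u \<in> L2 \<mu>" for u
      using integrable_norm[OF integrable_L2[OF that]] .
    have le: "norm (?F z w) \<le> D * (cmod (f w) * (cmod (G z) * h z) + cmod (f w) * h w * cmod (G z))"
      if "w \<in> ball 0 1" for z w
    proof (cases "cmod z \<le> \<rho>")
      case True
      have "norm (?F z w) = cmod (f w) * cmod (G z) * cmod (k z w)" by (simp add: norm_mult)
      also have "\<dots> \<le> cmod (f w) * cmod (G z) * (D * (h z + h w))" using D(2)[OF True that] by (intro mult_left_mono) auto
      finally show ?thesis by (simp add: algebra_simps)
    next
      case False
      then have "G z = 0" using G(2)[of z] by simp
      then show ?thesis by simp
    qed
    have iz: "integrable \<mu> (\<lambda>w. ?F z w)" if "z \<in> ball 0 1" for z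
      by (intro integrable_mult_left int f that)
    have "integrable (\<mu> \<Otimes>\<^sub>M \<mu>) (\<lambda>(z, w). ?F z w)"
    proof (rule pair.Fubini_integrable[OF m])
      show "AE z in \<mu>. integrable \<mu> (\<lambda>w. case (z, w) of (z, w) \<Rightarrow> ?F z w)" using iz by (intro AE_I2) simp
      let ?b = "\<lambda>z. D * ((LINT w|\<mu>. cmod (f w)) * (cmod (G z) * h z) + (LINT w|\<mu>. cmod (f w) * h w) * cmod (G z))"
      have ib: "integrable \<mu> ?b"
        by (intro integrable_mult_right Bochner_Integration.integrable_add i1 i2 G)
      have mb: "(\<lambda>z. LINT w|\<mu>. norm (case (z, w) of (z, w) \<Rightarrow> ?F z w)) \<in> borel_measurable \<mu>"
        using measurable_compose[OF m borel_measurable_norm] by (intro borel_measurable_lebesgue_integral) (simp add: case_prod_beta')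
      show "integrable \<mu> (\<lambda>z. LINT w|\<mu>. norm (case (z, w) of (z, w) \<Rightarrow> ?F z w))"
      proof (rule Bochner_Integration.integrable_bound[OF ib mb], rule AE_I2)
        fix z assume z: "z \<in> space \<mu>"
        have ir: "integrable \<mu> (\<lambda>w. cmod (f w) * (cmod (G z) * h z))" "integrable \<mu> (\<lambda>w. cmod (f w) * h w * cmod (G z))"
          using i2[OF f] i1[OF f] by auto
        have "(LINT w|\<mu>. norm (?F z w)) \<le> (LINT w|\<mu>. D * (cmod (f w) * (cmod (G z) * h z) + cmod (f w) * h w * cmod (G z)))"
          using z by (intro integral_mono integrable_norm iz le integrable_mult_right Bochner_Integration.integrable_add ir) auto
        also have "\<dots> = ?b z" using ir by simp
        finally have "(LINT w|\<mu>. norm (?F z w)) \<le> ?b z" .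
        moreover have "0 \<le> (LINT w|\<mu>. norm (?F z w))" by (rule Bochner_Integration.integral_nonneg) simp
        ultimately show "norm (LINT w|\<mu>. norm (case (z, w) of (z, w) \<Rightarrow> ?F z w)) \<le> norm (?b z)" by simp
      qed
    qed
    from pair.Fubini_integral[OF this]
    have swap: "(LINT w|\<mu>. LINT z|\<mu>. ?F z w) = (LINT z|\<mu>. LINT w|\<mu>. ?F z w)" .
    have "L2_inner \<mu> (kernel_op k f) G = (LINT z|\<mu>. LINT w|\<mu>. ?F z w)"
      unfolding L2_inner_def kernel_op_def by simp
    also have "\<dots> = (LINT w|\<mu>. LINT z|\<mu>. ?F z w)" by (rule swap[symmetric])
    also have "\<dots> = (LINT w|\<mu>. e * (f w * cnj (kernel_op k G w)))"
    proof (rule Bochner_Integration.integral_cong[OF refl])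
      fix w assume w: "w \<in> space \<mu>"
      have "(LINT z|\<mu>. ?F z w) = (LINT z|\<mu>. (e * f w) * cnj (G z * k w z))"
      proof (rule Bochner_Integration.integral_cong[OF refl])
        fix z assume "z \<in> space \<mu>"
        then have kz: "k z w = e * cnj (k w z)" using w by (intro sym) auto
        show "?F z w = (e * f w) * cnj (G z * k w z)" unfolding kz by (simp add: mult_ac)
      qed
      also have "\<dots> = e * f w * cnj (kernel_op k G w)"
        unfolding kernel_op_def integral_mult_right_zero Bochner_Integration.integral_cnj ..
      finally show "(LINT z|\<mu>. ?F z w) = e * (f w * cnj (kernel_op k G w))" by (simp add: mult.assoc)
    qed
    also have "\<dots> = e * L2_inner \<mu> f (kernel_op k G)" unfolding L2_inner_def by (rule integral_mult_right_zero)
    finally show ?thesis .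
  qed
  define \<rho> where "\<rho> n = 1 - 1 / real (Suc (Suc n))" for n
  have \<rho>: "0 \<le> \<rho> n" "\<rho> n < 1" for n by (simp_all add: \<rho>_def field_simps)
  have \<rho>lim: "\<rho> \<longlonglongrightarrow> 1"
  proof -
    have "(\<lambda>n. 1 - inverse (real (Suc (Suc n)))) \<longlonglongrightarrow> 1 - 0"
      by (intro tendsto_diff tendsto_const LIMSEQ_Suc[OF LIMSEQ_inverse_real_of_nat])
    then show ?thesis by (simp add: \<rho>_def[abs_def] inverse_eq_divide)
  qed
  define G where "G n z = indicator (cball 0 (\<rho> n)) z * g z" for n z
  have Gm: "indicator (cball 0 r) \<in> borel_measurable \<mu>" for r :: real
    by (rule borel_measurable_\<mu>) (intro borel_measurable_indicator borel_closed closed_cball)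
  have GL: "G n \<in> L2 \<mu>" for n unfolding G_def by (rule L2_mult_bounded(1)[OF g Gm]) (simp add: indicator_def)
  have diff: "L2_norm \<mu> (g - G n) = sqrt (LINT z|\<mu>. (cmod (g z - G n z))\<^sup>2)" for n by (simp add: L2_norm_def)
  have "(\<lambda>n. LINT z|\<mu>. (cmod (g z - G n z))\<^sup>2) \<longlonglongrightarrow> (LINT z|\<mu>. 0)"
  proof (rule integral_dominated_convergence[where w = "\<lambda>z. (cmod (g z))\<^sup>2"])
    show "(\<lambda>z. (cmod (g z - G n z))\<^sup>2) \<in> borel_measurable \<mu>" for n using L2D(1)[OF GL[of n]] by measurable
    show "AE z in \<mu>. (\<lambda>n. (cmod (g z - G n z))\<^sup>2) \<longlonglongrightarrow> 0"
    proof (rule AE_I2)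
      fix z assume "z \<in> space \<mu>"
      then have "cmod z < 1" by simp
      then have "\<forall>\<^sub>F n in sequentially. cmod z < \<rho> n" using \<rho>lim by (rule order_tendstoD(1)[rotated])
      then have "\<forall>\<^sub>F n in sequentially. (cmod (g z - G n z))\<^sup>2 = 0" by eventually_elim (simp add: G_def)
      then show "(\<lambda>n. (cmod (g z - G n z))\<^sup>2) \<longlonglongrightarrow> 0" by (rule tendsto_eventually)
    qed
    show "AE z in \<mu>. norm ((cmod (g z - G n z))\<^sup>2) \<le> (cmod (g z))\<^sup>2" for n
      by (rule AE_I2) (simp add: G_def indicator_def)
  qed (use L2D(2)[OF g] in auto)
  then have "(\<lambda>n. sqrt (LINT z|\<mu>. (cmod (g z - G n z))\<^sup>2)) \<longlonglongrightarrow> sqrt 0" by (intro tendsto_real_sqrt) simp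
  then have lim: "(\<lambda>n. L2_norm \<mu> (g - G n)) \<longlonglongrightarrow> 0" unfolding diff by simp
  define d where "d n = L2_inner \<mu> (kernel_op k f) (g - G n) - e * L2_inner \<mu> f (kernel_op k (g - G n))" for n
  have dn: "L2_inner \<mu> (kernel_op k f) g - e * L2_inner \<mu> f (kernel_op k g) = d n" for n
  proof -
    have add: "L2_inner \<mu> f (kernel_op k (g - G n)) = L2_inner \<mu> f (kernel_op k g) - L2_inner \<mu> f (kernel_op k (G n))"
    proof -
      have "kernel_op k (g - G n) z = kernel_op k g z - kernel_op k (G n) z" if "z \<in> ball 0 1" for z
        unfolding kernel_op_def using int[OF g that] int[OF GL that, of n] by (simp add: left_diff_distrib)
      then have "L2_inner \<mu> f (kernel_op k (g - G n)) = L2_inner \<mu> f (kernel_op k g - kernel_op k (G n))"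
        unfolding L2_inner_def by (intro Bochner_Integration.integral_cong refl) simp
      then show ?thesis using f g GL[of n] TL by (simp add: ip_diff_right)
    qed
    have "L2_inner \<mu> (kernel_op k f) (G n) = e * L2_inner \<mu> f (kernel_op k (G n))"
      by (rule trunc[OF \<rho>[of n] GL]) (simp add: G_def)
    then show ?thesis unfolding d_def add using f g GL[of n] TL by (simp add: ip_diff_right algebra_simps)
  qed
  have "cmod (d n) \<le> (L2_norm \<mu> (kernel_op k f) + cmod e * (L2_norm \<mu> f * C)) * L2_norm \<mu> (g - G n)" for n
  proof -
    have gG: "g - G n \<in> L2 \<mu>" using g GL by (rule diff_in)
    have "cmod (L2_inner \<mu> f (kernel_op k (g - G n))) \<le> L2_norm \<mu> f * (C * L2_norm \<mu> (g - G n))"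
      using cauchy_schwarz[OF f TL[OF gG]] mult_left_mono[OF TC[OF gG] L2_norm_nonneg[of \<mu> f]] by linarith
    then have "cmod e * cmod (L2_inner \<mu> f (kernel_op k (g - G n))) \<le> cmod e * (L2_norm \<mu> f * (C * L2_norm \<mu> (g - G n)))"
      by (intro mult_left_mono) auto
    moreover have "cmod (L2_inner \<mu> (kernel_op k f) (g - G n)) \<le> L2_norm \<mu> (kernel_op k f) * L2_norm \<mu> (g - G n)"
      by (rule cauchy_schwarz[OF TL[OF f] gG])
    moreover have "cmod (d n) \<le> cmod (L2_inner \<mu> (kernel_op k f) (g - G n)) + cmod e * cmod (L2_inner \<mu> f (kernel_op k (g - G n)))"
      unfolding d_def norm_mult[symmetric] by (rule norm_triangle_ineq4)
    ultimately show ?thesis by (simp add: algebra_simps)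
  qed
  then have "\<forall>\<^sub>F n in sequentially. norm (d n) \<le> (L2_norm \<mu> (kernel_op k f) + cmod e * (L2_norm \<mu> f * C)) * L2_norm \<mu> (g - G n)"
    by (simp add: always_eventually)
  from Lim_null_comparison[OF this tendsto_mult_right_zero[OF lim]]
  have "d \<longlonglongrightarrow> 0" .
  then have "L2_inner \<mu> (kernel_op k f) g - e * L2_inner \<mu> f (kernel_op k g) = 0"
    unfolding dn[symmetric, abs_def] by (simp add: LIMSEQ_const_iff)
  then show ?thesis by simp
qed

section \<open>The harmonic Bergman projection\<close>

lemma harmonic_proj_eq: "harmonic_proj \<alpha> = kernel_op (harmonic_kernel \<alpha>)"
  by (auto simp: harmonic_proj_def kernel_op_def fun_eq_iff)

lemma kernel_integrable:
  assumes f: "integrable \<mu> f" and z: "z \<in> ball 0 1"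
  shows "integrable \<mu> (\<lambda>w. f w * harmonic_kernel \<alpha> z w)"
proof -
  obtain D where D: "0 \<le> D" "\<And>x w. cmod x \<le> cmod z \<Longrightarrow> w \<in> ball 0 1 \<Longrightarrow> cmod (harmonic_kernel \<alpha> x w) \<le> D"
    using harmonic_kernel_bound[of "cmod z"] z by auto
  have "(\<lambda>w. harmonic_kernel \<alpha> z w) \<in> borel_measurable \<mu>"
    using measurable_compose[OF measurable_Pair1' harmonic_kernel_measurable, of z] z by simp
  then have m: "(\<lambda>w. f w * harmonic_kernel \<alpha> z w) \<in> borel_measurable \<mu>"
    using f by (intro borel_measurable_times) auto
  show ?thesis
  proof (rule Bochner_Integration.integrable_bound[OF integrable_mult_right[OF integrable_norm[OF f], of D] m], rule AE_I2)
    fix w assume "w \<in> space \<mu>"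
    then show "norm (f w * harmonic_kernel \<alpha> z w) \<le> norm (D * norm (f w))"
      using mult_left_mono[OF D(2)[of z w], of "cmod (f w)"] D(1) by (simp add: norm_mult mult.commute)
  qed
qed

lemma monomial_L2: "(\<lambda>w. w ^ n) \<in> L2 \<mu>" "L2_norm \<mu> (\<lambda>w. w ^ n) = sqrt (1 / \<gamma> n)"
  using radial_monomial_L2[of "\<lambda>_. 1" n] moment[of n] by (simp_all add: radial_monomial_def[abs_def])

lemma monomial_inner: "L2_inner \<mu> (\<lambda>w. w ^ j) (\<lambda>w. w ^ n) = (if j = n then of_real (1 / \<gamma> n) else 0)"
proof (cases "j = n")
  case True
  have "L2_inner \<mu> (\<lambda>w. w ^ n) (\<lambda>w. w ^ n) = of_real (LINT w|\<mu>. cmod w ^ (2 * n))"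
    unfolding L2_inner_self by (simp add: norm_power power_mult[symmetric] mult.commute)
  then show ?thesis using True moment(2)[of n] by simp
next
  case False
  then show ?thesis using radial_monomial_orthogonal[of "\<lambda>_. 1" "\<lambda>_. 1" j n] by (simp add: radial_monomial_def[abs_def])
qed

lemma bergman_op_series:
  assumes f: "f \<in> L2 \<mu>" and z: "z \<in> ball 0 1"
  shows "integrable \<mu> (\<lambda>w. f w * bergman z w)"
    and "(\<lambda>n. L2_inner \<mu> f (\<lambda>w. w ^ n) * (of_real (\<gamma> n) * z ^ n)) sums kernel_op bergman f z"
proof -
  have le: "cmod (of_real (\<gamma> n) * z ^ n * cnj (w ^ n)) \<le> \<gamma> n * cmod z ^ n * 1" if "w \<in> ball 0 1" for n w
  proof -
    have "\<gamma> n * cmod z ^ n * cmod (w ^ n) \<le> \<gamma> n * cmod z ^ n * 1"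
      using \<gamma>_pos[of n] power_le_1[OF that] by (intro mult_left_mono) auto
    then show ?thesis using \<gamma>_pos[of n] by (simp add: norm_mult norm_power)
  qed
  have sm: "summable (\<lambda>n. \<gamma> n * cmod z ^ n)" using z by (intro \<gamma>_summable) auto
  have k: "(\<lambda>n. of_real (\<gamma> n) * z ^ n * cnj (w ^ n)) sums bergman z w" if "w \<in> ball 0 1" for w
    using bergman_sums[OF z that] by (simp add: power_mult_distrib mult.assoc)
  have one: "(\<lambda>w. complex_of_real 1) \<in> L2 \<mu>" using one_L2 by simp
  have pos: "0 \<le> \<gamma> n * cmod z ^ n" for n using \<gamma>_pos[of n] by simp
  note * = diagonal_sums[where h = "\<lambda>_. 1", OF monomial_L2(1) le sm pos one zero_le_one k f]
  show "integrable \<mu> (\<lambda>w. f w * bergman z w)" by (rule *(1))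
  show "(\<lambda>n. L2_inner \<mu> f (\<lambda>w. w ^ n) * (of_real (\<gamma> n) * z ^ n)) sums kernel_op bergman f z"
    unfolding kernel_op_def by (rule *(2))
qed

text \<open>The monomials are orthogonal with \<open>\<gamma> n \<parallel>w\<^sup>n\<parallel>\<^sup>2 = 1\<close>, so all diagonal entries are 1.\<close>

lemma bergman_op_bounded:
  assumes f: "f \<in> L2 \<mu>"
  shows "kernel_op bergman f \<in> L2 \<mu>" "L2_norm \<mu> (kernel_op bergman f) \<le> L2_norm \<mu> f"
proof -
  have a: "(\<lambda>z. of_real (\<gamma> n) * z ^ n) \<in> L2 \<mu>" for n by (rule L2_cmult[OF monomial_L2(1)])
  have ao: "L2_inner \<mu> (\<lambda>z. of_real (\<gamma> m) * z ^ m) (\<lambda>z. of_real (\<gamma> n) * z ^ n) = 0" if "m \<noteq> n" for m n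
    using radial_monomial_orthogonal[of "\<lambda>_. \<gamma> m" "\<lambda>_. \<gamma> n" m n] that by (simp add: radial_monomial_def[abs_def])
  have bo: "L2_inner \<mu> (\<lambda>w. w ^ m) (\<lambda>w. w ^ n) = 0" if "m \<noteq> n" for m n using that by (simp add: monomial_inner)
  have n: "L2_norm \<mu> (\<lambda>z. of_real (\<gamma> n) * z ^ n) * L2_norm \<mu> (\<lambda>w. w ^ n) \<le> 1" for n
  proof -
    have "sqrt (1 / \<gamma> n) * sqrt (1 / \<gamma> n) = 1 / \<gamma> n" using \<gamma>_pos[of n] by simp
    then show ?thesis using \<gamma>_pos[of n] by (simp only: L2_norm_cmult monomial_L2(2) norm_of_real mult.assoc) simp
  qed
  note * = diagonal_bound[OF a ao monomial_L2(1) bo f _ kernel_op_measurable[OF bergman_measurable L2D(1)[OF f]] _ bergman_op_series(2)[OF f], of 1]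
  show "kernel_op bergman f \<in> L2 \<mu>" by (rule *(1)) (use n in auto)
  have "L2_norm \<mu> (kernel_op bergman f) \<le> 1 * L2_norm \<mu> f" by (rule *(2)) (use n in auto)
  then show "L2_norm \<mu> (kernel_op bergman f) \<le> L2_norm \<mu> f" by simp
qed

lemma proj_split:
  assumes f: "f \<in> L2 \<mu>" and z: "z \<in> ball 0 1"
  shows "kernel_op (harmonic_kernel \<alpha>) f z
     = kernel_op bergman f z + cnj (kernel_op bergman (\<lambda>w. cnj (f w)) z) - L2_inner \<mu> f (\<lambda>_. 1)"
proof -
  have i2: "integrable \<mu> (\<lambda>w. f w * cnj (bergman z w))"
    using integrable_cnj[OF bergman_op_series(1)[OF L2_cnj(1)[OF f] z]] by simp
  have "kernel_op (harmonic_kernel \<alpha>) f z = (LINT w|\<mu>. (f w * bergman z w + f w * cnj (bergman z w)) - f w)"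
    unfolding kernel_op_def using z
    by (intro Bochner_Integration.integral_cong refl) (simp add: harmonic_kernel_eq algebra_simps)
  also have "\<dots> = (LINT w|\<mu>. f w * bergman z w) + (LINT w|\<mu>. f w * cnj (bergman z w)) - (LINT w|\<mu>. f w)"
    using bergman_op_series(1)[OF f z] i2 integrable_L2[OF f] by simp
  also have "(LINT w|\<mu>. f w * cnj (bergman z w)) = cnj (kernel_op bergman (\<lambda>w. cnj (f w)) z)"
    unfolding kernel_op_def Bochner_Integration.integral_cnj[symmetric] by simp
  finally show ?thesis by (simp add: kernel_op_def L2_inner_def)
qed

lemma proj_bounded:
  assumes f: "f \<in> L2 \<mu>"
  shows "kernel_op (harmonic_kernel \<alpha>) f \<in> L2 \<mu>"
    "L2_norm \<mu> (kernel_op (harmonic_kernel \<alpha>) f) \<le> 3 * L2_norm \<mu> f"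
proof -
  interpret semi_inner "\<lambda>c f x. c * f x" "L2 \<mu>" "L2_inner \<mu>"
    rewrites "semi_inner.nrm (L2_inner \<mu>) = L2_norm \<mu>"
    by (rule semi_inner_L2) (rule L2_norm_eq_nrm)
  let ?c = "L2_inner \<mu> f (\<lambda>_. 1)"
  let ?g = "\<lambda>z. (kernel_op bergman f z + cnj (kernel_op bergman (\<lambda>w. cnj (f w)) z)) + (- ?c) * 1"
  note c = bergman_op_bounded[OF L2_cnj(1)[OF f]]
  have L: "(\<lambda>z. kernel_op bergman f z + cnj (kernel_op bergman (\<lambda>w. cnj (f w)) z)) \<in> L2 \<mu>" "(\<lambda>z. (- ?c) * 1) \<in> L2 \<mu>"
    by (rule L2_add[OF bergman_op_bounded(1)[OF f] L2_cnj(1)[OF c(1)]], rule L2_cmult[OF one_L2])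
  have one: "L2_norm \<mu> (\<lambda>_. 1) = 1" using monomial_L2(2)[of 0] by simp
  have "L2_norm \<mu> (\<lambda>z. (- ?c) * 1) = cmod ?c" unfolding L2_norm_cmult one by simp
  also have "\<dots> \<le> L2_norm \<mu> f" using cauchy_schwarz[OF f one_L2] one by simp
  finally have 3: "L2_norm \<mu> (\<lambda>z. (- ?c) * 1) \<le> L2_norm \<mu> f" .
  have 12: "L2_norm \<mu> (\<lambda>z. kernel_op bergman f z + cnj (kernel_op bergman (\<lambda>w. cnj (f w)) z)) \<le> L2_norm \<mu> f + L2_norm \<mu> f"
    using L2_norm_triangle[OF bergman_op_bounded(1)[OF f] L2_cnj(1)[OF c(1)]] bergman_op_bounded(2)[OF f] c(2)
    by (simp add: L2_cnj(2))
  have g: "?g \<in> L2 \<mu>" "L2_norm \<mu> ?g \<le> 3 * L2_norm \<mu> f"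
    using L2_add[OF L] L2_norm_triangle[OF L] 12 3 by auto
  have "AE z in \<mu>. ?g z = kernel_op (harmonic_kernel \<alpha>) f z"
    by (rule AE_I2) (simp add: proj_split[OF f])
  from L2_cong_AE[OF g(1) kernel_op_measurable[OF harmonic_kernel_measurable L2D(1)[OF f]] this] g(2)
  show "kernel_op (harmonic_kernel \<alpha>) f \<in> L2 \<mu>" "L2_norm \<mu> (kernel_op (harmonic_kernel \<alpha>) f) \<le> 3 * L2_norm \<mu> f"
    by simp_all
qed

lemma proj_self_adjoint:
  assumes "f \<in> L2 \<mu>" "g \<in> L2 \<mu>"
  shows "L2_inner \<mu> (kernel_op (harmonic_kernel \<alpha>) f) g = L2_inner \<mu> f (kernel_op (harmonic_kernel \<alpha>) g)"
proof -
  have "L2_inner \<mu> (kernel_op (harmonic_kernel \<alpha>) f) g = 1 * L2_inner \<mu> f (kernel_op (harmonic_kernel \<alpha>) g)"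
  proof (rule kernel_op_adjoint[OF harmonic_kernel_measurable kernel_integrable[OF integrable_L2] proj_bounded])
    show "harmonic_kernel \<alpha> z w = 1 * cnj (harmonic_kernel \<alpha> w z)" if "z \<in> ball 0 1" "w \<in> ball 0 1" for z w
      using cnj_harmonic_kernel[OF that(2,1)] harmonic_kernel_commute[of z w] by simp
    show "(\<lambda>w. complex_of_real (1/2)) \<in> L2 \<mu>" by (simp add: L2_def)
    show "\<exists>D\<ge>0. \<forall>z w. cmod z \<le> \<rho> \<longrightarrow> w \<in> ball 0 1 \<longrightarrow> cmod (harmonic_kernel \<alpha> z w) \<le> D * (1/2 + 1/2)"
      if "0 \<le> \<rho>" "\<rho> < 1" for \<rho>
      using harmonic_kernel_bound[OF that] by simp
  qed (use assms in auto)
  then show ?thesis by simp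
qed

lemma proj_monomial:
  assumes z: "z \<in> ball 0 1" shows "kernel_op (harmonic_kernel \<alpha>) (\<lambda>w. w ^ k) z = z ^ k"
proof -
  have "L2_inner \<mu> (\<lambda>w. w ^ k) (\<lambda>w. w ^ n) * (of_real (\<gamma> n) * z ^ n) = (if n = k then z ^ k else 0)" for n
    using \<gamma>_pos[of n] by (auto simp: monomial_inner)
  then have "(\<lambda>n. if n = k then z ^ k else 0) sums kernel_op bergman (\<lambda>w. w ^ k) z"
    using bergman_op_series(2)[OF monomial_L2(1) z, of k] by simp
  from sums_unique2[OF this sums_single[of k "\<lambda>_. z ^ k"]]
  have 1: "kernel_op bergman (\<lambda>w. w ^ k) z = z ^ k" .
  have i: "L2_inner \<mu> (\<lambda>w. cnj (w ^ k)) (\<lambda>w. w ^ n) = (if k = 0 \<and> n = 0 then 1 else 0)" for n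
  proof -
    have "L2_inner \<mu> (\<lambda>w. cnj (w ^ k)) (\<lambda>w. w ^ n) = cnj (L2_inner \<mu> (\<lambda>w. w ^ (n + k)) (\<lambda>w. w ^ 0))"
      unfolding L2_inner_def Bochner_Integration.integral_cnj[symmetric] by (simp add: power_add mult_ac)
    then show ?thesis by (simp add: monomial_inner del: power_0)
  qed
  have "L2_inner \<mu> (\<lambda>w. cnj (w ^ k)) (\<lambda>w. w ^ n) * (of_real (\<gamma> n) * z ^ n) = (if n = 0 then (if k = 0 then 1 else 0) else 0)" for n
    unfolding i by auto
  then have "(\<lambda>n. if n = 0 then (if k = 0 then 1 else 0) else 0) sums kernel_op bergman (\<lambda>w. cnj (w ^ k)) z"
    using bergman_op_series(2)[OF L2_cnj(1)[OF monomial_L2(1)] z, of k] by simp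
  from sums_unique2[OF this sums_single[of 0 "\<lambda>_. if k = 0 then 1 else 0"]]
  have 2: "kernel_op bergman (\<lambda>w. cnj (w ^ k)) z = (if k = 0 then 1 else 0)" .
  have 3: "L2_inner \<mu> (\<lambda>w. w ^ k) (\<lambda>_. 1) = (if k = 0 then 1 else 0)"
    using monomial_inner[of k 0] by simp
  show ?thesis unfolding proj_split[OF monomial_L2(1) z] 1 2 3 by simp
qed

section \<open>Symbols that commute with the projection\<close>

text \<open>As \<open>1 / \<gamma> 1\<close> is the mean of \<open>\<bar>w\<bar>\<^sup>2\<close>, this radial function has mean 0 and is orthogonal to all
  square-integrable harmonic functions.\<close>
definition radial_test :: "complex \<Rightarrow> real" where "radial_test w = (cmod w)\<^sup>2 - 1 / \<gamma> 1"

lemma radial_test_le_1: "w \<in> ball 0 1 \<Longrightarrow> \<bar>radial_test w\<bar> \<le> 1"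
proof -
  assume "w \<in> ball 0 1"
  then have "(cmod w)\<^sup>2 \<le> 1" by (simp add: power_le_one)
  moreover have "1 \<le> \<gamma> 1" using \<gamma>_Suc[of 0] \<alpha> by simp
  then have "0 < 1 / \<gamma> 1" "1 / \<gamma> 1 \<le> 1" by auto
  moreover have "0 \<le> (cmod w)\<^sup>2" by simp
  ultimately show ?thesis unfolding radial_test_def by linarith
qed

lemma radial_test_measurable: "radial_test \<in> borel_measurable borel"
  unfolding radial_test_def by measurable

lemma radial_test_L2: "(\<lambda>w. complex_of_real (radial_test w)) \<in> L2 \<mu>"
proof -
  have "(\<lambda>w. complex_of_real (radial_test w)) \<in> borel_measurable \<mu>"
    by (rule borel_measurable_\<mu>) (use radial_test_measurable in measurable)
  from L2_mult_bounded(1)[OF one_L2 this] radial_test_le_1 show ?thesis by simp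
qed

lemma radial_test_moment:
  "integrable \<mu> (\<lambda>w. cmod w ^ (2 * k) * radial_test w)"
  "(LINT w|\<mu>. cmod w ^ (2 * k) * radial_test w) = 1 / \<gamma> (Suc k) - 1 / \<gamma> k * (1 / \<gamma> 1)"
proof -
  have eq: "cmod w ^ (2 * k) * radial_test w = cmod w ^ (2 * Suc k) - cmod w ^ (2 * k) * (1 / \<gamma> 1)" for w
    by (simp add: radial_test_def right_diff_distrib power_add power2_eq_square)
  show "integrable \<mu> (\<lambda>w. cmod w ^ (2 * k) * radial_test w)"
    unfolding eq by (intro Bochner_Integration.integrable_diff integrable_mult_left moment)
  have "(LINT w|\<mu>. cmod w ^ (2 * k) * radial_test w)
      = (LINT w|\<mu>. cmod w ^ (2 * Suc k)) - (LINT w|\<mu>. cmod w ^ (2 * k) * (1 / \<gamma> 1))"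
    unfolding eq by (intro Bochner_Integration.integral_diff integrable_mult_left moment)
  also have "\<dots> = 1 / \<gamma> (Suc k) - 1 / \<gamma> k * (1 / \<gamma> 1)"
    by (simp only: integral_mult_left_zero moment(2))
  finally show "(LINT w|\<mu>. cmod w ^ (2 * k) * radial_test w) = 1 / \<gamma> (Suc k) - 1 / \<gamma> k * (1 / \<gamma> 1)" .
qed

lemma radial_test_moment_0: "(LINT w|\<mu>. radial_test w) = 0"
  using radial_test_moment(2)[of 0] by simp

text \<open>If the moment of order \<open>k\<close> were 0, then \<open>\<gamma> (k + 1) = \<gamma> k * \<gamma> 1\<close>, and by the recursion for \<open>\<gamma>\<close> this means
  \<open>(\<alpha> + 1) k = 0\<close>.\<close>

lemma radial_test_moment_nonzero:
  assumes "0 < k" shows "(LINT w|\<mu>. cmod w ^ (2 * k) * radial_test w) \<noteq> 0"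
proof
  assume "(LINT w|\<mu>. cmod w ^ (2 * k) * radial_test w) = 0"
  then have "1 / \<gamma> (Suc k) = 1 / \<gamma> k * (1 / \<gamma> 1)" using radial_test_moment(2)[of k] by simp
  then have "\<gamma> k * \<gamma> 1 = \<gamma> (Suc k)" using \<gamma>_pos[of k] \<gamma>_pos[of 1] \<gamma>_pos[of "Suc k"] by (simp add: field_simps)
  then have "\<gamma> k * \<gamma> 1 * (real k + 1) = \<gamma> k * (\<alpha> + 2 + real k)" using \<gamma>_Suc[of k] by simp
  moreover have "\<gamma> 1 = \<alpha> + 2" using \<gamma>_Suc[of 0] by simp
  ultimately have "(\<alpha> + 2) * (real k + 1) = \<alpha> + 2 + real k" using \<gamma>_pos[of k] by simp
  then have "(\<alpha> + 1) * real k = 0" by (simp add: algebra_simps)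
  then show False using \<alpha> assms by simp
qed

lemma radial_test_radial_zero:
  assumes "\<psi> \<in> borel_measurable borel" "j \<noteq> n"
  shows "(LINT w|\<mu>. of_real (\<psi> (cmod w) * radial_test w) * w ^ j * cnj w ^ n) = 0"
proof -
  have "(\<lambda>r. \<psi> r * (r\<^sup>2 - 1 / \<gamma> 1)) \<in> borel_measurable borel" using assms(1) by measurable
  from integral_monomials_zero[OF this assms(2)] show ?thesis by (simp add: radial_test_def)
qed

lemma radial_test_monomials:
  "(LINT w|\<mu>. w ^ j * cnj w ^ n * of_real (radial_test w))
    = (if j = n then of_real (LINT w|\<mu>. cmod w ^ (2 * n) * radial_test w) else 0)"
proof (cases "j = n")
  case True
  have eq: "w ^ n * cnj w ^ n * of_real (radial_test w) = complex_of_real (cmod w ^ (2 * n) * radial_test w)" for w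
    by (simp add: power_mult_distrib[symmetric] complex_norm_square[symmetric] power_mult)
  show ?thesis unfolding True eq integral_complex_of_real by simp
next
  case False
  then show ?thesis using radial_test_radial_zero[of "\<lambda>_. 1" j n] by (simp add: mult_ac)
qed

lemma proj_radial_test: "z \<in> ball 0 1 \<Longrightarrow> kernel_op (harmonic_kernel \<alpha>) (\<lambda>w. of_real (radial_test w)) z = 0"
proof -
  assume z: "z \<in> ball 0 1"
  let ?g = "\<lambda>w. complex_of_real (radial_test w)"
  have i: "L2_inner \<mu> ?g (\<lambda>w. w ^ n) = 0" for n
    using radial_test_monomials[of 0 n] radial_test_moment_0 by (simp add: L2_inner_def mult.commute split: if_splits)
  have "(\<lambda>n. 0) sums kernel_op bergman ?g z" using bergman_op_series(2)[OF radial_test_L2 z] i by simp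
  from sums_unique2[OF this sums_zero] have 1: "kernel_op bergman ?g z = 0" .
  have c: "(\<lambda>w. cnj (?g w)) = ?g" by simp
  show ?thesis unfolding proj_split[OF radial_test_L2 z] c 1 using i[of 0] by simp
qed

text \<open>Both factors increase with \<open>\<bar>w\<bar>\<close> and the second has mean 0. Subtracting from the logarithm its value \<open>l\<close>
  at the zero of the second factor does not change the integral and makes the integrand nonnegative.\<close>

lemma integral_ln_radial_test_nonzero: "(LINT w|\<mu>. ln (cmod w) * radial_test w) \<noteq> 0"
proof
  assume zero: "(LINT w|\<mu>. ln (cmod w) * radial_test w) = 0"
  define l where "l = ln (1 / \<gamma> 1) / 2"
  let ?F = "\<lambda>w. (ln (cmod w) - l) * radial_test w"
  have i1: "integrable \<mu> (\<lambda>w. ln (cmod w) * radial_test w)"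
    using integrable_Re[OF integrable_mult_L2(1)[OF lnabs_L2 radial_test_L2]] by (simp add: lnabs_def)
  have i2: "integrable \<mu> radial_test" using radial_test_moment(1)[of 0] by simp
  have F: "integrable \<mu> ?F" unfolding left_diff_distrib by (intro Bochner_Integration.integrable_diff i1 integrable_mult_right i2)
  have "(LINT w|\<mu>. ?F w) = 0"
    unfolding left_diff_distrib using zero i1 i2 radial_test_moment_0 by simp
  moreover have pos: "AE w in \<mu>. 0 \<le> ?F w \<and> (?F w = 0 \<longrightarrow> radial_test w = 0)"
    using AE_\<mu>_nonzero
  proof eventually_elim
    case (elim w)
    define t where "t = (cmod w)\<^sup>2"
    define s where "s = 1 / \<gamma> 1"
    have ts: "0 < t" "0 < s" using elim \<gamma>_pos[of 1] by (auto simp: t_def s_def)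
    have "ln t = 2 * ln (cmod w)" using elim by (simp add: t_def ln_realpow)
    then have eq: "?F w = (ln t - ln s) / 2 * (t - s)" by (simp add: l_def radial_test_def t_def s_def diff_divide_distrib)
    consider "t < s" | "t = s" | "s < t" by linarith
    then show ?case
    proof cases
      case 1
      then have "ln t - ln s < 0" using ts by simp
      then have "0 < (ln t - ln s) / 2 * (t - s)" using 1 by (intro mult_neg_neg) auto
      then have "0 \<le> ?F w" "?F w \<noteq> 0" unfolding eq by linarith+
      then show ?thesis by blast
    next
      case 2
      then have "radial_test w = 0" by (simp add: radial_test_def t_def s_def)
      then show ?thesis by simp
    next
      case 3
      then have "0 < ln t - ln s" using ts by simp
      then have "0 < (ln t - ln s) / 2 * (t - s)" using 3 by (intro mult_pos_pos) auto
      then have "0 \<le> ?F w" "?F w \<noteq> 0" unfolding eq by linarith+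
      then show ?thesis by blast
    qed
  qed
  ultimately have "AE w in \<mu>. ?F w = 0" using F by (subst (asm) integral_nonneg_eq_0_iff_AE) (auto elim: eventually_mono)
  with pos have "AE w in \<mu>. radial_test w = 0" by eventually_elim simp
  then have "AE w in \<mu>. cmod w ^ (2 * 1) * radial_test w = 0" by eventually_elim simp
  then have "(LINT w|\<mu>. cmod w ^ (2 * 1) * radial_test w) = 0" by (rule integral_eq_zero_AE)
  then show False using radial_test_moment_nonzero[of 1] by simp
qed

text \<open>If \<open>P\<close> commutes with multiplication by \<open>v\<close>, then \<open>v z\<^sup>k = P (v z\<^sup>k)\<close> is orthogonal to the radial test
  function for every \<open>k\<close>. The case \<open>k = 0\<close> gives \<open>c = 0\<close>. In the case \<open>k > 0\<close>, the term of degree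
  \<open>k\<close> in the conjugate of \<open>L\<close> is the only one that survives the angular integration against \<open>z\<^sup>k\<close>, so the
  \<open>k\<close>-th Taylor coefficient vanishes.\<close>

lemma symbol_trivial_if_commutes:
  assumes R: "1 < R" and L: "L holomorphic_on ball 0 R"
    and v: "\<And>z. v z = c * ln (cmod z) + Re (L z)" and vL2: "(\<lambda>w. complex_of_real (v w)) \<in> L2 \<mu>"
    and comm: "\<And>k. AE z in \<mu>. of_real (v z) * kernel_op (harmonic_kernel \<alpha>) (\<lambda>w. w ^ k) z
        = kernel_op (harmonic_kernel \<alpha>) (\<lambda>w. of_real (v w) * w ^ k) z"
  shows "c = 0" "\<And>z. z \<in> ball 0 R \<Longrightarrow> L z = L 0"
proof -
  define a where "a n = (deriv ^^ n) L 0 / fact n" for n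
  have sums: "(\<lambda>n. a n * z ^ n) sums L z" if "z \<in> ball 0 R" for z
    using holomorphic_power_series[OF L that] by (simp add: a_def)
  obtain q where q: "1 < q" "q < R" using dense[OF R] by blast
  have "summable (\<lambda>n. a n * of_real q ^ n)" using q by (intro sums_summable[OF sums]) auto
  then have "summable (\<lambda>n. norm (a n * 1 ^ n))" using q by (intro powser_insidea[of a "of_real q"]) auto
  then have an: "summable (\<lambda>n. cmod (a n))" by simp
  have vk: "(\<lambda>w. of_real (v w) * w ^ k) \<in> L2 \<mu>" for k
    using L2_mult_bounded(1)[OF vL2 power_measurable, of k] power_le_1 by (simp add: mult.commute)
  have inner0: "L2_inner \<mu> (\<lambda>w. of_real (v w) * w ^ k) (\<lambda>w. of_real (radial_test w)) = 0" for k
  proof -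
    have "AE z in \<mu>. z \<in> space \<mu>" by (rule AE_space)
    with comm[of k] have "AE z in \<mu>. of_real (v z) * z ^ k = kernel_op (harmonic_kernel \<alpha>) (\<lambda>w. of_real (v w) * w ^ k) z"
      by eventually_elim (simp add: proj_monomial)
    then have "L2_inner \<mu> (\<lambda>w. of_real (v w) * w ^ k) (\<lambda>w. of_real (radial_test w))
        = L2_inner \<mu> (kernel_op (harmonic_kernel \<alpha>) (\<lambda>w. of_real (v w) * w ^ k)) (\<lambda>w. of_real (radial_test w))"
      by (rule L2_inner_cong_AE[OF vk proj_bounded(1)[OF vk] radial_test_L2])
    also have "\<dots> = L2_inner \<mu> (\<lambda>w. of_real (v w) * w ^ k) (kernel_op (harmonic_kernel \<alpha>) (\<lambda>w. of_real (radial_test w)))"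
      by (rule proj_self_adjoint[OF vk radial_test_L2])
    also have "\<dots> = (LINT w|\<mu>. 0)" unfolding L2_inner_def
      by (intro Bochner_Integration.integral_cong refl) (simp add: proj_radial_test)
    finally show ?thesis by simp
  qed
  \<comment> \<open>The angular integration leaves only the term of degree \<open>j - k\<close> of the Taylor series of \<open>L\<close>.\<close>
  have series: "integrable \<mu> (\<lambda>w. L w * cnj w ^ j * w ^ k * of_real (radial_test w))"
    "(LINT w|\<mu>. L w * cnj w ^ j * w ^ k * of_real (radial_test w))
      = (if k \<le> j then a (j - k) * of_real (LINT w|\<mu>. cmod w ^ (2 * j) * radial_test w) else 0)" for j k
  proof -
    let ?F = "\<lambda>n w. a n * (w ^ (n + k) * cnj w ^ j * of_real (radial_test w))"
    have m: "(\<lambda>w. w ^ (n + k) * cnj w ^ j * complex_of_real (radial_test w)) \<in> borel_measurable \<mu>" for n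
      by (intro borel_measurable_times power_measurable L2D(1)[OF radial_test_L2]
          borel_measurable_cnj[OF power_measurable, of j, unfolded complex_cnj_power])
    have le1: "cmod (w ^ (n + k) * cnj w ^ j * complex_of_real (radial_test w)) \<le> 1" if "w \<in> ball 0 1" for n w
      using power_le_1[OF that, of "n + k"] power_le_1[OF that, of j] radial_test_le_1[OF that]
      by (simp add: norm_mult norm_power mult_le_one)
    have F: "integrable \<mu> (?F n)" for n
      by (intro integrable_mult_right integrable_L2)
        (use L2_mult_bounded(1)[OF one_L2 m[of n]] le1 in simp)
    have le: "cmod (?F n w) \<le> cmod (a n) * 1" if "w \<in> ball 0 1" for n w
      unfolding norm_mult[of "a n"] by (intro mult_left_mono le1[OF that]) simp
    have G: "(\<lambda>n. ?F n w) sums (L w * cnj w ^ j * w ^ k * of_real (radial_test w))" if "w \<in> ball 0 1" for w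
    proof -
      have "w \<in> ball 0 R" using that R by simp
      from sums_mult2[OF sums[OF this], of "cnj w ^ j * w ^ k * of_real (radial_test w)"]
      show ?thesis by (simp add: power_add mult_ac)
    qed
    have 1: "integrable \<mu> (\<lambda>w. 1::real)" by simp
    note * = integral_sums_dominated[OF F le an 1 _ _ G]
    show "integrable \<mu> (\<lambda>w. L w * cnj w ^ j * w ^ k * of_real (radial_test w))" by (rule *(1)) auto
    have s: "(\<lambda>n. LINT w|\<mu>. ?F n w) sums (LINT w|\<mu>. L w * cnj w ^ j * w ^ k * of_real (radial_test w))" by (rule *(2)) auto
    have I: "(LINT w|\<mu>. ?F n w) = (if n = j - k then (if k \<le> j then a (j - k) * of_real (LINT w|\<mu>. cmod w ^ (2 * j) * radial_test w) else 0) else 0)" for n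
      unfolding integral_mult_right_zero radial_test_monomials by auto
    from s show "(LINT w|\<mu>. L w * cnj w ^ j * w ^ k * of_real (radial_test w))
      = (if k \<le> j then a (j - k) * of_real (LINT w|\<mu>. cmod w ^ (2 * j) * radial_test w) else 0)"
      unfolding I by (rule sums_unique2[OF _ sums_single])
  qed
  have lnk: "integrable \<mu> (\<lambda>w. lnabs w * (w ^ k * of_real (radial_test w)))" for k
    by (intro integrable_mult_L2(1) lnabs_L2 L2_mult_bounded(1)[OF radial_test_L2 power_measurable]) (auto simp: norm_power power_le_one)
  have expand: "of_real c * (LINT w|\<mu>. lnabs w * (w ^ k * of_real (radial_test w)))
      + cnj (a k) / 2 * of_real (LINT w|\<mu>. cmod w ^ (2 * k) * radial_test w)
      + (if k = 0 then a 0 / 2 * of_real (LINT w|\<mu>. radial_test w) else 0) = 0" for k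
  proof -
    let ?A = "\<lambda>w. of_real c * (lnabs w * (w ^ k * of_real (radial_test w)))"
    let ?B = "\<lambda>w. 1/2 * (L w * cnj w ^ 0 * w ^ k * of_real (radial_test w))"
    let ?D = "\<lambda>w. 1/2 * cnj (L w * cnj w ^ k * w ^ 0 * of_real (radial_test w))"
    have re: "complex_of_real (Re x) = 1/2 * (x + cnj x)" for x by (simp add: complex_add_cnj)
    have eq: "of_real (v w) * w ^ k * cnj (of_real (radial_test w)) = (?A w + ?B w) + ?D w" for w
      unfolding v of_real_add of_real_mult re lnabs_def by (simp add: algebra_simps)
    have "0 = (LINT w|\<mu>. of_real (v w) * w ^ k * cnj (of_real (radial_test w)))"
      using inner0[of k] unfolding L2_inner_def by simp
    also have "\<dots> = ((LINT w|\<mu>. ?A w) + (LINT w|\<mu>. ?B w)) + (LINT w|\<mu>. ?D w)"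
      unfolding eq
      by (subst Bochner_Integration.integral_add,
          intro Bochner_Integration.integrable_add integrable_mult_right lnk series(1),
          intro integrable_mult_right integrable_cnj series(1),
          subst Bochner_Integration.integral_add, intro integrable_mult_right lnk, intro integrable_mult_right series(1), rule refl)
    also have "(LINT w|\<mu>. ?B w) = (if k = 0 then a 0 / 2 * of_real (LINT w|\<mu>. radial_test w) else 0)"
      unfolding integral_mult_right_zero series(2) by simp
    also have "(LINT w|\<mu>. ?D w) = cnj (a k) / 2 * of_real (LINT w|\<mu>. cmod w ^ (2 * k) * radial_test w)"
      unfolding integral_mult_right_zero Bochner_Integration.integral_cnj series(2) by simp
    also have "(LINT w|\<mu>. ?A w) = of_real c * (LINT w|\<mu>. lnabs w * (w ^ k * of_real (radial_test w)))"
      by (rule integral_mult_right_zero)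
    finally show ?thesis by (simp add: algebra_simps)
  qed
  have "lnabs w * (w ^ 0 * of_real (radial_test w)) = complex_of_real (ln (cmod w) * radial_test w)" for w by (simp add: lnabs_def)
  then have "of_real c * complex_of_real (LINT w|\<mu>. ln (cmod w) * radial_test w) = 0"
    using expand[of 0] radial_test_moment_0 by (simp only: integral_complex_of_real) simp
  then show c: "c = 0" using integral_ln_radial_test_nonzero by simp
  have "a k = 0" if "0 < k" for k
    using expand[of k] that radial_test_moment_nonzero[OF that] by (simp add: c)
  then have an0: "a n * z ^ n = (if n = 0 then a 0 else 0)" for n z by (cases n) auto
  have "L z = a 0" if "z \<in> ball 0 R" for z
    using sums[OF that] unfolding an0 by (rule sums_unique2[OF _ sums_single])
  moreover have "0 \<in> ball (0::complex) R" using R by simp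
  ultimately show "L z = L 0" if "z \<in> ball 0 R" for z using that by metis
qed

section \<open>The commutator\<close>

lemma singleton_zero_null: "emeasure \<mu> {0} = 0" "{0} \<in> sets \<mu>"
proof -
  show s: "{0} \<in> sets \<mu>" by (simp add: disk_measure_def sets_restrict_space_iff)
  have "AE z in \<mu>. z \<notin> {0}" using AE_\<mu>_nonzero by eventually_elim simp
  then show "emeasure \<mu> {0} = 0" using AE_iff_measurable[OF s] by (simp add: Collect_conv_if)
qed

lemma measurable_off_0:
  fixes f g :: "complex \<Rightarrow> complex"
  assumes "f \<in> borel_measurable \<mu>" "\<And>z. z \<in> ball 0 1 - {0} \<Longrightarrow> f z = g z"
  shows "g \<in> borel_measurable \<mu>"
  by (rule measurable_discrete_difference[of f \<mu> borel "{0}"]) (use assms singleton_zero_null in auto)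

lemma integral_off_0:
  fixes f g :: "complex \<Rightarrow> complex"
  assumes "\<And>z. z \<in> ball 0 1 - {0} \<Longrightarrow> f z = g z"
  shows "(LINT z|\<mu>. f z) = (LINT z|\<mu>. g z)"
  by (rule integral_discrete_difference[where X = "{0}"]) (use assms singleton_zero_null in auto)

text \<open>The bound on \<open>k\<close> is there for the Fubini theorem behind the skew-adjointness. The operators \<open>T f\<close>
  and \<open>kernel_op k f\<close> may differ at 0, where the symbol need not be finite.\<close>

lemma commutator_schatten:
  assumes k: "good_kernel k" and h: "(\<lambda>w. complex_of_real (h w)) \<in> L2 \<mu>" "\<And>w. 0 \<le> h w"
    and skew: "\<And>z w. z \<in> ball 0 1 \<Longrightarrow> w \<in> ball 0 1 \<Longrightarrow> k z w = - cnj (k w z)"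
    and bd: "\<And>\<rho>. 0 \<le> \<rho> \<Longrightarrow> \<rho> < 1 \<Longrightarrow> \<exists>D\<ge>0. \<forall>z w. cmod z \<le> \<rho> \<longrightarrow> w \<in> ball 0 1 \<longrightarrow> cmod (k z w) \<le> D * (h z + h w)"
    and T: "\<And>f z. z \<in> ball 0 1 - {0} \<Longrightarrow> T f z = kernel_op k f z" and p: "1 < p"
  shows "schatten_class \<mu> p T"
proof -
  have ae: "AE z in \<mu>. kernel_op k f z = T f z" for f
    using AE_\<mu>_nonzero by eventually_elim (simp add: T)
  have m: "T f \<in> borel_measurable \<mu>" if "f \<in> L2 \<mu>" for f
    using kernel_op_measurable[OF good_kernelD(1)[OF k] L2D(1)[OF that]] by (rule measurable_off_0) (simp add: T)
  have rate: "rate_one \<mu> T" by (rule rate_one_cong_AE[OF good_kernelD(3)[OF k] m ae])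
  obtain K C B where B: "0 \<le> C" "\<And>f. f \<in> L2 \<mu> \<Longrightarrow> T f \<in> L2 \<mu>"
    "\<And>N. finite (B N)" "\<And>N. B N \<subseteq> L2 \<mu>" "\<And>N. card (B N) \<le> K * N"
    "\<And>N f. f \<in> L2 \<mu> \<Longrightarrow> (\<And>b. b \<in> B N \<Longrightarrow> L2_inner \<mu> f b = 0) \<Longrightarrow> L2_norm \<mu> (T f) \<le> C / (real N + 1) * L2_norm \<mu> f"
    by (rule rate_oneE[OF rate]) blast
  have norm: "L2_norm \<mu> (kernel_op k f) \<le> C * L2_norm \<mu> f" if f: "f \<in> L2 \<mu>" for f
  proof -
    have "B 0 = {}" using B(3)[of 0] B(5)[of 0] by simp
    then have "L2_norm \<mu> (T f) \<le> C / (real 0 + 1) * L2_norm \<mu> f" by (intro B(6) f) simp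
    then show ?thesis using L2_cong_AE(2)[OF good_kernelD(4)[OF k f] m[OF f] ae] by simp
  qed
  have "L2_inner \<mu> (kernel_op k f) g = - 1 * L2_inner \<mu> f (kernel_op k g)" if "f \<in> L2 \<mu>" "g \<in> L2 \<mu>" for f g
  proof (rule kernel_op_adjoint[where k = k and h = h and e = "-1" and C = C])
    show "k z w = - 1 * cnj (k w z)" if "z \<in> ball 0 1" "w \<in> ball 0 1" for z w
      using skew[OF that] by simp
  qed (fact good_kernelD[OF k] norm h bd that)+
  moreover have "L2_inner \<mu> (T f) g = L2_inner \<mu> (kernel_op k f) g" "L2_inner \<mu> g (T f) = L2_inner \<mu> g (kernel_op k f)" for f g
    unfolding L2_inner_def by (rule integral_off_0, simp add: T)+
  ultimately have skewT: "L2_inner \<mu> (T f) g = - L2_inner \<mu> f (T g)" if "f \<in> L2 \<mu>" "g \<in> L2 \<mu>" for f g using that by simp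
  show ?thesis
  proof (rule schatten_class_if_small_off_finite[OF B(2) skewT])
    show "\<exists>B. finite B \<and> B \<subseteq> L2 \<mu> \<and> card B \<le> K * N \<and>
      (\<forall>f\<in>L2 \<mu>. (\<forall>b\<in>B. L2_inner \<mu> f b = 0) \<longrightarrow> L2_norm \<mu> (T f) \<le> C / (real N + 1) * L2_norm \<mu> f)" for N
      using B(3-5)[of N] B(6)[of _ N] by (intro exI[of _ "B N"]) auto
  qed (use p in auto)
qed

text \<open>The symbol is replaced by \<open>v z = c ln \<bar>z\<bar> + Re (L z)\<close>, which agrees with it off the null set \<open>{0}\<close>;
  all the integrals are those of an integral operator with an explicit kernel.\<close>

lemma commutator_main:
  fixes u :: "complex \<Rightarrow> ereal"
  assumes R: "1 < R" and u: "subharmonic_on u (ball 0 R)"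
    and fin: "\<And>z. z \<in> ball 0 R - {0} \<Longrightarrow> \<bar>u z\<bar> \<noteq> \<infinity>"
    and L: "L holomorphic_on ball 0 R"
    and ur: "\<And>z. z \<in> ball 0 R - {0} \<Longrightarrow> real_of_ereal (u z) = c * ln (cmod z) + Re (L z)"
  shows "(\<forall>f\<in>L2 \<mu>. AE z in \<mu>. mult_op u (harmonic_proj \<alpha> f) z = harmonic_proj \<alpha> (mult_op u f) z) \<longleftrightarrow> u constant_on ball 0 R"
    and "(\<forall>f\<in>L2 \<mu>. AE z in \<mu>. commutator \<alpha> u f z = 0) \<longleftrightarrow> u constant_on ball 0 R"
    and "1 < p \<Longrightarrow> schatten_class \<mu> p (commutator \<alpha> u)"
proof -
  define v where "v z = c * ln (cmod z) + Re (L z)" for z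
  define k where "k z w = (complex_of_real (v z) - complex_of_real (v w)) * harmonic_kernel \<alpha> z w" for z w
  have uv: "real_of_ereal (u z) = v z" if "z \<in> ball 0 1 - {0}" for z
  proof -
    have "z \<in> ball 0 R - {0}" using that R by auto
    from ur[OF this] show ?thesis by (simp add: v_def)
  qed
  have good: "good_kernel k" unfolding k_def by (rule good_kernel_commutator[OF R L, where c = c]) (simp add: v_def)
  have contL: "continuous_on (cball 0 1) L"
    by (rule continuous_on_subset[OF holomorphic_on_imp_continuous_on[OF L]]) (use R in auto)
  have vL2: "(\<lambda>w. complex_of_real (v w)) \<in> L2 \<mu>"
  proof -
    have "bounded (L ` cball 0 1)" by (intro compact_imp_bounded compact_continuous_image contL) simp
    then obtain D where D: "\<And>z. z \<in> cball 0 1 \<Longrightarrow> cmod (L z) \<le> D" unfolding bounded_iff by blast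
    have sets: "sets \<mu> = sets (restrict_space borel (ball 0 1))"
      by (simp add: disk_measure_def sets_restrict_space)
    have "continuous_on (ball 0 1) (\<lambda>z. complex_of_real (Re (L z)))"
      by (intro continuous_intros continuous_on_subset[OF contL]) auto
    then have m: "(\<lambda>z. complex_of_real (Re (L z))) \<in> borel_measurable \<mu>"
      unfolding measurable_cong_sets[OF sets refl] by (rule borel_measurable_continuous_on_restrict)
    have "integrable \<mu> (\<lambda>z. (cmod (complex_of_real (Re (L z))))\<^sup>2)"
    proof (rule integrable_const_bound[where B = "D\<^sup>2"])
      show "AE z in \<mu>. norm ((cmod (complex_of_real (Re (L z))))\<^sup>2) \<le> D\<^sup>2"
      proof (rule AE_I2)
        fix z assume "z \<in> space \<mu>"
        then have "\<bar>Re (L z)\<bar> \<le> D" using D[of z] abs_Re_le_cmod[of "L z"] by simp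
        then have "\<bar>Re (L z)\<bar>\<^sup>2 \<le> D\<^sup>2" by (intro power_mono) auto
        then show "norm ((cmod (complex_of_real (Re (L z))))\<^sup>2) \<le> D\<^sup>2" by simp
      qed
      show "(\<lambda>z. (cmod (complex_of_real (Re (L z))))\<^sup>2) \<in> borel_measurable \<mu>"
        by (intro borel_measurable_power measurable_compose[OF m borel_measurable_norm])
    qed
    then have "(\<lambda>z. complex_of_real (Re (L z))) \<in> L2 \<mu>" using m by (simp add: L2_def)
    from L2_add[OF L2_cmult[OF lnabs_L2, of "of_real c"] this] show ?thesis
      by (simp add: lnabs_def v_def)
  qed
  have vf: "integrable \<mu> (\<lambda>w. of_real (v w) * f w)" if "f \<in> L2 \<mu>" for f
    by (rule integrable_mult_L2(1)[OF vL2 that])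
  have proj_mult: "harmonic_proj \<alpha> (mult_op u f) z = kernel_op (harmonic_kernel \<alpha>) (\<lambda>w. of_real (v w) * f w) z" for f z
    unfolding harmonic_proj_def kernel_op_def by (rule integral_off_0) (simp add: mult_op_def uv)
  have comm: "commutator \<alpha> u f z = kernel_op k f z" if "z \<in> ball 0 1 - {0}" for f z
    unfolding commutator_def kernel_op_def by (rule integral_off_0) (simp add: k_def uv[OF that] uv mult.assoc)
  have comm_eq: "commutator \<alpha> u f z = mult_op u (harmonic_proj \<alpha> f) z - harmonic_proj \<alpha> (mult_op u f) z"
    if f: "f \<in> L2 \<mu>" and z: "z \<in> ball 0 1 - {0}" for f z
  proof -
    have zb: "z \<in> ball 0 1" using z by simp
    have "kernel_op k f z = (LINT w|\<mu>. of_real (v z) * (f w * harmonic_kernel \<alpha> z w) - of_real (v w) * f w * harmonic_kernel \<alpha> z w)"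
      unfolding kernel_op_def k_def by (intro Bochner_Integration.integral_cong refl) (simp add: algebra_simps)
    also have "\<dots> = of_real (v z) * kernel_op (harmonic_kernel \<alpha>) f z - kernel_op (harmonic_kernel \<alpha>) (\<lambda>w. of_real (v w) * f w) z"
      unfolding kernel_op_def
      using kernel_integrable[OF integrable_L2[OF f] zb] kernel_integrable[OF vf[OF f] zb] by simp
    finally show ?thesis unfolding comm[OF z] proj_mult by (simp add: mult_op_def uv[OF z] harmonic_proj_eq)
  qed
  have equiv: "(AE z in \<mu>. commutator \<alpha> u f z = 0) \<longleftrightarrow> (AE z in \<mu>. mult_op u (harmonic_proj \<alpha> f) z = harmonic_proj \<alpha> (mult_op u f) z)"
    if "f \<in> L2 \<mu>" for f
  proof (rule eventually_subst)
    show "\<forall>\<^sub>F z in ae_filter \<mu>. (commutator \<alpha> u f z = 0) = (mult_op u (harmonic_proj \<alpha> f) z = harmonic_proj \<alpha> (mult_op u f) z)"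
      using AE_\<mu>_nonzero by eventually_elim (simp add: comm_eq[OF that])
  qed
  have "u constant_on ball 0 R" if commute: "\<forall>f\<in>L2 \<mu>. AE z in \<mu>. mult_op u (harmonic_proj \<alpha> f) z = harmonic_proj \<alpha> (mult_op u f) z"
  proof -
    have "AE z in \<mu>. of_real (v z) * kernel_op (harmonic_kernel \<alpha>) (\<lambda>w. w ^ n) z
        = kernel_op (harmonic_kernel \<alpha>) (\<lambda>w. of_real (v w) * w ^ n) z" for n
    proof -
      have "AE z in \<mu>. mult_op u (harmonic_proj \<alpha> (\<lambda>w. w ^ n)) z = harmonic_proj \<alpha> (mult_op u (\<lambda>w. w ^ n)) z"
        using commute monomial_L2(1) by blast
      with AE_\<mu>_nonzero show ?thesis
        unfolding proj_mult by eventually_elim (simp add: mult_op_def uv harmonic_proj_eq)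
    qed
    note triv = symbol_trivial_if_commutes[OF R L v_def vL2 this]
    have "u z = ereal (Re (L 0))" if z: "z \<in> ball 0 R - {0}" for z
    proof -
      have "real_of_ereal (u z) = Re (L 0)" using ur[OF z] triv(1) triv(2)[of z] z by simp
      then show ?thesis using fin[OF z] by (metis ereal_real')
    qed
    moreover from subharmonic_value_at_puncture[OF u R this] have "u 0 = ereal (Re (L 0))" .
    ultimately show ?thesis unfolding constant_on_def by (intro exI[of _ "ereal (Re (L 0))"]) (metis DiffI singletonD)
  qed
  moreover have "AE z in \<mu>. commutator \<alpha> u f z = 0" if const: "u constant_on ball 0 R" for f
  proof (rule AE_I2)
    fix z assume z: "z \<in> space \<mu>"
    obtain y where y: "\<And>x. x \<in> ball 0 R \<Longrightarrow> u x = y" using const unfolding constant_on_def by blast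
    have "commutator \<alpha> u f z = (LINT w|\<mu>. 0)"
      unfolding commutator_def using z R by (intro Bochner_Integration.integral_cong refl) (simp add: y)
    then show "commutator \<alpha> u f z = 0" by simp
  qed
  ultimately show "(\<forall>f\<in>L2 \<mu>. AE z in \<mu>. mult_op u (harmonic_proj \<alpha> f) z = harmonic_proj \<alpha> (mult_op u f) z) \<longleftrightarrow> u constant_on ball 0 R"
    and "(\<forall>f\<in>L2 \<mu>. AE z in \<mu>. commutator \<alpha> u f z = 0) \<longleftrightarrow> u constant_on ball 0 R"
    using equiv by blast+
  show "schatten_class \<mu> p (commutator \<alpha> u)" if "1 < p"
  proof (rule commutator_schatten[OF good, where h = "\<lambda>w. \<bar>v w\<bar>"])
    show "(\<lambda>w. complex_of_real \<bar>v w\<bar>) \<in> L2 \<mu>"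
    proof -
      have "(\<lambda>w. complex_of_real (cmod (complex_of_real (v w)))) \<in> borel_measurable \<mu>"
        using L2D(1)[OF vL2] by measurable
      then show ?thesis using L2D(2)[OF vL2] by (simp add: L2_def)
    qed
    show "k z w = - cnj (k w z)" if "z \<in> ball 0 1" "w \<in> ball 0 1" for z w
      using cnj_harmonic_kernel[OF that(2,1)] harmonic_kernel_commute[of z w] by (simp add: k_def algebra_simps)
    fix \<rho> :: real assume "0 \<le> \<rho>" "\<rho> < 1"
    from harmonic_kernel_bound[OF this] obtain D where D: "0 \<le> D"
      "\<And>z w. cmod z \<le> \<rho> \<Longrightarrow> w \<in> ball 0 1 \<Longrightarrow> cmod (harmonic_kernel \<alpha> z w) \<le> D" by blast
    have "cmod (k z w) \<le> D * (\<bar>v z\<bar> + \<bar>v w\<bar>)" if "cmod z \<le> \<rho>" "w \<in> ball 0 1" for z w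
    proof -
      have "cmod (complex_of_real (v z) - complex_of_real (v w)) \<le> \<bar>v z\<bar> + \<bar>v w\<bar>"
        using norm_triangle_ineq4[of "complex_of_real (v z)" "complex_of_real (v w)"] by simp
      then have "cmod (k z w) \<le> (\<bar>v z\<bar> + \<bar>v w\<bar>) * D"
        unfolding k_def norm_mult using D that by (intro mult_mono) auto
      then show ?thesis by (simp add: mult.commute)
    qed
    then show "\<exists>D\<ge>0. \<forall>z w. cmod z \<le> \<rho> \<longrightarrow> w \<in> ball 0 1 \<longrightarrow> cmod (k z w) \<le> D * (\<bar>v z\<bar> + \<bar>v w\<bar>)"
      using D(1) by blast
  qed (use that comm in auto)
qed

end

theorem corollary1:
  fixes \<alpha> R :: real and u :: "complex \<Rightarrow> ereal"
  assumes "\<alpha> > -1" and "R > 1"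
    and "subharmonic_on u (ball 0 R)"
    and "\<forall>z\<in>ball 0 R - {0}. \<bar>u z\<bar> \<noteq> \<infinity>"
    and "harmonic_on (\<lambda>z. real_of_ereal (u z)) (ball 0 R - {0})"
  shows "((\<forall>f\<in>L2 (disk_measure \<alpha>). AE z in disk_measure \<alpha>.
             mult_op u (harmonic_proj \<alpha> f) z = harmonic_proj \<alpha> (mult_op u f) z)
           \<longleftrightarrow> u constant_on ball 0 R)
       \<and> ((\<forall>f\<in>L2 (disk_measure \<alpha>). AE z in disk_measure \<alpha>. commutator \<alpha> u f z = 0)
           \<longleftrightarrow> u constant_on ball 0 R)
       \<and> (\<forall>p>1. schatten_class (disk_measure \<alpha>) p (commutator \<alpha> u))"
proof -
  interpret weighted_disk \<alpha> by standard (rule assms(1))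
  have fin: "\<bar>u z\<bar> \<noteq> \<infinity>" if "z \<in> ball 0 R - {0}" for z :: complex using assms(4) that by (rule bspec)
  have zero: "0 \<in> ball (0::complex) R" and R0: "0 < R" using assms(2) by simp_all
  \<comment> \<open>Upper semicontinuity at 0 bounds \<open>u\<close> from above near the puncture.\<close>
  have "u 0 < \<infinity>" using assms(3) zero unfolding subharmonic_on_def by blast
  then obtain M where M: "u 0 < ereal M" using ereal_dense2 by blast
  then have "\<forall>\<^sub>F z in at 0 within ball 0 R. u z < ereal M"
    using assms(3) zero unfolding subharmonic_on_def by blast
  moreover have "at 0 within ball 0 R = at (0::complex)" using zero by (intro at_within_open) auto
  ultimately have "\<forall>\<^sub>F z in at 0. u z < ereal M" by simp
  moreover have "\<forall>\<^sub>F z in at (0::complex). z \<in> ball 0 R - {0}"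
    using zero by (intro eventually_at_in_open) auto
  ultimately have "\<forall>\<^sub>F z in at 0. real_of_ereal (u z) \<le> M"
  proof eventually_elim
    case (elim z)
    then show ?case using fin[of z] by (cases "u z") auto
  qed
  then obtain c L where "L holomorphic_on ball 0 R"
    "\<And>z. z \<in> ball 0 R - {0} \<Longrightarrow> real_of_ereal (u z) = c * ln (cmod z) + Re (L z)"
    using harmonic_bounded_above_near_puncture[OF R0 assms(5)] by blast
  from commutator_main[OF assms(2,3) fin this] show ?thesis by blast
qed

end
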